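(* Let $\mathbb{K}$ be a field, let $s\geq 3$ and $t:=2s\geq 6$, and let $I=I(C_{t}^{bc})$ be the edge ideal associated to the bipartite complement of the even cycle $C_t$ of length $t$. Write $\beta_{i,j}=\beta_{i,j}(I)$. Then $I$ has regularity $4$, and the nonzero entries of its Betti diagram are located at the following positions: $\beta_{i,i+2}$ with $0\leq i\leq s-3$; $\beta_{i,i+3}$ with $1\leq i\leq t-5$; and $\beta_{t-4,t}$, with $\beta_{t-4,t}=1$. Moreover, the numbers $\beta_{j-2,j}$ for $2\leq j\leq s-1$, and $\beta_{j-3,j}$ for $4\leq j\leq t-2$, are given respectively by $$\beta_{j-2,j}=\sum_{k=1}^{j-1}\sum_{c=1}^{k}\frac{s}{c}\binom{k-1}{c-1}\binom{s-k-1}{c-1}\binom{s-k-c}{j-k},$$ $$\beta_{j-3,j}=\sum_{m=2}^{\lfloor j/2\rfloor}t\,\frac{m-1}{m}\binom{t-j-1}{m-1}\sum_{a=0}^{j-2m}\binom{j-m-a-1}{m-1}\binom{t-j-m}{a}.$$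
   Context: All graphs are finite and simple. $C_t$ is the connected graph on $t$ vertices all of degree two. For $t=2s$, $C_{2s}$ is bipartite with vertices $X\sqcup Y$, $X=\{x_1,\ldots,x_s\}$, $Y=\{y_1,\ldots,y_s\}$, and edges $\{x_1,y_1\},\{y_1,x_2\},\{x_2,y_2\},\ldots,\{x_s,y_s\},\{y_s,x_1\}$; its bipartite complement $C_{2s}^{bc}$ is the bipartite graph on $X\sqcup Y$ whose edges are the pairs $\{x,y\}$, $x\in X$, $y\in Y$, that are not edges of $C_{2s}$. For a graph $G$, $R$ is the polynomial ring over $\mathbb{K}$ whose variables are the vertices of $G$, with the standard grading, and the edge ideal $I(G)\subset R$ is generated by the monomials $uv$ with $\{u,v\}\in E(G)$. The graded Betti number $\beta_{i,j}(I)$ is the number of copies of $R(-j)$ in homological degree $i$ in the minimal graded free resolution of $I$ (of the ideal $I$, not of $R/I$; so $\beta_{0,j}(I)$ counts minimal generators of degree $j$), and $\mathrm{reg}(I)=\max\{j-i:\beta_{i,j}(I)\neq 0\}$. The Betti diagram of $I$ is the table with $\beta_{i,j}$ in column $i$ and row $j-i$. Binomial coefficients $\binom{p}{q}$ are zero unless $0\leq q\leq p$. *)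

theory Defs
  imports
    Complex_Main
    "HOL-Library.Poly_Mapping"
    "HOL-Algebra.Ideal"
    "Jordan_Normal_Form.Matrix_Kernel"
begin

section \<open>The even cycle and its bipartite complement\<close>

text \<open>A graph is given by its vertex set and its set of edges, an edge being the
  two-element set of its end points.\<close>

datatype vertex = vx nat | vy nat

definition cycle_X :: "nat \<Rightarrow> vertex set" where
  "cycle_X s = vx ` {1..s}"

definition cycle_Y :: "nat \<Rightarrow> vertex set" where
  "cycle_Y s = vy ` {1..s}"

definition even_cycle_edges :: "nat \<Rightarrow> vertex set set" where
  "even_cycle_edges s =
     {{vx i, vy i} | i. i \<in> {1..s}} \<union> {{vy i, vx (i + 1)} | i. i \<in> {1..<s}} \<union> {{vy s, vx 1}}"

definition bipartite_complement :: "'v set \<Rightarrow> 'v set \<Rightarrow> 'v set set \<Rightarrow> 'v set set" where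
  "bipartite_complement X Y E = {{x, y} | x y. x \<in> X \<and> y \<in> Y \<and> {x, y} \<notin> E}"


section \<open>Polynomials in a set of variables, edge ideals\<close>

text \<open>A monomial is a finitely supported exponent function and a polynomial a finitely
  supported coefficient function on monomials. The type variable \<open>'v\<close> may have more elements
  than the intended set \<open>V\<close> of variables, so the polynomial ring is a carrier set in this type.\<close>

type_synonym ('v, 'k) polynomial = "('v \<Rightarrow>\<^sub>0 nat) \<Rightarrow>\<^sub>0 'k"

definition poly_carrier :: "'v set \<Rightarrow> ('v, 'k::field) polynomial set" where
  "poly_carrier V = {p. \<forall>m \<in> Poly_Mapping.keys p. Poly_Mapping.keys m \<subseteq> V}"

definition poly_ring :: "'v set \<Rightarrow> ('v, 'k::field) polynomial ring" where
  "poly_ring V = \<lparr>carrier = poly_carrier V, mult = (*), one = 1, zero = 0, add = (+)\<rparr>"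

definition indet :: "'v \<Rightarrow> ('v, 'k::field) polynomial" where
  "indet v = Poly_Mapping.single (Poly_Mapping.single v 1) 1"

definition mono_degree :: "('v \<Rightarrow>\<^sub>0 nat) \<Rightarrow> nat" where
  "mono_degree m = (\<Sum>v \<in> Poly_Mapping.keys m. Poly_Mapping.lookup m v)"

text \<open>Degrees are integers; the zero polynomial is homogeneous of every degree, and it is the
  only one that is homogeneous of a negative degree.\<close>

definition homogeneous :: "int \<Rightarrow> ('v, 'k::field) polynomial \<Rightarrow> bool" where
  "homogeneous d p \<longleftrightarrow> (\<forall>m \<in> Poly_Mapping.keys p. int (mono_degree m) = d)"

definition edge_ideal :: "'v set \<Rightarrow> 'v set set \<Rightarrow> ('v, 'k::field) polynomial set" where
  "edge_ideal V E = Idl\<^bsub>poly_ring V\<^esub> {indet u * indet v | u v. {u, v} \<in> E}"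


section \<open>Minimal graded free resolutions and graded Betti numbers\<close>

definition free_module :: "'v set \<Rightarrow> nat \<Rightarrow> ('v, 'k::field) polynomial vec set" where
  "free_module V n = {w \<in> carrier_vec n. \<forall>k < n. w $ k \<in> poly_carrier V}"

text \<open>
  With \<open>R\<close> the polynomial ring in the variables \<open>V\<close>, the data \<open>d\<close>, \<open>\<phi>\<close> describe a sequence
  \<open>\<dots> \<rightarrow> F 2 \<rightarrow> F 1 \<rightarrow> F 0 \<rightarrow> I \<rightarrow> 0\<close>, where
    \<^item> \<open>F i\<close> is the direct sum of the modules \<open>R(-(d i ! k))\<close> for \<open>k < length (d i)\<close>, that is,
      its \<open>k\<close>-th basis element has degree \<open>d i ! k\<close>;
    \<^item> the \<open>1 \<times> length (d 0)\<close> matrix \<open>\<phi> 0\<close> is the augmentation \<open>F 0 \<rightarrow> I \<subseteq> R\<close>, and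
      \<open>\<phi> (i + 1)\<close> is the matrix of \<open>F (i + 1) \<rightarrow> F i\<close>.

  The maps preserve degrees; the sequence is exact; and it is minimal, i.e. the image of
  \<open>F (i + 1)\<close> lies in \<open>\<mm> F i\<close> for the homogeneous maximal ideal \<open>\<mm>\<close>, so the entries of
  \<open>\<phi> (i + 1)\<close> have no constant term.
\<close>

definition minimal_graded_free_resolution ::
  "'v set \<Rightarrow> ('v, 'k::field) polynomial set \<Rightarrow> (nat \<Rightarrow> int list)
     \<Rightarrow> (nat \<Rightarrow> ('v, 'k) polynomial mat) \<Rightarrow> bool" where
  "minimal_graded_free_resolution V I d \<phi> \<longleftrightarrow>
     \<phi> 0 \<in> carrier_mat 1 (length (d 0)) \<and>
     (\<forall>i. \<phi> (Suc i) \<in> carrier_mat (length (d i)) (length (d (Suc i)))) \<and>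
     (\<forall>i. elements_mat (\<phi> i) \<subseteq> poly_carrier V) \<and>
     (\<forall>k < length (d 0). homogeneous (d 0 ! k) (\<phi> 0 $$ (0, k))) \<and>
     (\<forall>i. \<forall>l < length (d i). \<forall>k < length (d (Suc i)).
        homogeneous (d (Suc i) ! k - d i ! l) (\<phi> (Suc i) $$ (l, k))) \<and>
     {(\<phi> 0 *\<^sub>v w) $ 0 | w. w \<in> free_module V (length (d 0))} = I \<and>
     (\<forall>i. mat_kernel (\<phi> i) \<inter> free_module V (length (d i))
            = {\<phi> (Suc i) *\<^sub>v w | w. w \<in> free_module V (length (d (Suc i)))}) \<and>
     (\<forall>i. \<forall>p \<in> elements_mat (\<phi> (Suc i)). Poly_Mapping.lookup p 0 = 0)"

text \<open>The number of copies of \<open>R(-j)\<close> in homological degree \<open>i\<close>; well defined for homogeneous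
  ideals in finitely many variables, as the minimal graded free resolution of such an ideal
  exists and is unique up to isomorphism.\<close>

definition graded_betti :: "'v set \<Rightarrow> ('v, 'k::field) polynomial set \<Rightarrow> nat \<Rightarrow> int \<Rightarrow> nat" where
  "graded_betti V I i j =
     (THE n. \<exists>d \<phi>. minimal_graded_free_resolution V I d \<phi> \<and> n = count_list (d i) j)"

definition regularity :: "'v set \<Rightarrow> ('v, 'k::field) polynomial set \<Rightarrow> int" where
  "regularity V I = Max {j - int i | i j. graded_betti V I i j \<noteq> 0}"


section \<open>Binomial coefficients\<close>

text \<open>Zero unless \<open>0 \<le> q \<le> p\<close>, in particular for negative \<open>p\<close> also when \<open>q = 0\<close>.\<close>

definition binom :: "int \<Rightarrow> int \<Rightarrow> nat" where
  "binom p q = (if 0 \<le> q \<and> q \<le> p then nat p choose nat q else 0)"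

end

theory Submission
  imports Defs "HOL-Library.Function_Algebras" "HOL-Computational_Algebra.Formal_Power_Series"
begin

text \<open>
  The Betti numbers are dimensions of Koszul homology. For an ideal spanned by monomials this
  homology splits into small combinatorial complexes, one for each multidegree, and here these can
  be computed by hand; what remains is to count sets of vertices of the cycle.

  \<^emph>\<open>Koszul homology.\<close> Let \<open>H p M j\<close> be the degree \<open>j\<close> part of the homology at
  \<open>p\<close> of the Koszul complex of a graded module \<open>M\<close>. Suppose that \<open>F \<rightarrow> M\<close> is onto,
  \<open>F\<close> is free, and the kernel \<open>N\<close> lies in \<open>\<mm> F\<close>. The Koszul complex of \<open>F\<close> is exact apart
  from constants at place \<open>0\<close>, which \<open>N\<close> does not contain, so \<open>H (p + 1) M j\<close> and \<open>H p N j\<close>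
  have the same dimension (\<open>koszul_betti_shift\<close>). Moreover the dimension of \<open>H 0 M j\<close> is the
  number of generators of \<open>F\<close> in degree \<open>j\<close> (\<open>koszul_betti_0\<close>). Going down a minimal
  resolution of \<open>I\<close> step by step, one finds that \<open>\<beta> i j\<close> is the dimension of \<open>H i I j\<close>,
  whatever the resolution. A minimal resolution exists because bases of \<open>H 0\<close> lift to minimal
  generators (\<open>minimal_cover_exists\<close>); there are finitely many of them at each step since the
  dimensions vanish for \<open>j > t\<close>, a property that kernels inherit. Both facts are combined in
  \<open>graded_betti_monomial_ideal\<close>.

  \<^emph>\<open>Multidegrees.\<close> In the multidegree \<open>\<alpha>\<close> with support \<open>U\<close>, the Koszul complex has one
  basis element for every \<open>T \<subseteq> U\<close> such that the monomial of exponent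
  \<open>\<alpha> - 1\<^bsub>U - T\<^esub>\<close> lies in the ideal, and the differential is the simplicial coboundary. If
  some exponent in \<open>\<alpha>\<close> is at least two, this is a cone and contributes nothing. Otherwise the
  condition on \<open>T\<close> is that it contains an edge of the bipartite complement.

  \<^emph>\<open>The cycle.\<close> Such a \<open>T\<close> meets both sides of the bipartition. Conversely, if \<open>T\<close> meets
  both sides and contains no edge of the bipartite complement, then all pairs across are edges of
  the cycle, and because \<open>t \<ge> 6\<close> this makes \<open>T\<close> an edge or a path with three vertices. The
  cochains on all sets that meet both sides are the relative cochains of a simplex modulo two
  disjoint faces, so they are exact except for one class \<open>theta\<close>, on two-element sets. Hence the
  homology is that of the restriction to edges and three-vertex paths of the cycle inside \<open>U\<close>,
  shifted by one and corrected by \<open>theta\<close>: functions on the edges together with the differences of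
  neighbouring edges. With \<open>p\<close> the Koszul degree, the result (\<open>qdim_local\<close>) is for a set
  \<open>U\<close> that meets both sides
    \<^item> for \<open>card U = p + 2\<close>: one if \<open>U\<close> contains no edge of the cycle, else zero;
    \<^item> for \<open>card U = p + 3\<close>: the number of components with at least one edge, minus one (zero if
      there is none);
    \<^item> for \<open>card U = p + 4\<close>: one if \<open>U\<close> is the set of all vertices, else zero;
    \<^item> zero in all other cases.
  These are the three rows of the Betti diagram, and the last one gives the regularity.

  \<^emph>\<open>Counting.\<close> It remains to sum over \<open>U\<close>. A subset of a cycle together with a marked run can
  be rotated so that the run begins at \<open>0\<close>; it is then a word that decomposes into blocks of
  ones ended by a zero. Counting the lists of block lengths by generating functions, and counting
  the pairs of a set and a marked run in two ways (\<open>cyclic_count\<close>), gives the number of sets with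
  a given number of runs, hence the sum for the second row (\<open>sum_edge_runs\<close>). For the first row, an
  independent set that meets both sides is a set \<open>A\<close> of \<open>k\<close> vertices in \<open>X\<close> and a set of vertices
  of \<open>Y\<close> away from the neighbours of \<open>A\<close>; if \<open>A\<close> has \<open>c\<close> runs in the cyclic order of \<open>X\<close>,
  it has \<open>k + c\<close> neighbours (\<open>card_independent_sets\<close>).
\<close>

section \<open>Dimensions of quotient spaces\<close>

lemma sum_fun_apply: "(\<Sum>i\<in>A. f i) x = (\<Sum>i\<in>A. f i x)"
  by (induction A rule: infinite_finite_induct) auto

text \<open>The family \<open>b\<close> represents a basis of the quotient of \<open>Z\<close> by \<open>B\<close>. Stating dimensions of homology
  as the existence of such families avoids quotient spaces and makes finiteness part of the
  assertion.\<close>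

definition basis_mod ::
  "('k::field \<Rightarrow> 'm::ab_group_add \<Rightarrow> 'm) \<Rightarrow> 'm set \<Rightarrow> 'm set \<Rightarrow> 'i set \<Rightarrow> ('i \<Rightarrow> 'm) \<Rightarrow> bool" where
  "basis_mod sc Z B A b \<longleftrightarrow> (\<forall>i\<in>A. b i \<in> Z) \<and>
     (\<forall>z\<in>Z. \<exists>c. z - (\<Sum>i\<in>A. sc (c i) (b i)) \<in> B) \<and>
     (\<forall>c. (\<Sum>i\<in>A. sc (c i) (b i)) \<in> B \<longrightarrow> (\<forall>i\<in>A. c i = 0))"

definition qdim :: "('k::field \<Rightarrow> 'm::ab_group_add \<Rightarrow> 'm) \<Rightarrow> 'm set \<Rightarrow> 'm set \<Rightarrow> nat \<Rightarrow> bool" where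
  "qdim sc Z B n \<longleftrightarrow> (\<exists>b. basis_mod sc Z B {..<n} b)"

lemma qdimI:
  assumes "finite A" "basis_mod sc Z B A b"
  shows "qdim sc Z B (card A)"
proof -
  obtain h where h: "bij_betw h {..<card A} A"
    using ex_bij_betw_nat_finite[OF assms(1)] by (auto simp: atLeast0LessThan)
  have re: "(\<Sum>i<card A. sc (c i) (b (h i))) = (\<Sum>a\<in>A. sc (c (inv_into {..<card A} h a)) (b a))" for c
    using sum.reindex_bij_betw[OF h, of "\<lambda>a. sc (c (inv_into {..<card A} h a)) (b a)"] h
    by (simp add: bij_betw_def inv_into_f_f)
  have re2: "(\<Sum>i<card A. sc (c (h i)) (b (h i))) = (\<Sum>a\<in>A. sc (c a) (b a))" for c
    using sum.reindex_bij_betw[OF h] .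
  have "basis_mod sc Z B {..<card A} (b \<circ> h)"
    unfolding basis_mod_def
  proof (intro conjI ballI allI impI)
    fix i assume "i \<in> {..<card A}" then show "(b \<circ> h) i \<in> Z"
      using assms(2) h unfolding basis_mod_def bij_betw_def by auto
  next
    fix z assume "z \<in> Z"
    then obtain c where "z - (\<Sum>i\<in>A. sc (c i) (b i)) \<in> B"
      using assms(2) unfolding basis_mod_def by blast
    then show "\<exists>c. z - (\<Sum>i<card A. sc (c i) ((b \<circ> h) i)) \<in> B"
      by (intro exI[of _ "c \<circ> h"]) (simp add: re2)
  next
    fix c i assume "(\<Sum>i<card A. sc (c i) ((b \<circ> h) i)) \<in> B" and i: "i \<in> {..<card A}"
    then have "(\<Sum>a\<in>A. sc (c (inv_into {..<card A} h a)) (b a)) \<in> B" by (simp add: re)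
    moreover have "\<forall>u. (\<Sum>a\<in>A. sc (u a) (b a)) \<in> B \<longrightarrow> (\<forall>a\<in>A. u a = 0)"
      using assms(2) unfolding basis_mod_def by blast
    ultimately have "\<forall>a\<in>A. c (inv_into {..<card A} h a) = 0"
      by (elim allE[of _ "\<lambda>a. c (inv_into {..<card A} h a)"]) blast
    moreover have "h i \<in> A" "inv_into {..<card A} h (h i) = i"
      using h i unfolding bij_betw_def by (auto simp: inv_into_f_f)
    ultimately show "c i = 0" by metis
  qed
  then show ?thesis unfolding qdim_def by blast
qed

text \<open>Gaussian elimination: an equation with a nonzero coefficient is used to eliminate one unknown
  from the others.\<close>

lemma homogeneous_system_nontrivial:
  fixes a :: "'j \<Rightarrow> nat \<Rightarrow> 'k::field"
  assumes "finite J" "card J > n"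
  shows "\<exists>c. (\<exists>j\<in>J. c j \<noteq> 0) \<and> (\<forall>i<n. (\<Sum>j\<in>J. c j * a j i) = 0)"
  using assms
proof (induction n arbitrary: J a)
  case 0
  then obtain j where "j \<in> J" by (auto simp: card_gt_0_iff)
  then show ?case by (intro exI[of _ "\<lambda>_. 1"]) auto
next
  case (Suc n)
  show ?case
  proof (cases "\<forall>j\<in>J. a j n = 0")
    case True
    obtain c where "\<exists>j\<in>J. c j \<noteq> 0" "\<forall>i<n. (\<Sum>j\<in>J. c j * a j i) = 0"
      using Suc.IH[of J a] Suc.prems by auto
    with True show ?thesis by (intro exI[of _ c]) (auto simp: less_Suc_eq)
  next
    case False
    then obtain j0 where j0: "j0 \<in> J" "a j0 n \<noteq> 0" by blast
    define a' where "a' j i = a j i - a j n / a j0 n * a j0 i" for j i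
    obtain c where c: "\<exists>j\<in>J - {j0}. c j \<noteq> 0" "\<forall>i<n. (\<Sum>j\<in>J - {j0}. c j * a' j i) = 0"
      using Suc.IH[of "J - {j0}" a'] Suc.prems j0 by (fastforce simp: card_Diff_singleton)
    define e where "e j = (if j = j0 then - (\<Sum>j\<in>J - {j0}. c j * a j n / a j0 n) else c j)" for j
    have eq: "(\<Sum>j\<in>J. e j * a j i) = (\<Sum>j\<in>J - {j0}. c j * a' j i)" for i
    proof -
      have "(\<Sum>j\<in>J. e j * a j i) = e j0 * a j0 i + (\<Sum>j\<in>J - {j0}. e j * a j i)"
        using Suc.prems j0 by (simp add: sum.remove)
      also have "(\<Sum>j\<in>J - {j0}. e j * a j i) = (\<Sum>j\<in>J - {j0}. c j * a j i)"
        by (rule sum.cong) (auto simp: e_def)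
      finally show ?thesis
        by (simp add: e_def a'_def algebra_simps sum_subtractf sum_distrib_left sum_distrib_right sum_divide_distrib)
    qed
    have "a' j n = 0" for j using j0 by (simp add: a'_def)
    then have "(\<Sum>j\<in>J. e j * a j i) = 0" if "i < Suc n" for i
      using c(2) that by (auto simp: eq less_Suc_eq)
    moreover have "\<exists>j\<in>J. e j \<noteq> 0" using c(1) by (auto simp: e_def)
    ultimately show ?thesis by blast
  qed
qed

lemma qdim_le:
  assumes vs: "vector_space sc" and B: "module.subspace sc B"
    and "qdim sc Z B n" "qdim sc Z B m"
  shows "m \<le> n"
proof (rule ccontr)
  interpret vector_space sc by fact
  assume "\<not> m \<le> n"
  obtain b where b: "basis_mod sc Z B {..<n} b" using assms unfolding qdim_def by blast
  obtain b' where b': "basis_mod sc Z B {..<m} b'" using assms unfolding qdim_def by blast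
  have "\<forall>j\<in>{..<m}. \<exists>c. b' j - (\<Sum>i<n. sc (c i) (b i)) \<in> B"
    using b b' unfolding basis_mod_def by blast
  then obtain a where a: "\<And>j. j < m \<Longrightarrow> b' j - (\<Sum>i<n. sc (a j i) (b i)) \<in> B"
    by (auto dest!: bchoice)
  obtain c where c: "\<exists>j<m. c j \<noteq> 0" "\<And>i. i < n \<Longrightarrow> (\<Sum>j<m. c j * a j i) = 0"
    using homogeneous_system_nontrivial[of "{..<m}" n a] \<open>\<not> m \<le> n\<close> by auto
  have "(\<Sum>j<m. sc (c j) (b' j - (\<Sum>i<n. sc (a j i) (b i)))) \<in> B"
    by (intro subspace_sum[OF B] subspace_scale[OF B] a) auto
  also have "(\<Sum>j<m. sc (c j) (b' j - (\<Sum>i<n. sc (a j i) (b i))))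
      = (\<Sum>j<m. sc (c j) (b' j)) - (\<Sum>j<m. \<Sum>i<n. sc (c j * a j i) (b i))"
    by (simp add: scale_right_diff_distrib sum_subtractf scale_sum_right)
  also have "(\<Sum>j<m. \<Sum>i<n. sc (c j * a j i) (b i)) = (\<Sum>i<n. sc (\<Sum>j<m. c j * a j i) (b i))"
    by (subst sum.swap) (simp add: scale_sum_left)
  also have "\<dots> = 0" by (simp add: c(2))
  finally have "\<forall>j\<in>{..<m}. c j = 0" using b' unfolding basis_mod_def by simp
  then show False using c(1) by auto
qed

lemma qdim_unique:
  assumes "vector_space sc" "module.subspace sc B" "qdim sc Z B n" "qdim sc Z B m"
  shows "m = n"
  using assms qdim_le by (metis order_antisym)

text \<open>
  The comparison used for every shift of homology: both quotients are \<open>F / (ker d + ker \<pi>)\<close>. A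
  connecting isomorphism is thus obtained by finding one space of chains with two maps out of it.
\<close>

lemma qdim_two_images:
  assumes "Vector_Spaces.linear sF sM \<pi>" "Vector_Spaces.linear sF sN d"
    and F: "module.subspace sF F"
    and q: "qdim sM (\<pi> ` F) (\<pi> ` {f \<in> F. d f = 0}) n"
  shows "qdim sN (d ` F) (d ` {f \<in> F. \<pi> f = 0}) n"
proof -
  interpret p: Vector_Spaces.linear sF sM \<pi> by fact
  interpret d: Vector_Spaces.linear sF sN d by fact
  obtain b where b: "basis_mod sM (\<pi> ` F) (\<pi> ` {f \<in> F. d f = 0}) {..<n} b"
    using q unfolding qdim_def by blast
  have "\<exists>f\<in>F. \<pi> f = b i" if "i \<in> {..<n}" for i
  proof -
    have "b i \<in> \<pi> ` F" using b that unfolding basis_mod_def by blast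
    then show ?thesis by (metis imageE)
  qed
  then have "\<exists>f. \<forall>i\<in>{..<n}. f i \<in> F \<and> \<pi> (f i) = b i" by (intro bchoice) blast
  then obtain f where f: "\<And>i. i < n \<Longrightarrow> f i \<in> F" "\<And>i. i < n \<Longrightarrow> \<pi> (f i) = b i"
    by auto
  have sF: "(\<Sum>i<n. sF (c i) (f i)) \<in> F" for c
    by (intro p.vs1.subspace_sum[OF F] p.vs1.subspace_scale[OF F] f) auto
  have ps: "\<pi> (\<Sum>i<n. sF (c i) (f i)) = (\<Sum>i<n. sM (c i) (b i))" for c
    by (simp add: p.sum p.scale f)
  have ds: "d (\<Sum>i<n. sF (c i) (f i)) = (\<Sum>i<n. sN (c i) (d (f i)))" for c
    by (simp add: d.sum d.scale)
  have "basis_mod sN (d ` F) (d ` {f \<in> F. \<pi> f = 0}) {..<n} (\<lambda>i. d (f i))"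
    unfolding basis_mod_def
  proof (intro conjI ballI allI impI)
    fix i assume "i \<in> {..<n}" then show "d (f i) \<in> d ` F" using f by auto
  next
    fix z assume "z \<in> d ` F"
    then obtain g where g: "g \<in> F" "z = d g" by blast
    then obtain c where "\<pi> g - (\<Sum>i<n. sM (c i) (b i)) \<in> \<pi> ` {f \<in> F. d f = 0}"
      using b unfolding basis_mod_def by blast
    then obtain k where k: "k \<in> F" "d k = 0" "\<pi> g - (\<Sum>i<n. sM (c i) (b i)) = \<pi> k" by blast
    let ?e = "g - (\<Sum>i<n. sF (c i) (f i)) - k"
    have "?e \<in> F" by (intro p.vs1.subspace_diff[OF F] g k sF)
    moreover have "\<pi> ?e = 0" by (simp add: p.diff ps k(3)[symmetric])
    moreover have "d ?e = z - (\<Sum>i<n. sN (c i) (d (f i)))" by (simp add: d.diff ds g k)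
    ultimately show "\<exists>c. z - (\<Sum>i<n. sN (c i) (d (f i))) \<in> d ` {f \<in> F. \<pi> f = 0}"
      by (intro exI[of _ c]) (auto intro!: image_eqI[of _ _ ?e])
  next
    fix c i assume "(\<Sum>i<n. sN (c i) (d (f i))) \<in> d ` {f \<in> F. \<pi> f = 0}" and i: "i \<in> {..<n}"
    then obtain k where k: "k \<in> F" "\<pi> k = 0" "d (\<Sum>i<n. sF (c i) (f i)) = d k"
      unfolding ds[symmetric] by blast
    let ?e = "(\<Sum>i<n. sF (c i) (f i)) - k"
    have "?e \<in> F" by (intro p.vs1.subspace_diff[OF F] k sF)
    moreover have "d ?e = 0" by (simp add: d.diff k)
    moreover have "\<pi> ?e = (\<Sum>i<n. sM (c i) (b i))" by (simp add: p.diff ps k)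
    ultimately have "(\<Sum>i<n. sM (c i) (b i)) \<in> \<pi> ` {f \<in> F. d f = 0}"
      by (auto intro!: image_eqI[of _ _ ?e])
    then show "c i = 0" using b i unfolding basis_mod_def by blast
  qed
  then show ?thesis unfolding qdim_def by blast
qed

lemma vector_space_pointwise:
  "vector_space sc \<Longrightarrow> vector_space (\<lambda>c f x. sc c (f x))"
  unfolding vector_space_def by (simp add: fun_eq_iff)

lemma vector_space_fun: "vector_space (\<lambda>c (f::'i \<Rightarrow> 'k::field) x. c * f x)"
  by unfold_locales (auto simp: fun_eq_iff algebra_simps)

text \<open>If \<open>B\<close> is cut out of \<open>Z\<close> by functionals that take arbitrary values on \<open>Z\<close>, the quotient has
  one dimension for each of them; the dual elements form the basis.\<close>

lemma qdim_by_functionals: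
  assumes L: "Vector_Spaces.linear sc (\<lambda>c f x. c * f x) L"
    and Z: "module.subspace sc Z" and fin: "finite A"
    and ker: "\<And>z. z \<in> Z \<Longrightarrow> z \<in> B \<longleftrightarrow> (\<forall>i\<in>A. L z i = 0)"
    and surj: "\<And>i. i \<in> A \<Longrightarrow> \<exists>z\<in>Z. \<forall>j\<in>A. L z j = (if j = i then 1 else 0)"
  shows "qdim sc Z B (card A)"
proof -
  interpret L: Vector_Spaces.linear sc "\<lambda>c f x. c * f x" L by fact
  obtain b where b: "\<And>i. i \<in> A \<Longrightarrow> b i \<in> Z"
    "\<And>i j. i \<in> A \<Longrightarrow> j \<in> A \<Longrightarrow> L (b i) j = (if j = i then 1 else 0)"
    using bchoice[of A "\<lambda>i z. z \<in> Z \<and> (\<forall>j\<in>A. L z j = (if j = i then 1 else 0))"] surj by metis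
  have sZ: "(\<Sum>i\<in>A. sc (c i) (b i)) \<in> Z" for c
    by (intro L.vs1.subspace_sum[OF Z] L.vs1.subspace_scale[OF Z] b)
  have Ls: "L (\<Sum>i\<in>A. sc (c i) (b i)) j = c j" if "j \<in> A" for c j
  proof -
    have "L (\<Sum>i\<in>A. sc (c i) (b i)) j = (\<Sum>i\<in>A. c i * L (b i) j)"
      by (simp add: L.sum L.scale sum_fun_apply)
    also have "\<dots> = (\<Sum>i\<in>A. if i = j then c i else 0)"
      by (rule sum.cong) (auto simp: b that)
    finally show ?thesis using fin that by simp
  qed
  have "basis_mod sc Z B A b"
    unfolding basis_mod_def
  proof (intro conjI ballI allI impI)
    fix z assume z: "z \<in> Z"
    have "z - (\<Sum>i\<in>A. sc (L z i) (b i)) \<in> Z" by (intro L.vs1.subspace_diff[OF Z] z sZ)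
    then have "z - (\<Sum>i\<in>A. sc (L z i) (b i)) \<in> B" by (simp add: ker L.diff Ls)
    then show "\<exists>c. z - (\<Sum>i\<in>A. sc (c i) (b i)) \<in> B" by blast
  next
    fix c i assume "(\<Sum>i\<in>A. sc (c i) (b i)) \<in> B" "i \<in> A"
    then show "c i = 0" using ker[OF sZ] Ls by auto
  qed (use b in auto)
  with fin show ?thesis by (rule qdimI)
qed

lemma qdim_zero:
  assumes "vector_space sc" "Z \<subseteq> B"
  shows "qdim sc Z B 0"
proof -
  interpret vector_space sc by fact
  show ?thesis using assms(2) unfolding qdim_def basis_mod_def by auto
qed

text \<open>A complex that is a finite direct sum has the sum of the dimensions as its homology. The maps
  \<open>e\<close> and \<open>c\<close> are the inclusions and the projections of the summands.\<close>

lemma qdim_direct_sum: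
  assumes fin: "finite A"
    and e: "\<And>\<alpha>. \<alpha> \<in> A \<Longrightarrow> Vector_Spaces.linear sl sc (e \<alpha>)"
    and c: "\<And>\<alpha>. \<alpha> \<in> A \<Longrightarrow> Vector_Spaces.linear sc sl (c \<alpha>)"
    and ce: "\<And>\<alpha> \<alpha>' F. \<alpha> \<in> A \<Longrightarrow> \<alpha>' \<in> A \<Longrightarrow> F \<in> Zl \<alpha> \<Longrightarrow> c \<alpha>' (e \<alpha> F) = (if \<alpha>' = \<alpha> then F else 0)"
    and ec: "\<And>f. f \<in> Z \<Longrightarrow> f = (\<Sum>\<alpha>\<in>A. e \<alpha> (c \<alpha> f))"
    and eZ: "\<And>\<alpha> F. \<alpha> \<in> A \<Longrightarrow> F \<in> Zl \<alpha> \<Longrightarrow> e \<alpha> F \<in> Z"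
    and eB: "\<And>\<alpha> F. \<alpha> \<in> A \<Longrightarrow> F \<in> Bl \<alpha> \<Longrightarrow> e \<alpha> F \<in> B"
    and cZ: "\<And>\<alpha> f. \<alpha> \<in> A \<Longrightarrow> f \<in> Z \<Longrightarrow> c \<alpha> f \<in> Zl \<alpha>"
    and cB: "\<And>\<alpha> f. \<alpha> \<in> A \<Longrightarrow> f \<in> B \<Longrightarrow> c \<alpha> f \<in> Bl \<alpha>"
    and B: "module.subspace sc B" and vsc: "vector_space sc"
    and q: "\<And>\<alpha>. \<alpha> \<in> A \<Longrightarrow> qdim sl (Zl \<alpha>) (Bl \<alpha>) (n \<alpha>)"
  shows "qdim sc Z B (\<Sum>\<alpha>\<in>A. n \<alpha>)"
proof -
  interpret V: vector_space sc by fact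
  obtain b where b: "\<And>\<alpha>. \<alpha> \<in> A \<Longrightarrow> basis_mod sl (Zl \<alpha>) (Bl \<alpha>) {..<n \<alpha>} (b \<alpha>)"
    using bchoice[of A "\<lambda>\<alpha> b. basis_mod sl (Zl \<alpha>) (Bl \<alpha>) {..<n \<alpha>} b"] q
    unfolding qdim_def by metis
  let ?I = "SIGMA \<alpha>:A. {..<n \<alpha>}"
  let ?b = "\<lambda>(\<alpha>, i). e \<alpha> (b \<alpha> i)"
  have bZ: "b \<alpha> i \<in> Zl \<alpha>" if "\<alpha> \<in> A" "i < n \<alpha>" for \<alpha> i
    using b[OF that(1)] that(2) unfolding basis_mod_def by auto
  have split: "(\<Sum>x\<in>?I. sc (u x) (?b x)) = (\<Sum>\<alpha>\<in>A. \<Sum>i<n \<alpha>. sc (u (\<alpha>, i)) (e \<alpha> (b \<alpha> i)))" for u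
    by (subst sum.Sigma) (auto simp: fin intro!: sum.cong)
  have split': "(\<Sum>x\<in>?I. sc (u x) (?b x)) = (\<Sum>\<alpha>\<in>A. e \<alpha> (\<Sum>i<n \<alpha>. sl (u (\<alpha>, i)) (b \<alpha> i)))" for u
    unfolding split
  proof (rule sum.cong[OF refl])
    fix \<alpha> assume "\<alpha> \<in> A"
    interpret E: Vector_Spaces.linear sl sc "e \<alpha>" by (rule e) fact
    show "(\<Sum>i<n \<alpha>. sc (u (\<alpha>, i)) (e \<alpha> (b \<alpha> i))) = e \<alpha> (\<Sum>i<n \<alpha>. sl (u (\<alpha>, i)) (b \<alpha> i))"
      by (simp add: E.sum E.scale)
  qed
  have cs: "c \<alpha>' (\<Sum>x\<in>?I. sc (u x) (?b x)) = (\<Sum>i<n \<alpha>'. sl (u (\<alpha>', i)) (b \<alpha>' i))"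
    if a': "\<alpha>' \<in> A" for \<alpha>' u
  proof -
    interpret C: Vector_Spaces.linear sc sl "c \<alpha>'" by (rule c) fact
    have "c \<alpha>' (\<Sum>x\<in>?I. sc (u x) (?b x))
      = (\<Sum>\<alpha>\<in>A. \<Sum>i<n \<alpha>. sl (u (\<alpha>, i)) (c \<alpha>' (e \<alpha> (b \<alpha> i))))"
      unfolding split by (simp add: C.sum C.scale)
    also have "\<dots> = (\<Sum>\<alpha>\<in>A. if \<alpha> = \<alpha>' then \<Sum>i<n \<alpha>'. sl (u (\<alpha>', i)) (b \<alpha>' i) else 0)"
      by (intro sum.cong refl) (auto simp: ce[OF _ a'] bZ)
    finally show ?thesis using fin a' by simp
  qed
  have "basis_mod sc Z B ?I ?b"
    unfolding basis_mod_def
  proof (intro conjI ballI allI impI)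
    fix x assume "x \<in> ?I" then show "?b x \<in> Z" using eZ bZ by auto
  next
    fix z assume z: "z \<in> Z"
    have "\<forall>\<alpha>\<in>A. \<exists>u. c \<alpha> z - (\<Sum>i<n \<alpha>. sl (u i) (b \<alpha> i)) \<in> Bl \<alpha>"
      using b cZ[OF _ z] unfolding basis_mod_def by blast
    then obtain u where u: "\<And>\<alpha>. \<alpha> \<in> A \<Longrightarrow> c \<alpha> z - (\<Sum>i<n \<alpha>. sl (u \<alpha> i) (b \<alpha> i)) \<in> Bl \<alpha>"
      by (auto dest!: bchoice)
    have "(\<Sum>\<alpha>\<in>A. e \<alpha> (c \<alpha> z - (\<Sum>i<n \<alpha>. sl (u \<alpha> i) (b \<alpha> i)))) \<in> B"
      by (intro V.subspace_sum[OF B] eB u)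
    also have "(\<Sum>\<alpha>\<in>A. e \<alpha> (c \<alpha> z - (\<Sum>i<n \<alpha>. sl (u \<alpha> i) (b \<alpha> i))))
       = (\<Sum>\<alpha>\<in>A. e \<alpha> (c \<alpha> z) - e \<alpha> (\<Sum>i<n \<alpha>. sl (u \<alpha> i) (b \<alpha> i)))"
    proof (rule sum.cong[OF refl])
      fix \<alpha> assume "\<alpha> \<in> A"
      interpret E: Vector_Spaces.linear sl sc "e \<alpha>" by (rule e) fact
      show "e \<alpha> (c \<alpha> z - (\<Sum>i<n \<alpha>. sl (u \<alpha> i) (b \<alpha> i))) = e \<alpha> (c \<alpha> z) - e \<alpha> (\<Sum>i<n \<alpha>. sl (u \<alpha> i) (b \<alpha> i))"
        by (simp add: E.diff)
    qed
    also have "\<dots> = z - (\<Sum>x\<in>?I. sc ((\<lambda>(\<alpha>, i). u \<alpha> i) x) (?b x))"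
      unfolding split' sum_subtractf using ec[OF z] by simp
    finally show "\<exists>u. z - (\<Sum>x\<in>?I. sc (u x) (?b x)) \<in> B" by blast
  next
    fix u x assume s: "(\<Sum>x\<in>?I. sc (u x) (?b x)) \<in> B" and x: "x \<in> ?I"
    then obtain \<alpha> i where ai: "x = (\<alpha>, i)" "\<alpha> \<in> A" "i < n \<alpha>" by auto
    have "(\<Sum>i<n \<alpha>. sl (u (\<alpha>, i)) (b \<alpha> i)) \<in> Bl \<alpha>" using cB[OF ai(2) s] cs[OF ai(2)] by simp
    then show "u x = 0" using b[OF ai(2)] ai
      unfolding basis_mod_def by (auto dest!: spec[of _ "\<lambda>i. u (\<alpha>, i)"])
  qed
  moreover have "finite ?I" using fin by auto
  ultimately have "qdim sc Z B (card ?I)" using qdimI by blast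
  moreover have "card ?I = (\<Sum>\<alpha>\<in>A. n \<alpha>)" by (subst card_SigmaI) (auto simp: fin)
  ultimately show ?thesis by simp
qed

section \<open>Monomials and homogeneous polynomials\<close>

lemma mono_degree_superset:
  "finite A \<Longrightarrow> Poly_Mapping.keys m \<subseteq> A \<Longrightarrow> mono_degree m = (\<Sum>v\<in>A. Poly_Mapping.lookup m v)"
  unfolding mono_degree_def by (rule sum.mono_neutral_left) (auto simp: in_keys_iff)

lemma mono_degree_add: "mono_degree (a + b) = mono_degree a + mono_degree b"
  unfolding mono_degree_def by (rule setsum_keys_plus_distrib) auto

lemma mono_degree_single [simp]: "mono_degree (Poly_Mapping.single v n) = n"
  by (simp add: mono_degree_def)

lemma mono_degree_0 [simp]: "mono_degree 0 = 0"
  by (simp add: mono_degree_def)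

lemma keys_add_nat: "Poly_Mapping.keys (a + b) = Poly_Mapping.keys a \<union> Poly_Mapping.keys (b :: 'v \<Rightarrow>\<^sub>0 nat)"
  by (auto simp: in_keys_iff lookup_add)

definition set_mono :: "'v set \<Rightarrow> 'v \<Rightarrow>\<^sub>0 nat" where
  "set_mono S = (\<Sum>v\<in>S. Poly_Mapping.single v 1)"

lemma lookup_set_mono: "finite S \<Longrightarrow> Poly_Mapping.lookup (set_mono S) v = (if v \<in> S then 1 else 0)"
  unfolding set_mono_def lookup_sum lookup_single when_def by simp

lemma keys_set_mono: "finite S \<Longrightarrow> Poly_Mapping.keys (set_mono S) = S"
  by (auto simp: in_keys_iff lookup_set_mono split: if_splits)

lemma mono_degree_set_mono: "finite S \<Longrightarrow> mono_degree (set_mono S) = card S"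
  using mono_degree_superset[of S "set_mono S"] by (simp add: keys_set_mono lookup_set_mono)

lemma minus_set_mono_add:
  assumes "finite S" "S \<subseteq> Poly_Mapping.keys \<alpha>"
  shows "\<alpha> - set_mono S + set_mono S = (\<alpha> :: 'v \<Rightarrow>\<^sub>0 nat)"
proof (rule poly_mapping_eqI)
  fix v
  have "v \<in> S \<Longrightarrow> Poly_Mapping.lookup \<alpha> v \<ge> 1"
    using assms(2) by (metis One_nat_def Suc_leI in_keys_iff neq0_conv subsetD)
  then show "Poly_Mapping.lookup (\<alpha> - set_mono S + set_mono S) v = Poly_Mapping.lookup \<alpha> v"
    using assms(1) by (auto simp: lookup_add lookup_minus lookup_set_mono)
qed

lemma keys_minus_set_mono:
  assumes "finite S"
  shows "Poly_Mapping.keys (\<alpha> - set_mono S)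
    = (Poly_Mapping.keys \<alpha> - S) \<union> {v \<in> Poly_Mapping.keys \<alpha>. Poly_Mapping.lookup \<alpha> v \<ge> 2}"
  using assms by (auto simp: in_keys_iff lookup_minus lookup_set_mono split: if_splits)

lemma mono_degree_minus_set_mono:
  assumes "finite S" "S \<subseteq> Poly_Mapping.keys \<alpha>"
  shows "mono_degree \<alpha> = mono_degree (\<alpha> - set_mono S) + card S"
  using mono_degree_add[of "\<alpha> - set_mono S" "set_mono S"] minus_set_mono_add[OF assms]
    mono_degree_set_mono[OF assms(1)] by simp

lemma lookup_single_times:
  fixes p :: "('v, 'k::field) polynomial"
  shows "Poly_Mapping.lookup (Poly_Mapping.single t c * p) (t + m) = c * Poly_Mapping.lookup p m"
proof -
  have "Poly_Mapping.lookup (Poly_Mapping.single t c * p) (t + m)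
     = (\<Sum>l. (c when t = l) * (\<Sum>q. Poly_Mapping.lookup p q when t + m = l + q))"
    by (simp add: lookup_mult lookup_single)
  also have "\<dots> = (\<Sum>l. (c * (\<Sum>q. Poly_Mapping.lookup p q when t + m = l + q)) when t = l)"
    by (simp add: when_mult)
  also have "\<dots> = c * (\<Sum>q. Poly_Mapping.lookup p q when t + m = t + q)" by simp
  also have "\<dots> = c * Poly_Mapping.lookup p m" by simp
  finally show ?thesis .
qed

lemma lookup_const_times:
  fixes p :: "('v, 'k::field) polynomial"
  shows "Poly_Mapping.lookup (Poly_Mapping.single 0 c * p) m = c * Poly_Mapping.lookup p m"
  using lookup_single_times[of 0 c p m] by simp

lemma lookup_indet_times:
  fixes p :: "('v, 'k::field) polynomial"
  shows "Poly_Mapping.lookup (indet v * p) m =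
    (if v \<in> Poly_Mapping.keys m then Poly_Mapping.lookup p (m - Poly_Mapping.single v 1) else 0)"
proof (cases "v \<in> Poly_Mapping.keys m")
  case True
  have "m = Poly_Mapping.single v 1 + (m - Poly_Mapping.single v 1)"
    using minus_set_mono_add[of "{v}" m] True by (simp add: set_mono_def add.commute)
  then show ?thesis unfolding indet_def using lookup_single_times True by (metis mult_1)
next
  case False
  have "m \<notin> Poly_Mapping.keys (indet v * p)"
  proof
    assume "m \<in> Poly_Mapping.keys (indet v * p)"
    then obtain b where "m = Poly_Mapping.single v 1 + b"
      using keys_mult[of "indet v" p] by (auto simp: indet_def)
    then show False using False by (simp add: keys_add_nat)
  qed
  then show ?thesis using False by (simp add: in_keys_iff)
qed

lemma sum_single:
  "(\<Sum>v\<in>A. Poly_Mapping.single m (f v)) = Poly_Mapping.single m (\<Sum>v\<in>A. f v)"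
  by (induction A rule: infinite_finite_induct) (simp_all add: single_add)

lemma indet_times_single:
  "indet v * Poly_Mapping.single m c = Poly_Mapping.single (Poly_Mapping.single v 1 + m) (c :: 'k::field)"
  by (simp add: indet_def mult_single)

lemma minus_one_power_times_single:
  "(-1) ^ n * Poly_Mapping.single m c = Poly_Mapping.single m ((-1) ^ n * (c :: 'k::field))"
  by (cases "even n") (simp_all add: single_uminus)

lemma lookup_minus_one_power_times:
  fixes p :: "('v, 'k::field) polynomial"
  shows "Poly_Mapping.lookup ((-1) ^ n * p) m = (-1) ^ n * Poly_Mapping.lookup p m"
  by (cases "even n") simp_all

lemma poly_carrier_zero [simp]: "0 \<in> poly_carrier W" by (simp add: poly_carrier_def)

lemma poly_carrier_one: "1 \<in> poly_carrier W" by (simp add: poly_carrier_def)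

lemma poly_carrier_uminus: "p \<in> poly_carrier W \<Longrightarrow> - p \<in> poly_carrier W"
  by (simp add: poly_carrier_def in_keys_iff)

lemma poly_carrier_add: "p \<in> poly_carrier W \<Longrightarrow> q \<in> poly_carrier W \<Longrightarrow> p + q \<in> poly_carrier W"
  unfolding poly_carrier_def using keys_add[of p q] by blast

lemma poly_carrier_mult: "p \<in> poly_carrier W \<Longrightarrow> q \<in> poly_carrier W \<Longrightarrow> p * q \<in> poly_carrier W"
  unfolding poly_carrier_def using keys_mult[of p q] by (fastforce simp: keys_add_nat)

definition graded_piece :: "'v set \<Rightarrow> int \<Rightarrow> ('v, 'k::field) polynomial set" where
  "graded_piece V j = {p \<in> poly_carrier V. homogeneous j p}"

lemma graded_piece_iff:
  "p \<in> graded_piece V j \<longleftrightarrow>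
     (\<forall>m. Poly_Mapping.lookup p m \<noteq> 0 \<longrightarrow> Poly_Mapping.keys m \<subseteq> V \<and> int (mono_degree m) = j)"
  by (auto simp: graded_piece_def poly_carrier_def homogeneous_def in_keys_iff)

definition mono_piece :: "'v set \<Rightarrow> ('v \<Rightarrow>\<^sub>0 nat) set \<Rightarrow> int \<Rightarrow> ('v, 'k::field) polynomial set" where
  "mono_piece V L j = {p \<in> graded_piece V j. Poly_Mapping.keys p \<subseteq> L}"

lemma mono_piece_iff:
  "p \<in> mono_piece V L j \<longleftrightarrow>
     (\<forall>m. Poly_Mapping.lookup p m \<noteq> 0 \<longrightarrow> m \<in> L \<and> Poly_Mapping.keys m \<subseteq> V \<and> int (mono_degree m) = j)"
  by (auto simp: mono_piece_def graded_piece_iff in_keys_iff)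

lemma finite_monomials: 
  assumes "finite V"
  shows "finite {m :: 'v \<Rightarrow>\<^sub>0 nat. Poly_Mapping.keys m \<subseteq> V \<and> int (mono_degree m) = j}" (is "finite ?M")
proof (rule finite_imageD)
  let ?F = "{f. \<forall>v. (v \<in> V \<longrightarrow> f v \<in> {..nat j}) \<and> (v \<notin> V \<longrightarrow> f v = 0)}"
  show "finite (Poly_Mapping.lookup ` ?M)"
  proof (rule finite_subset)
    have "Poly_Mapping.lookup m v \<le> mono_degree m" if "Poly_Mapping.keys m \<subseteq> V" "v \<in> V" for m :: "'v \<Rightarrow>\<^sub>0 nat" and v
      unfolding mono_degree_superset[OF assms that(1)] using assms that by (intro member_le_sum) auto
    moreover have "Poly_Mapping.lookup m v = 0"
      if "Poly_Mapping.keys m \<subseteq> V" "v \<notin> V" for m :: "'v \<Rightarrow>\<^sub>0 nat" and v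
      using that by (auto simp: in_keys_iff)
    moreover have "nat j = mono_degree m" if "m \<in> ?M" for m using that by auto
    ultimately have "Poly_Mapping.lookup m \<in> ?F" if "m \<in> ?M" for m
      using that by (simp only: mem_Collect_eq atMost_iff) blast
    then show "Poly_Mapping.lookup ` ?M \<subseteq> ?F" by (rule image_subsetI)
    show "finite ?F" by (rule finite_set_of_finite_funs[OF assms finite_atMost])
  qed
  show "inj_on Poly_Mapping.lookup ?M" by (rule inj_onI) (simp only: poly_mapping_eq_iff)
qed

section \<open>Alternating cochains on a simplex\<close>

text \<open>The properties of the signs of a coboundary on the subsets of \<open>U\<close> that make it square to zero and
  cones acyclic. The signs of the Koszul complex in a given multidegree satisfy them, and no other
  orientation has to be chosen.\<close>

definition alt_signs :: "'v set \<Rightarrow> ('v \<Rightarrow> 'v set \<Rightarrow> 'k::field) \<Rightarrow> bool" where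
  "alt_signs U \<sigma> \<longleftrightarrow> (\<forall>T\<subseteq>U. \<forall>v\<in>T. \<sigma> v T * \<sigma> v T = 1) \<and>
     (\<forall>T\<subseteq>U. \<forall>u\<in>T. \<forall>v\<in>T. u \<noteq> v \<longrightarrow> \<sigma> v T * \<sigma> u (T - {v}) = - (\<sigma> u T * \<sigma> v (T - {u})))"

definition coboundary :: "('v \<Rightarrow> 'v set \<Rightarrow> 'k::field) \<Rightarrow> ('v set \<Rightarrow> 'k) \<Rightarrow> 'v set \<Rightarrow> 'k" where
  "coboundary \<sigma> F T = (\<Sum>v\<in>T. \<sigma> v T * F (T - {v}))"

text \<open>The terms cancel in pairs. In characteristic two it would not suffice that the sum equals its own
  negative, hence the induction on \<open>A\<close>.\<close>

lemma sum_alternating_zero: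
  fixes a :: "'v \<Rightarrow> 'v \<Rightarrow> 'b::ab_group_add"
  assumes "finite A" "\<And>u v. u \<in> A \<Longrightarrow> v \<in> A \<Longrightarrow> u \<noteq> v \<Longrightarrow> a u v + a v u = 0"
  shows "(\<Sum>v\<in>A. \<Sum>u\<in>A - {v}. a v u) = 0"
  using assms
proof (induction A rule: finite_induct)
  case (insert x A)
  have "(\<Sum>v\<in>insert x A. \<Sum>u\<in>insert x A - {v}. a v u)
      = (\<Sum>u\<in>A. a x u) + (\<Sum>v\<in>A. a v x + (\<Sum>u\<in>A - {v}. a v u))"
  proof -
    have "insert x A - {x} = A" using insert by auto
    moreover have "(\<Sum>u\<in>insert x A - {v}. a v u) = a v x + (\<Sum>u\<in>A - {v}. a v u)" if "v \<in> A" for v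
    proof -
      have "insert x A - {v} = insert x (A - {v})" using that insert by auto
      then show ?thesis using insert by simp
    qed
    ultimately show ?thesis using insert by simp
  qed
  also have "\<dots> = (\<Sum>u\<in>A. a x u + a u x) + (\<Sum>v\<in>A. \<Sum>u\<in>A - {v}. a v u)"
    by (simp add: sum.distrib algebra_simps)
  also have "(\<Sum>u\<in>A. a x u + a u x) = 0"
    by (rule sum.neutral) (use insert in auto)
  also have "(\<Sum>v\<in>A. \<Sum>u\<in>A - {v}. a v u) = 0" using insert by auto
  finally show ?case by simp
qed simp

lemma coboundary_coboundary:
  assumes "alt_signs U \<sigma>" "T \<subseteq> U" "finite U"
  shows "coboundary \<sigma> (coboundary \<sigma> F) T = 0"
proof -
  have fT: "finite T" using assms finite_subset by blast
  have "coboundary \<sigma> (coboundary \<sigma> F) T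
     = (\<Sum>v\<in>T. \<Sum>u\<in>T - {v}. \<sigma> v T * \<sigma> u (T - {v}) * F (T - {v} - {u}))"
    by (simp add: coboundary_def sum_distrib_left mult.assoc)
  also have "\<dots> = 0"
  proof (rule sum_alternating_zero[OF fT])
    fix u v assume "u \<in> T" "v \<in> T" "u \<noteq> v"
    then have "\<sigma> v T * \<sigma> u (T - {v}) = - (\<sigma> u T * \<sigma> v (T - {u}))"
      using assms unfolding alt_signs_def by blast
    moreover have "T - {v} - {u} = T - {u} - {v}" by blast
    ultimately show "\<sigma> u T * \<sigma> v (T - {u}) * F (T - {u} - {v}) + \<sigma> v T * \<sigma> u (T - {v}) * F (T - {v} - {u}) = 0"
      by simp
  qed
  finally show ?thesis .
qed

text \<open>A cocycle on the full simplex is the coboundary of its contraction against a vertex \<open>v0\<close>. Because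
  the contraction at \<open>T\<close> only involves \<open>insert v0 T\<close>, the same formula works for every family of
  sets that is closed under removing \<open>v0\<close>.\<close>

lemma coboundary_cone:
  fixes F :: "'v set \<Rightarrow> 'k::field"
  assumes s: "alt_signs U \<sigma>" and fU: "finite U" and v0: "v0 \<in> U"
    and cyc: "\<And>T. T \<subseteq> U \<Longrightarrow> coboundary \<sigma> F T = 0"
    and G: "\<And>T. T \<subseteq> U \<Longrightarrow> G T = (if v0 \<in> T then 0 else \<sigma> v0 (insert v0 T) * F (insert v0 T))"
    and T: "T \<subseteq> U"
  shows "coboundary \<sigma> G T = F T"
proof -
  have fT: "finite T" using T fU finite_subset by blast
  have sq: "\<sigma> v S * \<sigma> v S = 1" if "S \<subseteq> U" "v \<in> S" for v S using s that unfolding alt_signs_def by blast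
  show ?thesis
  proof (cases "v0 \<in> T")
    case True
    have "coboundary \<sigma> G T = \<sigma> v0 T * G (T - {v0}) + (\<Sum>v\<in>T - {v0}. \<sigma> v T * G (T - {v}))"
      unfolding coboundary_def using True fT by (simp add: sum.remove)
    also have "(\<Sum>v\<in>T - {v0}. \<sigma> v T * G (T - {v})) = 0"
    proof (rule sum.neutral, rule ballI)
      fix v assume "v \<in> T - {v0}"
      then have "v0 \<in> T - {v}" "T - {v} \<subseteq> U" using True T by auto
      then show "\<sigma> v T * G (T - {v}) = 0" by (simp add: G)
    qed
    also have "G (T - {v0}) = \<sigma> v0 T * F T"
      using True T G[of "T - {v0}"] by (auto simp: insert_absorb)
    finally show ?thesis using sq[OF T True] by (simp add: mult.assoc[symmetric])
  next
    case False
    let ?T = "insert v0 T"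
    have sub: "?T \<subseteq> U" using T v0 by auto
    have "coboundary \<sigma> F ?T = \<sigma> v0 ?T * F T + (\<Sum>u\<in>T. \<sigma> u ?T * F (?T - {u}))"
      unfolding coboundary_def using False fT by simp
    then have z: "(\<Sum>u\<in>T. \<sigma> u ?T * F (?T - {u})) = - (\<sigma> v0 ?T * F T)"
      using cyc[OF sub] by (simp add: eq_neg_iff_add_eq_0 add.commute)
    \<comment> \<open>the cocycle condition at \<open>insert v0 T\<close> expresses \<open>F T\<close> by the values on sets that contain \<open>v0\<close>\<close>
    have "coboundary \<sigma> G T = (\<Sum>u\<in>T. \<sigma> u T * (\<sigma> v0 (?T - {u}) * F (?T - {u})))"
      unfolding coboundary_def
    proof (rule sum.cong[OF refl])
      fix u assume u: "u \<in> T"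
      then have "insert v0 (T - {u}) = ?T - {u}" "v0 \<notin> T - {u}" "T - {u} \<subseteq> U" using False T by auto
      then have "G (T - {u}) = \<sigma> v0 (?T - {u}) * F (?T - {u})" using G[of "T - {u}"] by (simp only: if_False)
      then show "\<sigma> u T * G (T - {u}) = \<sigma> u T * (\<sigma> v0 (?T - {u}) * F (?T - {u}))" by (simp only:)
    qed
    also have "\<dots> = (\<Sum>u\<in>T. - \<sigma> v0 ?T * (\<sigma> u ?T * F (?T - {u})))"
    proof (rule sum.cong[OF refl])
      fix u assume u: "u \<in> T"
      then have ne: "u \<noteq> v0" using False by auto
      have "?T - {v0} = T" using False by auto
      then have "\<sigma> v0 ?T * \<sigma> u T = - (\<sigma> u ?T * \<sigma> v0 (?T - {u}))"
        using s sub u ne unfolding alt_signs_def by (metis insertI1 insertI2)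
      then have "\<sigma> v0 ?T * (\<sigma> v0 ?T * \<sigma> u T) * \<sigma> v0 (?T - {u})
          = - (\<sigma> v0 ?T * \<sigma> u ?T * (\<sigma> v0 (?T - {u}) * \<sigma> v0 (?T - {u})))" by (simp add: algebra_simps)
      moreover have "\<sigma> v0 ?T * (\<sigma> v0 ?T * \<sigma> u T) = \<sigma> u T"
        using sq[OF sub, of v0] by (simp add: mult.assoc[symmetric])
      moreover have "\<sigma> v0 (?T - {u}) * \<sigma> v0 (?T - {u}) = 1"
        using sub ne by (intro sq) auto
      ultimately have "\<sigma> u T * \<sigma> v0 (?T - {u}) = - \<sigma> v0 ?T * \<sigma> u ?T" by simp
      then show "\<sigma> u T * (\<sigma> v0 (?T - {u}) * F (?T - {u})) = - \<sigma> v0 ?T * (\<sigma> u ?T * F (?T - {u}))"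
        by (simp add: mult.assoc[symmetric])
    qed
    also have "\<dots> = - \<sigma> v0 ?T * (\<Sum>u\<in>T. \<sigma> u ?T * F (?T - {u}))" by (rule sum_distrib_left[symmetric])
    also have "\<dots> = F T" unfolding z using sq[OF sub, of v0] by (simp add: mult.assoc[symmetric])
    finally show ?thesis .
  qed
qed

text \<open>Cochains in one multidegree with support \<open>U\<close>. The index is the Koszul degree \<open>p\<close>, so the sets
  have \<open>card U - p\<close> elements and the coboundary lowers \<open>p\<close>.\<close>

definition local_cochains :: "'v set \<Rightarrow> 'v set set \<Rightarrow> nat \<Rightarrow> ('v set \<Rightarrow> 'k::field) set" where
  "local_cochains U C p = {F. \<forall>T. F T \<noteq> 0 \<longrightarrow> T \<in> C \<and> T \<subseteq> U \<and> card T + p = card U}"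

definition local_cycles :: "('v \<Rightarrow> 'v set \<Rightarrow> 'k::field) \<Rightarrow> 'v set \<Rightarrow> 'v set set \<Rightarrow> nat \<Rightarrow> ('v set \<Rightarrow> 'k) set" where
  "local_cycles \<sigma> U C p = {F \<in> local_cochains U C p. \<forall>T\<subseteq>U. coboundary \<sigma> F T = 0}"

definition local_boundaries :: "('v \<Rightarrow> 'v set \<Rightarrow> 'k::field) \<Rightarrow> 'v set \<Rightarrow> 'v set set \<Rightarrow> nat \<Rightarrow> ('v set \<Rightarrow> 'k) set" where
  "local_boundaries \<sigma> U C p = (\<lambda>G T. if T \<subseteq> U then coboundary \<sigma> G T else 0) ` local_cochains U C (Suc p)"

lemma local_cone_acyclic:
  assumes s: "alt_signs U \<sigma>" and fU: "finite U" and v0: "v0 \<in> U"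
    and cone: "\<And>T. T \<subseteq> U \<Longrightarrow> insert v0 T \<in> C \<Longrightarrow> T \<in> C"
  shows "local_cycles \<sigma> U C p \<subseteq> local_boundaries \<sigma> U C p"
proof
  fix F assume F: "F \<in> local_cycles \<sigma> U C p"
  define G where "G T = (if v0 \<in> T \<or> \<not> T \<subseteq> U then 0 else \<sigma> v0 (insert v0 T) * F (insert v0 T))" for T
  have "G \<in> local_cochains U C (Suc p)"
    unfolding local_cochains_def
  proof (intro CollectI allI impI)
    fix T assume "G T \<noteq> 0"
    then have T: "v0 \<notin> T" "T \<subseteq> U" "F (insert v0 T) \<noteq> 0" by (auto simp: G_def split: if_splits)
    then have "insert v0 T \<in> C" "card (insert v0 T) + p = card U"
      using F by (auto simp: local_cycles_def local_cochains_def)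
    moreover have "finite T" using T fU finite_subset by blast
    ultimately show "T \<in> C \<and> T \<subseteq> U \<and> card T + Suc p = card U" using T cone by auto
  qed
  moreover have "F = (\<lambda>T. if T \<subseteq> U then coboundary \<sigma> G T else 0)"
  proof
    fix T
    show "F T = (if T \<subseteq> U then coboundary \<sigma> G T else 0)"
    proof (cases "T \<subseteq> U")
      case True
      have "coboundary \<sigma> G T = F T"
        by (rule coboundary_cone[OF s fU v0 _ _ True, of F])
          (use F in \<open>auto simp: local_cycles_def G_def\<close>)
      then show ?thesis using True by simp
    next
      case False
      then show ?thesis using F by (auto simp: local_cycles_def local_cochains_def)
    qed
  qed
  ultimately show "F \<in> local_boundaries \<sigma> U C p" unfolding local_boundaries_def by blast
qed

section \<open>The Koszul differential\<close>

definition poly_scale :: "'k::field \<Rightarrow> ('v, 'k) polynomial \<Rightarrow> ('v, 'k) polynomial" where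
  "poly_scale c p = Poly_Mapping.single 0 c * p"

lemma vector_space_poly_scale: "vector_space poly_scale"
proof
  fix a b :: "'k::field" and p :: "('v, 'k) polynomial"
  show "poly_scale a (poly_scale b p) = poly_scale (a * b) p"
    by (simp add: poly_scale_def mult.assoc[symmetric] mult_single)
qed (auto simp: poly_scale_def algebra_simps single_add)

lemma lookup_poly_scale: "Poly_Mapping.lookup (poly_scale c p) m = c * Poly_Mapping.lookup p m"
  by (simp add: poly_scale_def lookup_const_times)

text \<open>The rank orders the variables; it only serves to fix the signs of the exterior basis.\<close>

locale koszul =
  fixes V :: "'v set" and r :: "'v \<Rightarrow> nat"
  assumes finV: "finite V" and injr: "inj_on r V"
begin

definition ksign :: "'v \<Rightarrow> 'v set \<Rightarrow> 'b::comm_ring_1" where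
  "ksign v S = (-1) ^ card {u \<in> S. r u < r v}"

lemma ksign_square [simp]: "ksign v S * ksign v S = (1 :: 'b::comm_ring_1)"
  by (simp add: ksign_def flip: power_add mult_2)

lemma ksign_alternating:
  assumes S: "S \<subseteq> V" and uv: "u \<in> V" "v \<in> V" "u \<notin> S" "v \<notin> S" "u \<noteq> v"
  shows "ksign v S * ksign u (insert v S) = - (ksign u S * ksign v (insert u S) :: 'b::comm_ring_1)"
proof -
  have fS: "finite S" using S finV finite_subset by blast
  have main: "ksign v S * ksign u (insert v S) = - (ksign u S * ksign v (insert u S) :: 'b)"
    if "r u < r v" "u \<notin> S" "v \<notin> S" for u v
  proof -
    have "{w \<in> insert v S. r w < r u} = {w \<in> S. r w < r u}" using that by auto
    moreover have "{w \<in> insert u S. r w < r v} = insert u {w \<in> S. r w < r v}" using that by auto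
    ultimately show ?thesis using fS that by (simp add: ksign_def)
  qed
  have "r u \<noteq> r v" using injr uv by (meson inj_onD)
  then consider "r u < r v" | "r v < r u" by linarith
  then show ?thesis
  proof cases
    case 1 then show ?thesis using main[of u v] uv by simp
  next
    case 2 then show ?thesis using main[of v u] uv by simp
  qed
qed

lemma alt_signs_ksign:
  assumes "U \<subseteq> V"
  shows "alt_signs U (\<lambda>v T. ksign v (U - T))"
  unfolding alt_signs_def
proof (intro conjI allI impI ballI)
  fix T u v assume T: "T \<subseteq> U" "u \<in> T" "v \<in> T" "u \<noteq> v"
  have "U - (T - {v}) = insert v (U - T)" "U - (T - {u}) = insert u (U - T)" using T by auto
  then show "ksign v (U - T) * ksign u (U - (T - {v})) = - (ksign u (U - T) * ksign v (U - (T - {u})))"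
    using ksign_alternating[of "U - T" u v] T assms by auto
qed simp

text \<open>The chain \<open>f\<close> has the coefficient \<open>f S\<close> at the exterior basis element \<open>e\<^sub>S\<close>. The coefficient of
  its differential at \<open>e\<^sub>S\<close> collects the terms from \<open>S\<close> with one more variable.\<close>

definition kdiff :: "('v set \<Rightarrow> ('v, 'k::field) polynomial) \<Rightarrow> 'v set \<Rightarrow> ('v, 'k) polynomial" where
  "kdiff f S = (\<Sum>v\<in>V - S. ksign v S * (indet v * f (insert v S)))"

lemma kdiff_kdiff:
  fixes f :: "'v set \<Rightarrow> ('v, 'k::field) polynomial"
  assumes "S \<subseteq> V"
  shows "kdiff (kdiff f) S = 0"
proof -
  have "kdiff (kdiff f) S = (\<Sum>v\<in>V - S. \<Sum>u\<in>(V - S) - {v}.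
      ksign v S * ksign u (insert v S) * (indet v * indet u * f (insert u (insert v S))))"
  proof -
    have "V - insert v S = V - S - {v}" for v by blast
    then show ?thesis by (simp add: kdiff_def sum_distrib_left algebra_simps)
  qed
  also have "\<dots> = 0"
  proof (rule sum_alternating_zero)
    fix u v assume uv: "u \<in> V - S" "v \<in> V - S" "u \<noteq> v"
    have "ksign u S * ksign v (insert u S) * (indet u * indet v * f (insert v (insert u S))) =
      - (ksign v S * ksign u (insert v S) * (indet v * indet u * f (insert u (insert v S))))"
    proof -
      have "ksign u S * ksign v (insert u S) = - (ksign v S * ksign u (insert v S) :: ('v, 'k::field) polynomial)"
        using uv assms by (intro ksign_alternating) auto
      then show ?thesis by (simp add: insert_commute mult.commute[of "indet u"])
    qed
    then show "ksign u S * ksign v (insert u S) * (indet u * indet v * f (insert v (insert u S))) +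
      ksign v S * ksign u (insert v S) * (indet v * indet u * f (insert u (insert v S))) = 0" by simp
  qed (use finV in auto)
  finally show ?thesis .
qed

section \<open>Splitting by multidegree\<close>

text \<open>The term \<open>x\<^sup>m e\<^sub>S\<close> has the multidegree \<open>\<alpha> = m + 1\<^sub>S\<close>. In the part of multidegree \<open>\<alpha>\<close> it is
  recorded at the complement \<open>T\<close> of \<open>S\<close> in the support of \<open>\<alpha>\<close>: this turns the Koszul
  differential into a coboundary. The projection \<open>coef\<close> and the inclusion \<open>emb\<close> describe the
  corresponding direct summand.\<close>

definition coef :: "('v \<Rightarrow>\<^sub>0 nat) \<Rightarrow> ('v set \<Rightarrow> ('v, 'k::field) polynomial) \<Rightarrow> 'v set \<Rightarrow> 'k" where
  "coef \<alpha> f T = (if T \<subseteq> Poly_Mapping.keys \<alpha>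
     then Poly_Mapping.lookup (f (Poly_Mapping.keys \<alpha> - T)) (\<alpha> - set_mono (Poly_Mapping.keys \<alpha> - T)) else 0)"

definition emb :: "('v \<Rightarrow>\<^sub>0 nat) \<Rightarrow> ('v set \<Rightarrow> 'k::field) \<Rightarrow> 'v set \<Rightarrow> ('v, 'k) polynomial" where
  "emb \<alpha> F S = (if S \<subseteq> Poly_Mapping.keys \<alpha>
     then Poly_Mapping.single (\<alpha> - set_mono S) (F (Poly_Mapping.keys \<alpha> - S)) else 0)"

abbreviation msign :: "('v \<Rightarrow>\<^sub>0 nat) \<Rightarrow> 'v \<Rightarrow> 'v set \<Rightarrow> 'k::field" where
  "msign \<alpha> \<equiv> \<lambda>v T. ksign v (Poly_Mapping.keys \<alpha> - T)"

text \<open>The sets \<open>T\<close> whose monomial belongs to \<open>L\<close>; for the ideal spanned by \<open>L\<close> these carry the complex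
  in multidegree \<open>\<alpha>\<close>.\<close>

definition mono_complex :: "('v \<Rightarrow>\<^sub>0 nat) set \<Rightarrow> ('v \<Rightarrow>\<^sub>0 nat) \<Rightarrow> 'v set set" where
  "mono_complex L \<alpha> = {T. T \<subseteq> Poly_Mapping.keys \<alpha> \<and> \<alpha> - set_mono (Poly_Mapping.keys \<alpha> - T) \<in> L}"

lemma lookup_ksign_times:
  "Poly_Mapping.lookup (ksign v S * p) m = ksign v S * Poly_Mapping.lookup (p :: ('v, 'k::field) polynomial) m"
  unfolding ksign_def by (rule lookup_minus_one_power_times)

lemma minus_set_mono_insert:
  assumes "finite S" "v \<notin> S"
  shows "\<alpha> - set_mono (insert v S) = \<alpha> - set_mono S - Poly_Mapping.single v (1::nat)"
  by (rule poly_mapping_eqI)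
    (use assms in \<open>auto simp: lookup_minus lookup_set_mono lookup_single when_def\<close>)

lemma minus_single_add:
  assumes "finite S" "v \<notin> S" "insert v S \<subseteq> Poly_Mapping.keys \<alpha>"
  shows "Poly_Mapping.single v 1 + (\<alpha> - set_mono (insert v S)) = \<alpha> - set_mono S"
proof -
  have "v \<in> Poly_Mapping.keys (\<alpha> - set_mono S)" using assms by (simp add: keys_minus_set_mono)
  then have "\<alpha> - set_mono S - set_mono {v} + set_mono {v} = \<alpha> - set_mono S"
    by (intro minus_set_mono_add) auto
  then show ?thesis unfolding minus_set_mono_insert[OF assms(1,2)] by (simp add: set_mono_def add.commute)
qed

lemma coef_kdiff:
  assumes \<alpha>: "Poly_Mapping.keys \<alpha> \<subseteq> V" and T: "T \<subseteq> Poly_Mapping.keys \<alpha>"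
  shows "coef \<alpha> (kdiff f) T = coboundary (msign \<alpha>) (coef \<alpha> f) T"
proof -
  let ?U = "Poly_Mapping.keys \<alpha>"
  let ?S = "?U - T"
  let ?m = "\<alpha> - set_mono ?S"
  have "coef \<alpha> (kdiff f) T = (\<Sum>v\<in>V - ?S. ksign v ?S * Poly_Mapping.lookup (indet v * f (insert v ?S)) ?m)"
    using T by (simp add: coef_def kdiff_def lookup_sum lookup_ksign_times)
  also have "\<dots> = (\<Sum>v\<in>T. ksign v ?S * Poly_Mapping.lookup (indet v * f (insert v ?S)) ?m)"
  proof (rule sum.mono_neutral_right)
    show "T \<subseteq> V - ?S" using T \<alpha> by auto
    show "\<forall>v\<in>V - ?S - T. ksign v ?S * Poly_Mapping.lookup (indet v * f (insert v ?S)) ?m = 0"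
      by (auto simp: lookup_indet_times keys_minus_set_mono)
  qed (use finV in auto)
  also have "\<dots> = (\<Sum>v\<in>T. ksign v ?S * coef \<alpha> f (T - {v}))"
  proof (rule sum.cong[OF refl])
    fix v assume v: "v \<in> T"
    have U: "?U - (T - {v}) = insert v ?S" using v T by auto
    have "v \<in> Poly_Mapping.keys ?m" using v T by (auto simp: keys_minus_set_mono)
    moreover have "?m - Poly_Mapping.single v 1 = \<alpha> - set_mono (insert v ?S)"
      using minus_set_mono_insert[of ?S v \<alpha>] v by simp
    moreover have "T - {v} \<subseteq> ?U" using T by auto
    ultimately show "ksign v ?S * Poly_Mapping.lookup (indet v * f (insert v ?S)) ?m
        = ksign v ?S * coef \<alpha> f (T - {v})" using T by (simp add: lookup_indet_times coef_def U)
  qed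
  finally show ?thesis by (simp add: coboundary_def)
qed

lemma kdiff_emb:
  assumes \<alpha>: "Poly_Mapping.keys \<alpha> \<subseteq> V"
  shows "kdiff (emb \<alpha> G) = emb \<alpha> (\<lambda>T. if T \<subseteq> Poly_Mapping.keys \<alpha> then coboundary (msign \<alpha>) G T else 0)"
proof
  fix S
  let ?U = "Poly_Mapping.keys \<alpha>"
  show "kdiff (emb \<alpha> G) S = emb \<alpha> (\<lambda>T. if T \<subseteq> ?U then coboundary (msign \<alpha>) G T else 0) S"
  proof (cases "S \<subseteq> ?U")
    case False
    then show ?thesis by (simp add: kdiff_def emb_def)
  next
    case True
    then have fS: "finite S" by (meson finite_keys finite_subset)
    have "kdiff (emb \<alpha> G) S = (\<Sum>v\<in>?U - S. ksign v S * (indet v * emb \<alpha> G (insert v S)))"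
      unfolding kdiff_def
      by (rule sum.mono_neutral_right) (use \<alpha> finV in \<open>auto simp: emb_def\<close>)
    also have "\<dots> = (\<Sum>v\<in>?U - S. Poly_Mapping.single (\<alpha> - set_mono S) (ksign v S * G (?U - S - {v})))"
    proof (rule sum.cong[OF refl])
      fix v assume v: "v \<in> ?U - S"
      have "?U - insert v S = ?U - S - {v}" by blast
      moreover have "insert v S \<subseteq> ?U" using v True by auto
      ultimately show "ksign v S * (indet v * emb \<alpha> G (insert v S))
          = Poly_Mapping.single (\<alpha> - set_mono S) (ksign v S * G (?U - S - {v}))"
        using v minus_single_add[OF fS, of v \<alpha>]
        by (simp add: emb_def indet_times_single ksign_def minus_one_power_times_single)
    qed
    also have "\<dots> = Poly_Mapping.single (\<alpha> - set_mono S) (\<Sum>v\<in>?U - S. ksign v S * G (?U - S - {v}))"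
      by (rule sum_single)
    also have "\<dots> = emb \<alpha> (\<lambda>T. if T \<subseteq> ?U then coboundary (msign \<alpha>) G T else 0) S"
    proof -
      have "?U - (?U - S) = S" using True by blast
      then show ?thesis unfolding emb_def coboundary_def by (simp only: True Diff_subset if_True)
    qed
    finally show ?thesis .
  qed
qed

definition chain_scale :: "'k::field \<Rightarrow> ('v set \<Rightarrow> ('v, 'k) polynomial) \<Rightarrow> 'v set \<Rightarrow> ('v, 'k) polynomial" where
  "chain_scale c f S = poly_scale c (f S)"

text \<open>The Koszul complex of the span of the monomials in \<open>L\<close>, in homological degree \<open>p\<close> and total degree
  \<open>j\<close>; each variable in \<open>e\<^sub>S\<close> counts for one degree.\<close>

definition kchains :: "('v \<Rightarrow>\<^sub>0 nat) set \<Rightarrow> nat \<Rightarrow> int \<Rightarrow> ('v set \<Rightarrow> ('v, 'k::field) polynomial) set" where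
  "kchains L p j = {f. \<forall>S. if S \<subseteq> V \<and> card S = p then f S \<in> mono_piece V L (j - int p) else f S = 0}"

definition kcycles :: "('v \<Rightarrow>\<^sub>0 nat) set \<Rightarrow> nat \<Rightarrow> int \<Rightarrow> ('v set \<Rightarrow> ('v, 'k::field) polynomial) set" where
  "kcycles L p j = {f \<in> kchains L p j. kdiff f = 0}"

definition kboundaries :: "('v \<Rightarrow>\<^sub>0 nat) set \<Rightarrow> nat \<Rightarrow> int \<Rightarrow> ('v set \<Rightarrow> ('v, 'k::field) polynomial) set" where
  "kboundaries L p j = kdiff ` kchains L (Suc p) j"

definition multidegrees :: "int \<Rightarrow> ('v \<Rightarrow>\<^sub>0 nat) set" where
  "multidegrees j = {\<alpha>. Poly_Mapping.keys \<alpha> \<subseteq> V \<and> int (mono_degree \<alpha>) = j}"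

lemma finite_multidegrees: "finite (multidegrees j)"
  unfolding multidegrees_def by (rule finite_monomials[OF finV])

lemma vector_space_chain_scale: "vector_space (chain_scale :: 'k::field \<Rightarrow> ('v set \<Rightarrow> ('v, 'k) polynomial) \<Rightarrow> _)"
proof -
  have "chain_scale = (\<lambda>c (f :: 'v set \<Rightarrow> ('v, 'k) polynomial) S. poly_scale c (f S))"
    by (intro ext) (simp add: chain_scale_def)
  then show ?thesis using vector_space_pointwise[OF vector_space_poly_scale] by metis
qed

lemma linear_coef: "Vector_Spaces.linear chain_scale (\<lambda>c (F :: 'v set \<Rightarrow> 'k::field) T. c * F T) (coef \<alpha>)"
  unfolding Vector_Spaces.linear_iff
  using vector_space_chain_scale vector_space_fun
  by (auto simp: fun_eq_iff coef_def lookup_add chain_scale_def lookup_poly_scale)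

lemma linear_emb: "Vector_Spaces.linear (\<lambda>c (F :: 'v set \<Rightarrow> 'k::field) T. c * F T) chain_scale (emb \<alpha>)"
  unfolding Vector_Spaces.linear_iff
  using vector_space_chain_scale vector_space_fun
  by (auto simp: fun_eq_iff emb_def single_add chain_scale_def poly_scale_def mult_single)

lemma kdiff_add: "kdiff (f + g) = kdiff f + kdiff g"
  by (auto simp: fun_eq_iff kdiff_def algebra_simps sum.distrib)

lemma kdiff_const_times: "kdiff (\<lambda>S. c * f S) = (\<lambda>S. c * kdiff f S)"
  by (auto simp: fun_eq_iff kdiff_def sum_distrib_left algebra_simps)

lemma linear_kdiff: "Vector_Spaces.linear chain_scale chain_scale (kdiff :: ('v set \<Rightarrow> ('v, 'k::field) polynomial) \<Rightarrow> _)"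
  unfolding Vector_Spaces.linear_iff
proof (intro conjI allI vector_space_chain_scale kdiff_add)
  fix c :: 'k and f :: "'v set \<Rightarrow> ('v, 'k) polynomial"
  have e: "chain_scale c f = (\<lambda>S. Poly_Mapping.single 0 c * f S)" for f :: "'v set \<Rightarrow> ('v, 'k) polynomial"
    by (auto simp: chain_scale_def poly_scale_def)
  show "kdiff (chain_scale c f) = chain_scale c (kdiff f)" unfolding e by (rule kdiff_const_times)
qed

lemma coef_emb:
  fixes F :: "'v set \<Rightarrow> 'k::field"
  assumes F: "\<And>T. F T \<noteq> 0 \<Longrightarrow> T \<subseteq> Poly_Mapping.keys \<alpha>"
  shows "coef \<alpha>' (emb \<alpha> F) = (if \<alpha>' = \<alpha> then F else 0)"
proof (cases "\<alpha>' = \<alpha>")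
  case True
  have "coef \<alpha> (emb \<alpha> F) T = F T" for T
  proof (cases "T \<subseteq> Poly_Mapping.keys \<alpha>")
    case True
    then have "Poly_Mapping.keys \<alpha> - (Poly_Mapping.keys \<alpha> - T) = T" by blast
    then show ?thesis using True by (simp add: coef_def emb_def)
  next
    case False
    then have "F T = 0" using F by blast
    then show ?thesis using False by (simp add: coef_def)
  qed
  then show ?thesis using True by auto
next
  case False
  have "coef \<alpha>' (emb \<alpha> F) T = 0" for T
  proof (rule ccontr)
    assume a: "coef \<alpha>' (emb \<alpha> F) T \<noteq> 0"
    let ?S = "Poly_Mapping.keys \<alpha>' - T"
    have "?S \<subseteq> Poly_Mapping.keys \<alpha>" "\<alpha> - set_mono ?S = \<alpha>' - set_mono ?S"
      using a by (auto simp: coef_def emb_def lookup_single when_def split: if_splits)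
    moreover have "finite ?S" "?S \<subseteq> Poly_Mapping.keys \<alpha>'" by auto
    ultimately show False using minus_set_mono_add[of ?S \<alpha>] minus_set_mono_add[of ?S \<alpha>'] False by simp
  qed
  then show ?thesis using False by auto
qed

lemma chain_eq_sum_emb:
  fixes f :: "'v set \<Rightarrow> ('v, 'k::field) polynomial"
  assumes f: "f \<in> kchains L p j"
  shows "f = (\<Sum>\<alpha>\<in>multidegrees j. emb \<alpha> (coef \<alpha> f))"
proof
  fix S
  show "f S = (\<Sum>\<alpha>\<in>multidegrees j. emb \<alpha> (coef \<alpha> f)) S"
  proof (rule poly_mapping_eqI)
    fix m
    have "Poly_Mapping.lookup ((\<Sum>\<alpha>\<in>multidegrees j. emb \<alpha> (coef \<alpha> f)) S) m
        = (\<Sum>\<alpha>\<in>multidegrees j. Poly_Mapping.lookup (emb \<alpha> (coef \<alpha> f) S) m)"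
      by (simp add: sum_fun_apply lookup_sum)
    also have "\<dots> = (\<Sum>\<alpha>\<in>multidegrees j. if \<alpha> = m + set_mono S then Poly_Mapping.lookup (f S) m else 0)"
    proof (rule sum.cong[OF refl])
      fix \<alpha> assume \<alpha>: "\<alpha> \<in> multidegrees j"
      show "Poly_Mapping.lookup (emb \<alpha> (coef \<alpha> f) S) m = (if \<alpha> = m + set_mono S then Poly_Mapping.lookup (f S) m else 0)"
      proof (cases "S \<subseteq> Poly_Mapping.keys \<alpha>")
        case True
        then have fS: "finite S" by (meson finite_keys finite_subset)
        have "Poly_Mapping.keys \<alpha> - (Poly_Mapping.keys \<alpha> - S) = S" using True by blast
        then have "Poly_Mapping.lookup (emb \<alpha> (coef \<alpha> f) S) m
          = (if \<alpha> - set_mono S = m then Poly_Mapping.lookup (f S) m else 0)"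
          using True by (auto simp: emb_def coef_def lookup_single when_def)
        also have "\<alpha> - set_mono S = m \<longleftrightarrow> \<alpha> = m + set_mono S"
          using minus_set_mono_add[OF fS True] by auto
        finally show ?thesis .
      next
        case False
        have "Poly_Mapping.lookup (f S) m = 0" if e: "\<alpha> = m + set_mono S"
        proof (rule ccontr)
          assume "Poly_Mapping.lookup (f S) m \<noteq> 0"
          then have "f S \<noteq> 0" by auto
          then have "S \<subseteq> V" using f by (auto simp: kchains_def split: if_splits)
          then have "finite S" using finV finite_subset by blast
          then show False using False unfolding e by (auto simp: keys_add_nat keys_set_mono)
        qed
        then show ?thesis using False by (auto simp: emb_def)
      qed
    qed
    also have "\<dots> = (if m + set_mono S \<in> multidegrees j then Poly_Mapping.lookup (f S) m else 0)"
      using finite_multidegrees by simp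
    also have "\<dots> = Poly_Mapping.lookup (f S) m"
    proof -
      have "m + set_mono S \<in> multidegrees j" if "Poly_Mapping.lookup (f S) m \<noteq> 0"
      proof -
        have "f S \<noteq> 0" using that by auto
        then have S: "S \<subseteq> V" "card S = p" "f S \<in> mono_piece V L (j - int p)"
          using f by (auto simp: kchains_def split: if_splits)
        then have "finite S" using finV finite_subset by blast
        then show ?thesis using S that
          by (auto simp: multidegrees_def keys_add_nat keys_set_mono mono_degree_add mono_degree_set_mono mono_piece_iff)
      qed
      then show ?thesis by auto
    qed
    finally show "Poly_Mapping.lookup (f S) m = Poly_Mapping.lookup ((\<Sum>\<alpha>\<in>multidegrees j. emb \<alpha> (coef \<alpha> f)) S) m" ..
  qed
qed

lemma emb_in_kchains:
  fixes F :: "'v set \<Rightarrow> 'k::field"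
  assumes \<alpha>: "\<alpha> \<in> multidegrees j"
    and F: "F \<in> local_cochains (Poly_Mapping.keys \<alpha>) (mono_complex L \<alpha>) p"
  shows "emb \<alpha> F \<in> kchains L p j"
proof -
  let ?U = "Poly_Mapping.keys \<alpha>"
  have "if S \<subseteq> V \<and> card S = p then emb \<alpha> F S \<in> mono_piece V L (j - int p) else emb \<alpha> F S = 0" for S
  proof (cases "S \<subseteq> ?U \<and> F (?U - S) \<noteq> 0")
    case False
    then have "emb \<alpha> F S = 0" by (auto simp: emb_def)
    then show ?thesis by (auto simp: mono_piece_iff)
  next
    case True
    then have S: "S \<subseteq> ?U" "?U - S \<in> mono_complex L \<alpha>" "card (?U - S) + p = card ?U"
      using F by (auto simp: local_cochains_def)
    then have fS: "finite S" by (meson finite_keys finite_subset)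
    have "card S = p" using S fS card_mono[of ?U S] by (simp add: card_Diff_subset)
    moreover have "?U - (?U - S) = S" using S by blast
    then have "\<alpha> - set_mono S \<in> L" using S by (simp add: mono_complex_def)
    moreover have "S \<subseteq> V" using S \<alpha> by (auto simp: multidegrees_def)
    moreover have "Poly_Mapping.keys (\<alpha> - set_mono S) \<subseteq> V"
      using \<alpha> by (auto simp: multidegrees_def keys_minus_set_mono[OF fS])
    moreover have "int (mono_degree (\<alpha> - set_mono S)) = j - int p"
      using mono_degree_minus_set_mono[OF fS S(1)] \<alpha> \<open>card S = p\<close> by (simp add: multidegrees_def)
    ultimately show ?thesis using S(1) by (auto simp: emb_def mono_piece_iff lookup_single when_def)
  qed
  then show ?thesis unfolding kchains_def by blast
qed

lemma coef_in_local_cochains: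
  fixes f :: "'v set \<Rightarrow> ('v, 'k::field) polynomial"
  assumes f: "f \<in> kchains L p j"
  shows "coef \<alpha> f \<in> local_cochains (Poly_Mapping.keys \<alpha>) (mono_complex L \<alpha>) p"
  unfolding local_cochains_def
proof (intro CollectI allI impI)
  fix T assume a: "coef \<alpha> f T \<noteq> 0"
  let ?U = "Poly_Mapping.keys \<alpha>"
  let ?S = "?U - T"
  have T: "T \<subseteq> ?U" and l: "Poly_Mapping.lookup (f ?S) (\<alpha> - set_mono ?S) \<noteq> 0"
    using a by (auto simp: coef_def split: if_splits)
  then have "f ?S \<noteq> 0" by auto
  then have S: "card ?S = p" "f ?S \<in> mono_piece V L (j - int p)"
    using f by (auto simp: kchains_def split: if_splits)
  have fT: "finite T" using T by (meson finite_keys finite_subset)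
  have "card T + p = card ?U" using S(1) T fT card_mono[of ?U T] by (simp add: card_Diff_subset)
  moreover have "\<alpha> - set_mono ?S \<in> L" using S(2) l by (auto simp: mono_piece_iff)
  ultimately show "T \<in> mono_complex L \<alpha> \<and> T \<subseteq> ?U \<and> card T + p = card ?U"
    using T by (simp add: mono_complex_def)
qed

abbreviation "degree_cycles L \<alpha> p \<equiv> local_cycles (msign \<alpha>) (Poly_Mapping.keys \<alpha>) (mono_complex L \<alpha>) p"
abbreviation "degree_boundaries L \<alpha> p \<equiv> local_boundaries (msign \<alpha>) (Poly_Mapping.keys \<alpha>) (mono_complex L \<alpha>) p"

lemma coef_in_degree_cycles:
  fixes f :: "'v set \<Rightarrow> ('v, 'k::field) polynomial"
  assumes "\<alpha> \<in> multidegrees j" "f \<in> kcycles L p j"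
  shows "coef \<alpha> f \<in> degree_cycles L \<alpha> p"
proof -
  have "coboundary (msign \<alpha>) (coef \<alpha> f) T = 0" if "T \<subseteq> Poly_Mapping.keys \<alpha>" for T
    using coef_kdiff[of \<alpha> T f] assms that by (simp add: multidegrees_def kcycles_def coef_def)
  then show ?thesis using coef_in_local_cochains assms by (auto simp: local_cycles_def kcycles_def)
qed

lemma coef_in_degree_boundaries:
  fixes f :: "'v set \<Rightarrow> ('v, 'k::field) polynomial"
  assumes "\<alpha> \<in> multidegrees j" "f \<in> kboundaries L p j"
  shows "coef \<alpha> f \<in> degree_boundaries L \<alpha> p"
proof -
  obtain g where g: "g \<in> kchains L (Suc p) j" "f = kdiff g" using assms by (auto simp: kboundaries_def)
  have "coef \<alpha> f = (\<lambda>T. if T \<subseteq> Poly_Mapping.keys \<alpha> then coboundary (msign \<alpha>) (coef \<alpha> g) T else 0)"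
    using coef_kdiff[of \<alpha> _ g] assms(1) g(2) by (auto simp: multidegrees_def coef_def)
  then show ?thesis using coef_in_local_cochains[OF g(1)] unfolding local_boundaries_def by blast
qed

lemma emb_in_kcycles:
  fixes F :: "'v set \<Rightarrow> 'k::field"
  assumes "\<alpha> \<in> multidegrees j" "F \<in> degree_cycles L \<alpha> p"
  shows "emb \<alpha> F \<in> kcycles L p j"
proof -
  have "kdiff (emb \<alpha> F) = emb \<alpha> (\<lambda>T. 0)"
    using assms kdiff_emb[of \<alpha> F] by (simp add: multidegrees_def local_cycles_def cong: if_cong)
  also have "\<dots> = 0" by (auto simp: emb_def)
  finally show ?thesis using emb_in_kchains assms by (auto simp: kcycles_def local_cycles_def)
qed

lemma emb_in_kboundaries:
  fixes F :: "'v set \<Rightarrow> 'k::field"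
  assumes "\<alpha> \<in> multidegrees j" "F \<in> degree_boundaries L \<alpha> p"
  shows "emb \<alpha> F \<in> kboundaries L p j"
proof -
  obtain G where G: "G \<in> local_cochains (Poly_Mapping.keys \<alpha>) (mono_complex L \<alpha>) (Suc p)"
    "F = (\<lambda>T. if T \<subseteq> Poly_Mapping.keys \<alpha> then coboundary (msign \<alpha>) G T else 0)"
    using assms(2) by (auto simp: local_boundaries_def)
  have "emb \<alpha> F = kdiff (emb \<alpha> G)"
    using assms(1) kdiff_emb[of \<alpha> G] unfolding G(2) by (simp add: multidegrees_def)
  then show ?thesis using emb_in_kchains[OF assms(1) G(1)] by (auto simp: kboundaries_def)
qed

lemma subspace_kchains: "module.subspace chain_scale (kchains L p j :: ('v set \<Rightarrow> ('v, 'k::field) polynomial) set)"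
proof -
  interpret vector_space "chain_scale :: 'k \<Rightarrow> ('v set \<Rightarrow> ('v, 'k) polynomial) \<Rightarrow> _" by (rule vector_space_chain_scale)
  have add: "a \<in> mono_piece V L i \<Longrightarrow> b \<in> mono_piece V L i \<Longrightarrow> a + b \<in> mono_piece V L i"
    for a b :: "('v, 'k) polynomial" and i
    unfolding mono_piece_iff lookup_add by (metis add.right_neutral)
  have sc: "a \<in> mono_piece V L i \<Longrightarrow> poly_scale c a \<in> mono_piece V L i" for a :: "('v, 'k) polynomial" and i c
    unfolding mono_piece_iff lookup_poly_scale by auto
  have z: "0 \<in> mono_piece V L i" for i by (simp add: mono_piece_iff)
  have z0: "poly_scale c 0 = (0 :: ('v, 'k) polynomial)" for c by (simp add: poly_scale_def)
  show ?thesis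
    unfolding subspace_def kchains_def by (auto simp: add sc z z0 chain_scale_def)
qed

lemma subspace_kboundaries: "module.subspace chain_scale (kboundaries L p j :: ('v set \<Rightarrow> ('v, 'k::field) polynomial) set)"
proof -
  interpret Vector_Spaces.linear chain_scale chain_scale "kdiff :: ('v set \<Rightarrow> ('v, 'k::field) polynomial) \<Rightarrow> _"
    by (rule linear_kdiff)
  show ?thesis unfolding kboundaries_def by (rule subspace_image[OF subspace_kchains])
qed

lemma kcycle_is_boundary_if_locally:
  fixes f :: "'v set \<Rightarrow> ('v, 'k::field) polynomial"
  assumes f: "f \<in> kcycles L p j"
    and l: "\<And>\<alpha>. \<alpha> \<in> multidegrees j \<Longrightarrow> coef \<alpha> f \<in> degree_boundaries L \<alpha> p"
  shows "f \<in> kboundaries L p j"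
proof -
  interpret vector_space "chain_scale :: 'k \<Rightarrow> ('v set \<Rightarrow> ('v, 'k) polynomial) \<Rightarrow> _" by (rule vector_space_chain_scale)
  have "(\<Sum>\<alpha>\<in>multidegrees j. emb \<alpha> (coef \<alpha> f)) \<in> kboundaries L p j"
    by (intro subspace_sum[OF subspace_kboundaries] emb_in_kboundaries l)
  then show ?thesis using chain_eq_sum_emb[of f L p j] f by (simp add: kcycles_def)
qed

text \<open>The Koszul complex of the polynomial ring resolves the field. For the ideal of all monomials the
  complex in a nonzero multidegree is a full simplex, hence a cone; multidegree zero only contains
  the constant of \<open>f {}\<close>.\<close>

lemma kcycles_UNIV_acyclic:
  fixes f :: "'v set \<Rightarrow> ('v, 'k::field) polynomial"
  assumes f: "f \<in> kcycles UNIV p j" and f0: "Poly_Mapping.lookup (f {}) 0 = 0"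
  shows "f \<in> kboundaries UNIV p j"
proof (rule kcycle_is_boundary_if_locally[OF f])
  fix \<alpha> :: "'v \<Rightarrow>\<^sub>0 nat" assume \<alpha>: "\<alpha> \<in> multidegrees j"
  have c: "coef \<alpha> f \<in> degree_cycles UNIV \<alpha> p" by (rule coef_in_degree_cycles[OF \<alpha> f])
  show "coef \<alpha> f \<in> degree_boundaries UNIV \<alpha> p"
  proof (cases "Poly_Mapping.keys \<alpha> = {}")
    case False
    then obtain v0 where v0: "v0 \<in> Poly_Mapping.keys \<alpha>" by blast
    have "Poly_Mapping.keys \<alpha> \<subseteq> V" using \<alpha> by (simp add: multidegrees_def)
    then have "degree_cycles UNIV \<alpha> p \<subseteq> (degree_boundaries UNIV \<alpha> p :: ('v set \<Rightarrow> 'k) set)"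
      by (rule local_cone_acyclic[OF alt_signs_ksign finite_keys v0]) (simp add: mono_complex_def)
    then show ?thesis using c by blast
  next
    case True
    then have "\<alpha> = 0" by simp
    have "coef \<alpha> f T = 0" for T
    proof (cases "T = {}")
      case True then show ?thesis using f0 \<open>\<alpha> = 0\<close> by (simp add: coef_def set_mono_def)
    next
      case False then show ?thesis using True by (simp add: coef_def)
    qed
    then have "coef \<alpha> f = 0" by auto
    also have "(0 :: 'v set \<Rightarrow> 'k) = (\<lambda>T. if T \<subseteq> Poly_Mapping.keys \<alpha> then coboundary (msign \<alpha>) 0 T else 0)"
      by (auto simp: coboundary_def)
    finally have z: "coef \<alpha> f = (\<lambda>T. if T \<subseteq> Poly_Mapping.keys \<alpha> then coboundary (msign \<alpha>) 0 T else 0)" .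
    have "0 \<in> local_cochains (Poly_Mapping.keys \<alpha>) (mono_complex UNIV \<alpha>) (Suc p)"
      by (simp add: local_cochains_def)
    then show ?thesis unfolding local_boundaries_def z by (rule imageI)
  qed
qed

lemma qdim_koszul_by_multidegree:
  assumes "\<And>\<alpha>. \<alpha> \<in> multidegrees j \<Longrightarrow>
     qdim (\<lambda>c (F :: 'v set \<Rightarrow> 'k::field) T. c * F T) (degree_cycles L \<alpha> p) (degree_boundaries L \<alpha> p) (n \<alpha>)"
  shows "qdim chain_scale (kcycles L p j :: ('v set \<Rightarrow> ('v, 'k) polynomial) set) (kboundaries L p j)
     (\<Sum>\<alpha>\<in>multidegrees j. n \<alpha>)"
proof (rule qdim_direct_sum[OF finite_multidegrees linear_emb linear_coef])
  show "qdim (\<lambda>c (F :: 'v set \<Rightarrow> 'k::field) T. c * F T) (degree_cycles L \<alpha> p) (degree_boundaries L \<alpha> p) (n \<alpha>)"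
    if "\<alpha> \<in> multidegrees j" for \<alpha> using assms that .
  show "coef \<alpha>' (emb \<alpha> F) = (if \<alpha>' = \<alpha> then F else 0)" if "F \<in> degree_cycles L \<alpha> p"
    for \<alpha> \<alpha>' and F :: "'v set \<Rightarrow> 'k"
    using that by (intro coef_emb) (auto simp: local_cycles_def local_cochains_def)
  show "f = (\<Sum>\<alpha>\<in>multidegrees j. emb \<alpha> (coef \<alpha> f))" if "f \<in> kcycles L p j"
    for f :: "'v set \<Rightarrow> ('v, 'k) polynomial"
    using that chain_eq_sum_emb[of f L p j] by (simp add: kcycles_def)
qed (fact emb_in_kcycles emb_in_kboundaries coef_in_degree_cycles coef_in_degree_boundaries subspace_kboundaries
     vector_space_chain_scale)+

end

section \<open>Graded pieces\<close>

lemma graded_piece_zero [simp]: "0 \<in> graded_piece V j"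
  by (simp add: graded_piece_iff)

lemma graded_piece_add: "p \<in> graded_piece V j \<Longrightarrow> q \<in> graded_piece V j \<Longrightarrow> p + q \<in> graded_piece V j"
  unfolding graded_piece_iff lookup_add by (metis add.right_neutral)

lemma graded_piece_mult:
  assumes "p \<in> graded_piece V i" "q \<in> graded_piece V j"
  shows "p * q \<in> graded_piece V (i + j)"
  unfolding graded_piece_iff
proof (intro allI impI)
  fix m assume "Poly_Mapping.lookup (p * q) m \<noteq> 0"
  then have "m \<in> Poly_Mapping.keys (p * q)" by (simp add: in_keys_iff)
  then obtain a b where ab: "m = a + b" "a \<in> Poly_Mapping.keys p" "b \<in> Poly_Mapping.keys q"
    using keys_mult[of p q] by blast
  then have "Poly_Mapping.keys a \<subseteq> V" "int (mono_degree a) = i" "Poly_Mapping.keys b \<subseteq> V" "int (mono_degree b) = j"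
    using assms by (auto simp: graded_piece_iff in_keys_iff)
  then show "Poly_Mapping.keys m \<subseteq> V \<and> int (mono_degree m) = i + j"
    unfolding ab(1) keys_add_nat mono_degree_add by simp
qed

lemma indet_in_graded_piece: "v \<in> V \<Longrightarrow> indet v \<in> graded_piece V 1"
  by (simp add: graded_piece_iff indet_def lookup_single when_def)

lemma const_in_graded_piece: "Poly_Mapping.single 0 c \<in> graded_piece V 0"
  by (simp add: graded_piece_iff lookup_single when_def)

lemma graded_piece_minus: "p \<in> graded_piece V j \<Longrightarrow> - p \<in> graded_piece V j"
  by (simp add: graded_piece_iff)

lemma graded_piece_minus_one_power: "p \<in> graded_piece V j \<Longrightarrow> (-1) ^ n * p \<in> graded_piece V j"
  by (cases "even n") (auto intro: graded_piece_minus)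

lemma lookup_mult_0:
  fixes a b :: "('v, 'k::field) polynomial"
  assumes "Poly_Mapping.lookup a 0 = 0"
  shows "Poly_Mapping.lookup (a * b) 0 = 0"
proof (rule ccontr)
  assume "Poly_Mapping.lookup (a * b) 0 \<noteq> 0"
  then have "0 \<in> Poly_Mapping.keys (a * b)" by (simp add: in_keys_iff)
  then obtain x y where xy: "0 = x + y" "x \<in> Poly_Mapping.keys a"
    using keys_mult[of a b] by blast
  then have "Poly_Mapping.keys x = {}" using keys_add_nat[of x y] by auto
  then have "x = 0" by simp
  then show False using xy assms by (simp add: in_keys_iff)
qed

section \<open>Graded submodules of free modules\<close>

text \<open>Elements of a free module are functions that vanish from the rank on, so that modules of different
  rank live in one type.\<close>

type_synonym ('v, 'k) pvec = "nat \<Rightarrow> ('v, 'k) polynomial"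

definition vmult :: "('v, 'k::field) polynomial \<Rightarrow> ('v, 'k) pvec \<Rightarrow> ('v, 'k) pvec" where
  "vmult q f = (\<lambda>l. q * f l)"

text \<open>The module homomorphism that sends the \<open>k\<close>-th basis vector to \<open>g k\<close>, for \<open>k < n\<close>.\<close>

definition gmap :: "nat \<Rightarrow> (nat \<Rightarrow> ('v, 'k::field) pvec) \<Rightarrow> ('v, 'k) pvec \<Rightarrow> ('v, 'k) pvec" where
  "gmap n g f = (\<lambda>l. \<Sum>k<n. f k * g k l)"

lemma gmap_add: "gmap n g (f + h) = gmap n g f + gmap n g h"
  by (auto simp: gmap_def fun_eq_iff algebra_simps sum.distrib)

lemma gmap_diff: "gmap n g (f - h) = gmap n g f - gmap n g h"
  by (auto simp: gmap_def fun_eq_iff algebra_simps sum_subtractf)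

lemma gmap_zero [simp]: "gmap n g 0 = 0"
  by (auto simp: gmap_def fun_eq_iff)

lemma gmap_vmult: "gmap n g (vmult q f) = vmult q (gmap n g f)"
  by (auto simp: gmap_def vmult_def sum_distrib_left mult.assoc)

lemma gmap_sum: "gmap n g (\<Sum>i\<in>A. f i) = (\<Sum>i\<in>A. gmap n g (f i))"
  by (intro ext) (simp only: gmap_def sum_fun_apply sum_distrib_right, rule sum.swap)

lemma vmult_zero_right [simp]: "vmult q 0 = 0"
  by (auto simp: vmult_def fun_eq_iff)

context koszul
begin

text \<open>A graded module of vectors of polynomials is given by the family of its graded pieces.\<close>

definition graded_module :: "(int \<Rightarrow> ('v, 'k::field) pvec set) \<Rightarrow> bool" where
  "graded_module M \<longleftrightarrow> (\<forall>j. 0 \<in> M j) \<and> (\<forall>j. \<forall>f\<in>M j. \<forall>h\<in>M j. f + h \<in> M j) \<and>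
     (\<forall>i j. \<forall>q\<in>graded_piece V i. \<forall>f\<in>M j. vmult q f \<in> M (i + j))"

lemma graded_moduleD:
  assumes "graded_module M"
  shows "0 \<in> M j" "f \<in> M j \<Longrightarrow> h \<in> M j \<Longrightarrow> f + h \<in> M j"
    "q \<in> graded_piece V i \<Longrightarrow> f \<in> M j \<Longrightarrow> vmult q f \<in> M (i + j)"
  using assms unfolding graded_module_def by auto

lemma graded_module_minus:
  assumes "graded_module M" "f \<in> M j"
  shows "- f \<in> M j"
proof -
  have "- 1 \<in> graded_piece V 0"
    by (rule graded_piece_minus) (simp add: graded_piece_iff lookup_one when_def)
  then have "vmult (- 1) f \<in> M (0 + j)" using assms graded_moduleD(3) by blast
  moreover have "vmult (- 1) f = - f" by (auto simp: vmult_def fun_eq_iff)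
  ultimately show ?thesis by simp
qed

lemma graded_module_diff:
  "graded_module M \<Longrightarrow> f \<in> M j \<Longrightarrow> h \<in> M j \<Longrightarrow> f - h \<in> M j"
  using graded_moduleD(2)[of M f j "- h"] graded_module_minus[of M h j] by simp

lemma graded_module_sum:
  "graded_module M \<Longrightarrow> (\<And>i. i \<in> A \<Longrightarrow> f i \<in> M j) \<Longrightarrow> (\<Sum>i\<in>A. f i) \<in> M j"
  by (induction A rule: infinite_finite_induct) (auto intro: graded_moduleD)

text \<open>The degree \<open>j\<close> piece of the direct sum of the \<open>R(-(d ! k))\<close>.\<close>

definition free_piece :: "int list \<Rightarrow> int \<Rightarrow> ('v, 'k::field) pvec set" where
  "free_piece d j = {f. \<forall>k. if k < length d then f k \<in> graded_piece V (j - d ! k) else f k = 0}"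

lemma graded_module_free_piece: "graded_module (free_piece d)"
  unfolding graded_module_def
proof (intro conjI allI ballI)
  fix j and f h :: "('v, 'k::field) pvec" assume "f \<in> free_piece d j" "h \<in> free_piece d j"
  then show "f + h \<in> free_piece d j" by (auto simp: free_piece_def intro: graded_piece_add)
next
  fix i j and q :: "('v, 'k::field) polynomial" and f :: "('v, 'k) pvec" assume q: "q \<in> graded_piece V i" and f: "f \<in> free_piece d j"
  have "q * f k \<in> graded_piece V (i + j - d ! k)" if "k < length d" for k
    using graded_piece_mult[OF q, of "f k" "j - d ! k"] f that by (simp add: free_piece_def add_diff_eq)
  then show "vmult q f \<in> free_piece d (i + j)" using f by (auto simp: free_piece_def vmult_def)
qed (simp add: free_piece_def)

lemma gmap_in_module:
  assumes M: "graded_module M" and g: "\<And>k. k < length d \<Longrightarrow> g k \<in> M (d ! k)" and f: "f \<in> free_piece d j"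
  shows "gmap (length d) g f \<in> M j"
proof -
  have "vmult (f k) (g k) \<in> M j" if "k < length d" for k
    using graded_moduleD(3)[OF M, of "f k" "j - d ! k" "g k" "d ! k"] g that f by (simp add: free_piece_def)
  then have "(\<Sum>k<length d. vmult (f k) (g k)) \<in> M j" by (intro graded_module_sum[OF M]) auto
  moreover have "(\<Sum>k<length d. vmult (f k) (g k)) = gmap (length d) g f"
    by (auto simp: gmap_def vmult_def sum_fun_apply)
  ultimately show ?thesis by simp
qed

section \<open>Koszul homology of graded modules\<close>

definition mdiff :: "('v set \<Rightarrow> ('v, 'k::field) pvec) \<Rightarrow> 'v set \<Rightarrow> ('v, 'k) pvec" where
  "mdiff f S = (\<Sum>v\<in>V - S. vmult (ksign v S * indet v) (f (insert v S)))"

definition mscale :: "'k::field \<Rightarrow> ('v set \<Rightarrow> ('v, 'k) pvec) \<Rightarrow> 'v set \<Rightarrow> ('v, 'k) pvec" where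
  "mscale c f S = vmult (Poly_Mapping.single 0 c) (f S)"

definition mchains :: "(int \<Rightarrow> ('v, 'k::field) pvec set) \<Rightarrow> nat \<Rightarrow> int \<Rightarrow> ('v set \<Rightarrow> ('v, 'k) pvec) set" where
  "mchains M p j = {f. \<forall>S. if S \<subseteq> V \<and> card S = p then f S \<in> M (j - int p) else f S = 0}"

definition mcycles :: "(int \<Rightarrow> ('v, 'k::field) pvec set) \<Rightarrow> nat \<Rightarrow> int \<Rightarrow> ('v set \<Rightarrow> ('v, 'k) pvec) set" where
  "mcycles M p j = {f \<in> mchains M p j. mdiff f = 0}"

definition mboundaries :: "(int \<Rightarrow> ('v, 'k::field) pvec set) \<Rightarrow> nat \<Rightarrow> int \<Rightarrow> ('v set \<Rightarrow> ('v, 'k) pvec) set" where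
  "mboundaries M p j = mdiff ` mchains M (Suc p) j"

definition koszul_betti :: "(int \<Rightarrow> ('v, 'k::field) pvec set) \<Rightarrow> nat \<Rightarrow> int \<Rightarrow> nat \<Rightarrow> bool" where
  "koszul_betti M p j n \<longleftrightarrow> qdim mscale (mcycles M p j) (mboundaries M p j) n"

lemma mdiff_apply: "mdiff f S l = kdiff (\<lambda>S. f S l) S"
  by (simp add: mdiff_def kdiff_def sum_fun_apply vmult_def mult.assoc)

lemma vector_space_mscale: "vector_space (mscale :: 'k::field \<Rightarrow> ('v set \<Rightarrow> ('v, 'k) pvec) \<Rightarrow> _)"
proof -
  have "mscale = (\<lambda>c (f :: 'v set \<Rightarrow> ('v, 'k) pvec) S l. poly_scale c (f S l))"
    by (intro ext) (simp add: mscale_def vmult_def poly_scale_def)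
  then show ?thesis using vector_space_pointwise[OF vector_space_pointwise[OF vector_space_poly_scale]] by metis
qed

lemma linear_mdiff: "Vector_Spaces.linear mscale mscale (mdiff :: ('v set \<Rightarrow> ('v, 'k::field) pvec) \<Rightarrow> _)"
  unfolding Vector_Spaces.linear_iff
proof (intro conjI allI vector_space_mscale)
  fix c :: 'k and f h :: "'v set \<Rightarrow> ('v, 'k) pvec"
  have "kdiff (\<lambda>S. (f + h) S l) = kdiff (\<lambda>S. f S l) + kdiff (\<lambda>S. h S l)" for l
    using kdiff_add[of "\<lambda>S. f S l" "\<lambda>S. h S l"] by (simp add: plus_fun_def)
  then show "mdiff (f + h) = mdiff f + mdiff h" by (intro ext) (simp add: mdiff_apply)
  have "kdiff (\<lambda>S. mscale c f S l) S = Poly_Mapping.single 0 c * kdiff (\<lambda>S. f S l) S" for l S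
    using kdiff_const_times[of "Poly_Mapping.single 0 c" "\<lambda>S. f S l"] by (simp add: mscale_def vmult_def)
  then show "mdiff (mscale c f) = mscale c (mdiff f)" by (intro ext) (simp add: mdiff_apply mscale_def vmult_def)
qed

definition chain_map :: "nat \<Rightarrow> (nat \<Rightarrow> ('v, 'k::field) pvec) \<Rightarrow> ('v set \<Rightarrow> ('v, 'k) pvec) \<Rightarrow> 'v set \<Rightarrow> ('v, 'k) pvec" where
  "chain_map n g f S = gmap n g (f S)"

lemma linear_chain_map: "Vector_Spaces.linear mscale mscale (chain_map n g :: ('v set \<Rightarrow> ('v, 'k::field) pvec) \<Rightarrow> _)"
  unfolding Vector_Spaces.linear_iff
  by (auto intro!: vector_space_mscale simp: fun_eq_iff chain_map_def gmap_add mscale_def gmap_vmult)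

lemma mdiff_chain_map: "mdiff (chain_map n g f) = chain_map n g (mdiff f)"
  by (intro ext) (simp add: mdiff_def chain_map_def gmap_sum gmap_vmult)

lemma mchains_outside: "f \<in> mchains M p j \<Longrightarrow> \<not> (S \<subseteq> V \<and> card S = p) \<Longrightarrow> f S = 0"
  by (simp add: mchains_def)

lemma mchains_inside: "f \<in> mchains M p j \<Longrightarrow> S \<subseteq> V \<Longrightarrow> card S = p \<Longrightarrow> f S \<in> M (j - int p)"
  unfolding mchains_def by (drule CollectD, drule spec[of _ S]) simp

lemma mdiff_in_mchains:
  fixes f :: "'v set \<Rightarrow> ('v, 'k::field) pvec"
  assumes M: "graded_module M" and f: "f \<in> mchains M (Suc p) j"
  shows "mdiff f \<in> mchains M p j"
proof -
  have "if S \<subseteq> V \<and> card S = p then mdiff f S \<in> M (j - int p) else mdiff f S = 0" for S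
  proof (cases "S \<subseteq> V \<and> card S = p")
    case True
    then have fS: "finite S" using finV finite_subset by blast
    have "vmult (ksign v S * indet v) (f (insert v S)) \<in> M (j - int p)" if v: "v \<in> V - S" for v
    proof -
      have "f (insert v S) \<in> M (j - int (Suc p))"
        using True v fS by (intro mchains_inside[OF f]) auto
      moreover have "(ksign v S * indet v :: ('v, 'k) polynomial) \<in> graded_piece V 1"
        unfolding ksign_def using v by (intro graded_piece_minus_one_power indet_in_graded_piece) auto
      ultimately have "vmult (ksign v S * indet v) (f (insert v S)) \<in> M (1 + (j - int (Suc p)))"
        by (intro graded_moduleD(3)[OF M])
      then show ?thesis by simp
    qed
    then show ?thesis using True unfolding mdiff_def using graded_module_sum[OF M, of "V - S"] by presburger
  next
    case False
    have "f (insert v S) = 0" if v: "v \<in> V - S" for v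
    proof (rule mchains_outside[OF f])
      show "\<not> (insert v S \<subseteq> V \<and> card (insert v S) = Suc p)"
        using False v finV finite_subset[of S V] by auto
    qed
    then have "mdiff f S = 0" unfolding mdiff_def by (intro sum.neutral) simp
    then show ?thesis unfolding if_not_P[OF False] .
  qed
  then show ?thesis unfolding mchains_def by blast
qed

lemma mdiff_mdiff:
  assumes f: "f \<in> mchains M p j"
  shows "mdiff (mdiff f) = 0"
proof (intro ext)
  fix S l
  have k: "kdiff (kdiff (\<lambda>S. f S l)) S = 0"
  proof (cases "S \<subseteq> V")
    case True then show ?thesis by (rule kdiff_kdiff)
  next
    case False
    then have "f (insert u (insert v S)) l = 0" for u v using mchains_outside[OF f, of "insert u (insert v S)"] by auto
    then show ?thesis by (simp add: kdiff_def)
  qed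
  have "mdiff (mdiff f) S l = kdiff (\<lambda>S. kdiff (\<lambda>S. f S l) S) S" by (simp add: mdiff_apply)
  then show "mdiff (mdiff f) S l = 0 S l" using k by simp
qed

lemma subspace_mchains:
  assumes M: "graded_module M"
  shows "module.subspace mscale (mchains M p j :: ('v set \<Rightarrow> ('v, 'k::field) pvec) set)"
proof -
  interpret vector_space "mscale :: 'k \<Rightarrow> ('v set \<Rightarrow> ('v, 'k) pvec) \<Rightarrow> _" by (rule vector_space_mscale)
  have sc: "vmult (Poly_Mapping.single 0 c) f \<in> M i" if "f \<in> M i" for c f i
    using graded_moduleD(3)[OF M const_in_graded_piece that, of c] by simp
  show ?thesis unfolding subspace_def mchains_def
    using sc graded_moduleD(1,2)[OF M] by (auto simp: mscale_def)
qed

lemma subspace_mboundaries: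
  assumes M: "graded_module M"
  shows "module.subspace mscale (mboundaries M p j :: ('v set \<Rightarrow> ('v, 'k::field) pvec) set)"
proof -
  interpret Vector_Spaces.linear mscale mscale "mdiff :: ('v set \<Rightarrow> ('v, 'k::field) pvec) \<Rightarrow> _"
    by (rule linear_mdiff)
  show ?thesis unfolding mboundaries_def by (rule subspace_image[OF subspace_mchains[OF M]])
qed

lemma koszul_betti_unique:
  "graded_module M \<Longrightarrow> koszul_betti M p j n \<Longrightarrow> koszul_betti M p j m \<Longrightarrow> m = n"
  unfolding koszul_betti_def by (rule qdim_unique[OF vector_space_mscale subspace_mboundaries])

text \<open>Componentwise this is the exactness of the Koszul complex of the polynomial ring.\<close>

lemma free_piece_acyclic:
  fixes f :: "'v set \<Rightarrow> ('v, 'k::field) pvec"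
  assumes f: "f \<in> mcycles (free_piece d) p j" and f0: "\<And>l. Poly_Mapping.lookup (f {} l) 0 = 0"
  shows "f \<in> mboundaries (free_piece d) p j"
proof -
  have "\<exists>h. h \<in> kchains UNIV (Suc p) (j - d ! l) \<and> (\<lambda>S. f S l) = kdiff h" if l: "l < length d" for l
  proof -
    have "(\<lambda>S. f S l) \<in> kchains UNIV p (j - d ! l)"
    proof -
      have "if S \<subseteq> V \<and> card S = p then f S l \<in> mono_piece V UNIV (j - d ! l - int p) else f S l = 0" for S
      proof -
        have "f S l \<in> graded_piece V (j - d ! l - int p)" if "S \<subseteq> V" "card S = p"
        proof -
          have "f S l \<in> graded_piece V (j - int p - d ! l)"
            using mchains_inside[of f "free_piece d" p j S] f l that by (simp add: mcycles_def free_piece_def)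
          moreover have "j - int p - d ! l = j - d ! l - int p" by simp
          ultimately show ?thesis by (simp only:)
        qed
        then show ?thesis
          using f l mchains_inside[of f "free_piece d" p j S] mchains_outside[of f "free_piece d" p j S]
          by (auto simp: mcycles_def mono_piece_def)
      qed
      then show ?thesis unfolding kchains_def by blast
    qed
    moreover have "kdiff (\<lambda>S. f S l) = 0"
    proof
      fix S
      have "mdiff f S l = 0" using f by (simp add: mcycles_def)
      then show "kdiff (\<lambda>S. f S l) S = 0 S" by (simp add: mdiff_apply)
    qed
    ultimately have "(\<lambda>S. f S l) \<in> kcycles UNIV p (j - d ! l)" by (simp add: kcycles_def)
    then have "(\<lambda>S. f S l) \<in> kboundaries UNIV p (j - d ! l)" by (rule kcycles_UNIV_acyclic) (rule f0)
    then show ?thesis unfolding kboundaries_def by blast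
  qed
  then obtain h where h: "\<And>l. l < length d \<Longrightarrow> h l \<in> kchains UNIV (Suc p) (j - d ! l)"
    "\<And>l. l < length d \<Longrightarrow> (\<lambda>S. f S l) = kdiff (h l)" by metis
  define H where "H S l = (if l < length d then h l S else 0)" for S l
  have "H \<in> mchains (free_piece d) (Suc p) j"
  proof -
    have "if S \<subseteq> V \<and> card S = Suc p then H S \<in> free_piece d (j - int (Suc p)) else H S = 0" for S
    proof (cases "S \<subseteq> V \<and> card S = Suc p")
      case True
      then have "h l S \<in> mono_piece V UNIV (j - d ! l - int (Suc p))" if "l < length d" for l
        using h(1)[OF that] unfolding kchains_def by (auto dest: spec[of _ S])
      then have "H S \<in> free_piece d (j - int (Suc p))"
        by (auto simp: free_piece_def H_def mono_piece_def algebra_simps)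
      then show ?thesis using True by simp
    next
      case False
      then have "h l S = 0" if "l < length d" for l
        using h(1)[OF that] unfolding kchains_def by (auto dest: spec[of _ S])
      then have "H S = 0" by (auto simp: H_def)
      then show ?thesis unfolding if_not_P[OF False] .
    qed
    then show ?thesis unfolding mchains_def by blast
  qed
  moreover have "mdiff H = f"
  proof (intro ext)
    fix S l
    show "mdiff H S l = f S l"
    proof (cases "l < length d")
      case True
      have "mdiff H S l = kdiff (h l) S" unfolding mdiff_apply using True by (simp add: H_def)
      also have "\<dots> = f S l" using h(2)[OF True] by metis
      finally show ?thesis .
    next
      case False
      then have "f S l = 0"
        using f mchains_inside[of f "free_piece d" p j S] mchains_outside[of f "free_piece d" p j S]
        by (cases "S \<subseteq> V \<and> card S = p") (auto simp: mcycles_def free_piece_def)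
      moreover have "mdiff H S l = 0" unfolding mdiff_apply using False by (simp add: H_def kdiff_def)
      ultimately show ?thesis by simp
    qed
  qed
  ultimately show ?thesis unfolding mboundaries_def by blast
qed

section \<open>Dimension shifting\<close>

definition gker :: "int list \<Rightarrow> (nat \<Rightarrow> ('v, 'k::field) pvec) \<Rightarrow> int \<Rightarrow> ('v, 'k) pvec set" where
  "gker d g j = {f \<in> free_piece d j. gmap (length d) g f = 0}"

text \<open>A surjection of a free module onto \<open>M\<close>; minimality is the last conjunct, which says that the
  kernel lies in \<open>\<mm> F\<close>.\<close>

definition minimal_cover :: "(int \<Rightarrow> ('v, 'k::field) pvec set) \<Rightarrow> int list \<Rightarrow> (nat \<Rightarrow> ('v, 'k) pvec) \<Rightarrow> bool" where
  "minimal_cover M d g \<longleftrightarrow> graded_module M \<and> (\<forall>k<length d. g k \<in> M (d ! k)) \<and>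
     (\<forall>j. \<forall>z\<in>M j. \<exists>f\<in>free_piece d j. gmap (length d) g f = z) \<and>
     (\<forall>j. \<forall>f\<in>gker d g j. \<forall>k<length d. Poly_Mapping.lookup (f k) 0 = 0)"

lemma graded_module_gker: "graded_module (gker d g)"
  using graded_module_free_piece[of d]
  unfolding graded_module_def gker_def by (auto simp: gmap_add gmap_vmult simp del: zero_fun_def)

lemma gker_const_zero:
  assumes "minimal_cover M d g" "f \<in> gker d g j"
  shows "Poly_Mapping.lookup (f k) 0 = 0"
proof (cases "k < length d")
  case True then show ?thesis using assms unfolding minimal_cover_def by blast
next
  case False then show ?thesis using assms(2) by (auto simp: gker_def free_piece_def)
qed

lemma minimal_coverD:
  assumes "minimal_cover M d g"
  shows "graded_module M" "k < length d \<Longrightarrow> g k \<in> M (d ! k)"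
    "z \<in> M j \<Longrightarrow> \<exists>f\<in>free_piece d j. gmap (length d) g f = z"
  using assms by (auto simp: minimal_cover_def)

lemma chain_map_in_mchains:
  assumes M: "graded_module M" and g: "\<And>k. k < length d \<Longrightarrow> g k \<in> M (d ! k)"
    and f: "f \<in> mchains (free_piece d) p j"
  shows "chain_map (length d) g f \<in> mchains M p j"
proof -
  have "if S \<subseteq> V \<and> card S = p then chain_map (length d) g f S \<in> M (j - int p)
     else chain_map (length d) g f S = 0" for S
  proof (cases "S \<subseteq> V \<and> card S = p")
    case True
    then show ?thesis using gmap_in_module[OF M g mchains_inside[OF f]] by (simp add: chain_map_def)
  next
    case False
    then have "f S = 0" using mchains_outside[OF f] by blast
    then have "chain_map (length d) g f S = 0" unfolding chain_map_def by (simp only: gmap_zero)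
    then show ?thesis unfolding if_not_P[OF False] .
  qed
  then show ?thesis unfolding mchains_def by blast
qed

lemma chain_map_lift:
  assumes c: "\<And>z. z \<in> M (j - int p) \<Longrightarrow> \<exists>f\<in>free_piece d (j - int p). gmap (length d) g f = z"
    and z: "z \<in> mchains M p j"
  shows "\<exists>f\<in>mchains (free_piece d) p j. chain_map (length d) g f = z"
proof -
  have "\<exists>f. if S \<subseteq> V \<and> card S = p then f \<in> free_piece d (j - int p) \<and> gmap (length d) g f = z S else f = 0" for S
  proof (cases "S \<subseteq> V \<and> card S = p")
    case True
    then have "z S \<in> M (j - int p)" using mchains_inside[OF z] by blast
    then have "\<exists>f\<in>free_piece d (j - int p). gmap (length d) g f = z S" by (rule c)
    then show ?thesis using True by auto
  next
    case False then show ?thesis unfolding if_not_P[OF False] by blast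
  qed
  then obtain f where f: "\<And>S. if S \<subseteq> V \<and> card S = p
     then f S \<in> free_piece d (j - int p) \<and> gmap (length d) g (f S) = z S else f S = 0" by metis
  have "f \<in> mchains (free_piece d) p j"
    unfolding mchains_def
  proof (intro CollectI allI)
    fix S show "if S \<subseteq> V \<and> card S = p then f S \<in> free_piece d (j - int p) else f S = 0"
      using f[of S] by (auto split: if_splits)
  qed
  moreover have "chain_map (length d) g f = z"
  proof
    fix S show "chain_map (length d) g f S = z S"
    proof (cases "S \<subseteq> V \<and> card S = p")
      case True then show ?thesis using f[of S] by (simp add: chain_map_def)
    next
      case False
      then have "f S = 0" "z S = 0" using f[of S] mchains_outside[OF z] by auto
      then show ?thesis unfolding chain_map_def by (simp only: gmap_zero)
    qed
  qed
  ultimately show ?thesis by blast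
qed

lemma mchains_gker_iff:
  "f \<in> mchains (gker d g) p j \<longleftrightarrow> f \<in> mchains (free_piece d) p j \<and> chain_map (length d) g f = 0"
proof
  assume f: "f \<in> mchains (gker d g) p j"
  have "if S \<subseteq> V \<and> card S = p then f S \<in> free_piece d (j - int p) else f S = 0" for S
    using mchains_inside[OF f, of S] mchains_outside[OF f, of S] by (auto simp: gker_def)
  then have "f \<in> mchains (free_piece d) p j" unfolding mchains_def by blast
  moreover have "chain_map (length d) g f S = 0" for S
  proof (cases "S \<subseteq> V \<and> card S = p")
    case True
    then show ?thesis using mchains_inside[OF f, of S] by (simp add: chain_map_def gker_def)
  next
    case False
    then have "f S = 0" using mchains_outside[OF f] by blast
    then show ?thesis unfolding chain_map_def by (simp only: gmap_zero)
  qed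
  ultimately show "f \<in> mchains (free_piece d) p j \<and> chain_map (length d) g f = 0" by auto
next
  assume a: "f \<in> mchains (free_piece d) p j \<and> chain_map (length d) g f = 0"
  then have f: "f \<in> mchains (free_piece d) p j" by blast
  have "gmap (length d) g (f S) = 0" for S using a chain_map_def[of "length d" g f S] by simp
  then have "if S \<subseteq> V \<and> card S = p then f S \<in> gker d g (j - int p) else f S = 0" for S
    using mchains_inside[OF f, of S] mchains_outside[OF f, of S] by (auto simp: gker_def)
  then show "f \<in> mchains (gker d g) p j" unfolding mchains_def by blast
qed

text \<open>The only obstruction to being a boundary in the free module is a constant in homological degree
  zero, and minimality excludes it.\<close>

lemma mcycle_gker_is_boundary:
  assumes c: "minimal_cover M d g" and z: "z \<in> mcycles (gker d g) p j"
  shows "z \<in> mboundaries (free_piece d) p j"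
proof (rule free_piece_acyclic)
  have zc: "z \<in> mchains (gker d g) p j" using z by (simp add: mcycles_def)
  then have "z \<in> mchains (free_piece d) p j" by (simp add: mchains_gker_iff)
  then show "z \<in> mcycles (free_piece d) p j" using z by (simp add: mcycles_def)
  fix l show "Poly_Mapping.lookup (z {} l) 0 = 0"
  proof (cases "p = 0")
    case True
    then have "z {} \<in> gker d g (j - int p)" using mchains_inside[OF zc, of "{}"] by simp
    then show ?thesis by (rule gker_const_zero[OF c])
  next
    case False then show ?thesis using mchains_outside[OF zc, of "{}"] by simp
  qed
qed

text \<open>The connecting homomorphism of \<open>0 \<rightarrow> ker \<rightarrow> F \<rightarrow> M \<rightarrow> 0\<close>, as a comparison of two images:
  on the chains of \<open>F\<close> that map to cycles of \<open>M\<close>, the covering map yields the homology of \<open>M\<close> and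
  the differential yields the homology of the kernel one degree below.\<close>

lemma koszul_betti_shift:
  assumes c: "minimal_cover M d g" and b: "koszul_betti M (Suc p) j n"
  shows "koszul_betti (gker d g) p j n"
proof -
  let ?\<pi> = "chain_map (length d) g"
  let ?C = "mchains (free_piece d) (Suc p) j"
  define F where "F = {f \<in> ?C. mdiff (?\<pi> f) = 0}"
  have M: "graded_module M" using c by (simp add: minimal_cover_def)
  interpret p: Vector_Spaces.linear mscale mscale ?\<pi> by (rule linear_chain_map)
  interpret d: Vector_Spaces.linear mscale mscale mdiff by (rule linear_mdiff)
  have subF: "module.subspace mscale F"
  proof -
    have C: "p.vs1.subspace ?C" by (rule subspace_mchains[OF graded_module_free_piece])
    have 0: "mdiff (?\<pi> 0) = 0" by (simp only: p.zero d.zero)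
    show ?thesis unfolding F_def p.vs1.subspace_def
      using p.vs1.subspace_0[OF C] p.vs1.subspace_add[OF C] p.vs1.subspace_scale[OF C] 0
      by (simp add: p.add p.scale d.add d.scale)
  qed
  have 1: "?\<pi> ` F = mcycles M (Suc p) j"
  proof
    show "?\<pi> ` F \<subseteq> mcycles M (Suc p) j"
      using chain_map_in_mchains[OF minimal_coverD(1,2)[OF c]] by (auto simp: F_def mcycles_def)
    show "mcycles M (Suc p) j \<subseteq> ?\<pi> ` F"
    proof
      fix z assume z: "z \<in> mcycles M (Suc p) j"
      then have "z \<in> mchains M (Suc p) j" by (simp add: mcycles_def)
      then obtain f where "f \<in> ?C" "?\<pi> f = z" using chain_map_lift[OF minimal_coverD(3)[OF c]] by blast
      then show "z \<in> ?\<pi> ` F" using z by (auto simp: F_def mcycles_def)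
    qed
  qed
  have 2: "?\<pi> ` {f \<in> F. mdiff f = 0} = mboundaries M (Suc p) j"
  proof
    show "?\<pi> ` {f \<in> F. mdiff f = 0} \<subseteq> mboundaries M (Suc p) j"
    proof clarify
      fix f assume f: "f \<in> F" "mdiff f = 0"
      then have fc: "f \<in> mcycles (free_piece d) (Suc p) j" by (simp add: F_def mcycles_def)
      have "f {} = 0" using f mchains_outside[of f "free_piece d" "Suc p" j "{}"] by (simp add: F_def)
      then have "f \<in> mboundaries (free_piece d) (Suc p) j" by (intro free_piece_acyclic fc) simp
      then obtain h where h: "h \<in> mchains (free_piece d) (Suc (Suc p)) j" "f = mdiff h"
        by (auto simp: mboundaries_def)
      then have "?\<pi> f = mdiff (?\<pi> h)" by (simp only: mdiff_chain_map)
      then show "?\<pi> f \<in> mboundaries M (Suc p) j"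
        using chain_map_in_mchains[OF minimal_coverD(1,2)[OF c] h(1)] by (auto simp: mboundaries_def)
    qed
    show "mboundaries M (Suc p) j \<subseteq> ?\<pi> ` {f \<in> F. mdiff f = 0}"
    proof
      fix z assume "z \<in> mboundaries M (Suc p) j"
      then obtain y where y: "y \<in> mchains M (Suc (Suc p)) j" "z = mdiff y" by (auto simp: mboundaries_def)
      obtain h where h: "h \<in> mchains (free_piece d) (Suc (Suc p)) j" "?\<pi> h = y"
        using chain_map_lift[OF minimal_coverD(3)[OF c] y(1)] by blast
      have "mdiff h \<in> ?C" by (rule mdiff_in_mchains[OF graded_module_free_piece h(1)])
      moreover have dd: "mdiff (mdiff h) = 0" by (rule mdiff_mdiff[OF h(1)])
      moreover have "?\<pi> (mdiff h) = z" using h y by (simp add: mdiff_chain_map[symmetric])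
      moreover have "mdiff z = 0" unfolding y(2) by (rule mdiff_mdiff[OF y(1)])
      ultimately show "z \<in> ?\<pi> ` {f \<in> F. mdiff f = 0}" unfolding F_def by blast
    qed
  qed
  have 3: "mdiff ` F = mcycles (gker d g) p j"
  proof
    show "mdiff ` F \<subseteq> mcycles (gker d g) p j"
    proof clarify
      fix f assume f: "f \<in> F"
      then have fC: "f \<in> ?C" by (simp add: F_def)
      have "mdiff f \<in> mchains (free_piece d) p j" by (rule mdiff_in_mchains[OF graded_module_free_piece fC])
      moreover have "?\<pi> (mdiff f) = 0" using f by (simp add: F_def mdiff_chain_map[symmetric])
      moreover have "mdiff (mdiff f) = 0" by (rule mdiff_mdiff[OF fC])
      ultimately show "mdiff f \<in> mcycles (gker d g) p j" by (simp add: mcycles_def mchains_gker_iff)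
    qed
    show "mcycles (gker d g) p j \<subseteq> mdiff ` F"
    proof
      fix z assume z: "z \<in> mcycles (gker d g) p j"
      obtain f where f: "f \<in> ?C" "z = mdiff f"
        using mcycle_gker_is_boundary[OF c z] by (auto simp: mboundaries_def)
      have "?\<pi> z = 0" using z by (simp add: mcycles_def mchains_gker_iff)
      then have "mdiff (?\<pi> f) = 0" using f by (simp add: mdiff_chain_map)
      then show "z \<in> mdiff ` F" using f by (auto simp: F_def)
    qed
  qed
  have 4: "mdiff ` {f \<in> F. ?\<pi> f = 0} = mboundaries (gker d g) p j"
  proof -
    have "{f \<in> F. ?\<pi> f = 0} = mchains (gker d g) (Suc p) j"
      by (auto simp: F_def mchains_gker_iff d.zero)
    then show ?thesis by (simp add: mboundaries_def)
  qed
  show ?thesis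
    using qdim_two_images[OF linear_chain_map[of "length d" g] linear_mdiff subF, of n] b
    unfolding koszul_betti_def 1 2 3 4 .
qed

section \<open>Minimal generators\<close>

definition point_chain :: "('v, 'k::field) pvec \<Rightarrow> 'v set \<Rightarrow> ('v, 'k) pvec" where
  "point_chain z S = (if S = {} then z else 0)"

lemma mchains_0_iff: "f \<in> mchains M 0 j \<longleftrightarrow> (\<exists>z\<in>M j. f = point_chain z)"
proof
  assume f: "f \<in> mchains M 0 j"
  have "f S = point_chain (f {}) S" for S
  proof (cases "S = {}")
    case False
    then have "\<not> (S \<subseteq> V \<and> card S = 0)" using finite_subset[OF _ finV] by (metis card_eq_0_iff)
    then show ?thesis using mchains_outside[OF f] False by (simp add: point_chain_def)
  qed (simp add: point_chain_def)
  then have "f = point_chain (f {})" by (rule ext)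
  moreover have "f {} \<in> M j" using mchains_inside[OF f, of "{}"] by simp
  ultimately show "\<exists>z\<in>M j. f = point_chain z" by (rule bexI)
next
  assume "\<exists>z\<in>M j. f = point_chain z"
  then obtain z where z: "z \<in> M j" "f = point_chain z" by blast
  have e: "S \<subseteq> V \<and> card S = 0 \<longleftrightarrow> S = {}" for S
    using finite_subset[OF _ finV] by (metis card_eq_0_iff empty_subsetI)
  show "f \<in> mchains M 0 j" unfolding mchains_def e using z by (simp add: point_chain_def)
qed

lemma mdiff_point_chain: "mdiff (point_chain z) = 0"
  by (intro ext) (simp add: mdiff_apply point_chain_def kdiff_def)

lemma mcycles_0: "mcycles M 0 j = point_chain ` M j"
  by (auto simp: mcycles_def mchains_0_iff mdiff_point_chain)

lemma mdiff_const_zero: "Poly_Mapping.lookup (mdiff f S l) 0 = 0"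
  by (simp add: mdiff_apply kdiff_def lookup_sum lookup_ksign_times lookup_indet_times)

lemma point_chain_sum:
  "point_chain (\<Sum>i\<in>A. vmult (Poly_Mapping.single 0 (c i)) (g i)) = (\<Sum>i\<in>A. mscale (c i) (point_chain (g i)))"
proof
  fix S
  show "point_chain (\<Sum>i\<in>A. vmult (Poly_Mapping.single 0 (c i)) (g i)) S = (\<Sum>i\<in>A. mscale (c i) (point_chain (g i))) S"
    by (cases "S = {}") (simp_all add: point_chain_def mscale_def sum_fun_apply)
qed

lemma point_chain_diff: "point_chain (z - w) = point_chain z - point_chain w"
  by (auto simp: point_chain_def fun_eq_iff)

text \<open>The part of an element of a free module that has constant coefficients.\<close>

definition const_part :: "int list \<Rightarrow> int \<Rightarrow> (nat \<Rightarrow> 'k::field) \<Rightarrow> ('v, 'k) pvec" where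
  "const_part d j c k = (if k < length d \<and> d ! k = j then Poly_Mapping.single 0 (c k) else 0)"

lemma const_part_in_free_piece: "const_part d j c \<in> free_piece d j"
  using const_in_graded_piece[where V = V] by (auto simp: free_piece_def const_part_def)

lemma gmap_const_part:
  "gmap (length d) g (const_part d j c) = (\<Sum>k\<in>{k. k < length d \<and> d ! k = j}. vmult (Poly_Mapping.single 0 (c k)) (g k))"
proof
  fix l
  have "gmap (length d) g (const_part d j c) l = (\<Sum>k<length d. if d ! k = j then Poly_Mapping.single 0 (c k) * g k l else 0)"
    unfolding gmap_def by (rule sum.cong) (auto simp: const_part_def)
  also have "\<dots> = (\<Sum>k\<in>{..<length d} \<inter> {k. d ! k = j}. Poly_Mapping.single 0 (c k) * g k l)"
    by (subst sum.inter_restrict) auto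
  also have "{..<length d} \<inter> {k. d ! k = j} = {k. k < length d \<and> d ! k = j}" by auto
  finally show "gmap (length d) g (const_part d j c) l
     = (\<Sum>k\<in>{k. k < length d \<and> d ! k = j}. vmult (Poly_Mapping.single 0 (c k)) (g k)) l"
    by (simp add: sum_fun_apply vmult_def)
qed

lemma free_piece_const_zero:
  assumes f: "f \<in> free_piece d j"
  shows "Poly_Mapping.lookup ((f - const_part d j (\<lambda>k. Poly_Mapping.lookup (f k) 0)) l) 0 = 0"
proof (cases "l < length d \<and> d ! l = j")
  case False
  have "Poly_Mapping.lookup (f l) 0 = 0"
  proof (cases "l < length d")
    case True
    then have "f l \<in> graded_piece V (j - d ! l)" "j - d ! l \<noteq> 0" using f False by (auto simp: free_piece_def)
    then show ?thesis by (auto simp: graded_piece_iff)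
  next
    case False then show ?thesis using f by (simp add: free_piece_def)
  qed
  then show ?thesis using False by (auto simp: const_part_def lookup_minus)
qed (simp add: const_part_def lookup_minus)

text \<open>In the free module, elements of \<open>\<mm> F\<close> are boundaries; this is exactness at place zero.\<close>

lemma no_const_part_boundary:
  assumes f: "f \<in> free_piece d j" and 0: "\<And>l. Poly_Mapping.lookup (f l) 0 = 0"
  shows "\<exists>h\<in>mchains (free_piece d) 1 j. mdiff h = point_chain f"
proof -
  have "point_chain f \<in> mcycles (free_piece d) 0 j" using f by (simp add: mcycles_0)
  then have "point_chain f \<in> mboundaries (free_piece d) 0 j"
    by (rule free_piece_acyclic) (simp add: point_chain_def 0)
  then show ?thesis unfolding mboundaries_def by auto
qed

lemma chain_map_point_chain: "chain_map n g (point_chain f) = point_chain (gmap n g f)"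
proof
  fix S show "chain_map n g (point_chain f) S = point_chain (gmap n g f) S"
    by (cases "S = {}") (simp_all add: chain_map_def point_chain_def gmap_zero del: zero_fun_apply)
qed

lemma mod_const_part_boundary:
  assumes g: "graded_module M" "\<And>k. k < length d \<Longrightarrow> g k \<in> M (d ! k)" and f: "f \<in> free_piece d j"
  shows "\<exists>h\<in>mchains (free_piece d) 1 j.
     point_chain (gmap (length d) g f)
       - (\<Sum>k\<in>{k. k < length d \<and> d ! k = j}. mscale (Poly_Mapping.lookup (f k) 0) (point_chain (g k)))
     = mdiff (chain_map (length d) g h)"
proof -
  let ?f = "f - const_part d j (\<lambda>k. Poly_Mapping.lookup (f k) 0)"
  have "?f \<in> free_piece d j"
    by (intro graded_module_diff[OF graded_module_free_piece] f const_part_in_free_piece)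
  then obtain h where h: "h \<in> mchains (free_piece d) 1 j" "mdiff h = point_chain ?f"
    using no_const_part_boundary free_piece_const_zero[OF f] by blast
  have "mdiff (chain_map (length d) g h) = point_chain (gmap (length d) g ?f)"
    by (simp only: mdiff_chain_map h chain_map_point_chain)
  also have "\<dots> = point_chain (gmap (length d) g f)
       - (\<Sum>k\<in>{k. k < length d \<and> d ! k = j}. mscale (Poly_Mapping.lookup (f k) 0) (point_chain (g k)))"
    by (simp only: gmap_diff gmap_const_part point_chain_diff point_chain_sum)
  finally show ?thesis using h(1) by metis
qed

lemma card_positions: "card {k. k < length d \<and> d ! k = j} = count_list d j"
  by (simp add: count_list_eq_length_filter length_filter_conv_card eq_commute)

text \<open>The homology at place zero is \<open>M / \<mm> M\<close>. The generators of degree \<open>j\<close> span its degree \<open>j\<close> part,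
  and a relation among them modulo \<open>\<mm> M\<close> would give an element of the kernel with a nonzero
  constant entry.\<close>

lemma koszul_betti_0:
  assumes c: "minimal_cover M d g"
  shows "koszul_betti M 0 j (count_list d j)"
proof -
  let ?A = "{k. k < length d \<and> d ! k = j}"
  have M: "graded_module M" and g: "\<And>k. k < length d \<Longrightarrow> g k \<in> M (d ! k)"
    using c by (auto simp: minimal_cover_def)
  have cm: "chain_map (length d) g h \<in> mchains M 1 j" if "h \<in> mchains (free_piece d) 1 j" for h
    by (rule chain_map_in_mchains[OF minimal_coverD(1,2)[OF c] that])
  have "basis_mod mscale (mcycles M 0 j) (mboundaries M 0 j) ?A (\<lambda>k. point_chain (g k))"
    unfolding basis_mod_def
  proof (intro conjI ballI allI impI)
    fix k assume "k \<in> ?A" then show "point_chain (g k) \<in> mcycles M 0 j" using g by (auto simp: mcycles_0)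
  next
    fix z assume "z \<in> mcycles M 0 j"
    then obtain y where y: "y \<in> M j" "z = point_chain y" by (auto simp: mcycles_0)
    then obtain f where f: "f \<in> free_piece d j" "gmap (length d) g f = y"
      using c unfolding minimal_cover_def by blast
    obtain h where h: "h \<in> mchains (free_piece d) 1 j"
      "point_chain y - (\<Sum>k\<in>?A. mscale (Poly_Mapping.lookup (f k) 0) (point_chain (g k)))
         = mdiff (chain_map (length d) g h)"
      using mod_const_part_boundary[OF M g f(1)] f(2) by auto
    have "mdiff (chain_map (length d) g h) \<in> mboundaries M 0 j"
      unfolding mboundaries_def using cm[OF h(1)] by simp
    then have "z - (\<Sum>k\<in>?A. mscale (Poly_Mapping.lookup (f k) 0) (point_chain (g k))) \<in> mboundaries M 0 j"
      unfolding y(2) h(2) .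
    then show "\<exists>c. z - (\<Sum>k\<in>?A. mscale (c k) (point_chain (g k))) \<in> mboundaries M 0 j"
      by (rule exI[of _ "\<lambda>k. Poly_Mapping.lookup (f k) 0"])
  next
    fix u k assume s: "(\<Sum>k\<in>?A. mscale (u k) (point_chain (g k))) \<in> mboundaries M 0 j" and k: "k \<in> ?A"
    then obtain y where y: "y \<in> mchains M 1 j" "(\<Sum>k\<in>?A. mscale (u k) (point_chain (g k))) = mdiff y"
      by (auto simp: mboundaries_def)
    obtain h where h: "h \<in> mchains (free_piece d) 1 j" "chain_map (length d) g h = y"
      using chain_map_lift[OF minimal_coverD(3)[OF c] y(1)] by blast
    have "mdiff h \<in> mchains (free_piece d) 0 j"
      using mdiff_in_mchains[OF graded_module_free_piece, of h d 0 j] h(1) by simp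
    then have h0: "mdiff h {} \<in> free_piece d j" using mchains_inside[of _ _ 0 j "{}"] by force
    let ?f = "const_part d j u - mdiff h {}"
    have "gmap (length d) g ?f = 0"
    proof -
      have "gmap (length d) g (const_part d j u) = mdiff y {}"
        using y(2) unfolding gmap_const_part
        by (simp add: point_chain_sum[symmetric] point_chain_def[of _ "{}"] flip: y(2))
      moreover have "gmap (length d) g (mdiff h {}) = mdiff y {}"
        using h(2) by (simp add: mdiff_chain_map chain_map_def flip: h(2))
      ultimately show ?thesis by (simp add: gmap_diff)
    qed
    moreover have "?f \<in> free_piece d j"
      by (intro graded_module_diff[OF graded_module_free_piece] h0 const_part_in_free_piece)
    ultimately have "?f \<in> gker d g j" by (simp add: gker_def)
    then have "Poly_Mapping.lookup (?f k) 0 = 0" by (rule gker_const_zero[OF c])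
    then show "u k = 0" using k by (simp add: lookup_minus mdiff_const_zero const_part_def)
  qed
  moreover have "finite ?A" by simp
  ultimately show ?thesis unfolding koszul_betti_def card_positions[symmetric] by (intro qdimI)
qed

end

section \<open>Existence of minimal covers\<close>

text \<open>Generators are listed as pairs of a degree and a number; the positions at which a degree occurs
  then correspond to the numbers that belong to it.\<close>

lemma bij_betw_positions:
  assumes ps: "distinct ps" "set ps = (SIGMA j:D. {..<b j})" and j: "j \<in> D"
  shows "bij_betw (\<lambda>k. snd (ps ! k)) {k. k < length (map fst ps) \<and> map fst ps ! k = j} {..<b j}"
  unfolding bij_betw_def
proof
  show "inj_on (\<lambda>k. snd (ps ! k)) {k. k < length (map fst ps) \<and> map fst ps ! k = j}"
  proof (rule inj_onI)
    fix k l assume kl: "k \<in> {k. k < length (map fst ps) \<and> map fst ps ! k = j}"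
      "l \<in> {k. k < length (map fst ps) \<and> map fst ps ! k = j}" "snd (ps ! k) = snd (ps ! l)"
    then have "ps ! k = ps ! l" by (auto simp: prod_eq_iff)
    then show "k = l" using kl ps(1) by (auto simp: nth_eq_iff_index_eq)
  qed
  show "(\<lambda>k. snd (ps ! k)) ` {k. k < length (map fst ps) \<and> map fst ps ! k = j} = {..<b j}"
  proof
    show "(\<lambda>k. snd (ps ! k)) ` {k. k < length (map fst ps) \<and> map fst ps ! k = j} \<subseteq> {..<b j}"
    proof
      fix i assume "i \<in> (\<lambda>k. snd (ps ! k)) ` {k. k < length (map fst ps) \<and> map fst ps ! k = j}"
      then obtain k where k: "k < length ps" "fst (ps ! k) = j" "i = snd (ps ! k)" by auto
      then have "ps ! k \<in> (SIGMA j:D. {..<b j})" using ps(2) nth_mem by metis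
      then show "i \<in> {..<b j}" using k by auto
    qed
    show "{..<b j} \<subseteq> (\<lambda>k. snd (ps ! k)) ` {k. k < length (map fst ps) \<and> map fst ps ! k = j}"
    proof
      fix i assume "i \<in> {..<b j}"
      then have "(j, i) \<in> set ps" using ps(2) j by auto
      then obtain k where "k < length ps" "ps ! k = (j, i)" by (auto simp: in_set_conv_nth)
      then show "i \<in> (\<lambda>k. snd (ps ! k)) ` {k. k < length (map fst ps) \<and> map fst ps ! k = j}"
        by (intro image_eqI[of _ _ k]) auto
    qed
  qed
qed

context koszul
begin

text \<open>The graded Nakayama lemma: representatives of bases of \<open>M / \<mm> M\<close> generate \<open>M\<close>, by induction on
  the degree, which starts because \<open>M\<close> is bounded below. Minimality expresses that the
  representatives are independent modulo \<open>\<mm> M\<close>. Finiteness of the list of generators comes from the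
  hypothesis on the homology at place zero and not from a Noetherian argument.\<close>

lemma minimal_cover_exists:
  fixes M :: "int \<Rightarrow> ('v, 'k::field) pvec set"
  assumes M: "graded_module M" and low: "\<And>j. j < lo \<Longrightarrow> M j \<subseteq> {0}"
    and betti: "\<And>j. koszul_betti M 0 j (b j)" and bJ: "\<And>j. j > J \<Longrightarrow> b j = 0"
  shows "\<exists>d g. minimal_cover M d g"
proof -
  have "\<forall>j. \<exists>\<beta>. basis_mod mscale (mcycles M 0 j) (mboundaries M 0 j) {..<b j} \<beta>"
    using betti unfolding koszul_betti_def qdim_def by blast
  then obtain \<beta> where \<beta>: "\<And>j. basis_mod mscale (mcycles M 0 j) (mboundaries M 0 j) {..<b j} (\<beta> j)"
    by metis
  have "\<exists>x\<in>M j. \<beta> j i = point_chain x" if "i < b j" for i j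
  proof -
    have "\<beta> j i \<in> mcycles M 0 j" using \<beta>[of j] that unfolding basis_mod_def by blast
    then show ?thesis unfolding mcycles_0 by blast
  qed
  then have "\<forall>j i. \<exists>x. i < b j \<longrightarrow> x \<in> M j \<and> \<beta> j i = point_chain x" by blast
  then obtain x where "\<forall>j i. i < b j \<longrightarrow> x j i \<in> M j \<and> \<beta> j i = point_chain (x j i)" by metis
  then have x: "\<And>i j. i < b j \<Longrightarrow> x j i \<in> M j" "\<And>i j. i < b j \<Longrightarrow> \<beta> j i = point_chain (x j i)"
    by blast+
  have "finite (SIGMA j:{lo..J}. {..<b j})" by auto
  then obtain ps where ps: "distinct ps" "set ps = (SIGMA j:{lo..J}. {..<b j})"
    using finite_distinct_list by metis
  define d where "d = map fst ps"
  define g where "g k = x (fst (ps ! k)) (snd (ps ! k))" for k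
  let ?A = "\<lambda>j. {k. k < length d \<and> d ! k = j}"
  have psk: "fst (ps ! k) \<in> {lo..J}" "snd (ps ! k) < b (fst (ps ! k))" "d ! k = fst (ps ! k)"
    if "k < length d" for k
  proof -
    have k: "k < length ps" using that by (simp add: d_def)
    then have "ps ! k \<in> (SIGMA j:{lo..J}. {..<b j})" using ps(2) nth_mem by metis
    then show "fst (ps ! k) \<in> {lo..J}" "snd (ps ! k) < b (fst (ps ! k))" by auto
    show "d ! k = fst (ps ! k)" using k by (simp add: d_def)
  qed
  have gM: "g k \<in> M (d ! k)" if "k < length d" for k
    unfolding psk(3)[OF that] g_def by (rule x(1)) (rule psk(2)[OF that])
  have bij: "bij_betw (\<lambda>k. snd (ps ! k)) (?A j) {..<b j}" if "j \<in> {lo..J}" for j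
    unfolding d_def by (rule bij_betw_positions[OF ps that])
  have reindex: "(\<Sum>k\<in>?A j. mscale (c (snd (ps ! k))) (point_chain (g k))) = (\<Sum>i<b j. mscale (c i) (\<beta> j i))"
    if "j \<in> {lo..J}" for c j
  proof -
    have "(\<Sum>i<b j. mscale (c i) (\<beta> j i)) = (\<Sum>k\<in>?A j. mscale (c (snd (ps ! k))) (\<beta> j (snd (ps ! k))))"
      by (rule sum.reindex_bij_betw[OF bij[OF that], symmetric])
    also have "\<dots> = (\<Sum>k\<in>?A j. mscale (c (snd (ps ! k))) (point_chain (g k)))"
    proof (rule sum.cong[OF refl])
      fix k assume k: "k \<in> ?A j"
      then have kj: "fst (ps ! k) = j" using psk(3)[of k] by simp
      then have "\<beta> j (snd (ps ! k)) = point_chain (x j (snd (ps ! k)))" using psk(2)[of k] k by (intro x(2)) simp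
      then show "mscale (c (snd (ps ! k))) (\<beta> j (snd (ps ! k))) = mscale (c (snd (ps ! k))) (point_chain (g k))"
        unfolding g_def kj by simp
    qed
    finally show ?thesis by simp
  qed
  \<comment> \<open>the number \<open>n\<close> bounds how far the degree is above \<open>lo\<close>\<close>
  have surj: "\<forall>z\<in>M j. \<exists>f\<in>free_piece d j. gmap (length d) g f = z" if "j < lo + int n" for j n
    using that
  proof (induction n arbitrary: j)
    case 0
    have "0 \<in> free_piece d j" by (rule graded_moduleD(1)[OF graded_module_free_piece])
    then have "\<exists>f\<in>free_piece d j. gmap (length d) g f = 0" using gmap_zero by blast
    then show ?case using low[of j] 0 by auto
  next
    case (Suc n)
    show ?case
    proof (cases "j < lo")
      case True
      have "0 \<in> free_piece d j" by (rule graded_moduleD(1)[OF graded_module_free_piece])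
      then have "\<exists>f\<in>free_piece d j. gmap (length d) g f = 0" using gmap_zero by blast
      then show ?thesis using low[OF True] by auto
    next
      case False
      show ?thesis
      proof
        fix z assume z: "z \<in> M j"
        have "point_chain z \<in> mcycles M 0 j" using z by (simp add: mcycles_0)
        then obtain c where c: "point_chain z - (\<Sum>i<b j. mscale (c i) (\<beta> j i)) \<in> mboundaries M 0 j"
          using \<beta>[of j] unfolding basis_mod_def by blast
        have eqs: "(\<Sum>i<b j. mscale (c i) (\<beta> j i)) = (\<Sum>k\<in>?A j. mscale (c (snd (ps ! k))) (point_chain (g k)))"
        proof (cases "j \<le> J")
          case True then show ?thesis using reindex[of j c] False by simp
        next
          case J: False
          have e: "?A j = {}" using psk J by force
          show ?thesis unfolding e using bJ[of j] J by simp
        qed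
        \<comment> \<open>modulo the chosen generators, \<open>z\<close> is a boundary, which involves only elements of degree \<open>j - 1\<close>\<close>
        obtain y where y: "y \<in> mchains M 1 j" "point_chain z - (\<Sum>i<b j. mscale (c i) (\<beta> j i)) = mdiff y"
          using c unfolding mboundaries_def by auto
        have "\<exists>h\<in>mchains (free_piece d) 1 j. chain_map (length d) g h = y"
        proof (rule chain_map_lift[OF _ y(1)])
          fix w assume "w \<in> M (j - int 1)"
          then show "\<exists>f\<in>free_piece d (j - int 1). gmap (length d) g f = w"
            using Suc.IH[of "j - int 1"] Suc.prems by auto
        qed
        then obtain h where h: "h \<in> mchains (free_piece d) 1 j" "chain_map (length d) g h = y" by blast
        let ?c = "const_part d j (\<lambda>k. c (snd (ps ! k)))"
        have "mdiff h \<in> mchains (free_piece d) 0 j"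
          using mdiff_in_mchains[OF graded_module_free_piece, of h d 0 j] h(1) by simp
        then have h0: "mdiff h {} \<in> free_piece d j" using mchains_inside[of _ _ 0 j "{}"] by force
        have "gmap (length d) g (?c + mdiff h {}) = z"
        proof -
          have "point_chain z - point_chain (gmap (length d) g ?c) = mdiff y"
            using y(2) unfolding eqs gmap_const_part point_chain_sum .
          then have "(point_chain z - point_chain (gmap (length d) g ?c)) {} = mdiff y {}" by (rule arg_cong)
          then have "z - gmap (length d) g ?c = mdiff y {}" by (simp add: point_chain_def)
          moreover have "gmap (length d) g (mdiff h {}) = mdiff y {}"
            unfolding h(2)[symmetric] mdiff_chain_map chain_map_def ..
          ultimately show ?thesis unfolding gmap_add by (metis add.commute diff_add_cancel)
        qed
        moreover have "?c + mdiff h {} \<in> free_piece d j"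
          by (intro graded_moduleD(2)[OF graded_module_free_piece] h0 const_part_in_free_piece)
        ultimately show "\<exists>f\<in>free_piece d j. gmap (length d) g f = z" by blast
      qed
    qed
  qed
  have min: "Poly_Mapping.lookup (f k) 0 = 0" if f: "f \<in> gker d g j" and k: "k < length d" for f j k
  proof (cases "d ! k = j")
    case False
    have "f \<in> free_piece d j" using f by (simp add: gker_def)
    then show ?thesis using free_piece_const_zero[of f d j k] False by (simp add: const_part_def lookup_minus)
  next
    case True
    have ff: "f \<in> free_piece d j" "gmap (length d) g f = 0" using f by (auto simp: gker_def)
    have j: "j \<in> {lo..J}" using psk[OF k] True by simp
    have kA: "k \<in> ?A j" using k True by simp
    define c where "c i = Poly_Mapping.lookup (f (inv_into (?A j) (\<lambda>k. snd (ps ! k)) i)) 0" for i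
    have cs: "c (snd (ps ! l)) = Poly_Mapping.lookup (f l) 0" if "l \<in> ?A j" for l
      unfolding c_def using bij_betw_imp_inj_on[OF bij[OF j]] that by (subst inv_into_f_f) auto
    obtain h where h: "h \<in> mchains (free_piece d) 1 j"
      "point_chain (gmap (length d) g f)
       - (\<Sum>k\<in>?A j. mscale (Poly_Mapping.lookup (f k) 0) (point_chain (g k))) = mdiff (chain_map (length d) g h)"
      using mod_const_part_boundary[OF M gM ff(1)] by blast
    have "chain_map (length d) g h \<in> mchains M 1 j" by (rule chain_map_in_mchains[OF M gM h(1)])
    then have bd: "mdiff (chain_map (length d) g h) \<in> mboundaries M 0 j" by (simp add: mboundaries_def)
    interpret vector_space "mscale :: 'k \<Rightarrow> ('v set \<Rightarrow> ('v, 'k) pvec) \<Rightarrow> _" by (rule vector_space_mscale)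
    have "(\<Sum>i<b j. mscale (c i) (\<beta> j i)) = (\<Sum>k\<in>?A j. mscale (c (snd (ps ! k))) (point_chain (g k)))"
      by (rule reindex[OF j, symmetric])
    also have "\<dots> = (\<Sum>k\<in>?A j. mscale (Poly_Mapping.lookup (f k) 0) (point_chain (g k)))"
      by (rule sum.cong[OF refl]) (simp only: cs)
    also have "\<dots> = point_chain (gmap (length d) g f) - mdiff (chain_map (length d) g h)"
      unfolding h(2)[symmetric] by simp
    also have "point_chain (gmap (length d) g f) = 0"
      unfolding ff(2) by (auto simp: point_chain_def)
    finally have "(\<Sum>i<b j. mscale (c i) (\<beta> j i)) = - mdiff (chain_map (length d) g h)" by (simp only: diff_0)
    then have "(\<Sum>i<b j. mscale (c i) (\<beta> j i)) \<in> mboundaries M 0 j"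
      using subspace_neg[OF subspace_mboundaries[OF M] bd] by simp
    then have "\<forall>i\<in>{..<b j}. c i = 0" using \<beta>[of j] unfolding basis_mod_def by blast
    moreover have "snd (ps ! k) < b j" using psk[OF k] True by simp
    ultimately show ?thesis using cs[OF kA] by simp
  qed
  have "minimal_cover M d g"
    unfolding minimal_cover_def
  proof (intro conjI allI impI M)
    fix j
    have "j < lo + int (nat (j - lo + 1))" by linarith
    then show "\<forall>z\<in>M j. \<exists>f\<in>free_piece d j. gmap (length d) g f = z" by (rule surj)
  qed (use gM min in blast)+
  then show ?thesis by blast
qed

text \<open>A minimal resolution, degree by degree: each step covers the kernel of the one before.\<close>

definition cover_sequence ::
  "(int \<Rightarrow> ('v, 'k::field) pvec set) \<Rightarrow> (nat \<Rightarrow> int list) \<Rightarrow> (nat \<Rightarrow> nat \<Rightarrow> ('v, 'k) pvec) \<Rightarrow> bool" where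
  "cover_sequence M d g \<longleftrightarrow> minimal_cover M (d 0) (g 0) \<and>
     (\<forall>i. minimal_cover (gker (d i) (g i)) (d (Suc i)) (g (Suc i)))"

text \<open>Every kernel shifts the homological degree by one, so the generators of the \<open>i\<close>-th step, which
  are counted by the homology at place zero of the \<open>i\<close>-th kernel, are counted by the homology of
  \<open>M\<close> at place \<open>i\<close>.\<close>

lemma cover_sequence_betti:
  assumes c: "cover_sequence M d g" and b: "\<And>p. koszul_betti M p j (b p)"
  shows "count_list (d i) j = b i"
proof -
  define N where "N i = (case i of 0 \<Rightarrow> M | Suc i \<Rightarrow> gker (d i) (g i))" for i
  have cov: "minimal_cover (N i) (d i) (g i)" for i
    using c by (cases i) (auto simp: cover_sequence_def N_def)
  have "koszul_betti (N i) p j (b (i + p))" for p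
  proof (induction i arbitrary: p)
    case 0 then show ?case using b by (simp add: N_def)
  next
    case (Suc i)
    show ?case using koszul_betti_shift[OF cov Suc.IH[of "Suc p"]] by (simp add: N_def)
  qed
  from this[of 0] have "koszul_betti (N i) 0 j (b i)" by simp
  then show ?thesis
    using koszul_betti_unique[OF minimal_coverD(1)[OF cov] _ koszul_betti_0[OF cov]] by blast
qed

lemma gker_bounded_below: "\<exists>lo. \<forall>j<lo. gker d g j \<subseteq> {0}"
proof (intro exI allI impI subsetI)
  fix j f assume j: "j < Min (insert 0 (set d))" and f: "f \<in> gker d g j"
  have "f k = 0" for k
  proof (cases "k < length d")
    case True
    then have "j - d ! k < 0" using j nth_mem[OF True] by simp
    moreover have "f k \<in> graded_piece V (j - d ! k)" using f True by (simp add: gker_def free_piece_def)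
    ultimately have "Poly_Mapping.lookup (f k) m = 0" for m by (auto simp: graded_piece_iff)
    then show ?thesis by (simp add: poly_mapping_eqI)
  next
    case False then show ?thesis using f by (simp add: gker_def free_piece_def)
  qed
  then show "f \<in> {0}" by auto
qed

text \<open>The construction can be iterated because a kernel satisfies the hypotheses again: its homology is
  that of \<open>M\<close>, shifted.\<close>

lemma cover_sequence_exists:
  fixes M :: "int \<Rightarrow> ('v, 'k::field) pvec set"
  assumes M: "graded_module M" and low: "\<And>j. j < lo \<Longrightarrow> M j \<subseteq> {0}"
    and betti: "\<And>p j. koszul_betti M p j (b p j)" and bJ: "\<And>p j. j > J \<Longrightarrow> b p j = 0"
  shows "\<exists>d g. cover_sequence M d g"
proof -
  define good where "good i N \<longleftrightarrow> graded_module N \<and> (\<exists>lo. \<forall>j<lo. N j \<subseteq> {0}) \<and> (\<forall>p j. koszul_betti N p j (b (i + p) j))"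
    for i and N :: "int \<Rightarrow> ('v, 'k) pvec set"
  have cov: "\<exists>d g. minimal_cover N d g" if N: "good i N" for i N
  proof -
    obtain lo where "\<forall>j<lo. N j \<subseteq> {0}" "graded_module N" using N by (auto simp: good_def)
    moreover have "koszul_betti N 0 j (b i j)" for j
      using N unfolding good_def by (metis add_0_right)
    ultimately show ?thesis using minimal_cover_exists[of N lo "b i" J] bJ by blast
  qed
  have next_good: "good (Suc i) (gker d g)" if "good i N" "minimal_cover N d g" for i N d g
    unfolding good_def
  proof (intro conjI allI graded_module_gker gker_bounded_below)
    fix p j
    have "koszul_betti N (Suc p) j (b (i + Suc p) j)" using that(1) unfolding good_def by blast
    then show "koszul_betti (gker d g) p j (b (Suc i + p) j)" using koszul_betti_shift[OF that(2)] by simp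
  qed
  \<comment> \<open>the sequence consists of the module that is covered, the degrees and the generators\<close>
  define P where "P i x \<longleftrightarrow> (case x of (N, d, g) \<Rightarrow> good i N \<and> minimal_cover N d g \<and> (i = 0 \<longrightarrow> N = M))"
    for i :: nat and x :: "(int \<Rightarrow> ('v, 'k) pvec set) \<times> int list \<times> (nat \<Rightarrow> ('v, 'k) pvec)"
  define Q where "Q x y \<longleftrightarrow> fst y = gker (fst (snd x)) (snd (snd x))"
    for x y :: "(int \<Rightarrow> ('v, 'k) pvec set) \<times> int list \<times> (nat \<Rightarrow> ('v, 'k) pvec)"
  have "\<exists>f. \<forall>i. P i (f i) \<and> Q (f i) (f (Suc i))"
  proof (rule dependent_nat_choice)
    have "good 0 M" unfolding good_def using M low betti by auto
    then show "\<exists>x. P 0 x" using cov by (auto simp: P_def)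
  next
    fix x i assume "P i x"
    then obtain N d g where x: "x = (N, d, g)" "good i N" "minimal_cover N d g" by (cases x) (auto simp: P_def)
    have "good (Suc i) (gker d g)" by (rule next_good[OF x(2,3)])
    then show "\<exists>y. P (Suc i) y \<and> Q x y" using cov[of "Suc i" "gker d g"] by (auto simp: P_def Q_def x(1))
  qed
  then obtain f where f: "\<And>i. P i (f i)" "\<And>i. Q (f i) (f (Suc i))" by blast
  have "cover_sequence M (\<lambda>i. fst (snd (f i))) (\<lambda>i. snd (snd (f i)))"
    unfolding cover_sequence_def
  proof (intro conjI allI)
    show "minimal_cover M (fst (snd (f 0))) (snd (snd (f 0)))" using f(1)[of 0] by (auto simp: P_def split: prod.splits)
    fix i
    show "minimal_cover (gker (fst (snd (f i))) (snd (snd (f i)))) (fst (snd (f (Suc i)))) (snd (snd (f (Suc i))))"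
      using f(1)[of "Suc i"] f(2)[of i] by (auto simp: P_def Q_def split: prod.splits)
  qed
  then show ?thesis by blast
qed

end

section \<open>Homogeneous components\<close>

definition hcomp :: "int \<Rightarrow> ('v, 'k::field) polynomial \<Rightarrow> ('v, 'k) polynomial" where
  "hcomp j p = Poly_Mapping.Abs_poly_mapping (\<lambda>m. if int (mono_degree m) = j then Poly_Mapping.lookup p m else 0)"

lemma lookup_hcomp: "Poly_Mapping.lookup (hcomp j p) m = (if int (mono_degree m) = j then Poly_Mapping.lookup p m else 0)"
proof -
  have "finite {m. (if int (mono_degree m) = j then Poly_Mapping.lookup p m else 0) \<noteq> 0}"
    by (rule finite_subset[of _ "Poly_Mapping.keys p"]) (auto simp: in_keys_iff)
  then show ?thesis unfolding hcomp_def by (subst lookup_Abs_poly_mapping) auto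
qed

lemma hcomp_sum: "hcomp j (\<Sum>i\<in>A. f i) = (\<Sum>i\<in>A. hcomp j (f i))"
  by (rule poly_mapping_eqI) (auto simp: lookup_hcomp lookup_sum)

lemma hcomp_graded: "p \<in> graded_piece W i \<Longrightarrow> hcomp j p = (if i = j then p else 0)"
  by (rule poly_mapping_eqI) (auto simp: lookup_hcomp graded_piece_iff)

lemma hcomp_in_graded_piece: "p \<in> poly_carrier W \<Longrightarrow> hcomp j p \<in> graded_piece W j"
  by (auto simp: graded_piece_iff lookup_hcomp poly_carrier_def in_keys_iff split: if_splits)

definition poly_degrees :: "('v, 'k::field) polynomial \<Rightarrow> int set" where
  "poly_degrees p = (\<lambda>m. int (mono_degree m)) ` Poly_Mapping.keys p"

lemma sum_hcomp:
  assumes "finite D" "poly_degrees p \<subseteq> D"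
  shows "(\<Sum>i\<in>D. hcomp i p) = p"
proof (rule poly_mapping_eqI)
  fix m
  have "Poly_Mapping.lookup (\<Sum>i\<in>D. hcomp i p) m = (if int (mono_degree m) \<in> D then Poly_Mapping.lookup p m else 0)"
    using assms(1) by (simp add: lookup_sum lookup_hcomp)
  also have "\<dots> = Poly_Mapping.lookup p m"
    using assms(2) unfolding poly_degrees_def by (metis imageI in_keys_iff subsetD)
  finally show "Poly_Mapping.lookup (\<Sum>i\<in>D. hcomp i p) m = Poly_Mapping.lookup p m" .
qed

lemma finite_poly_degrees: "finite (poly_degrees p)" by (simp add: poly_degrees_def)

lemma hcomp_mult:
  assumes a: "a \<in> graded_piece W e"
  shows "hcomp j (p * a) = hcomp (j - e) p * (a :: ('v, 'k::field) polynomial)"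
proof -
  have a': "a \<in> graded_piece UNIV e" using a by (auto simp: graded_piece_iff)
  let ?D = "insert (j - e) (poly_degrees p)"
  have "p \<in> poly_carrier UNIV" by (simp add: poly_carrier_def)
  then have h: "hcomp i p * a \<in> graded_piece UNIV (i + e)" for i
    using graded_piece_mult[OF hcomp_in_graded_piece a'] by blast
  have "p * a = (\<Sum>i\<in>?D. hcomp i p * a)"
  proof -
    have "(\<Sum>i\<in>?D. hcomp i p) = p" by (rule sum_hcomp) (auto simp: finite_poly_degrees)
    then show ?thesis by (simp only: sum_distrib_right[symmetric])
  qed
  then have "hcomp j (p * a) = (\<Sum>i\<in>?D. hcomp j (hcomp i p * a))" by (simp only: hcomp_sum)
  also have "\<dots> = (\<Sum>i\<in>?D. if i = j - e then hcomp i p * a else 0)"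
    using hcomp_graded[OF h] by (intro sum.cong refl) auto
  also have "\<dots> = hcomp (j - e) p * a" using finite_poly_degrees[of p] by (subst sum.delta) auto
  finally show ?thesis .
qed

definition vec_fun :: "'a::zero vec \<Rightarrow> nat \<Rightarrow> 'a" where
  "vec_fun w k = (if k < dim_vec w then w $ k else 0)"

lemma mult_mat_vec_gmap:
  assumes A: "A \<in> carrier_mat n m" and w: "w \<in> carrier_vec m"
    and g: "\<And>k l. k < m \<Longrightarrow> l < n \<Longrightarrow> g k l = A $$ (l, k)" and l: "l < n"
  shows "(A *\<^sub>v w) $ l = gmap m g (vec_fun w) l"
proof -
  have "(A *\<^sub>v w) $ l = (\<Sum>k\<in>{0..<m}. A $$ (l, k) * w $ k)"
    using A w l by (auto simp: scalar_prod_def intro!: sum.cong)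
  also have "\<dots> = (\<Sum>k<m. vec_fun w k * g k l)"
    unfolding atLeast0LessThan by (rule sum.cong) (use w g l in \<open>auto simp: vec_fun_def mult.commute\<close>)
  finally show ?thesis by (simp add: gmap_def)
qed

lemma vec_vec_fun: "w \<in> carrier_vec n \<Longrightarrow> vec n (vec_fun w) = w"
  by (auto simp: vec_fun_def)

context koszul
begin

definition free_all :: "int list \<Rightarrow> ('v, 'k::field) pvec set" where
  "free_all d = {f. \<forall>k. if k < length d then f k \<in> poly_carrier V else f k = 0}"

text \<open>The homogeneous component of degree \<open>j\<close> of an element of the free module with shifts \<open>d\<close>.\<close>

definition vcomp :: "int list \<Rightarrow> int \<Rightarrow> ('v, 'k::field) pvec \<Rightarrow> ('v, 'k) pvec" where
  "vcomp d j f k = (if k < length d then hcomp (j - d ! k) (f k) else 0)"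

lemma free_piece_subset_free_all: "free_piece d j \<subseteq> free_all d"
  by (auto simp: free_piece_def free_all_def graded_piece_def)

lemma vcomp_in_free_piece: "f \<in> free_all d \<Longrightarrow> vcomp d j f \<in> free_piece d j"
  by (auto simp: free_piece_def free_all_def vcomp_def intro: hcomp_in_graded_piece)

lemma vcomp_free_piece: "f \<in> free_piece d i \<Longrightarrow> vcomp d j f = (if i = j then f else 0)"
proof
  fix k assume f: "f \<in> free_piece d i"
  show "vcomp d j f k = (if i = j then f else 0) k"
  proof (cases "k < length d")
    case True
    then have "f k \<in> graded_piece V (i - d ! k)" using f by (simp add: free_piece_def)
    from hcomp_graded[OF this, of "j - d ! k"] show ?thesis using True by (auto simp: vcomp_def)
  next
    case False then show ?thesis using f by (simp add: vcomp_def free_piece_def)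
  qed
qed

text \<open>A homogeneous homomorphism commutes with taking components. This is the reason why exactness in
  each degree and exactness as modules are equivalent.\<close>

lemma gmap_vcomp:
  assumes g: "\<And>k. k < length d \<Longrightarrow> g k \<in> free_piece e (d ! k)"
  shows "gmap (length d) g (vcomp d j f) = vcomp e j (gmap (length d) g f)"
proof
  fix l
  show "gmap (length d) g (vcomp d j f) l = vcomp e j (gmap (length d) g f) l"
  proof (cases "l < length e")
    case True
    have "vcomp e j (gmap (length d) g f) l = (\<Sum>k<length d. hcomp (j - e ! l) (f k * g k l))"
      using True by (simp add: vcomp_def gmap_def hcomp_sum)
    also have "\<dots> = (\<Sum>k<length d. hcomp (j - d ! k) (f k) * g k l)"
    proof (rule sum.cong[OF refl])
      fix k assume "k \<in> {..<length d}"
      then have "g k l \<in> graded_piece V (d ! k - e ! l)" using g[of k] True by (simp add: free_piece_def)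
      from hcomp_mult[OF this, of "j - e ! l" "f k"]
      show "hcomp (j - e ! l) (f k * g k l) = hcomp (j - d ! k) (f k) * g k l" by simp
    qed
    finally show ?thesis by (simp add: gmap_def vcomp_def)
  next
    case False
    then have "g k l = 0" if "k < length d" for k using g[OF that] by (simp add: free_piece_def)
    then show ?thesis using False by (simp add: gmap_def vcomp_def)
  qed
qed

lemma sum_vcomp:
  assumes f: "f \<in> free_all d"
  shows "\<exists>D. finite D \<and> (\<Sum>j\<in>D. vcomp d j f) = f"
proof -
  let ?D = "\<Union>k<length d. (\<lambda>i. i + d ! k) ` poly_degrees (f k)"
  have fin: "finite ?D" using finite_poly_degrees by blast
  have "(\<Sum>j\<in>?D. vcomp d j f) = f"
  proof
    fix k
    show "(\<Sum>j\<in>?D. vcomp d j f) k = f k"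
    proof (cases "k < length d")
      case True
      have "(\<Sum>j\<in>?D. vcomp d j f) k = (\<Sum>j\<in>?D. hcomp (j - d ! k) (f k))"
        using True by (simp add: sum_fun_apply vcomp_def)
      also have "\<dots> = (\<Sum>i\<in>(\<lambda>j. j - d ! k) ` ?D. hcomp i (f k))"
        by (subst sum.reindex) (auto simp: inj_on_def)
      also have "\<dots> = f k"
      proof (rule sum_hcomp)
        show "poly_degrees (f k) \<subseteq> (\<lambda>j. j - d ! k) ` ?D" using True by force
      qed (use fin in blast)
      finally show ?thesis .
    next
      case False then show ?thesis using f by (simp add: sum_fun_apply vcomp_def free_all_def)
    qed
  qed
  with fin show ?thesis by blast
qed

lemma free_all_sum: "(\<And>i. i \<in> A \<Longrightarrow> f i \<in> free_all d) \<Longrightarrow> (\<Sum>i\<in>A. f i) \<in> free_all d"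
proof (induction A rule: infinite_finite_induct)
  case (insert x A)
  then have "f x \<in> free_all d" "(\<Sum>i\<in>A. f i) \<in> free_all d" by auto
  then have "f x + (\<Sum>i\<in>A. f i) \<in> free_all d" by (auto simp: free_all_def intro: poly_carrier_add)
  then show ?case by (simp only: sum.insert[OF insert(1,2)])
qed (auto simp: free_all_def)

section \<open>Ungraded exactness\<close>

lemma cover_lifts_all:
  assumes sur: "\<And>j z. z \<in> M j \<Longrightarrow> \<exists>f\<in>free_piece d j. gmap (length d) g f = z"
    and z: "z \<in> free_all e" "\<And>j. vcomp e j z \<in> M j"
  shows "\<exists>f\<in>free_all d. gmap (length d) g f = z"
proof -
  obtain D where D: "finite D" "(\<Sum>j\<in>D. vcomp e j z) = z" using sum_vcomp[OF z(1)] by blast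
  have "\<forall>j. \<exists>f\<in>free_piece d j. gmap (length d) g f = vcomp e j z" using sur z(2) by blast
  then obtain f where f: "\<And>j. f j \<in> free_piece d j" "\<And>j. gmap (length d) g (f j) = vcomp e j z" by metis
  have "(\<Sum>j\<in>D. f j) \<in> free_all d" using f(1) free_piece_subset_free_all by (intro free_all_sum) blast
  moreover have "gmap (length d) g (\<Sum>j\<in>D. f j) = z" by (simp only: gmap_sum f(2) D(2))
  ultimately show ?thesis by blast
qed

lemma lift_homogeneous:
  assumes sub: "\<And>k. k < length d \<Longrightarrow> g k \<in> free_piece e (d ! k)"
    and f: "f \<in> free_all d" "gmap (length d) g f = z" and z: "z \<in> free_piece e j"
  shows "\<exists>f\<in>free_piece d j. gmap (length d) g f = z"
proof
  show "vcomp d j f \<in> free_piece d j" by (rule vcomp_in_free_piece[OF f(1)])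
  show "gmap (length d) g (vcomp d j f) = z"
  proof -
    have "gmap (length d) g (vcomp d j f) = vcomp e j (gmap (length d) g f)" by (rule gmap_vcomp[OF sub])
    also have "\<dots> = z" unfolding f(2) using vcomp_free_piece[OF z, of j] by simp
    finally show ?thesis .
  qed
qed

lemma vec_fun_free_module: "w \<in> free_module V (length d) \<Longrightarrow> vec_fun w \<in> free_all d"
  by (auto simp: free_module_def free_all_def vec_fun_def)

lemma vec_in_free_module: "f \<in> free_all d \<Longrightarrow> vec (length d) f \<in> free_module V (length d)"
proof -
  assume f: "f \<in> free_all d"
  have "f k \<in> poly_carrier V" if "k < length d" for k
    using f that unfolding free_all_def by (drule_tac CollectD, drule_tac spec[of _ k]) simp
  then show ?thesis by (simp add: free_module_def)
qed

lemma vec_fun_vec: "f \<in> free_all d \<Longrightarrow> vec_fun (vec (length d) f) = f"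
  by (auto simp: free_all_def vec_fun_def fun_eq_iff)

section \<open>From cover sequences to minimal resolutions and back\<close>

definition ideal_module :: "('v, 'k::field) polynomial set \<Rightarrow> int \<Rightarrow> ('v, 'k) pvec set" where
  "ideal_module I j = {f \<in> free_piece [0] j. f 0 \<in> I}"

text \<open>The shifts of the free module in which the images of the \<open>i\<close>-th map lie; the augmentation maps to
  the ring itself, with its generator in degree zero.\<close>

definition target_degrees :: "(nat \<Rightarrow> int list) \<Rightarrow> nat \<Rightarrow> int list" where
  "target_degrees d i = (case i of 0 \<Rightarrow> [0] | Suc i \<Rightarrow> d i)"

lemma cover_sequence_in_free_piece:
  assumes c: "cover_sequence (ideal_module I) d g" and k: "k < length (d i)"
  shows "g i k \<in> free_piece (target_degrees d i) (d i ! k)"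
proof (cases i)
  case 0
  then have "g 0 k \<in> ideal_module I (d 0 ! k)"
    using c k unfolding cover_sequence_def by (blast dest: minimal_coverD(2))
  then show ?thesis using 0 by (simp add: ideal_module_def target_degrees_def)
next
  case (Suc i')
  then have "g (Suc i') k \<in> gker (d i') (g i') (d (Suc i') ! k)"
    using c k unfolding cover_sequence_def by (blast dest: minimal_coverD(2))
  then show ?thesis using Suc by (simp add: gker_def target_degrees_def)
qed

text \<open>Elements of the ideal and of the kernels have homogeneous components, which can be lifted one by
  one. Minimality of the next map is minimality of the cover, as its columns are in the kernel.\<close>

lemma resolution_of_cover_sequence:
  fixes I :: "('v, 'k::field) polynomial set"
  assumes c: "cover_sequence (ideal_module I) d g"
    and I: "I \<subseteq> poly_carrier V" "\<And>p j. p \<in> I \<Longrightarrow> hcomp j p \<in> I"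
      "0 \<in> I" "\<And>p q. p \<in> I \<Longrightarrow> q \<in> I \<Longrightarrow> p + q \<in> I"
      "\<And>p q. p \<in> I \<Longrightarrow> q \<in> poly_carrier V \<Longrightarrow> q * p \<in> I"
  shows "minimal_graded_free_resolution V I d
     (\<lambda>i. mat (length (target_degrees d i)) (length (d i)) (\<lambda>(l, k). g i k l))"
proof -
  let ?\<phi> = "\<lambda>i. mat (length (target_degrees d i)) (length (d i)) (\<lambda>(l, k). g i k l)"
  note fp = cover_sequence_in_free_piece[OF c]
  have c0: "minimal_cover (ideal_module I) (d 0) (g 0)" and cS: "minimal_cover (gker (d i) (g i)) (d (Suc i)) (g (Suc i))" for i
    using c by (auto simp: cover_sequence_def)
  have gp: "g i k l \<in> graded_piece V (d i ! k - target_degrees d i ! l)"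
    if "k < length (d i)" "l < length (target_degrees d i)" for i k l
    using fp[OF that(1)] that(2) by (simp add: free_piece_def)
  have carrier: "?\<phi> i \<in> carrier_mat (length (target_degrees d i)) (length (d i))" for i by simp
  have mv: "(?\<phi> i *\<^sub>v w) $ l = gmap (length (d i)) (g i) (vec_fun w) l"
    if "w \<in> carrier_vec (length (d i))" "l < length (target_degrees d i)" for i w l
    by (rule mult_mat_vec_gmap[OF carrier that(1) _ that(2)]) (use that in auto)
  have gfree: "gmap (length (d i)) (g i) f \<in> free_all (target_degrees d i)" if f: "f \<in> free_all (d i)" for f i
  proof -
    have eq: "gmap (length (d i)) (g i) f = (\<Sum>k<length (d i). vmult (f k) (g i k))"
      by (auto simp: gmap_def vmult_def sum_fun_apply)
    have "vmult (f k) (g i k) \<in> free_all (target_degrees d i)" if k: "k < length (d i)" for k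
    proof -
      have "f k \<in> poly_carrier V" using f k unfolding free_all_def by (drule_tac CollectD, drule_tac spec[of _ k]) simp
      moreover have "g i k \<in> free_all (target_degrees d i)" using fp[OF k] free_piece_subset_free_all by blast
      ultimately show ?thesis by (auto simp: free_all_def vmult_def intro: poly_carrier_mult)
    qed
    then show ?thesis unfolding eq by (intro free_all_sum) auto
  qed
  have outside: "f l = 0" if "f \<in> free_all e" "\<not> l < length e" for f :: "('v, 'k) pvec" and e l
    using that by (auto simp: free_all_def)
  show ?thesis
    unfolding minimal_graded_free_resolution_def
  proof (intro conjI allI impI ballI)
    show "?\<phi> 0 \<in> carrier_mat 1 (length (d 0))" by (simp add: target_degrees_def)
    show "?\<phi> (Suc i) \<in> carrier_mat (length (d i)) (length (d (Suc i)))" for i by (simp add: target_degrees_def)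
    show "elements_mat (?\<phi> i) \<subseteq> poly_carrier V" for i
    proof
      fix p assume "p \<in> elements_mat (?\<phi> i)"
      then obtain l k where "l < length (target_degrees d i)" "k < length (d i)" "p = g i k l"
        by (auto dest!: elements_matD)
      then show "p \<in> poly_carrier V" using gp by (auto simp: graded_piece_def)
    qed
    show "homogeneous (d 0 ! k) (?\<phi> 0 $$ (0, k))" if "k < length (d 0)" for k
      using gp[OF that, of 0] that by (simp add: target_degrees_def graded_piece_def)
    show "homogeneous (d (Suc i) ! k - d i ! l) (?\<phi> (Suc i) $$ (l, k))"
      if "l < length (d i)" "k < length (d (Suc i))" for i l k
      using gp[OF that(2), of l] that by (simp add: target_degrees_def graded_piece_def)
    show "{(?\<phi> 0 *\<^sub>v w) $ 0 |w. w \<in> free_module V (length (d 0))} = I"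
    proof (intro equalityI subsetI)
      fix p assume "p \<in> {(?\<phi> 0 *\<^sub>v w) $ 0 |w. w \<in> free_module V (length (d 0))}"
      then obtain w where w: "w \<in> free_module V (length (d 0))" "p = (?\<phi> 0 *\<^sub>v w) $ 0" by blast
      then have "p = gmap (length (d 0)) (g 0) (vec_fun w) 0"
        using mv[of w 0 0] by (simp add: free_module_def target_degrees_def)
      also have "\<dots> = (\<Sum>k<length (d 0). vec_fun w k * g 0 k 0)" by (simp add: gmap_def)
      also have "\<dots> \<in> I"
      proof -
        have "vec_fun w k * g 0 k 0 \<in> I" if k: "k < length (d 0)" for k
        proof (rule I(5))
          show "g 0 k 0 \<in> I" using minimal_coverD(2)[OF c0 k] by (simp add: ideal_module_def)
          show "vec_fun w k \<in> poly_carrier V" using w(1) k by (auto simp: free_module_def vec_fun_def)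
        qed
        moreover have sumI: "(\<And>k. k \<in> A \<Longrightarrow> h k \<in> I) \<Longrightarrow> (\<Sum>k\<in>A. h k) \<in> I" for A and h :: "nat \<Rightarrow> ('v, 'k) polynomial"
          by (induction A rule: infinite_finite_induct) (auto simp: I(3,4))
        ultimately show ?thesis by (intro sumI) simp
      qed
      finally show "p \<in> I" .
    next
      fix p assume p: "p \<in> I"
      define z where "z = (\<lambda>l::nat. if l = 0 then p else 0)"
      have zf: "z \<in> free_all [0]" using p I(1) by (auto simp: free_all_def z_def)
      have "vcomp [0] j z \<in> ideal_module I j" for j
        using vcomp_in_free_piece[OF zf, of j] I(2)[OF p, of j] by (simp add: ideal_module_def vcomp_def z_def)
      then obtain f where f: "f \<in> free_all (d 0)" "gmap (length (d 0)) (g 0) f = z"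
        using cover_lifts_all[OF minimal_coverD(3)[OF c0] zf] by blast
      let ?w = "vec (length (d 0)) f"
      have "(?\<phi> 0 *\<^sub>v ?w) $ 0 = z 0"
        using mv[of ?w 0 0] f by (simp add: target_degrees_def vec_fun_vec)
      then have "p = (?\<phi> 0 *\<^sub>v ?w) $ 0" by (simp add: z_def)
      then show "p \<in> {(?\<phi> 0 *\<^sub>v w) $ 0 |w. w \<in> free_module V (length (d 0))}"
        using vec_in_free_module[OF f(1)] by blast
    qed
    fix i
    show "mat_kernel (?\<phi> i) \<inter> free_module V (length (d i))
        = {?\<phi> (Suc i) *\<^sub>v w |w. w \<in> free_module V (length (d (Suc i)))}"
    proof (intro equalityI subsetI)
      fix z assume "z \<in> mat_kernel (?\<phi> i) \<inter> free_module V (length (d i))"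
      then have zk: "z \<in> carrier_vec (length (d i))" "?\<phi> i *\<^sub>v z = 0\<^sub>v (length (target_degrees d i))"
        and zf: "z \<in> free_module V (length (d i))"
        using mat_kernelD[OF carrier, of z i] by auto
      have fa: "vec_fun z \<in> free_all (d i)" by (rule vec_fun_free_module[OF zf])
      have g0: "gmap (length (d i)) (g i) (vec_fun z) = 0"
      proof
        fix l
        show "gmap (length (d i)) (g i) (vec_fun z) l = 0 l"
        proof (cases "l < length (target_degrees d i)")
          case True
          then show ?thesis using mv[OF zk(1) True] zk(2) by simp
        next
          case False then show ?thesis using outside[OF gfree[OF fa] False] by simp
        qed
      qed
      have "vcomp (d i) j (vec_fun z) \<in> gker (d i) (g i) j" for j
      proof -
        have "gmap (length (d i)) (g i) (vcomp (d i) j (vec_fun z)) = vcomp (target_degrees d i) j 0"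
          using gmap_vcomp[OF fp, where j = j and f = "vec_fun z"] g0 by simp
        also have "\<dots> = 0" by (auto simp: vcomp_def fun_eq_iff poly_mapping_eq_iff lookup_hcomp)
        finally show ?thesis using vcomp_in_free_piece[OF fa] by (simp add: gker_def)
      qed
      then obtain f where f: "f \<in> free_all (d (Suc i))" "gmap (length (d (Suc i))) (g (Suc i)) f = vec_fun z"
        using cover_lifts_all[OF minimal_coverD(3)[OF cS] fa] by blast
      let ?w = "vec (length (d (Suc i))) f"
      have "?\<phi> (Suc i) *\<^sub>v ?w = z"
      proof (rule eq_vecI)
        show "dim_vec (?\<phi> (Suc i) *\<^sub>v ?w) = dim_vec z" using zk by (simp add: target_degrees_def)
        fix l assume "l < dim_vec z"
        then have l: "l < length (d i)" using zk by simp
        have "(?\<phi> (Suc i) *\<^sub>v ?w) $ l = gmap (length (d (Suc i))) (g (Suc i)) (vec_fun ?w) l"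
          by (rule mv) (use l in \<open>auto simp: target_degrees_def\<close>)
        also have "\<dots> = z $ l" unfolding vec_fun_vec[OF f(1)] f(2) using l zk by (simp add: vec_fun_def)
        finally show "(?\<phi> (Suc i) *\<^sub>v ?w) $ l = z $ l" .
      qed
      then show "z \<in> {?\<phi> (Suc i) *\<^sub>v w |w. w \<in> free_module V (length (d (Suc i)))}"
        using vec_in_free_module[OF f(1)] by blast
    next
      fix z assume "z \<in> {?\<phi> (Suc i) *\<^sub>v w |w. w \<in> free_module V (length (d (Suc i)))}"
      then obtain w where w: "w \<in> free_module V (length (d (Suc i)))" "z = ?\<phi> (Suc i) *\<^sub>v w" by blast
      have wc: "w \<in> carrier_vec (length (d (Suc i)))" using w by (simp add: free_module_def)
      have wf: "vec_fun w \<in> free_all (d (Suc i))" by (rule vec_fun_free_module[OF w(1)])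
      have zc: "z \<in> carrier_vec (length (d i))" using w(2) by (simp add: target_degrees_def carrier_vecI)
      have zf: "vec_fun z = gmap (length (d (Suc i))) (g (Suc i)) (vec_fun w)"
      proof
        fix l
        show "vec_fun z l = gmap (length (d (Suc i))) (g (Suc i)) (vec_fun w) l"
        proof (cases "l < length (d i)")
          case True
          have "z $ l = gmap (length (d (Suc i))) (g (Suc i)) (vec_fun w) l"
            unfolding w(2) by (rule mv[OF wc]) (use True in \<open>simp add: target_degrees_def\<close>)
          then show ?thesis using True zc by (simp add: vec_fun_def)
        next
          case False
          then show ?thesis using outside[OF gfree[OF wf], of l] zc by (simp add: vec_fun_def target_degrees_def)
        qed
      qed
      have zfree: "vec_fun z \<in> free_all (d i)" using gfree[OF wf] zf by (simp add: target_degrees_def)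
      have "z \<in> free_module V (length (d i))"
        using vec_in_free_module[OF zfree] vec_vec_fun[OF zc] by simp
      moreover have "gmap (length (d i)) (g i) (vec_fun z) = 0"
      proof -
        have "gmap (length (d (Suc i))) (g (Suc i)) (vec_fun w)
          = (\<Sum>k<length (d (Suc i)). vmult (vec_fun w k) (g (Suc i) k))"
          by (auto simp: gmap_def vmult_def sum_fun_apply)
        then have "gmap (length (d i)) (g i) (vec_fun z)
          = (\<Sum>k<length (d (Suc i)). vmult (vec_fun w k) (gmap (length (d i)) (g i) (g (Suc i) k)))"
          unfolding zf by (simp only: gmap_sum gmap_vmult)
        also have "\<dots> = (\<Sum>k<length (d (Suc i)). 0)"
        proof (rule sum.cong[OF refl])
          fix k assume "k \<in> {..<length (d (Suc i))}"
          then have "gmap (length (d i)) (g i) (g (Suc i) k) = 0"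
            using minimal_coverD(2)[OF cS[of i], of k] by (simp add: gker_def)
          then show "vmult (vec_fun w k) (gmap (length (d i)) (g i) (g (Suc i) k)) = 0" by (simp only: vmult_zero_right)
        qed
        finally show ?thesis by simp
      qed
      then have "?\<phi> i *\<^sub>v z = 0\<^sub>v (length (target_degrees d i))"
        by (intro eq_vecI) (simp_all add: mv[OF zc] del: index_mult_mat_vec)
      then have "z \<in> mat_kernel (?\<phi> i)" by (rule mat_kernelI[OF carrier zc])
      ultimately show "z \<in> mat_kernel (?\<phi> i) \<inter> free_module V (length (d i))" by blast
    qed
    fix p assume "p \<in> elements_mat (?\<phi> (Suc i))"
    then obtain l k where lk: "l < length (d i)" "k < length (d (Suc i))" "p = g (Suc i) k l"
      by (auto dest!: elements_matD simp: target_degrees_def)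
    have "g (Suc i) k \<in> gker (d i) (g i) (d (Suc i) ! k)" by (rule minimal_coverD(2)[OF cS lk(2)])
    moreover have "minimal_cover (if i = 0 then ideal_module I else gker (d (i - 1)) (g (i - 1))) (d i) (g i)"
      using c0 cS[of "i - 1"] by (cases i) auto
    ultimately show "Poly_Mapping.lookup p 0 = 0" unfolding lk(3) using gker_const_zero by blast
  qed
qed

text \<open>Homogeneous elements of the kernel of a map are images of the next one; the entries of its matrix
  have no constant term, hence neither have the elements of the kernel.\<close>

lemma cover_sequence_of_resolution:
  fixes I :: "('v, 'k::field) polynomial set"
  assumes r: "minimal_graded_free_resolution V I d \<phi>"
    and M: "graded_module (ideal_module I)"
  shows "\<exists>g. cover_sequence (ideal_module I) d g"
proof -
  define e where "e = target_degrees d"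
  have carrier: "\<phi> i \<in> carrier_mat (length (e i)) (length (d i))" for i
    using r by (cases i) (auto simp: minimal_graded_free_resolution_def e_def target_degrees_def)
  have entries: "elements_mat (\<phi> i) \<subseteq> poly_carrier V" for i
    using r by (simp add: minimal_graded_free_resolution_def)
  have hom: "homogeneous (d i ! k - e i ! l) (\<phi> i $$ (l, k))" if "l < length (e i)" "k < length (d i)" for i l k
    using r that by (cases i) (auto simp: minimal_graded_free_resolution_def e_def target_degrees_def)
  have im: "{(\<phi> 0 *\<^sub>v w) $ 0 |w. w \<in> free_module V (length (d 0))} = I"
    using r by (simp add: minimal_graded_free_resolution_def)
  have ker: "mat_kernel (\<phi> i) \<inter> free_module V (length (d i))
      = {\<phi> (Suc i) *\<^sub>v w |w. w \<in> free_module V (length (d (Suc i)))}" for i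
    using r by (simp add: minimal_graded_free_resolution_def)
  have mini: "Poly_Mapping.lookup p 0 = 0" if "p \<in> elements_mat (\<phi> (Suc i))" for i p
    using r that unfolding minimal_graded_free_resolution_def by blast
  define g where "g i k l = (if l < length (e i) then \<phi> i $$ (l, k) else 0)" for i k l
  have mv: "(\<phi> i *\<^sub>v w) $ l = gmap (length (d i)) (g i) (vec_fun w) l"
    if "w \<in> carrier_vec (length (d i))" "l < length (e i)" for i w l
    by (rule mult_mat_vec_gmap[OF carrier that(1) _ that(2)]) (simp add: g_def)
  have fp: "g i k \<in> free_piece (e i) (d i ! k)" if "k < length (d i)" for i k
    unfolding free_piece_def
  proof (intro CollectI allI)
    fix l show "if l < length (e i) then g i k l \<in> graded_piece V (d i ! k - e i ! l) else g i k l = 0"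
    proof (cases "l < length (e i)")
      case True
      then have "\<phi> i $$ (l, k) \<in> poly_carrier V" using entries that elements_matI[OF carrier] by blast
      then show ?thesis using hom[OF True that] True by (simp add: g_def graded_piece_def)
    qed (simp add: g_def)
  qed
  have gout: "gmap (length (d i)) (g i) f l = 0" if "\<not> l < length (e i)" for i f l
    using that by (simp add: gmap_def g_def)
  have vf: "vec_fun (\<phi> i *\<^sub>v w) = gmap (length (d i)) (g i) (vec_fun w)"
    if w: "w \<in> carrier_vec (length (d i))" for i w
  proof
    fix l show "vec_fun (\<phi> i *\<^sub>v w) l = gmap (length (d i)) (g i) (vec_fun w) l"
    proof (cases "l < length (e i)")
      case True
      then show ?thesis using mv[OF w True] carrier[of i] by (simp add: vec_fun_def del: index_mult_mat_vec)
    next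
      case False
      then show ?thesis using gout[OF False, of "vec_fun w"] carrier[of i] by (simp add: vec_fun_def)
    qed
  qed
  have gcol: "gmap (length (d i)) (g i) (vec_fun (unit_vec (length (d i)) k)) = g i k" if "k < length (d i)" for i k
  proof
    fix l
    have "gmap (length (d i)) (g i) (vec_fun (unit_vec (length (d i)) k)) l
       = (\<Sum>k'<length (d i). if k' = k then g i k l else 0)"
      unfolding gmap_def by (rule sum.cong) (use that in \<open>auto simp: vec_fun_def\<close>)
    then show "gmap (length (d i)) (g i) (vec_fun (unit_vec (length (d i)) k)) l = g i k l" using that by simp
  qed
  have unit: "(unit_vec (length (d i)) k :: ('v, 'k) polynomial vec) \<in> free_module V (length (d i))" for i k
  proof -
    have "(1 :: ('v, 'k) polynomial) \<in> poly_carrier V" by (simp add: poly_carrier_def)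
    then show ?thesis by (auto simp: free_module_def unit_vec_def)
  qed
  have kerE: "\<exists>f\<in>free_piece (d (Suc i)) j. gmap (length (d (Suc i))) (g (Suc i)) f = z"
    and kermin: "Poly_Mapping.lookup (z l) 0 = 0"
    if z: "z \<in> gker (d i) (g i) j" for i j z l
  proof -
    have zp: "z \<in> free_piece (d i) j" and z0: "gmap (length (d i)) (g i) z = 0" using z by (auto simp: gker_def)
    have za: "z \<in> free_all (d i)" using zp free_piece_subset_free_all by blast
    let ?z = "vec (length (d i)) z"
    have "\<phi> i *\<^sub>v ?z = 0\<^sub>v (length (e i))"
    proof (rule eq_vecI)
      show "dim_vec (\<phi> i *\<^sub>v ?z) = dim_vec (0\<^sub>v (length (e i)) :: ('v, 'k) polynomial vec)"
        using carrier[of i] by simp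
      fix l assume "l < dim_vec (0\<^sub>v (length (e i)) :: ('v, 'k) polynomial vec)"
      then show "(\<phi> i *\<^sub>v ?z) $ l = (0\<^sub>v (length (e i)) :: ('v, 'k) polynomial vec) $ l"
        using mv[of ?z i l] z0 by (simp add: vec_fun_vec[OF za] del: index_mult_mat_vec)
    qed
    then have "?z \<in> mat_kernel (\<phi> i)" by (intro mat_kernelI[OF carrier]) auto
    then obtain w where w: "w \<in> free_module V (length (d (Suc i)))" "?z = \<phi> (Suc i) *\<^sub>v w"
      using ker[of i] vec_in_free_module[OF za] by blast
    have wc: "w \<in> carrier_vec (length (d (Suc i)))" using w by (simp add: free_module_def)
    have gz: "gmap (length (d (Suc i))) (g (Suc i)) (vec_fun w) = z"
      using vf[OF wc] w(2) vec_fun_vec[OF za] by metis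
    have "g (Suc i) k \<in> free_piece (d i) (d (Suc i) ! k)" if "k < length (d (Suc i))" for k
      using fp[OF that] by (simp add: e_def target_degrees_def)
    then show "\<exists>f\<in>free_piece (d (Suc i)) j. gmap (length (d (Suc i))) (g (Suc i)) f = z"
      using lift_homogeneous[OF _ vec_fun_free_module[OF w(1)] gz zp] by blast
    have "Poly_Mapping.lookup (g (Suc i) k l) 0 = 0" if "k < length (d (Suc i))" for k
    proof (cases "l < length (e (Suc i))")
      case True
      then have "\<phi> (Suc i) $$ (l, k) \<in> elements_mat (\<phi> (Suc i))" using elements_matI[OF carrier] that by blast
      then show ?thesis using mini True by (simp add: g_def)
    qed (simp add: g_def)
    then have "Poly_Mapping.lookup (g (Suc i) k l * vec_fun w k) 0 = 0" if "k < length (d (Suc i))" for k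
      using lookup_mult_0 that by blast
    then show "Poly_Mapping.lookup (z l) 0 = 0"
      unfolding gz[symmetric] gmap_def by (simp add: lookup_sum mult.commute)
  qed
  have "minimal_cover (ideal_module I) (d 0) (g 0)"
    unfolding minimal_cover_def
  proof (intro conjI allI impI ballI M)
    fix k assume k: "k < length (d 0)"
    have "g 0 k 0 = (\<phi> 0 *\<^sub>v unit_vec (length (d 0)) k) $ 0"
      using mv[of "unit_vec (length (d 0)) k" 0 0] gcol[OF k] by (simp add: e_def target_degrees_def)
    then have "g 0 k 0 \<in> I" using im unit by blast
    then show "g 0 k \<in> ideal_module I (d 0 ! k)" using fp[OF k] by (simp add: ideal_module_def e_def target_degrees_def)
  next
    fix j z assume z: "z \<in> ideal_module I j"
    then obtain w where w: "w \<in> free_module V (length (d 0))" "z 0 = (\<phi> 0 *\<^sub>v w) $ 0"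
      using im by (auto simp: ideal_module_def)
    have wc: "w \<in> carrier_vec (length (d 0))" using w by (simp add: free_module_def)
    have zp: "z \<in> free_piece (e 0) j" using z by (simp add: ideal_module_def e_def target_degrees_def)
    have "gmap (length (d 0)) (g 0) (vec_fun w) = z"
    proof
      fix l show "gmap (length (d 0)) (g 0) (vec_fun w) l = z l"
      proof (cases "l = 0")
        case True then show ?thesis using mv[OF wc, of 0] w(2) by (simp add: e_def target_degrees_def)
      next
        case False
        then have "\<not> l < length (e 0)" by (simp add: e_def target_degrees_def)
        then show ?thesis using gout zp by (simp add: free_piece_def)
      qed
    qed
    then show "\<exists>f\<in>free_piece (d 0) j. gmap (length (d 0)) (g 0) f = z"
      using lift_homogeneous[OF fp vec_fun_free_module[OF w(1)] _ zp] by blast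
  qed (rule kermin)
  moreover have "minimal_cover (gker (d i) (g i)) (d (Suc i)) (g (Suc i))" for i
    unfolding minimal_cover_def
  proof (intro conjI allI impI ballI graded_module_gker)
    fix k assume k: "k < length (d (Suc i))"
    let ?u = "unit_vec (length (d (Suc i))) k"
    have uc: "?u \<in> carrier_vec (length (d (Suc i)))" by simp
    have "\<phi> (Suc i) *\<^sub>v ?u \<in> mat_kernel (\<phi> i)" using ker[of i] unit by blast
    then have c: "\<phi> (Suc i) *\<^sub>v ?u \<in> carrier_vec (length (d i))" "\<phi> i *\<^sub>v (\<phi> (Suc i) *\<^sub>v ?u) = 0\<^sub>v (length (e i))"
      using mat_kernelD[OF carrier] by blast+
    have "vec_fun (\<phi> (Suc i) *\<^sub>v ?u) = g (Suc i) k" using vf[OF uc] gcol[OF k] by simp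
    then have "gmap (length (d i)) (g i) (g (Suc i) k) = vec_fun (0\<^sub>v (length (e i)))" using vf[OF c(1)] c(2) by simp
    also have "\<dots> = 0" by (auto simp: vec_fun_def)
    finally show "g (Suc i) k \<in> gker (d i) (g i) (d (Suc i) ! k)"
      using fp[OF k] by (simp add: gker_def e_def target_degrees_def)
  next
    fix j z assume "z \<in> gker (d i) (g i) j"
    then show "\<exists>f\<in>free_piece (d (Suc i)) j. gmap (length (d (Suc i))) (g (Suc i)) f = z" by (rule kerE)
  qed (rule kermin)
  ultimately show ?thesis unfolding cover_sequence_def by blast
qed

end

section \<open>Subsets of a cycle with a given number of runs\<close>

text \<open>The first elements of the maximal runs of length at least \<open>h\<close> of a subset of the cycle with the
  vertices \<open>0, \<dots>, t - 1\<close>. The full set has no first element and therefore no run.\<close>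

definition cyclic_starts :: "nat \<Rightarrow> nat \<Rightarrow> nat set \<Rightarrow> nat set" where
  "cyclic_starts h t A = {a \<in> {..<t}. (a + t - 1) mod t \<notin> A \<and> (\<forall>i<h. (a + i) mod t \<in> A)}"

text \<open>Words with \<open>n\<close> zeros and \<open>k\<close> ones that end in a zero are lists of \<open>n\<close> numbers with sum \<open>k\<close>,
  the lengths of the blocks of ones before each zero; \<open>m\<close> counts the blocks of length at least
  \<open>h\<close>. The leading block of the words in \<open>lead_block_lists\<close> is one of these.\<close>

definition block_lists :: "nat \<Rightarrow> nat \<Rightarrow> nat \<Rightarrow> nat \<Rightarrow> nat list set" where
  "block_lists h n k m = {xs. length xs = n \<and> sum_list xs = k \<and> length (filter (\<lambda>x. h \<le> x) xs) = m}"

definition lead_block_lists :: "nat \<Rightarrow> nat \<Rightarrow> nat \<Rightarrow> nat \<Rightarrow> nat list set" where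
  "lead_block_lists h n k m = {xs \<in> block_lists h n k m. xs \<noteq> [] \<and> h \<le> hd xs}"

definition blocks :: "nat list \<Rightarrow> bool list" where
  "blocks xs = concat (map (\<lambda>a. replicate a True @ [False]) xs)"

definition word_starts :: "nat \<Rightarrow> bool list \<Rightarrow> nat set" where
  "word_starts h w = {p. p + h \<le> length w \<and> (p = 0 \<or> \<not> w ! (p - 1)) \<and> (\<forall>i<h. w ! (p + i))}"

lemma finite_block_lists: "finite (block_lists h n k m)"
proof (rule finite_subset)
  show "block_lists h n k m \<subseteq> {xs. set xs \<subseteq> {..k} \<and> length xs = n}"
    unfolding block_lists_def using member_le_sum_list by fastforce
qed (simp add: finite_lists_length_eq)

lemma block_lists_Suc:
  "block_lists h (Suc n) k m =
     (\<Union>b\<in>{..k}. Cons b ` (if b < h then block_lists h n (k - b) m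
        else if m = 0 then {} else block_lists h n (k - b) (m - 1)))" (is "?L = ?R")
proof (rule Set.set_eqI)
  fix xs :: "nat list"
  show "xs \<in> ?L \<longleftrightarrow> xs \<in> ?R"
  proof (cases xs)
    case (Cons b ys)
    have "b # ys \<in> ?R \<longleftrightarrow> b \<le> k \<and> ys \<in> (if b < h then block_lists h n (k - b) m
        else if m = 0 then {} else block_lists h n (k - b) (m - 1))" by blast
    also have "\<dots> \<longleftrightarrow> b # ys \<in> ?L"
      by (cases "b < h"; cases "m = 0") (auto simp: block_lists_def)
    finally show ?thesis unfolding Cons by simp
  qed (auto simp: block_lists_def)
qed

lemma card_block_lists_Suc:
  "card (block_lists h (Suc n) k m) =
     (\<Sum>b\<le>k. if b < h then card (block_lists h n (k - b) m)
        else if m = 0 then 0 else card (block_lists h n (k - b) (m - 1)))"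
proof -
  have "card (block_lists h (Suc n) k m) = (\<Sum>b\<le>k. card (Cons b ` (if b < h then block_lists h n (k - b) m
        else if m = 0 then {} else block_lists h n (k - b) (m - 1))))"
    unfolding block_lists_Suc by (rule card_UN_disjoint) (auto simp: finite_block_lists)
  also have "\<dots> = (\<Sum>b\<le>k. if b < h then card (block_lists h n (k - b) m)
        else if m = 0 then 0 else card (block_lists h n (k - b) (m - 1)))"
    by (rule sum.cong) (auto simp: card_image)
  finally show ?thesis .
qed

text \<open>The generating functions of the lengths of one block that is shorter than \<open>h\<close>, respectively not.\<close>

definition short_fps :: "nat \<Rightarrow> nat fps" where "short_fps h = Abs_fps (\<lambda>b. if b < h then 1 else 0)"
definition long_fps :: "nat \<Rightarrow> nat fps" where "long_fps h = Abs_fps (\<lambda>b. if b < h then 0 else 1)"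

lemma short_mult: "fps_nth (short_fps h * Abs_fps f) k = (\<Sum>b\<le>k. if b < h then f (k - b) else 0)"
  by (auto simp: fps_mult_nth short_fps_def atLeast0AtMost intro!: sum.cong)

lemma long_mult: "fps_nth (long_fps h * Abs_fps f) k = (\<Sum>b\<le>k. if b < h then 0 else f (k - b))"
  by (auto simp: fps_mult_nth long_fps_def atLeast0AtMost intro!: sum.cong)

text \<open>The long blocks occupy \<open>m\<close> of the \<open>n\<close> places, and the lengths can be chosen independently of each
  other.\<close>

lemma block_lists_fps:
  "Abs_fps (\<lambda>k. card (block_lists h n k m)) = of_nat (n choose m) * short_fps h ^ (n - m) * long_fps h ^ m"
proof (induction n arbitrary: m)
  case 0
  have "block_lists h 0 k m = (if k = 0 \<and> m = 0 then {[]} else {})" for k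
    by (auto simp: block_lists_def)
  then show ?case by (cases "m = 0") (auto simp: fps_eq_iff)
next
  case (Suc n)
  have "Abs_fps (\<lambda>k. card (block_lists h (Suc n) k m)) = short_fps h * Abs_fps (\<lambda>k. card (block_lists h n k m))
     + (if m = 0 then 0 else long_fps h * Abs_fps (\<lambda>k. card (block_lists h n k (m - 1))))"
  proof (rule fps_ext)
    fix k
    show "fps_nth (Abs_fps (\<lambda>k. card (block_lists h (Suc n) k m))) k
      = fps_nth (short_fps h * Abs_fps (\<lambda>k. card (block_lists h n k m))
     + (if m = 0 then 0 else long_fps h * Abs_fps (\<lambda>k. card (block_lists h n k (m - 1))))) k"
    proof (cases "m = 0")
      case True
      then show ?thesis by (simp add: card_block_lists_Suc short_mult cong: if_cong)
    next
      case False
      then show ?thesis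
        by (simp only: card_block_lists_Suc short_mult long_mult fps_add_nth if_False fps_nth_Abs_fps)
          (simp only: sum.distrib[symmetric], rule sum.cong, simp_all)
    qed
  qed
  also have "\<dots> = of_nat (Suc n choose m) * short_fps h ^ (Suc n - m) * long_fps h ^ m"
  proof (cases m)
    case (Suc m')
    show ?thesis
    proof (cases "m \<le> n")
      case True
      then have "short_fps h ^ (n - m') = short_fps h * short_fps h ^ (n - m)"
        using Suc by (simp flip: power_Suc add: Suc_diff_le Suc_diff_Suc)
      then show ?thesis unfolding Suc.IH using Suc by (simp add: algebra_simps)
    next
      case False
      then show ?thesis unfolding Suc.IH using Suc by (simp add: algebra_simps binomial_eq_0)
    qed
  qed (simp add: Suc.IH)
  finally show ?case .
qed

lemma card_lead_block_lists:
  assumes "n > 0" "m > 0"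
  shows "card (lead_block_lists h n k m)
    = fps_nth (of_nat ((n - 1) choose (m - 1)) * short_fps h ^ (n - m) * long_fps h ^ m) k"
proof -
  obtain n' where n: "n = Suc n'" using assms by (cases n) auto
  have eq: "lead_block_lists h n k m = (\<Union>b\<in>{..k} \<inter> {h..}. Cons b ` block_lists h n' (k - b) (m - 1))" (is "?L = ?R")
  proof (rule Set.set_eqI)
    fix xs :: "nat list"
    show "xs \<in> ?L \<longleftrightarrow> xs \<in> ?R"
    proof (cases xs)
      case (Cons b ys)
      have "b # ys \<in> ?R \<longleftrightarrow> b \<le> k \<and> h \<le> b \<and> ys \<in> block_lists h n' (k - b) (m - 1)" by blast
      also have "\<dots> \<longleftrightarrow> b # ys \<in> ?L"
        using assms by (auto simp: block_lists_def lead_block_lists_def n)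
      finally show ?thesis unfolding Cons by simp
    qed (auto simp: lead_block_lists_def)
  qed
  have "card (lead_block_lists h n k m) = (\<Sum>b\<in>{..k} \<inter> {h..}. card (Cons b ` block_lists h n' (k - b) (m - 1)))"
    unfolding eq by (rule card_UN_disjoint) (auto simp: finite_block_lists)
  also have "\<dots> = (\<Sum>b\<in>{..k} \<inter> {h..}. card (block_lists h n' (k - b) (m - 1)))"
    by (simp add: card_image)
  also have "\<dots> = (\<Sum>b\<le>k. if h \<le> b then card (block_lists h n' (k - b) (m - 1)) else 0)"
    by (subst sum.inter_restrict) auto
  also have "\<dots> = fps_nth (long_fps h * Abs_fps (\<lambda>k. card (block_lists h n' k (m - 1)))) k"
    by (auto simp: fps_mult_nth long_fps_def atLeast0AtMost intro!: sum.cong)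
  also have "long_fps h * Abs_fps (\<lambda>k. card (block_lists h n' k (m - 1)))
      = of_nat ((n - 1) choose (m - 1)) * short_fps h ^ (n - m) * long_fps h ^ m"
    unfolding block_lists_fps using assms by (cases m) (auto simp: n algebra_simps)
  finally show ?thesis .
qed

lemma ones_fps_power:
  "fps_nth (Abs_fps (\<lambda>_. Suc 0) ^ Suc m) n = (n + m) choose m"
proof (induction m arbitrary: n)
  case (Suc m)
  have "fps_nth (Abs_fps (\<lambda>_. Suc 0) ^ Suc (Suc m)) n
      = (\<Sum>i\<le>n. fps_nth (Abs_fps (\<lambda>_. Suc 0) ^ Suc m) i)"
    unfolding power_Suc2[of _ "Suc m"] by (simp add: fps_mult_nth atLeast0AtMost del: power_Suc)
  also have "\<dots> = (\<Sum>i\<le>n. (i + m) choose m)" by (simp only: Suc.IH)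
  also have "\<dots> = (\<Sum>k\<le>n. (m + k) choose k)"
    by (intro sum.cong refl) (metis add.commute binomial_symmetric le_add1 add_diff_cancel_left')
  also have "\<dots> = (m + n + 1) choose n" by (simp add: sum_choose_lower)
  also have "\<dots> = (n + Suc m) choose Suc m"
    by (subst binomial_symmetric) (auto simp: add.commute)
  finally show ?case .
qed simp

lemma long_fps_power:
  assumes "m > 0"
  shows "fps_nth (long_fps h ^ m) n = (if h * m \<le> n then (n - h * m + m - 1) choose (m - 1) else 0)"
proof -
  obtain m' where m: "m = Suc m'" using assms by (cases m) auto
  have "long_fps h = fps_X ^ h * Abs_fps (\<lambda>_. 1)"
    by (auto simp: fps_eq_iff long_fps_def fps_X_power_mult_nth)
  then have "long_fps h ^ m = fps_X ^ (h * m) * Abs_fps (\<lambda>_. 1) ^ m"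
    by (simp add: power_mult_distrib power_mult)
  then show ?thesis
    using ones_fps_power[of m' "n - h * m"] by (simp add: fps_X_power_mult_nth m del: power_Suc)
qed

lemma short_fps_1: "short_fps 1 = 1"
  by (auto simp: fps_eq_iff short_fps_def)

lemma short_fps_2: "fps_nth (short_fps 2 ^ p) n = p choose n"
proof (induction p arbitrary: n)
  case 0 then show ?case by (cases n) auto
next
  case (Suc p)
  have "short_fps 2 = 1 + fps_X" by (auto simp: fps_eq_iff short_fps_def)
  then have "short_fps 2 ^ Suc p = short_fps 2 ^ p + fps_X * short_fps 2 ^ p" by (simp add: algebra_simps)
  then show ?case by (cases n) (auto simp: Suc.IH)
qed

text \<open>A block shorter than one is empty, so the generating function of short blocks is \<open>1\<close>.\<close>

lemma card_lead_block_lists_1: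
  assumes "n > 0" "m > 0" "k > 0"
  shows "card (lead_block_lists 1 n k m) = ((n - 1) choose (m - 1)) * ((k - 1) choose (m - 1))"
  using assms card_lead_block_lists[of n m 1 k]
  by (simp add: short_fps_1[simplified] long_fps_power fps_mult_of_nat_nth(1) binomial_eq_0)

text \<open>Short blocks have the generating function \<open>1 + X\<close>; the index \<open>a\<close> is the number of isolated ones.\<close>

lemma card_lead_block_lists_2:
  assumes "n > 0" "m > 0"
  shows "card (lead_block_lists 2 n k m) = ((n - 1) choose (m - 1)) *
     (\<Sum>a\<le>k. ((n - m) choose a) * (if 2 * m \<le> k - a then (k - a - m - 1) choose (m - 1) else 0))"
proof -
  have "k - a - 2 * m + m - 1 = k - a - m - 1" if "2 * m \<le> k - a" for a using that assms by linarith
  then show ?thesis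
    using assms by (simp add: card_lead_block_lists mult.assoc fps_mult_of_nat_nth fps_mult_nth[of "_ ^ _"]
      short_fps_2 long_fps_power atLeast0AtMost cong: if_cong)
qed

lemma blocks_simps [simp]:
  "blocks [] = []" "blocks (a # xs) = replicate a True @ False # blocks xs"
  by (auto simp: blocks_def)

lemma replicate_True_False_eq_iff:
  "replicate a True @ False # u = replicate b True @ False # v \<longleftrightarrow> a = b \<and> u = v"
proof (induction a arbitrary: b)
  case 0 then show ?case by (cases b) auto
next
  case (Suc a) then show ?case by (cases b) auto
qed

lemma blocks_inject: "blocks xs = blocks ys \<Longrightarrow> xs = ys"
proof (induction xs arbitrary: ys)
  case Nil then show ?case by (cases ys) auto
next
  case (Cons a xs) then show ?case by (cases ys) (auto simp: replicate_True_False_eq_iff)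
qed

lemma blocks_surj: "\<exists>xs. w @ [False] = blocks xs \<and> xs \<noteq> []"
proof (induction w)
  case Nil show ?case by (intro exI[of _ "[0]"]) simp
next
  case (Cons b w)
  then obtain a xs where xs: "w @ [False] = blocks (a # xs)" by (metis list.exhaust)
  show ?case
  proof (cases b)
    case True then show ?thesis using xs by (intro exI[of _ "Suc a # xs"]) simp
  next
    case False then show ?thesis using xs by (intro exI[of _ "0 # a # xs"]) simp
  qed
qed

lemma length_blocks: "length (blocks xs) = sum_list xs + length xs"
  by (induction xs) auto

lemma count_blocks: "length (filter (\<lambda>b. b) (blocks xs)) = sum_list xs"
  by (induction xs) auto

lemma last_blocks: "xs \<noteq> [] \<Longrightarrow> \<not> last (blocks xs)"
proof (induction xs)
  case (Cons a xs)
  then show ?case by (cases "xs = []") auto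
qed simp

lemma finite_word_starts: "finite (word_starts h w)"
  by (rule finite_subset[of _ "{..length w}"]) (auto simp: word_starts_def)

lemma prefix_long_iff:
  "a + h \<le> length (replicate a True @ False # u) + a \<and> (\<forall>i<h. (replicate a True @ False # u) ! i) \<longleftrightarrow> h \<le> a"
proof
  assume l: "a + h \<le> length (replicate a True @ False # u) + a \<and> (\<forall>i<h. (replicate a True @ False # u) ! i)"
  show "h \<le> a"
  proof (rule ccontr)
    assume "\<not> h \<le> a"
    then have "(replicate a True @ False # u) ! a" using l by auto
    then show False by (simp add: nth_append)
  qed
qed (auto simp: nth_append)

lemma word_starts_block:
  assumes "h > 0"
  shows "word_starts h (replicate a True @ False # u) =
     (if h \<le> a then {0} else {}) \<union> (\<lambda>p. p + Suc a) ` word_starts h u" (is "word_starts h ?w = ?R")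
proof (rule Set.set_eqI)
  fix p
  have sh: "?w ! (q + Suc a) = u ! q" for q by (simp add: nth_append)
  consider "p = 0" | "p > 0" "p \<le> a" | q where "p = q + Suc a"
    by (metis Suc_leI add.commute le_Suc_ex not_gr_zero not_le)
  then show "p \<in> word_starts h ?w \<longleftrightarrow> p \<in> ?R"
  proof cases
    case 1
    then show ?thesis using prefix_long_iff[of a h u] by (auto simp: word_starts_def)
  next
    case 2
    then have "?w ! (p - 1)" by (auto simp: nth_append)
    then show ?thesis using 2 by (auto simp: word_starts_def)
  next
    case 3
    have "?w ! (p - 1) = (if q = 0 then False else u ! (q - 1))"
      using 3 sh[of "q - 1"] by (auto simp: nth_append)
    moreover have "?w ! (p + i) = u ! (q + i)" for i using 3 sh[of "q + i"] by (simp add: ac_simps)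
    ultimately have "p \<in> word_starts h ?w \<longleftrightarrow> q \<in> word_starts h u"
      using 3 by (auto simp: word_starts_def)
    then show ?thesis using 3 by auto
  qed
qed

lemma card_word_starts_blocks:
  assumes "h > 0"
  shows "card (word_starts h (blocks xs)) = length (filter (\<lambda>x. h \<le> x) xs)"
proof (induction xs)
  case Nil then show ?case using assms by (simp add: word_starts_def)
next
  case (Cons a xs)
  have "card (word_starts h (blocks (a # xs))) =
     card (if h \<le> a then {0::nat} else {}) + card ((\<lambda>p. p + Suc a) ` word_starts h (blocks xs))"
    unfolding blocks_simps word_starts_block[OF assms]
    by (rule card_Un_disjoint) (auto simp: finite_word_starts)
  moreover have "card ((\<lambda>p. p + Suc a) ` word_starts h (blocks xs)) = card (word_starts h (blocks xs))"
    by (rule card_image) (simp add: inj_on_def)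
  ultimately show ?case using Cons by simp
qed

lemma card_filter_word:
  "length (filter (\<lambda>b. b) w) = card {i. i < length w \<and> w ! i}"
  by (rule length_filter_conv_card)

text \<open>A word that ends in a zero has no run across its ends, so runs of the cycle are runs of the word.\<close>

lemma cyclic_starts_word:
  assumes h: "h > 0" and w: "w \<noteq> []" "\<not> last w"
  shows "cyclic_starts h (length w) {i. i < length w \<and> w ! i} = word_starts h w"
proof (rule Set.set_eqI)
  fix a
  let ?t = "length w" let ?A = "{i. i < length w \<and> w ! i}"
  have t: "?t > 0" using w by simp
  have lastf: "\<not> w ! (?t - 1)" using w by (simp add: last_conv_nth)
  show "a \<in> cyclic_starts h ?t ?A \<longleftrightarrow> a \<in> word_starts h w"
  proof (cases "a < ?t")
    case False
    then show ?thesis using h by (auto simp: cyclic_starts_def word_starts_def)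
  next
    case True
    have prev: "(a + ?t - 1) mod ?t \<notin> ?A \<longleftrightarrow> a = 0 \<or> \<not> w ! (a - 1)"
    proof (cases "a = 0")
      case True then show ?thesis using lastf t by simp
    next
      case False
      then have "(a + ?t - 1) mod ?t = a - 1"
        using True by (simp add: mod_if)
      then show ?thesis using True False by auto
    qed
    have "(\<forall>i<h. (a + i) mod ?t \<in> ?A) \<longleftrightarrow> a + h \<le> ?t \<and> (\<forall>i<h. w ! (a + i))"
    proof
      assume l: "\<forall>i<h. (a + i) mod ?t \<in> ?A"
      have "a + h \<le> ?t"
      proof (rule ccontr)
        assume "\<not> a + h \<le> ?t"
        then have "?t - 1 - a < h" "a + (?t - 1 - a) = ?t - 1" using True by auto
        then have "(?t - 1) mod ?t \<in> ?A" using l by metis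
        then show False using lastf t by simp
      qed
      then show "a + h \<le> ?t \<and> (\<forall>i<h. w ! (a + i))" using l by auto
    qed auto
    then show ?thesis using prev True by (auto simp: cyclic_starts_def word_starts_def)
  qed
qed

text \<open>If a run begins at \<open>0\<close>, the last vertex of the cycle is not in the set. The indicator word then
  ends in a zero and decomposes uniquely into blocks.\<close>

lemma card_sets_starting_at_0:
  assumes h: "h > 0" and t: "t > 0"
  shows "card {A. A \<subseteq> {..<t} \<and> card A = k \<and> card (cyclic_starts h t A) = m \<and> 0 \<in> cyclic_starts h t A}
     = card (lead_block_lists h (t - k) k m)" (is "card ?S = card ?L")
proof -
  let ?f = "\<lambda>xs. {i. i < t \<and> blocks xs ! i}"
  show ?thesis
  proof (rule sym, rule bij_betw_same_card[of ?f], unfold bij_betw_def, intro conjI)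
    show "inj_on ?f ?L"
    proof (rule inj_onI)
      fix xs ys assume xs: "xs \<in> ?L" and ys: "ys \<in> ?L" and eq: "?f xs = ?f ys"
      have l: "length (blocks xs) = k + (t - k)" "length (blocks ys) = k + (t - k)"
        using xs ys by (auto simp: lead_block_lists_def block_lists_def length_blocks)
      have "length xs = t - k" "xs \<noteq> []" using xs by (auto simp: lead_block_lists_def block_lists_def)
      then have "t - k > 0" by (metis length_greater_0_conv)
      then have "blocks xs = blocks ys" using eq l by (intro nth_equalityI) (auto simp: set_eq_iff)
      then show "xs = ys" by (rule blocks_inject)
    qed
    show "?f ` ?L = ?S"
    proof (intro equalityI subsetI)
      fix A assume "A \<in> ?f ` ?L"
      then obtain xs where xs: "xs \<in> ?L" "A = ?f xs" by blast
      have ne: "xs \<noteq> []" "h \<le> hd xs" and ls: "length xs = t - k" "sum_list xs = k"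
        and fl: "length (filter (\<lambda>x. h \<le> x) xs) = m"
        using xs by (auto simp: lead_block_lists_def block_lists_def)
      have "t - k > 0" unfolding ls(1)[symmetric] using ne(1) by simp
      then have len: "length (blocks xs) = t" using ls by (simp add: length_blocks)
      have A: "A = {i. i < length (blocks xs) \<and> blocks xs ! i}" using xs len by simp
      have bne: "blocks xs \<noteq> []" using len t by auto
      have cs: "cyclic_starts h t A = word_starts h (blocks xs)"
        using cyclic_starts_word[OF h bne last_blocks[OF ne(1)]] A len by simp
      obtain a ys where ays: "xs = a # ys" using ne by (cases xs) auto
      have "card A = k" using A count_blocks[of xs] card_filter_word[of "blocks xs"] ls by simp
      moreover have "0 \<in> cyclic_starts h t A"
        unfolding cs ays blocks_simps word_starts_block[OF h] using ne ays by auto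
      ultimately show "A \<in> ?S" using card_word_starts_blocks[OF h, of xs] fl cs xs by auto
    next
      fix A assume A: "A \<in> ?S"
      define w where "w = map (\<lambda>i. i \<in> A) [0..<t]"
      have w: "length w = t" "\<And>i. i < t \<Longrightarrow> w ! i \<longleftrightarrow> i \<in> A" by (auto simp: w_def)
      have wA: "{i. i < length w \<and> w ! i} = A" using w A by auto
      have "(0 + t - 1) mod t \<notin> A" using A by (auto simp: cyclic_starts_def)
      then have lw: "\<not> last w" using w t by (simp add: last_conv_nth flip: length_0_conv)
      have wne: "w \<noteq> []" using w t by auto
      have "w = butlast w @ [False]" using lw wne by (metis append_butlast_last_id)
      then obtain xs where xs: "w = blocks xs" "xs \<noteq> []" using blocks_surj by metis
      have cs: "cyclic_starts h t A = word_starts h (blocks xs)"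
        using cyclic_starts_word[OF h wne lw] wA w(1) xs by simp
      have sk: "sum_list xs = k"
        using count_blocks[of xs] card_filter_word[of w] wA A xs by auto
      then have ln: "length xs = t - k" using length_blocks[of xs] w xs by auto
      have m: "length (filter (\<lambda>x. h \<le> x) xs) = m"
        using card_word_starts_blocks[OF h, of xs] cs A by auto
      obtain a ys where ays: "xs = a # ys" using xs by (cases xs) auto
      have "0 \<in> word_starts h (blocks xs)" using A cs by auto
      then have "h \<le> hd xs" unfolding ays blocks_simps word_starts_block[OF h] by (auto split: if_splits)
      then have "xs \<in> ?L" using sk ln m xs by (auto simp: lead_block_lists_def block_lists_def)
      moreover have "A = ?f xs" using wA w(1) xs by simp
      ultimately show "A \<in> ?f ` ?L" by blast
    qed
  qed
qed

definition rotate_set :: "nat \<Rightarrow> nat \<Rightarrow> nat set \<Rightarrow> nat set" where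
  "rotate_set t p A = {b \<in> {..<t}. (b + p) mod t \<in> A}"

lemma add_mod_inverse:
  assumes "b < t" "p \<le> t"
  shows "((b + p) mod t + (t - p)) mod t = b" "((b + (t - p)) mod t + p) mod t = (b::nat)"
proof -
  have "b + p + (t - p) = b + t" "b + (t - p) + p = b + t" using assms by auto
  then show "((b + p) mod t + (t - p)) mod t = b" "((b + (t - p)) mod t + p) mod t = b"
    unfolding mod_add_left_eq using assms(1) by simp_all
qed

lemma rotate_set_inverse:
  assumes "A \<subseteq> {..<t}" "p \<le> t"
  shows "rotate_set t (t - p) (rotate_set t p A) = A" "rotate_set t p (rotate_set t (t - p) A) = A"
proof -
  show "rotate_set t (t - p) (rotate_set t p A) = A" "rotate_set t p (rotate_set t (t - p) A) = A"
    using assms add_mod_inverse[OF _ assms(2)] by (auto simp: rotate_set_def)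
qed

lemma bij_betw_add_mod:
  assumes "t > 0" "p \<le> t"
  shows "bij_betw (\<lambda>b. (b + p) mod t) {..<t::nat} {..<t}"
  by (rule bij_betw_byWitness[of _ "\<lambda>b. (b + (t - p)) mod t"])
    (use assms add_mod_inverse[OF _ assms(2)] in auto)

lemma card_rotate_set:
  assumes "A \<subseteq> {..<t}" "t > 0" "p \<le> t"
  shows "card (rotate_set t p A) = card A"
proof -
  have "bij_betw (\<lambda>b. (b + p) mod t) (rotate_set t p A) A"
    unfolding bij_betw_def
  proof
    note bij = bij_betw_add_mod[OF assms(2,3)]
    show "inj_on (\<lambda>b. (b + p) mod t) (rotate_set t p A)"
      by (rule inj_on_subset[OF bij_betw_imp_inj_on[OF bij]]) (auto simp: rotate_set_def)
    show "(\<lambda>b. (b + p) mod t) ` rotate_set t p A = A"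
    proof
      show "A \<subseteq> (\<lambda>b. (b + p) mod t) ` rotate_set t p A"
      proof
        fix a assume a: "a \<in> A"
        then have "a \<in> (\<lambda>b. (b + p) mod t) ` {..<t}"
          using assms(1) bij_betw_imp_surj_on[OF bij] by blast
        then obtain b where "b < t" "(b + p) mod t = a" by blast
        with a show "a \<in> (\<lambda>b. (b + p) mod t) ` rotate_set t p A" unfolding rotate_set_def by blast
      qed
    qed (auto simp: rotate_set_def)
  qed
  then show ?thesis by (rule bij_betw_same_card)
qed

lemma cyclic_starts_rotate:
  assumes "t > 0"
  shows "cyclic_starts h t (rotate_set t p A) = rotate_set t p (cyclic_starts h t A)"
proof -
  have "((b + t - 1) mod t + p) mod t = ((b + p) mod t + t - 1) mod t" if "b < t" for b
  proof -
    have "((b + t - 1) mod t + p) mod t = (b + p + (t - 1)) mod t"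
    proof -
      have "b + t - 1 + p = b + p + (t - 1)" using assms by simp
      then show ?thesis by (simp only: mod_add_left_eq)
    qed
    also have "\<dots> = ((b + p) mod t + (t - 1)) mod t" by (simp add: mod_add_left_eq)
    finally show ?thesis using assms by simp
  qed
  moreover have "((b + i) mod t + p) mod t = ((b + p) mod t + i) mod t" for b i
  proof -
    have "b + i + p = b + p + i" by simp
    then show ?thesis by (simp only: mod_add_left_eq)
  qed
  ultimately show ?thesis using assms by (auto simp: cyclic_starts_def rotate_set_def)
qed

text \<open>Pairs of a set and the first element of one of its runs are counted in two ways: each set has
  \<open>m\<close> of them, and each of the \<open>t\<close> possible first elements can be rotated to \<open>0\<close>.\<close>

lemma cyclic_count:
  assumes h: "h > 0" and t: "t > 0"
  shows "m * card {A. A \<subseteq> {..<t} \<and> card A = k \<and> card (cyclic_starts h t A) = m}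
     = t * card (lead_block_lists h (t - k) k m)"
proof -
  let ?S = "{A. A \<subseteq> {..<t} \<and> card A = k \<and> card (cyclic_starts h t A) = m}"
  let ?Sp = "\<lambda>p. {A. A \<subseteq> {..<t} \<and> card A = k \<and> card (cyclic_starts h t A) = m \<and> p \<in> cyclic_starts h t A}"
  have finS: "finite ?S" by (rule finite_subset[of _ "Pow {..<t}"]) auto
  have cssub: "cyclic_starts h t A \<subseteq> {..<t}" for A by (auto simp: cyclic_starts_def)
  have lt: "a < t" if "a \<in> cyclic_starts h t A" for a A using that by (simp add: cyclic_starts_def)
  have fincs: "finite (cyclic_starts h t A)" for A using cssub finite_subset by blast
  have rot: "card (?Sp p) = card (?Sp 0)" if p: "p < t" for p
  proof (rule bij_betw_same_card[of "rotate_set t p"], rule bij_betw_byWitness[of _ "rotate_set t (t - p)"])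
    have sub: "rotate_set t q A \<subseteq> {..<t}" for q A by (auto simp: rotate_set_def)
    show "\<forall>A\<in>?Sp p. rotate_set t (t - p) (rotate_set t p A) = A"
      "\<forall>A\<in>?Sp 0. rotate_set t p (rotate_set t (t - p) A) = A"
      using rotate_set_inverse p by auto
    have mv: "rotate_set t q A \<in> ?Sp b" if "A \<in> ?Sp a" "q \<le> t" "(b + q) mod t = a" "b < t" for q A a b
    proof -
      have "card (cyclic_starts h t (rotate_set t q A)) = card (cyclic_starts h t A)"
        unfolding cyclic_starts_rotate[OF t] by (rule card_rotate_set[OF cssub t that(2)])
      moreover have "b \<in> cyclic_starts h t (rotate_set t q A)"
        unfolding cyclic_starts_rotate[OF t] using that by (simp add: rotate_set_def)
      moreover have "card (rotate_set t q A) = card A"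
        using that by (intro card_rotate_set t) auto
      ultimately show ?thesis using that(1) sub by simp
    qed
    show "rotate_set t p ` ?Sp p \<subseteq> ?Sp 0"
      using mv[of _ p p 0] p t by auto
    show "rotate_set t (t - p) ` ?Sp 0 \<subseteq> ?Sp p"
      using mv[of _ 0 "t - p" p] p t by auto
  qed
  have "(\<Sum>A\<in>?S. card (cyclic_starts h t A)) = (\<Sum>A\<in>?S. m)" by (rule sum.cong) blast+
  then have "m * card ?S = (\<Sum>A\<in>?S. card (cyclic_starts h t A))" by (simp only: sum_constant mult.commute of_nat_id)
  also have "\<dots> = (\<Sum>A\<in>?S. \<Sum>p<t. if p \<in> cyclic_starts h t A then 1 else 0)"
  proof (rule sum.cong[OF refl])
    fix A
    have "{..<t} \<inter> {p. p \<in> cyclic_starts h t A} = cyclic_starts h t A" using lt by blast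
    then show "card (cyclic_starts h t A) = (\<Sum>p<t. if p \<in> cyclic_starts h t A then 1 else 0)"
      by (simp add: sum.If_cases)
  qed
  also have "\<dots> = (\<Sum>p<t. \<Sum>A\<in>?S. if p \<in> cyclic_starts h t A then 1 else 0)" by (rule sum.swap)
  also have "\<dots> = (\<Sum>p<t. card (?Sp p))"
  proof (rule sum.cong[OF refl])
    fix p
    have eq: "?S \<inter> {A. p \<in> cyclic_starts h t A} = ?Sp p" by blast
    then show "(\<Sum>A\<in>?S. if p \<in> cyclic_starts h t A then 1 else 0) = card (?Sp p)"
      unfolding sum.If_cases[OF finS] eq by (simp only: sum.neutral_const card_eq_sum[symmetric] add_0_right)
  qed
  also have "\<dots> = (\<Sum>p<t. card (?Sp 0))" by (rule sum.cong[OF refl], rule rot) (simp only: lessThan_iff)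
  also have "\<dots> = t * card (?Sp 0)" by (simp only: sum_constant card_lessThan of_nat_id)
  also have "\<dots> = t * card (lead_block_lists h (t - k) k m)"
    unfolding card_sets_starting_at_0[OF h t] ..
  finally show ?thesis .
qed

section \<open>Two sums over subsets of a cycle\<close>

lemma sum_by_value:
  fixes g :: "nat \<Rightarrow> real"
  assumes "finite S" "\<And>A. A \<in> S \<Longrightarrow> c A \<le> n"
  shows "(\<Sum>A\<in>S. g (c A)) = (\<Sum>m\<le>n. real (card {A \<in> S. c A = m}) * g m)"
proof -
  have "(\<Sum>A\<in>S. g (c A)) = (\<Sum>m\<le>n. \<Sum>A\<in>{A \<in> S. c A = m}. g (c A))"
    using assms by (intro sum.group[symmetric]) auto
  also have "\<dots> = (\<Sum>m\<le>n. \<Sum>A\<in>{A \<in> S. c A = m}. g m)"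
    by (intro sum.cong refl) auto
  finally show ?thesis by simp
qed

lemma lead_block_lists_empty_if_long:
  assumes "h * m > k"
  shows "lead_block_lists h n k m = {}"
proof -
  have "h * length (filter (\<lambda>x. h \<le> x) xs) \<le> sum_list xs" for xs :: "nat list"
    by (induction xs) auto
  then show ?thesis using assms by (auto simp: lead_block_lists_def block_lists_def not_le[symmetric])
qed

lemma card_cyclic_starts_le: "card (cyclic_starts h t A) \<le> t"
  using card_mono[of "{..<t}" "cyclic_starts h t A"] by (auto simp: cyclic_starts_def)

lemma binom_nat: "binom (int p) (int q) = p choose q"
  by (simp add: binom_def binomial_eq_0)

text \<open>The sets are sorted by the number \<open>m\<close> of runs with at least two elements. The truncated difference
  vanishes for \<open>m < 2\<close>, and there are no sets with \<open>2 * m > j\<close>.\<close>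

lemma sum_edge_runs:
  assumes t: "t > 0"
  shows "real (\<Sum>A\<in>{A. A \<subseteq> {..<t} \<and> card A = j}. card (cyclic_starts 2 t A) - 1) =
    (\<Sum>m = 2..j div 2.
       real t * ((real m - 1) / real m)
       * real (binom (int t - int j - 1) (int m - 1))
       * (\<Sum>a = 0..j - 2 * m.
            real (binom (int j - int m - int a - 1) (int m - 1))
            * real (binom (int t - int j - int m) (int a))))"
proof -
  let ?S = "{A. A \<subseteq> {..<t} \<and> card A = j}"
  let ?c = "\<lambda>A. card (cyclic_starts 2 t A)"
  let ?N = "\<lambda>m. real (card {A \<in> ?S. ?c A = m})"
  have fin: "finite ?S" by (rule finite_subset[of _ "Pow {..<t}"]) auto
  have N: "real m * ?N m = real t * real (card (lead_block_lists 2 (t - j) j m))" for m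
    using arg_cong[OF cyclic_count[of 2 t m j], of real] t by (simp add: conj_assoc)
  have "real (\<Sum>A\<in>?S. ?c A - 1) = (\<Sum>A\<in>?S. real (?c A - 1))" by simp
  also have "\<dots> = (\<Sum>m\<le>t. ?N m * real (m - 1))"
    by (rule sum_by_value[OF fin]) (rule card_cyclic_starts_le)
  also have "\<dots> = (\<Sum>m\<in>{..t} \<union> {2..j div 2}. ?N m * real (m - 1))"
  proof (rule sum.mono_neutral_left)
    show "\<forall>m\<in>{..t} \<union> {2..j div 2} - {..t}. ?N m * real (m - 1) = 0"
    proof
      fix m assume "m \<in> {..t} \<union> {2..j div 2} - {..t}"
      then have "{A \<in> ?S. ?c A = m} = {}" using card_cyclic_starts_le[of 2 t] by auto
      then show "?N m * real (m - 1) = 0" by (simp only: card.empty of_nat_0 mult_zero_left)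
    qed
  qed auto
  also have "\<dots> = (\<Sum>m = 2..j div 2. ?N m * real (m - 1))"
  proof (rule sum.mono_neutral_right)
    show "\<forall>m\<in>{..t} \<union> {2..j div 2} - {2..j div 2}. ?N m * real (m - 1) = 0"
    proof
      fix m assume m: "m \<in> {..t} \<union> {2..j div 2} - {2..j div 2}"
      show "?N m * real (m - 1) = 0"
      proof (cases "m < 2")
        case False
        then have "j < 2 * m" using m by auto
        then have "real m * ?N m = 0" using lead_block_lists_empty_if_long[of j 2 m] by (simp only: N card.empty of_nat_0 mult_zero_right)
        then show ?thesis using False by auto
      qed auto
    qed
  qed auto
  also have "\<dots> = (\<Sum>m = 2..j div 2.
       real t * ((real m - 1) / real m)
       * real (binom (int t - int j - 1) (int m - 1))
       * (\<Sum>a = 0..j - 2 * m.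
            real (binom (int j - int m - int a - 1) (int m - 1))
            * real (binom (int t - int j - int m) (int a))))"
  proof (rule sum.cong[OF refl])
    fix m assume m: "m \<in> {2..j div 2}"
    then have m2: "m \<ge> 2" "2 * m \<le> j" by auto
    have Nm: "?N m = real t / real m * real (card (lead_block_lists 2 (t - j) j m))"
      using N[of m] m2 by (simp add: field_simps)
    have L: "real (card (lead_block_lists 2 (t - j) j m)) =
       real (binom (int t - int j - 1) (int m - 1))
       * (\<Sum>a = 0..j - 2 * m. real (binom (int j - int m - int a - 1) (int m - 1))
            * real (binom (int t - int j - int m) (int a)))"
    proof (cases "m \<le> t - j")
      case False
      have "length (filter (\<lambda>x. 2 \<le> x) xs) \<le> length xs" for xs :: "nat list" by simp
      then have "lead_block_lists 2 (t - j) j m = {}"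
        using False unfolding lead_block_lists_def block_lists_def
        by (metis (mono_tags, lifting) empty_Collect_eq mem_Collect_eq)
      moreover have "binom (int t - int j - 1) (int m - 1) = 0" using False by (auto simp: binom_def)
      ultimately show ?thesis by simp
    next
      case True
      then have b1: "binom (int t - int j - 1) (int m - 1) = (t - j - 1) choose (m - 1)"
      proof -
        have "int t - int j - 1 = int (t - j - 1)" "int m - 1 = int (m - 1)" using True m2 by auto
        then show ?thesis using binom_nat by metis
      qed
      have b2: "binom (int t - int j - int m) (int a) = (t - j - m) choose a" for a
      proof -
        have "int t - int j - int m = int (t - j - m)" using True m2 by auto
        then show ?thesis using binom_nat by metis
      qed
      have b3: "binom (int j - int m - int a - 1) (int m - 1) = (j - a - m - 1) choose (m - 1)"
        if "a \<le> j - 2 * m" for a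
      proof -
        have "int j - int m - int a - 1 = int (j - a - m - 1)" "int m - 1 = int (m - 1)"
          using that m2 by auto
        then show ?thesis using binom_nat by metis
      qed
      have "card (lead_block_lists 2 (t - j) j m) = ((t - j - 1) choose (m - 1)) *
         (\<Sum>a\<le>j. ((t - j - m) choose a) * (if 2 * m \<le> j - a then (j - a - m - 1) choose (m - 1) else 0))"
        using True m2 by (intro card_lead_block_lists_2) auto
      also have "(\<Sum>a\<le>j. ((t - j - m) choose a) * (if 2 * m \<le> j - a then (j - a - m - 1) choose (m - 1) else 0))
         = (\<Sum>a = 0..j - 2 * m. ((t - j - m) choose a) * ((j - a - m - 1) choose (m - 1)))"
        using m2 by (intro sum.mono_neutral_cong_right) auto
      finally show ?thesis by (simp add: b1 b2 b3 mult.commute)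
    qed
    show "?N m * real (m - 1) = real t * ((real m - 1) / real m)
       * real (binom (int t - int j - 1) (int m - 1))
       * (\<Sum>a = 0..j - 2 * m.
            real (binom (int j - int m - int a - 1) (int m - 1))
            * real (binom (int t - int j - int m) (int a)))"
      unfolding Nm L using m2 by (simp add: of_nat_diff)
  qed
  finally show ?thesis .
qed

lemma cyclic_starts_subset: "h > 0 \<Longrightarrow> cyclic_starts h t A \<subseteq> A"
  by (auto simp: cyclic_starts_def)

lemma cyclic_starts_empty_imp_full:
  assumes A: "A \<subseteq> {..<s}" "A \<noteq> {}" and e: "cyclic_starts 1 s A = {}"
  shows "A = {..<s}"
proof -
  have step: "(a + s - 1) mod s \<in> A" if "a \<in> A" for a
    using that e A(1) by (auto simp: cyclic_starts_def)
  obtain a where a: "a \<in> A" using A by blast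
  then have as: "a < s" using A by auto
  have walk: "n \<le> a + s \<Longrightarrow> (a + s - n) mod s \<in> A" for n
  proof (induction n)
    case 0 then show ?case using a as by simp
  next
    case (Suc n)
    let ?b = "(a + s - n) mod s"
    have "(?b + s - 1) mod s = (a + s - n + (s - 1)) mod s"
      using as by (simp add: mod_add_left_eq flip: Nat.add_diff_assoc)
    also have "a + s - n + (s - 1) = (a + s - Suc n) + s" using Suc.prems as by simp
    finally have "(?b + s - 1) mod s = (a + s - Suc n) mod s" by simp
    then show ?case using step[of ?b] Suc by simp
  qed
  have "x \<in> A" if "x < s" for x
    using walk[of "a + s - x"] that as by simp
  then show ?thesis using A by auto
qed

text \<open>In a cycle of even length with \<open>X\<close> and \<open>Y\<close> both numbered from \<open>0\<close>, a vertex of \<open>X\<close> has the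
  neighbours with the same number and with the preceding number in \<open>Y\<close>. Beyond \<open>card A\<close>, a set
  \<open>A\<close> of vertices of \<open>X\<close> gains one neighbour before each of its runs.\<close>

lemma card_closed_neighbours:
  assumes A: "A \<subseteq> {..<s}" and s: "s > 0"
  shows "card (A \<union> (\<lambda>i. (i + s - 1) mod s) ` A) = card A + card (cyclic_starts 1 s A)"
proof -
  let ?p = "\<lambda>i. (i + s - 1) mod s"
  have inj: "inj_on ?p {..<s}"
    using bij_betw_add_mod[OF s, of "s - 1"] s by (auto simp: bij_betw_def)
  have fin: "finite A" using A finite_subset by blast
  have "A \<union> ?p ` A = A \<union> ?p ` cyclic_starts 1 s A"
  proof -
    have "i \<in> cyclic_starts 1 s A" if "i \<in> A" "?p i \<notin> A" for i
      using that A by (auto simp: cyclic_starts_def)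
    then show ?thesis using cyclic_starts_subset[of 1 s A] by auto
  qed
  also have "card \<dots> = card A + card (?p ` cyclic_starts 1 s A)"
    using fin cyclic_starts_subset[of 1 s A] by (intro card_Un_disjoint) (auto simp: cyclic_starts_def)
  also have "card (?p ` cyclic_starts 1 s A) = card (cyclic_starts 1 s A)"
    by (rule card_image, rule inj_on_subset[OF inj]) (auto simp: cyclic_starts_def)
  finally show ?thesis .
qed

definition cyclic_independent :: "nat \<Rightarrow> nat set \<Rightarrow> bool" where
  "cyclic_independent t P \<longleftrightarrow> (\<forall>a\<in>P. (a + 1) mod t \<notin> P)"

text \<open>Splits a set of vertices of a cycle of even length into its two sides.\<close>

definition even_odd_union :: "nat set \<times> nat set \<Rightarrow> nat set" where
  "even_odd_union = (\<lambda>(A, B). (\<lambda>i. 2 * i) ` A \<union> (\<lambda>i. 2 * i + 1) ` B)"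

lemma even_mem_even_odd_union [simp]: "2 * i \<in> even_odd_union (A, B) \<longleftrightarrow> i \<in> A"
  by (auto simp: even_odd_union_def) presburger

lemma odd_mem_even_odd_union [simp]: "Suc (2 * i) \<in> even_odd_union (A, B) \<longleftrightarrow> i \<in> B"
  by (auto simp: even_odd_union_def) presburger

lemma cyclic_independent_even_odd:
  assumes AB: "A \<subseteq> {..<s}" "B \<subseteq> {..<s}" and s: "s > 0"
  shows "cyclic_independent (2 * s) (even_odd_union (A, B)) \<longleftrightarrow>
    B \<inter> (A \<union> (\<lambda>i. (i + s - 1) mod s) ` A) = {}"
proof -
  have 1: "(2 * i + 1) mod (2 * s) = Suc (2 * i)" if "i < s" for i using that by simp
  have 2: "(Suc (2 * i) + 1) mod (2 * s) = 2 * ((i + 1) mod s)" for i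
    using mod_mult_mult1[of 2 "i + 1" s] by simp
  have "cyclic_independent (2 * s) (even_odd_union (A, B)) \<longleftrightarrow>
     (\<forall>i\<in>A. (2 * i + 1) mod (2 * s) \<notin> even_odd_union (A, B)) \<and>
     (\<forall>i\<in>B. (Suc (2 * i) + 1) mod (2 * s) \<notin> even_odd_union (A, B))"
    unfolding cyclic_independent_def
    by (subst (1) even_odd_union_def) (auto simp: ball_Un)
  also have "\<dots> \<longleftrightarrow> (\<forall>i\<in>A. i \<notin> B) \<and> (\<forall>i\<in>B. (i + 1) mod s \<notin> A)"
  proof -
    have "(\<forall>i\<in>A. (2 * i + 1) mod (2 * s) \<notin> even_odd_union (A, B)) \<longleftrightarrow> (\<forall>i\<in>A. i \<notin> B)"
    proof (rule ball_cong[OF refl])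
      fix i assume "i \<in> A"
      then have "i < s" using AB by auto
      show "(2 * i + 1) mod (2 * s) \<notin> even_odd_union (A, B) \<longleftrightarrow> i \<notin> B"
        unfolding 1[OF \<open>i < s\<close>] by simp
    qed
    then show ?thesis unfolding 2 by simp
  qed
  also have "(\<forall>i\<in>B. (i + 1) mod s \<notin> A) \<longleftrightarrow> B \<inter> (\<lambda>i. (i + s - 1) mod s) ` A = {}"
  proof -
    have a: "((i + 1) mod s + (s - 1)) mod s = i" "((i + (s - 1)) mod s + 1) mod s = i" if "i < s" for i
      using add_mod_inverse[OF that, of 1] s by auto
    have a: "((i + 1) mod s + s - 1) mod s = i" "((i + s - 1) mod s + 1) mod s = i" if "i < s" for i
      using a[OF that] s by auto
    show ?thesis
    proof
      assume l: "\<forall>i\<in>B. (i + 1) mod s \<notin> A"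
      show "B \<inter> (\<lambda>i. (i + s - 1) mod s) ` A = {}"
      proof (rule ccontr)
        assume "\<not> ?thesis"
        then obtain i where i: "i \<in> A" "(i + s - 1) mod s \<in> B" by blast
        then have "i < s" using AB by auto
        have "((i + s - 1) mod s + 1) mod s \<notin> A" using l i(2) by blast
        then show False unfolding a(2)[OF \<open>i < s\<close>] using i by simp
      qed
    next
      assume r: "B \<inter> (\<lambda>i. (i + s - 1) mod s) ` A = {}"
      show "\<forall>i\<in>B. (i + 1) mod s \<notin> A"
      proof
        fix i assume i: "i \<in> B"
        then have "i < s" using AB by auto
        show "(i + 1) mod s \<notin> A"
        proof
          assume "(i + 1) mod s \<in> A"
          then have "((i + 1) mod s + s - 1) mod s \<in> (\<lambda>i. (i + s - 1) mod s) ` A" by blast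
          then show False unfolding a(1)[OF \<open>i < s\<close>] using i r by blast
        qed
      qed
    qed
  qed
  finally show ?thesis by blast
qed

lemma card_even_odd_union:
  assumes "finite A" "finite B"
  shows "card (even_odd_union (A, B)) = card A + card B"
proof -
  have "2 * i \<noteq> 2 * k + 1" for i k :: nat by presburger
  then have "(\<lambda>i. 2 * i) ` A \<inter> (\<lambda>i. 2 * i + 1) ` B = {}" by blast
  then show ?thesis using assms unfolding even_odd_union_def
    by (simp add: card_Un_disjoint card_image inj_on_def)
qed

lemma bij_betw_even_odd_union:
  "bij_betw even_odd_union (Pow {..<s} \<times> Pow {..<s}) (Pow {..<2 * s})"
proof (rule bij_betw_byWitness[of _ "\<lambda>P. ({i. 2 * i \<in> P}, {i. Suc (2 * i) \<in> P})"])
  show "\<forall>P\<in>Pow {..<2 * s}. even_odd_union ({i. 2 * i \<in> P}, {i. Suc (2 * i) \<in> P}) = P"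
  proof
    fix P :: "nat set"
    have "a \<in> even_odd_union ({i. 2 * i \<in> P}, {i. Suc (2 * i) \<in> P}) \<longleftrightarrow> a \<in> P" for a
    proof (cases "even a")
      case True then show ?thesis by (auto elim!: evenE)
    next
      case False then show ?thesis by (auto elim!: oddE)
    qed
    then show "even_odd_union ({i. 2 * i \<in> P}, {i. Suc (2 * i) \<in> P}) = P" by blast
  qed
next
  show "\<forall>p\<in>Pow {..<s} \<times> Pow {..<s}.
      ({i. 2 * i \<in> even_odd_union p}, {i. Suc (2 * i) \<in> even_odd_union p}) = p" by auto
qed (auto simp: even_odd_union_def)

lemma bij_betw_restrict_to_preimage:
  assumes "bij_betw f X Y" "Q \<subseteq> Y"
  shows "bij_betw f {p \<in> X. f p \<in> Q} Q"
  using assms unfolding bij_betw_def inj_on_def by blast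

text \<open>With \<open>k\<close> even elements in \<open>c\<close> runs, the odd elements are an arbitrary set of \<open>j - k\<close> among the
  \<open>s - k - c\<close> non-neighbours. The sum over \<open>c\<close> starts at \<open>1\<close>: among nonempty sets only the
  full one has no run, and it leaves no room for odd elements.\<close>

lemma card_independent_sets:
  assumes s: "s > 0"
  shows "real (card {P. P \<subseteq> {..<2 * s} \<and> card P = j \<and> cyclic_independent (2 * s) P
             \<and> (\<exists>a\<in>P. even a) \<and> (\<exists>a\<in>P. odd a)}) =
    (\<Sum>k = 1..j - 1. \<Sum>c = 1..k.
        real s / real c
        * real (binom (int k - 1) (int c - 1))
        * real (binom (int s - int k - 1) (int c - 1))
        * real (binom (int s - int k - int c) (int j - int k)))"
proof -
  let ?n = "\<lambda>A. A \<union> (\<lambda>i. (i + s - 1) mod s) ` A"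
  let ?Q = "{P. P \<subseteq> {..<2 * s} \<and> card P = j \<and> cyclic_independent (2 * s) P
             \<and> (\<exists>a\<in>P. even a) \<and> (\<exists>a\<in>P. odd a)}"
  let ?As = "\<lambda>k. {A. A \<subseteq> {..<s} \<and> card A = k}"
  let ?Bs = "\<lambda>k A. {B. B \<subseteq> {..<s} - ?n A \<and> card B = j - k}"
  let ?c = "\<lambda>A. card (cyclic_starts 1 s A)"
  have finA: "finite (?As k)" for k by (rule finite_subset[of _ "Pow {..<s}"]) auto
  have finB: "finite (?Bs k A)" for k A by (rule finite_subset[of _ "Pow {..<s}"]) auto
  have fin: "finite A" if "A \<subseteq> {..<s}" for A using that finite_subset by blast
  let ?T = "SIGMA k:{1..j - 1}. SIGMA A:?As k. ?Bs k A"
  have "bij_betw even_odd_union {p \<in> Pow {..<s} \<times> Pow {..<s}. even_odd_union p \<in> ?Q} ?Q"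
    by (rule bij_betw_restrict_to_preimage[OF bij_betw_even_odd_union]) (simp add: subset_iff)
  then have "card ?Q = card {p \<in> Pow {..<s} \<times> Pow {..<s}. even_odd_union p \<in> ?Q}"
    by (rule bij_betw_same_card[symmetric])
  also have "{p \<in> Pow {..<s} \<times> Pow {..<s}. even_odd_union p \<in> ?Q} = snd ` ?T"
  proof (rule Set.set_eqI)
    fix p :: "nat set \<times> nat set"
    obtain A B where p: "p = (A, B)" by (cases p)
    show "p \<in> {p \<in> Pow {..<s} \<times> Pow {..<s}. even_odd_union p \<in> ?Q} \<longleftrightarrow> p \<in> snd ` ?T"
    proof (cases "A \<subseteq> {..<s} \<and> B \<subseteq> {..<s}")
      case False then show ?thesis unfolding p by auto
    next
      case True
      have ev: "(\<exists>a\<in>even_odd_union (A, B). even a) \<longleftrightarrow> A \<noteq> {}"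
        "(\<exists>a\<in>even_odd_union (A, B). odd a) \<longleftrightarrow> B \<noteq> {}"
        unfolding even_odd_union_def prod.case bex_Un by auto
      have sub: "even_odd_union (A, B) \<subseteq> {..<2 * s}" using True by (auto simp: even_odd_union_def)
      have "p \<in> {p \<in> Pow {..<s} \<times> Pow {..<s}. even_odd_union p \<in> ?Q} \<longleftrightarrow>
          card A + card B = j \<and> B \<inter> ?n A = {} \<and> A \<noteq> {} \<and> B \<noteq> {}"
        unfolding p using True sub ev cyclic_independent_even_odd[of A s B] s
          card_even_odd_union[OF fin fin, of A B] by auto
      also have "\<dots> \<longleftrightarrow> card A \<in> {1..j - 1} \<and> B \<in> ?Bs (card A) A"
      proof -
        have "A \<noteq> {} \<longleftrightarrow> card A > 0" "B \<noteq> {} \<longleftrightarrow> card B > 0" using fin True by (auto simp: card_gt_0_iff)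
        moreover have "B \<inter> ?n A = {} \<longleftrightarrow> B \<subseteq> {..<s} - ?n A" using True by blast
        ultimately show ?thesis by auto
      qed
      also have "\<dots> \<longleftrightarrow> p \<in> snd ` ?T" unfolding p using True by force
      finally show ?thesis .
    qed
  qed
  also have "card (snd ` ?T) = card ?T"
    by (rule card_image) (auto simp: inj_on_def)
  also have "card ?T = (\<Sum>k = 1..j - 1. \<Sum>A\<in>?As k. card (?Bs k A))"
  proof -
    have "finite (SIGMA A:?As k. ?Bs k A)" for k using finA finB by blast
    then show ?thesis using finA finB by (simp add: card_SigmaI)
  qed
  finally have "real (card ?Q) = (\<Sum>k = 1..j - 1. \<Sum>A\<in>?As k. real (card (?Bs k A)))" by simp
  also have "\<dots> = (\<Sum>k = 1..j - 1. \<Sum>c = 1..k.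
        real s / real c
        * real (binom (int k - 1) (int c - 1))
        * real (binom (int s - int k - 1) (int c - 1))
        * real (binom (int s - int k - int c) (int j - int k)))"
  proof (rule sum.cong[OF refl])
    fix k assume k: "k \<in> {1..j - 1}"
    let ?N = "\<lambda>c. real (card {A \<in> ?As k. ?c A = c})"
    have N: "real c * ?N c = real s * real (card (lead_block_lists 1 (s - k) k c))" for c
      using arg_cong[OF cyclic_count[of 1 s c k], of real] s by (simp add: conj_assoc)
    have "(\<Sum>A\<in>?As k. real (card (?Bs k A))) = (\<Sum>A\<in>?As k. real ((s - (k + ?c A)) choose (j - k)))"
    proof (rule sum.cong[OF refl])
      fix A assume A: "A \<in> ?As k"
      have "?n A \<subseteq> {..<s}" using A s by auto
      then have "card ({..<s} - ?n A) = s - (k + ?c A)"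
        using card_closed_neighbours[of A s] A s fin by (subst card_Diff_subset) auto
      moreover have "card (?Bs k A) = card ({..<s} - ?n A) choose (j - k)"
        by (rule n_subsets) simp
      ultimately show "real (card (?Bs k A)) = real ((s - (k + ?c A)) choose (j - k))" by simp
    qed
    also have "\<dots> = (\<Sum>c\<le>k. ?N c * real ((s - (k + c)) choose (j - k)))"
    proof (rule sum_by_value[OF finA])
      fix A assume "A \<in> ?As k"
      then show "?c A \<le> k" using card_mono[OF _ cyclic_starts_subset[of 1 s A]] fin by auto
    qed
    also have "\<dots> = (\<Sum>c = 1..k. ?N c * real ((s - (k + c)) choose (j - k)))"
    proof (rule sum.mono_neutral_right)
      show "\<forall>c\<in>{..k} - {1..k}. ?N c * real ((s - (k + c)) choose (j - k)) = 0"
      proof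
        fix c assume "c \<in> {..k} - {1..k}"
        then have c: "c = 0" by auto
        show "?N c * real ((s - (k + c)) choose (j - k)) = 0"
        proof (cases "k = s")
          case True then show ?thesis using k by (auto simp: binomial_eq_0)
        next
          case False
          have "{A \<in> ?As k. ?c A = c} = {}"
          proof (rule ccontr)
            assume "\<not> ?thesis"
            then obtain A where A: "A \<subseteq> {..<s}" "card A = k" "?c A = 0" using c by blast
            have "finite (cyclic_starts 1 s A)" by (rule finite_subset[of _ "{..<s}"]) (auto simp: cyclic_starts_def)
            then have "A = {..<s}" using A k by (intro cyclic_starts_empty_imp_full) auto
            then show False using A False by simp
          qed
          then show ?thesis by (simp only: card.empty of_nat_0 mult_zero_left)
        qed
      qed
    qed auto
    also have "\<dots> = (\<Sum>c = 1..k.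
        real s / real c
        * real (binom (int k - 1) (int c - 1))
        * real (binom (int s - int k - 1) (int c - 1))
        * real (binom (int s - int k - int c) (int j - int k)))"
    proof (rule sum.cong[OF refl])
      fix c assume c: "c \<in> {1..k}"
      have Nc: "?N c = real s / real c * real (card (lead_block_lists 1 (s - k) k c))"
        using N[of c] c by (simp add: field_simps)
      have b1: "binom (int k - 1) (int c - 1) = (k - 1) choose (c - 1)"
        using c k binom_nat[of "k - 1" "c - 1"] by (simp add: of_nat_diff)
      have L: "card (lead_block_lists 1 (s - k) k c) =
          binom (int k - 1) (int c - 1) * binom (int s - int k - 1) (int c - 1)"
      proof (cases "k < s")
        case True
        then have "binom (int s - int k - 1) (int c - 1) = (s - k - 1) choose (c - 1)"
        proof -
          have "int s - int k - 1 = int (s - k - 1)" "int c - 1 = int (c - 1)" using True c by auto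
          then show ?thesis using binom_nat by metis
        qed
        then show ?thesis using card_lead_block_lists_1[of "s - k" c k] True c k b1 by simp
      next
        case False
        then have "lead_block_lists 1 (s - k) k c = {}" by (auto simp: lead_block_lists_def block_lists_def)
        moreover have "binom (int s - int k - 1) (int c - 1) = 0" using False c by (simp add: binom_def)
        ultimately show ?thesis by simp
      qed
      have b2: "binom (int s - int k - int c) (int j - int k) = (s - (k + c)) choose (j - k)"
      proof (cases "k + c \<le> s")
        case True
        then have "int s - int k - int c = int (s - (k + c))" "int j - int k = int (j - k)" using k by auto
        then show ?thesis using binom_nat by metis
      next
        case False
        then show ?thesis using k by (auto simp: binom_def binomial_eq_0)
      qed
      show "?N c * real ((s - (k + c)) choose (j - k)) = real s / real c
        * real (binom (int k - 1) (int c - 1))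
        * real (binom (int s - int k - 1) (int c - 1))
        * real (binom (int s - int k - int c) (int j - int k))"
        unfolding Nc L b2 by simp
    qed
    finally show "(\<Sum>A\<in>?As k. real (card (?Bs k A))) = (\<Sum>c = 1..k.
        real s / real c
        * real (binom (int k - 1) (int c - 1))
        * real (binom (int s - int k - 1) (int c - 1))
        * real (binom (int s - int k - int c) (int j - int k)))" .
  qed
  finally show ?thesis .
qed

section \<open>Functions on the edges of a subgraph of a cycle\<close>

definition csuc :: "nat \<Rightarrow> nat \<Rightarrow> nat" where
  "csuc t a = (if a + 1 = t then 0 else a + 1)"

lemma csuc_mod: "a < t \<Longrightarrow> csuc t a = (a + 1) mod t"
  by (auto simp: csuc_def)

lemma csuc_less: "a < t \<Longrightarrow> csuc t a < t"
  by (auto simp: csuc_def)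

lemma csuc_inject: "a < t \<Longrightarrow> b < t \<Longrightarrow> csuc t a = csuc t b \<longleftrightarrow> a = b"
  by (auto simp: csuc_def split: if_splits)

definition cpred :: "nat \<Rightarrow> nat \<Rightarrow> nat" where
  "cpred t a = (if a = 0 then t - 1 else a - 1)"

lemma cpred_less: "a < t \<Longrightarrow> cpred t a < t"
  by (auto simp: cpred_def)

lemma csuc_cpred: "a < t \<Longrightarrow> csuc t (cpred t a) = a"
  by (auto simp: csuc_def cpred_def)

lemma cpred_mod: "a < t \<Longrightarrow> cpred t a = (a + t - 1) mod t"
  by (auto simp: cpred_def mod_if)

text \<open>The position of \<open>a\<close> when the cycle is cut after \<open>z\<close>, so that \<open>z\<close> comes last.\<close>

definition unroll :: "nat \<Rightarrow> nat \<Rightarrow> nat \<Rightarrow> nat" where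
  "unroll t z a = (if z < a then a - z - 1 else a + t - z - 1)"

lemma unroll_csuc: "a < t \<Longrightarrow> z < t \<Longrightarrow> a \<noteq> z \<Longrightarrow> unroll t z (csuc t a) = Suc (unroll t z a)"
  by (auto simp: unroll_def csuc_def)

lemma unroll_inject: "a < t \<Longrightarrow> b < t \<Longrightarrow> z < t \<Longrightarrow> unroll t z a = unroll t z b \<longleftrightarrow> a = b"
  by (auto simp: unroll_def split: if_splits)

text \<open>The edges of the subgraph of the cycle induced by \<open>P\<close>, and its paths with two edges. An edge or a
  path is named by its first vertex.\<close>

definition cycle_arcs :: "nat \<Rightarrow> nat set \<Rightarrow> nat set" where
  "cycle_arcs t P = {a. a < t \<and> a \<in> P \<and> csuc t a \<in> P}"

definition arc_pairs :: "nat \<Rightarrow> nat set \<Rightarrow> nat set" where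
  "arc_pairs t P = {a. a \<in> cycle_arcs t P \<and> csuc t a \<in> cycle_arcs t P}"

lemma cyclic_starts_2_iff:
  assumes P: "P \<subseteq> {..<t}"
  shows "cyclic_starts 2 t P = {a. a \<in> cycle_arcs t P \<and> cpred t a \<notin> cycle_arcs t P}"
proof -
  have "(\<forall>i<2. (a + i) mod t \<in> P) \<longleftrightarrow> a \<in> P \<and> csuc t a \<in> P" if "a < t" for a
    using that by (auto simp: csuc_mod numeral_2_eq_2 less_Suc_eq)
  moreover have "(a + t - 1) mod t = cpred t a" if "a < t" for a using that by (simp add: cpred_mod)
  ultimately show ?thesis
    unfolding cyclic_starts_def cycle_arcs_def by (auto simp: cpred_less csuc_cpred)
qed

text \<open>If an edge is missing, the cycle can be cut there and the equation solved by partial sums.\<close>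

lemma arc_difference_solvable:
  fixes r :: "nat \<Rightarrow> 'k::field"
  assumes z: "z < t" "z \<notin> cycle_arcs t P"
  shows "\<exists>q. \<forall>a\<in>arc_pairs t P. q (csuc t a) - q a = r a"
proof -
  define w where "w i = (SOME a. a < t \<and> unroll t z a = i)" for i
  have w: "w (unroll t z a) = a" if "a < t" for a
  proof -
    have "w (unroll t z a) < t \<and> unroll t z (w (unroll t z a)) = unroll t z a"
      unfolding w_def by (rule someI[of _ a]) (use that in simp)
    then show ?thesis using unroll_inject[of _ t a z] that z by blast
  qed
  define q where "q a = (\<Sum>i<unroll t z a. r (w i))" for a
  have "q (csuc t a) - q a = r a" if a: "a \<in> arc_pairs t P" for a
  proof -
    have "a < t" "a \<noteq> z" using a z by (auto simp: arc_pairs_def cycle_arcs_def)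
    then show ?thesis using z by (simp add: q_def unroll_csuc w)
  qed
  then show ?thesis by blast
qed

text \<open>The differences telescope around the cycle; conversely, the partial sums close up.\<close>

lemma cycle_difference_solvable_iff:
  fixes r :: "nat \<Rightarrow> 'k::field"
  assumes t: "t > 0"
  shows "(\<exists>q. \<forall>a<t. q (csuc t a) - q a = r a) \<longleftrightarrow> (\<Sum>a<t. r a) = 0"
proof
  assume "\<exists>q. \<forall>a<t. q (csuc t a) - q a = r a"
  then obtain q where q: "\<And>a. a < t \<Longrightarrow> q (csuc t a) - q a = r a" by blast
  have "bij_betw (csuc t) {..<t} {..<t}"
  proof -
    have "csuc t ` {..<t} \<subseteq> {..<t}" "inj_on (csuc t) {..<t}"
      using csuc_less csuc_inject by (auto simp: inj_on_def)
    then show ?thesis by (simp add: bij_betw_def endo_inj_surj)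
  qed
  then have "(\<Sum>a<t. q (csuc t a)) = (\<Sum>a<t. q a)" by (rule sum.reindex_bij_betw)
  moreover have "(\<Sum>a<t. r a) = (\<Sum>a<t. q (csuc t a)) - (\<Sum>a<t. q a)"
    by (subst sum_subtractf[symmetric]) (simp add: q)
  ultimately show "(\<Sum>a<t. r a) = 0" by simp
next
  assume s: "(\<Sum>a<t. r a) = 0"
  obtain t' where t': "t = Suc t'" using t by (cases t) auto
  have "(\<Sum>i<csuc t a. r i) - (\<Sum>i<a. r i) = r a" if "a < t" for a
  proof (cases "a + 1 = t")
    case True
    then have "(\<Sum>i<a. r i) + r a = 0" using s by (simp add: t')
    then show ?thesis using True by (simp add: csuc_def add_eq_0_iff)
  qed (simp add: csuc_def)
  then show "\<exists>q. \<forall>a<t. q (csuc t a) - q a = r a" by (intro exI[of _ "\<lambda>a. \<Sum>i<a. r i"]) blast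
qed

abbreviation (input) fscale :: "'k::field \<Rightarrow> ('i \<Rightarrow> 'k) \<Rightarrow> 'i \<Rightarrow> 'k" where
  "fscale \<equiv> \<lambda>c f x. c * f x"

definition supported :: "'i set \<Rightarrow> ('i \<Rightarrow> 'k::field) set" where
  "supported A = {f. \<forall>i. i \<notin> A \<longrightarrow> f i = 0}"

text \<open>Functions on edges and on paths with two edges, with the difference along a path as the
  differential: the cochain complex of a graph whose vertices are the edges of the induced subgraph.
  Its cohomology counts the components and, if the graph is the full cycle, the one loop.\<close>

definition arc_coboundaries :: "nat \<Rightarrow> nat set \<Rightarrow> (nat \<Rightarrow> 'k::field) set" where
  "arc_coboundaries t P = {r \<in> supported (arc_pairs t P).
     \<exists>q\<in>supported (cycle_arcs t P). \<forall>a\<in>arc_pairs t P. r a = q (csuc t a) - q a}"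

definition arc_cocycles :: "nat \<Rightarrow> nat set \<Rightarrow> (nat \<Rightarrow> 'k::field) set" where
  "arc_cocycles t P = {q \<in> supported (cycle_arcs t P). \<forall>a\<in>arc_pairs t P. q (csuc t a) = q a}"

definition arc_constants :: "nat \<Rightarrow> nat set \<Rightarrow> (nat \<Rightarrow> 'k::field) set" where
  "arc_constants t P = {q. \<exists>c. q = (\<lambda>a. if a \<in> cycle_arcs t P then c else 0)}"

lemma subspace_supported: "module.subspace fscale (supported A :: ('i \<Rightarrow> 'k::field) set)"
proof -
  interpret vector_space "fscale :: 'k \<Rightarrow> ('i \<Rightarrow> 'k) \<Rightarrow> _" by (rule vector_space_fun)
  show ?thesis by (auto simp: subspace_def supported_def)
qed

lemma restrict_to_arcs:
  assumes "a \<in> arc_pairs t P"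
  shows "a \<in> cycle_arcs t P" "csuc t a \<in> cycle_arcs t P"
  using assms by (auto simp: arc_pairs_def)

lemma qdim_arc_coboundaries:
  assumes t: "t > 0" and P: "P \<subseteq> {..<t}"
  shows "qdim fscale (supported (arc_pairs t P) :: (nat \<Rightarrow> 'k::field) set) (arc_coboundaries t P)
    (if P = {..<t} then 1 else 0)"
proof (cases "P = {..<t}")
  case False
  then obtain z where z: "z < t" "z \<notin> P" using P by auto
  have "supported (arc_pairs t P) \<subseteq> (arc_coboundaries t P :: (nat \<Rightarrow> 'k) set)"
  proof
    fix r :: "nat \<Rightarrow> 'k" assume r: "r \<in> supported (arc_pairs t P)"
    obtain q where q: "\<forall>a\<in>arc_pairs t P. q (csuc t a) - q a = r a"
      using arc_difference_solvable[of z t P r] z by (auto simp: cycle_arcs_def)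
    let ?q = "\<lambda>a. if a \<in> cycle_arcs t P then q a else 0"
    have "?q \<in> supported (cycle_arcs t P)" by (auto simp: supported_def)
    moreover have "\<forall>a\<in>arc_pairs t P. r a = ?q (csuc t a) - ?q a"
      using q restrict_to_arcs[of _ t P] by simp
    ultimately show "r \<in> arc_coboundaries t P" using r unfolding arc_coboundaries_def
      by (intro CollectI conjI bexI[of _ ?q])
  qed
  then show ?thesis using False by (simp add: qdim_zero[OF vector_space_fun])
next
  case True
  then have arcs: "cycle_arcs t P = {..<t}" "arc_pairs t P = {..<t}"
    by (auto simp: cycle_arcs_def arc_pairs_def csuc_less)
  have "qdim fscale (supported (arc_pairs t P) :: (nat \<Rightarrow> 'k) set) (arc_coboundaries t P) (card {0::nat})"
  proof (rule qdim_by_functionals[where L = "\<lambda>r _. \<Sum>a<t. r a"])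
    show "Vector_Spaces.linear fscale fscale (\<lambda>(r :: nat \<Rightarrow> 'k) (_ :: nat). \<Sum>a<t. r a)"
      unfolding Vector_Spaces.linear_iff using vector_space_fun
      by (auto simp: fun_eq_iff sum.distrib sum_distrib_left)
    fix r :: "nat \<Rightarrow> 'k" assume r: "r \<in> supported (arc_pairs t P)"
    have "r \<in> arc_coboundaries t P \<longleftrightarrow> (\<exists>q. \<forall>a<t. q (csuc t a) - q a = r a)"
    proof
      assume "\<exists>q. \<forall>a<t. q (csuc t a) - q a = r a"
      then obtain q where q: "\<forall>a<t. q (csuc t a) - q a = r a" by blast
      let ?q = "\<lambda>a. if a < t then q a else 0"
      have "?q \<in> supported (cycle_arcs t P)" by (auto simp: supported_def arcs)
      moreover have "\<forall>a\<in>arc_pairs t P. r a = ?q (csuc t a) - ?q a"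
        using q by (auto simp: arcs csuc_less)
      ultimately show "r \<in> arc_coboundaries t P" using r unfolding arc_coboundaries_def
      by (intro CollectI conjI bexI[of _ ?q])
    next
      assume "r \<in> arc_coboundaries t P"
      then obtain q where "\<forall>a\<in>arc_pairs t P. r a = q (csuc t a) - q a" unfolding arc_coboundaries_def by blast
      then show "\<exists>q. \<forall>a<t. q (csuc t a) - q a = r a" by (intro exI[of _ q]) (auto simp: arcs)
    qed
    then show "r \<in> arc_coboundaries t P \<longleftrightarrow> (\<forall>i\<in>{0::nat}. (\<Sum>a<t. r a) = 0)"
      using cycle_difference_solvable_iff[OF t, of r] by simp
  next
    fix i :: nat assume i: "i \<in> {0}"
    have "(\<lambda>a. if a = 0 then 1 else 0 :: 'k) \<in> supported (arc_pairs t P)" using t by (auto simp: supported_def arcs)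
    moreover have "(\<Sum>a<t. if a = 0 then 1 else 0 :: 'k) = 1" using t by simp
    ultimately show "\<exists>r\<in>supported (arc_pairs t P). \<forall>j\<in>{0}. (\<Sum>a<t. r a) = (if j = i then 1 else 0 :: 'k)"
      using i by (intro bexI[of _ "\<lambda>a. if a = 0 then 1 else 0"]) auto
  qed (auto intro: subspace_supported)
  then show ?thesis using True by simp
qed

text \<open>A cocycle is determined by its values at the first edges of the runs, which are arbitrary. The
  quotient by the constants has one dimension less, or none if there is no run; the latter includes
  the full cycle, where all cocycles are constant.\<close>

lemma qdim_arc_cocycles:
  assumes P: "P \<subseteq> {..<t}"
  shows "qdim fscale (arc_cocycles t P :: (nat \<Rightarrow> 'k::field) set) (arc_constants t P) (card (cyclic_starts 2 t P) - 1)"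
proof -
  let ?E = "cycle_arcs t P"
  let ?S = "cyclic_starts 2 t P"
  note S = cyclic_starts_2_iff[OF P]
  have Et: "a < t" if "a \<in> ?E" for a using that by (simp add: cycle_arcs_def)
  have pair: "cpred t a \<in> arc_pairs t P" if "a \<in> ?E" "a \<notin> ?S" for a
    using that Et[OF that(1)] by (simp add: S arc_pairs_def csuc_cpred)
  have finS: "finite ?S" by (rule finite_subset[of _ "{..<t}"]) (auto simp: cyclic_starts_def)
  have subc: "module.subspace fscale (arc_cocycles t P :: (nat \<Rightarrow> 'k) set)"
  proof -
    interpret vector_space "fscale :: 'k \<Rightarrow> (nat \<Rightarrow> 'k) \<Rightarrow> _" by (rule vector_space_fun)
    show ?thesis by (auto simp: subspace_def supported_def arc_cocycles_def)
  qed
  show ?thesis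
  proof (cases "P = {..<t}")
    case True
    have E: "?E = {..<t}" unfolding True by (auto simp: cycle_arcs_def csuc_less)
    have pr: "arc_pairs t P = {..<t}" by (auto simp: arc_pairs_def E csuc_less)
    have "?S = {}" using S by (auto simp: E cpred_less)
    moreover have "arc_cocycles t P \<subseteq> (arc_constants t P :: (nat \<Rightarrow> 'k) set)"
    proof
      fix q :: "nat \<Rightarrow> 'k" assume q: "q \<in> arc_cocycles t P"
      have q0: "q a = q 0" if "a < t" for a
        using that
      proof (induction a)
        case (Suc a)
        then have "q (csuc t a) = q a" using q by (auto simp: arc_cocycles_def pr)
        then show ?case using Suc by (simp add: csuc_def)
      qed simp
      have "q = (\<lambda>a. if a \<in> ?E then q 0 else 0)"
      proof
        fix a show "q a = (if a \<in> ?E then q 0 else 0)"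
          using q0[of a] q by (cases "a < t") (simp_all add: E arc_cocycles_def supported_def)
      qed
      then show "q \<in> arc_constants t P" unfolding arc_constants_def by blast
    qed
    ultimately show ?thesis by (simp add: qdim_zero[OF vector_space_fun])
  next
    case False
    then obtain z where z: "z < t" "z \<notin> P" using P by auto
    then have zE: "z \<notin> ?E" by (simp add: cycle_arcs_def)
    let ?u = "unroll t z"
    have up: "?u (cpred t a) < ?u a" if "a \<in> ?E" "a \<notin> ?S" for a
    proof -
      have "cpred t a \<noteq> z" using pair[OF that] zE restrict_to_arcs(1) by blast
      then show ?thesis
        using unroll_csuc[of "cpred t a" t z] cpred_less[OF Et[OF that(1)]] csuc_cpred[OF Et[OF that(1)]] z by simp
    qed
    have const: "q a = c" if q: "q \<in> arc_cocycles t P" and c: "\<And>b. b \<in> ?S \<Longrightarrow> q b = c" and a: "a \<in> ?E"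
      for q :: "nat \<Rightarrow> 'k" and c a
      using a
    proof (induction "?u a" arbitrary: a rule: less_induct)
      case less
      show ?case
      proof (cases "a \<in> ?S")
        case False
        have "q a = q (cpred t a)"
          using q pair[OF less.prems False] csuc_cpred[OF Et[OF less.prems]] by (force simp: arc_cocycles_def)
        also have "\<dots> = c"
          using less.hyps[OF up[OF less.prems False]] restrict_to_arcs(1)[OF pair[OF less.prems False]] by blast
        finally show ?thesis .
      qed (rule c)
    qed
    show ?thesis
    proof (cases "?E = {}")
      case True
      then have "?S = {}" using S by auto
      moreover have "arc_cocycles t P \<subseteq> (arc_constants t P :: (nat \<Rightarrow> 'k) set)"
        using True by (auto simp: arc_cocycles_def arc_constants_def supported_def)
      ultimately show ?thesis by (simp add: qdim_zero[OF vector_space_fun])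
    next
      case False
      obtain s0 where s0: "s0 \<in> ?S"
      proof -
        obtain a where a: "a \<in> ?E" using False by blast
        have "\<exists>b. b \<in> ?S" using a
        proof (induction "?u a" arbitrary: a rule: less_induct)
          case less
          show ?case
          proof (cases "a \<in> ?S")
            case F: False
            then show ?thesis
              using less.hyps[OF up[OF less.prems F]] restrict_to_arcs(1)[OF pair[OF less.prems F]] by blast
          qed blast
        qed
        then show ?thesis using that by blast
      qed
      have "qdim fscale (arc_cocycles t P :: (nat \<Rightarrow> 'k) set) (arc_constants t P) (card (?S - {s0}))"
      proof (rule qdim_by_functionals[where L = "\<lambda>q i. q i - q s0"])
        show "Vector_Spaces.linear fscale fscale (\<lambda>(q :: nat \<Rightarrow> 'k) i. q i - q s0)"
          unfolding Vector_Spaces.linear_iff using vector_space_fun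
          by (auto simp: fun_eq_iff algebra_simps)
        fix q :: "nat \<Rightarrow> 'k" assume q: "q \<in> arc_cocycles t P"
        show "q \<in> arc_constants t P \<longleftrightarrow> (\<forall>i\<in>?S - {s0}. q i - q s0 = 0)"
        proof
          assume "q \<in> arc_constants t P"
          then obtain c where "q = (\<lambda>a. if a \<in> ?E then c else 0)" unfolding arc_constants_def by blast
          then show "\<forall>i\<in>?S - {s0}. q i - q s0 = 0" using S s0 by auto
        next
          assume "\<forall>i\<in>?S - {s0}. q i - q s0 = 0"
          then have "\<And>b. b \<in> ?S \<Longrightarrow> q b = q s0" by auto
          then have qc: "q a = q s0" if "a \<in> ?E" for a using const[OF q _ that] by blast
          have "q = (\<lambda>a. if a \<in> ?E then q s0 else 0)"
          proof
            fix a show "q a = (if a \<in> ?E then q s0 else 0)"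
              using qc[of a] q by (cases "a \<in> ?E") (simp_all add: arc_cocycles_def supported_def)
          qed
          then show "q \<in> arc_constants t P" unfolding arc_constants_def by blast
        qed
      next
        fix i assume i: "i \<in> ?S - {s0}"
        \<comment> \<open>indicator of the run that begins at \<open>i\<close>: the edges that come after the same number of first edges in the cut cycle\<close>
        define n where "n a = card {b \<in> ?S. ?u b \<le> ?u a}" for a
        have fin: "finite {b \<in> ?S. ?u b \<le> ?u a}" for a using finS by simp
        define q where "q a = (if a \<in> ?E \<and> n a = n i then 1 else 0 :: 'k)" for a
        have nS: "n a = n b \<longleftrightarrow> a = b" if "a \<in> ?S" "b \<in> ?S" for a b
        proof -
          have lt: "n a < n b" if "a \<in> ?S" "b \<in> ?S" "?u a < ?u b" for a b
            unfolding n_def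
          proof (rule psubset_card_mono[OF fin])
            have "{c \<in> ?S. ?u c \<le> ?u a} \<subseteq> {c \<in> ?S. ?u c \<le> ?u b}" using that by auto
            moreover have "b \<in> {c \<in> ?S. ?u c \<le> ?u b}" "b \<notin> {c \<in> ?S. ?u c \<le> ?u a}" using that by auto
            ultimately show "{c \<in> ?S. ?u c \<le> ?u a} \<subset> {c \<in> ?S. ?u c \<le> ?u b}" by blast
          qed
          have "?u a \<noteq> ?u b" if "a \<noteq> b"
            using unroll_inject[of a t b z] that \<open>a \<in> ?S\<close> \<open>b \<in> ?S\<close> z by (auto simp: cyclic_starts_def)
          then show ?thesis using lt[OF that] lt[OF that(2,1)] by (metis less_irrefl nat_neq_iff)
        qed
        have npair: "n (csuc t a) = n a" if a: "a \<in> arc_pairs t P" for a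
        proof -
          have at: "a < t" "a \<noteq> z" using restrict_to_arcs(1)[OF a] Et zE by auto
          have su: "?u (csuc t a) = Suc (?u a)" using unroll_csuc[OF at(1) z(1) at(2)] .
          have "csuc t a \<notin> ?S"
          proof
            assume "csuc t a \<in> ?S"
            then have "cpred t (csuc t a) \<notin> ?E" using S by blast
            moreover have "cpred t (csuc t a) = a" using at by (auto simp: cpred_def csuc_def)
            ultimately show False using restrict_to_arcs(1)[OF a] by simp
          qed
          then have "?u b \<noteq> Suc (?u a)" if "b \<in> ?S" for b
            using unroll_inject[of b t "csuc t a" z] that su z csuc_less[OF at(1)] by (auto simp: cyclic_starts_def)
          then have "{b \<in> ?S. ?u b \<le> ?u (csuc t a)} = {b \<in> ?S. ?u b \<le> ?u a}"
            unfolding su by (auto simp: le_Suc_eq)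
          then show ?thesis unfolding n_def by simp
        qed
        have "q \<in> arc_cocycles t P"
          using npair restrict_to_arcs[of _ t P] by (auto simp: arc_cocycles_def supported_def q_def)
        moreover have "q j = (if j = i then 1 else 0)" if "j \<in> ?S" for j
          using that i nS[OF that, of i] S by (auto simp: q_def)
        ultimately show "\<exists>q\<in>arc_cocycles t P. \<forall>j\<in>?S - {s0}. q j - q s0 = (if j = i then 1 else 0 :: 'k)"
          using i s0 by (intro bexI[of _ q]) auto
      qed (use finS subc in auto)
      then show ?thesis using s0 finS by simp
    qed
  qed
qed

section \<open>Cochains on subsets meeting both sides\<close>

definition cochains :: "'v set set \<Rightarrow> nat \<Rightarrow> ('v set \<Rightarrow> 'k::field) set" where
  "cochains C n = {F. \<forall>T. F T \<noteq> 0 \<longrightarrow> T \<in> C \<and> card T = n}"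

definition trunc_coboundary :: "('v \<Rightarrow> 'v set \<Rightarrow> 'k::field) \<Rightarrow> 'v set \<Rightarrow> ('v set \<Rightarrow> 'k) \<Rightarrow> 'v set \<Rightarrow> 'k" where
  "trunc_coboundary \<sigma> U F T = (if T \<subseteq> U then coboundary \<sigma> F T else 0)"

lemma coboundary_cong:
  "(\<And>v. v \<in> T \<Longrightarrow> F (T - {v}) = G (T - {v})) \<Longrightarrow> coboundary \<sigma> F T = coboundary \<sigma> G T"
  by (simp add: coboundary_def)

lemma coboundary_add: "coboundary \<sigma> (\<lambda>T. F T + G T) T = coboundary \<sigma> F T + coboundary \<sigma> G T"
  by (simp add: coboundary_def algebra_simps sum.distrib)

lemma coboundary_diff: "coboundary \<sigma> (\<lambda>T. F T - G T) T = coboundary \<sigma> F T - coboundary \<sigma> G T"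
  by (simp add: coboundary_def algebra_simps sum_subtractf)

lemma coboundary_cmult: "coboundary \<sigma> (\<lambda>T. c * F T) T = c * coboundary \<sigma> F T"
  by (simp add: coboundary_def algebra_simps sum_distrib_left)

lemma linear_trunc_coboundary:
  "Vector_Spaces.linear fscale fscale (trunc_coboundary \<sigma> U :: ('v set \<Rightarrow> 'k::field) \<Rightarrow> _)"
  unfolding Vector_Spaces.linear_iff
proof (intro conjI allI vector_space_fun)
  fix F G :: "'v set \<Rightarrow> 'k" and c :: 'k
  show "trunc_coboundary \<sigma> U (F + G) = trunc_coboundary \<sigma> U F + trunc_coboundary \<sigma> U G"
    using coboundary_add[of \<sigma> F G] by (auto simp: trunc_coboundary_def fun_eq_iff plus_fun_def)
  show "trunc_coboundary \<sigma> U (\<lambda>x. c * F x) = (\<lambda>x. c * trunc_coboundary \<sigma> U F x)"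
    by (auto simp: trunc_coboundary_def fun_eq_iff coboundary_cmult)
qed

lemma subspace_cochains: "module.subspace fscale (cochains C n :: ('v set \<Rightarrow> 'k::field) set)"
proof -
  interpret vector_space "fscale :: 'k \<Rightarrow> ('v set \<Rightarrow> 'k) \<Rightarrow> _" by (rule vector_space_fun)
  show ?thesis unfolding subspace_def cochains_def
  proof (intro conjI ballI allI)
    fix x y :: "'v set \<Rightarrow> 'k"
    assume "x \<in> {F. \<forall>T. F T \<noteq> 0 \<longrightarrow> T \<in> C \<and> card T = n}" "y \<in> {F. \<forall>T. F T \<noteq> 0 \<longrightarrow> T \<in> C \<and> card T = n}"
    then show "x + y \<in> {F. \<forall>T. F T \<noteq> 0 \<longrightarrow> T \<in> C \<and> card T = n}"
      by (auto simp: plus_fun_def) (metis add.right_neutral)+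
  qed auto
qed

text \<open>The full simplex is acyclic in every degree.\<close>

lemma simplex_primitive:
  fixes F :: "'v set \<Rightarrow> 'k::field"
  assumes s: "alt_signs U \<sigma>" and fU: "finite U" and ne: "U \<noteq> {}"
    and cyc: "\<And>T. T \<subseteq> U \<Longrightarrow> coboundary \<sigma> F T = 0"
    and supp: "\<And>T. T \<subseteq> U \<Longrightarrow> F T \<noteq> 0 \<Longrightarrow> card T = Suc n"
  shows "\<exists>G. (\<forall>T. G T \<noteq> 0 \<longrightarrow> T \<subseteq> U \<and> card T = n) \<and> (\<forall>T\<subseteq>U. coboundary \<sigma> G T = F T)"
proof -
  obtain v0 where v0: "v0 \<in> U" using ne by blast
  define G where "G T = (if v0 \<in> T \<or> \<not> T \<subseteq> U then 0 else \<sigma> v0 (insert v0 T) * F (insert v0 T))" for T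
  have "T \<subseteq> U \<and> card T = n" if "G T \<noteq> 0" for T
  proof -
    have T: "v0 \<notin> T" "T \<subseteq> U" "F (insert v0 T) \<noteq> 0" using that by (auto simp: G_def split: if_splits)
    moreover have "finite T" using T fU finite_subset by blast
    moreover have "card (insert v0 T) = Suc n" using supp[of "insert v0 T"] T v0 by auto
    ultimately show ?thesis by simp
  qed
  moreover have "coboundary \<sigma> G T = F T" if "T \<subseteq> U" for T
    by (rule coboundary_cone[OF s fU v0 cyc _ that]) (auto simp: G_def)
  ultimately show ?thesis by blast
qed

lemma alt_signs_subset: "alt_signs U \<sigma> \<Longrightarrow> U' \<subseteq> U \<Longrightarrow> alt_signs U' \<sigma>"
  unfolding alt_signs_def by (meson order_trans)

text \<open>Two nonempty sides of a vertex set. Sets that meet both sides are the simplices not in the union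
  of two disjoint faces; the cochains on them compute the relative cohomology of a simplex modulo
  two points, up to homotopy, which is of dimension one in the lowest degree and zero otherwise.\<close>

locale bipartite_cochains =
  fixes U :: "'v set" and q :: "'v \<Rightarrow> bool" and \<sigma> :: "'v \<Rightarrow> 'v set \<Rightarrow> 'k::field"
  assumes fU: "finite U" and alt: "alt_signs U \<sigma>"
    and sideX: "\<exists>x\<in>U. q x" and sideY: "\<exists>y\<in>U. \<not> q y"
begin

definition mixed :: "'v set set" where
  "mixed = {T. T \<subseteq> U \<and> (\<exists>x\<in>T. q x) \<and> (\<exists>y\<in>T. \<not> q y)}"

lemma not_mixed: "T \<subseteq> U \<Longrightarrow> T \<notin> mixed \<Longrightarrow> T \<subseteq> {x \<in> U. q x} \<or> T \<subseteq> {x \<in> U. \<not> q x}"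
  by (auto simp: mixed_def)

lemma sq: "T \<subseteq> U \<Longrightarrow> v \<in> T \<Longrightarrow> \<sigma> v T * \<sigma> v T = 1"
  using alt unfolding alt_signs_def by blast

text \<open>First \<open>F\<close> is integrated on the whole simplex, to \<open>G\<close>. On either side \<open>G\<close> is a cocycle, as \<open>F\<close> is
  zero there, and can be integrated again.\<close>

lemma sides_primitives:
  assumes F: "F \<in> cochains mixed (Suc (Suc n))" and cyc: "\<And>T. T \<subseteq> U \<Longrightarrow> coboundary \<sigma> F T = 0"
  obtains G HX HY where
    "\<And>T. G T \<noteq> 0 \<Longrightarrow> T \<subseteq> U \<and> card T = Suc n" "\<And>T. T \<subseteq> U \<Longrightarrow> coboundary \<sigma> G T = F T"
    "\<And>T. HX T \<noteq> 0 \<Longrightarrow> T \<subseteq> {x \<in> U. q x} \<and> card T = n" "\<And>T. T \<subseteq> {x \<in> U. q x} \<Longrightarrow> coboundary \<sigma> HX T = G T"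
    "\<And>T. HY T \<noteq> 0 \<Longrightarrow> T \<subseteq> {x \<in> U. \<not> q x} \<and> card T = n" "\<And>T. T \<subseteq> {x \<in> U. \<not> q x} \<Longrightarrow> coboundary \<sigma> HY T = G T"
proof -
  have "\<exists>G. (\<forall>T. G T \<noteq> 0 \<longrightarrow> T \<subseteq> U \<and> card T = Suc n) \<and> (\<forall>T\<subseteq>U. coboundary \<sigma> G T = F T)"
    by (rule simplex_primitive[OF alt fU _ cyc]) (use sideX F in \<open>auto simp: cochains_def\<close>)
  then obtain G where G: "\<And>T. G T \<noteq> 0 \<Longrightarrow> T \<subseteq> U \<and> card T = Suc n" "\<And>T. T \<subseteq> U \<Longrightarrow> coboundary \<sigma> G T = F T" by blast
  have side: "\<exists>H. (\<forall>T. H T \<noteq> 0 \<longrightarrow> T \<subseteq> A \<and> card T = n) \<and> (\<forall>T\<subseteq>A. coboundary \<sigma> H T = G T)"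
    if A: "A \<subseteq> U" "A \<noteq> {}" "\<And>T. T \<subseteq> A \<Longrightarrow> T \<notin> mixed" for A
  proof (rule simplex_primitive[OF alt_signs_subset[OF alt A(1)] finite_subset[OF A(1) fU] A(2)])
    fix T assume T: "T \<subseteq> A"
    then have "F T = 0" using A(3)[OF T] F by (auto simp: cochains_def)
    then show "coboundary \<sigma> G T = 0" using G(2)[of T] T A(1) by auto
    show "card T = Suc n" if "G T \<noteq> 0" using G(1) that by blast
  qed
  obtain HX where "(\<forall>T. HX T \<noteq> 0 \<longrightarrow> T \<subseteq> {x \<in> U. q x} \<and> card T = n) \<and> (\<forall>T\<subseteq>{x \<in> U. q x}. coboundary \<sigma> HX T = G T)"
    using side[of "{x \<in> U. q x}"] sideX by (auto simp: mixed_def subset_iff)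
  moreover obtain HY where "(\<forall>T. HY T \<noteq> 0 \<longrightarrow> T \<subseteq> {x \<in> U. \<not> q x} \<and> card T = n) \<and> (\<forall>T\<subseteq>{x \<in> U. \<not> q x}. coboundary \<sigma> HY T = G T)"
    using side[of "{x \<in> U. \<not> q x}"] sideY by (auto simp: mixed_def subset_iff)
  ultimately show ?thesis using that[of G HX HY] G by simp
qed

lemma coboundary_support:
  assumes H: "\<And>T. H T \<noteq> 0 \<Longrightarrow> T \<subseteq> A \<and> card T = n" and c: "coboundary \<sigma> H T \<noteq> 0" and T: "finite T"
  shows "card T = Suc n" "\<exists>v\<in>T. T - {v} \<subseteq> A"
proof -
  obtain v where v: "v \<in> T" "H (T - {v}) \<noteq> 0"
  proof -
    have "\<exists>v\<in>T. \<sigma> v T * H (T - {v}) \<noteq> 0"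
    proof (rule ccontr)
      assume "\<not> ?thesis"
      then have "coboundary \<sigma> H T = 0" unfolding coboundary_def by (intro sum.neutral) blast
      then show False using c by simp
    qed
    then show ?thesis using that by auto
  qed
  show "card T = Suc n" using H[OF v(2)] v(1) T by (metis card_Suc_Diff1)
  show "\<exists>v\<in>T. T - {v} \<subseteq> A" using H v by blast
qed

text \<open>Subtracting from \<open>G\<close> the coboundary of both second primitives leaves a primitive that vanishes on
  either side. The sizes matter: a primitive on one side has a coboundary that vanishes on subsets
  of the other side, unless it lives on the empty set.\<close>

lemma mixed_exact:
  assumes F: "F \<in> cochains mixed (Suc (Suc (Suc n)))" and cyc: "\<And>T. T \<subseteq> U \<Longrightarrow> coboundary \<sigma> F T = 0"
  shows "\<exists>G\<in>cochains mixed (Suc (Suc n)). trunc_coboundary \<sigma> U G = F"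
proof -
  obtain G HX HY where G: "\<And>T. G T \<noteq> 0 \<Longrightarrow> T \<subseteq> U \<and> card T = Suc (Suc n)" "\<And>T. T \<subseteq> U \<Longrightarrow> coboundary \<sigma> G T = F T"
    and X: "\<And>T. HX T \<noteq> 0 \<Longrightarrow> T \<subseteq> {x \<in> U. q x} \<and> card T = Suc n" "\<And>T. T \<subseteq> {x \<in> U. q x} \<Longrightarrow> coboundary \<sigma> HX T = G T"
    and Y: "\<And>T. HY T \<noteq> 0 \<Longrightarrow> T \<subseteq> {x \<in> U. \<not> q x} \<and> card T = Suc n" "\<And>T. T \<subseteq> {x \<in> U. \<not> q x} \<Longrightarrow> coboundary \<sigma> HY T = G T"
    by (rule sides_primitives[OF F cyc]) (assumption | rule that, assumption+)+
  define H where "H T = HX T + HY T" for T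
  define G' where "G' T = (if T \<subseteq> U then G T - coboundary \<sigma> H T else 0)" for T
  have cH: "coboundary \<sigma> H T = coboundary \<sigma> HX T + coboundary \<sigma> HY T" for T
    unfolding H_def by (rule coboundary_add)
  have fin: "finite T" if "T \<subseteq> U" for T using that fU finite_subset by blast
  have other: "coboundary \<sigma> K T = 0"
    if K: "\<And>T. K T \<noteq> 0 \<Longrightarrow> T \<subseteq> A \<and> card T = Suc n" and T: "T \<subseteq> U" "T \<inter> A = {}" for K A T
  proof (rule ccontr)
    assume c: "coboundary \<sigma> K T \<noteq> 0"
    note cs = coboundary_support[OF K c fin[OF T(1)]]
    then obtain v where "v \<in> T" "T - {v} \<subseteq> A" by blast
    then have "T \<subseteq> {v}" using T(2) by blast
    then have "card T \<le> 1" using card_mono[of "{v}" T] by simp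
    then show False using cs(1) by simp
  qed
  have "G' T = 0" if "T \<subseteq> U" "T \<notin> mixed" for T
  proof -
    have "T \<subseteq> {x \<in> U. q x} \<or> T \<subseteq> {x \<in> U. \<not> q x}" by (rule not_mixed[OF that])
    then have "coboundary \<sigma> H T = G T"
    proof
      assume t: "T \<subseteq> {x \<in> U. q x}"
      then have "coboundary \<sigma> HY T = 0" by (intro other[OF Y(1) that(1)]) auto
      then show ?thesis using X(2)[OF t] by (simp add: cH)
    next
      assume t: "T \<subseteq> {x \<in> U. \<not> q x}"
      then have "coboundary \<sigma> HX T = 0" by (intro other[OF X(1) that(1)]) auto
      then show ?thesis using Y(2)[OF t] by (simp add: cH)
    qed
    then show ?thesis using that by (simp add: G'_def)
  qed
  moreover have "card T = Suc (Suc n)" if "G' T \<noteq> 0" for T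
  proof -
    have T: "T \<subseteq> U" using that by (auto simp: G'_def split: if_splits)
    have "G T \<noteq> 0 \<or> coboundary \<sigma> HX T \<noteq> 0 \<or> coboundary \<sigma> HY T \<noteq> 0" using that T by (auto simp: G'_def cH)
    then show ?thesis
      using G(1) coboundary_support(1)[OF X(1) _ fin[OF T]] coboundary_support(1)[OF Y(1) _ fin[OF T]] by blast
  qed
  ultimately have "G' \<in> cochains mixed (Suc (Suc n))"
    unfolding cochains_def by (auto simp: G'_def split: if_splits)
  moreover have "trunc_coboundary \<sigma> U G' = F"
  proof
    fix T
    show "trunc_coboundary \<sigma> U G' T = F T"
    proof (cases "T \<subseteq> U")
      case True
      have "coboundary \<sigma> G' T = coboundary \<sigma> (\<lambda>T. G T - coboundary \<sigma> H T) T"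
        by (rule coboundary_cong) (use True in \<open>auto simp: G'_def\<close>)
      also have "\<dots> = coboundary \<sigma> G T - coboundary \<sigma> (coboundary \<sigma> H) T" by (rule coboundary_diff)
      also have "\<dots> = F T" using coboundary_coboundary[OF alt True fU] G(2)[OF True] by simp
      finally show ?thesis using True by (simp add: trunc_coboundary_def)
    next
      case False
      then show ?thesis using F by (auto simp: trunc_coboundary_def cochains_def mixed_def)
    qed
  qed
  ultimately show ?thesis by blast
qed

text \<open>The restriction to one side of the coboundary of the function \<open>1\<close> on the empty set. On each side
  it is a coboundary, or zero, but the primitives do not agree on the empty set, and therefore its
  coboundary \<open>theta\<close> is not the coboundary of a cochain on mixed sets.\<close>

definition omega :: "'v set \<Rightarrow> 'k" where
  "omega T = (if \<exists>x\<in>U. q x \<and> T = {x} then \<sigma> (the_elem T) T else 0)"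

definition theta :: "'v set \<Rightarrow> 'k" where
  "theta = trunc_coboundary \<sigma> U omega"

lemma omega_singleton: "v \<in> U \<Longrightarrow> omega {v} = (if q v then \<sigma> v {v} else 0)"
  by (auto simp: omega_def)

lemma coboundary_theta: "T \<subseteq> U \<Longrightarrow> coboundary \<sigma> theta T = 0"
proof -
  assume T: "T \<subseteq> U"
  have "coboundary \<sigma> theta T = coboundary \<sigma> (coboundary \<sigma> omega) T"
    by (rule coboundary_cong) (use T in \<open>auto simp: theta_def trunc_coboundary_def\<close>)
  then show ?thesis using coboundary_coboundary[OF alt T fU] by simp
qed

text \<open>Here the second primitives are two constants, the values at the empty set. Their common part can
  be removed, and the difference gives a multiple of \<open>theta\<close>.\<close>

lemma mixed_2_cocycle:
  assumes F: "F \<in> cochains mixed 2" and cyc: "\<And>T. T \<subseteq> U \<Longrightarrow> coboundary \<sigma> F T = 0"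
  shows "\<exists>c. \<forall>T. F T = c * theta T"
proof -
  have "F \<in> cochains mixed (Suc (Suc 0))" using F by (simp add: numeral_2_eq_2)
  then obtain G HX HY where G: "\<And>T. G T \<noteq> 0 \<Longrightarrow> T \<subseteq> U \<and> card T = Suc 0" "\<And>T. T \<subseteq> U \<Longrightarrow> coboundary \<sigma> G T = F T"
    and X: "\<And>T. T \<subseteq> {x \<in> U. q x} \<Longrightarrow> coboundary \<sigma> HX T = G T"
    and Y: "\<And>T. T \<subseteq> {x \<in> U. \<not> q x} \<Longrightarrow> coboundary \<sigma> HY T = G T"
    by (rule sides_primitives[OF _ cyc]) blast+
  define a where "a = HX {}"
  define b where "b = HY {}"
  define \<delta> :: "'v set \<Rightarrow> 'k" where "\<delta> T = (if T = {} then 1 else 0)" for T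
  have GT: "G T = (a - b) * omega T + b * coboundary \<sigma> \<delta> T" if T: "T \<subseteq> U" for T
  proof (cases "\<exists>v. T = {v}")
    case True
    then obtain v where v: "T = {v}" "v \<in> U" using T by blast
    have "G {v} = (if q v then \<sigma> v {v} * a else \<sigma> v {v} * b)"
      using X[of "{v}"] Y[of "{v}"] v by (auto simp: coboundary_def a_def b_def)
    moreover have "coboundary \<sigma> \<delta> {v} = \<sigma> v {v}" by (simp add: coboundary_def \<delta>_def)
    ultimately show ?thesis unfolding v(1) omega_singleton[OF v(2)] by (simp add: algebra_simps)
  next
    case False
    then have "card T \<noteq> Suc 0" by (simp add: card_1_singleton_iff)
    then have "G T = 0" using G(1) by blast
    moreover have "omega T = 0" using False by (auto simp: omega_def)
    moreover have "coboundary \<sigma> \<delta> T = 0"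
      unfolding coboundary_def \<delta>_def using False by (intro sum.neutral) auto
    ultimately show ?thesis by simp
  qed
  have "F T = (a - b) * theta T" for T
  proof (cases "T \<subseteq> U")
    case True
    have "F T = coboundary \<sigma> (\<lambda>T. (a - b) * omega T + b * coboundary \<sigma> \<delta> T) T"
      unfolding G(2)[OF True, symmetric]
    proof (rule coboundary_cong)
      fix v assume "v \<in> T"
      have "T - {v} \<subseteq> U" using True by auto
      then show "G (T - {v}) = (a - b) * omega (T - {v}) + b * coboundary \<sigma> \<delta> (T - {v})" by (rule GT)
    qed
    also have "\<dots> = (a - b) * coboundary \<sigma> omega T + b * coboundary \<sigma> (coboundary \<sigma> \<delta>) T"
      unfolding coboundary_add coboundary_cmult ..
    also have "\<dots> = (a - b) * theta T"
      using coboundary_coboundary[OF alt True fU] True by (simp add: theta_def trunc_coboundary_def)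
    finally show ?thesis .
  next
    case False
    then show ?thesis using F by (auto simp: theta_def trunc_coboundary_def cochains_def mixed_def)
  qed
  then show ?thesis by blast
qed

lemma theta_pair:
  assumes "x \<in> U" "y \<in> U" "q x" "\<not> q y"
  shows "theta {x, y} = \<sigma> y {x, y} * \<sigma> x {x}"
proof -
  have "x \<noteq> y" using assms by auto
  then have "{x, y} - {x} = {y}" "{x, y} - {y} = {x}" by auto
  then show ?thesis
    using assms \<open>x \<noteq> y\<close> by (simp add: theta_def trunc_coboundary_def coboundary_def omega_singleton)
qed

lemma theta_pair_square:
  assumes "x \<in> U" "y \<in> U" "q x" "\<not> q y"
  shows "theta {x, y} * theta {x, y} = 1"
proof -
  have "theta {x, y} * theta {x, y} = (\<sigma> y {x, y} * \<sigma> y {x, y}) * (\<sigma> x {x} * \<sigma> x {x})"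
    unfolding theta_pair[OF assms] by (simp add: algebra_simps)
  then show ?thesis using sq[of "{x, y}" y] sq[of "{x}" x] assms by simp
qed

lemma theta_cochain: "theta \<in> cochains mixed 2"
  unfolding cochains_def
proof (intro CollectI allI impI)
  fix T assume c: "theta T \<noteq> 0"
  then have T: "T \<subseteq> U" "coboundary \<sigma> omega T \<noteq> 0" by (auto simp: theta_def trunc_coboundary_def split: if_splits)
  have fT: "finite T" using T fU finite_subset by blast
  have "S \<subseteq> U \<and> card S = 1" if "omega S \<noteq> 0" for S
    using that by (auto simp: omega_def split: if_splits)
  then have card: "card T = 2"
    using coboundary_support(1)[OF _ T(2) fT] by (metis numeral_2_eq_2 One_nat_def)
  then obtain x y where xy: "T = {x, y}" "x \<noteq> y" by (auto simp: card_2_iff)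
  have d: "{x, y} - {x} = {y}" "{x, y} - {y} = {x}" using xy by auto
  have U: "x \<in> U" "y \<in> U" using T xy by auto
  have "T \<in> mixed"
  proof (rule ccontr)
    assume "T \<notin> mixed"
    then have "q x \<and> q y \<or> \<not> q x \<and> \<not> q y" using T xy U by (auto simp: mixed_def)
    then show False
    proof
      assume "q x \<and> q y"
      \<comment> \<open>on the side where \<open>omega\<close> lives it is a coboundary\<close>
      define \<delta> :: "'v set \<Rightarrow> 'k" where "\<delta> T = (if T = {} then 1 else 0)" for T
      have "coboundary \<sigma> omega T = coboundary \<sigma> (coboundary \<sigma> \<delta>) T"
      proof (rule coboundary_cong)
        fix v assume "v \<in> T"
        then obtain w where w: "T - {v} = {w}" "w \<in> U" "q w" using xy(1) d U \<open>q x \<and> q y\<close> by blast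
        show "omega (T - {v}) = coboundary \<sigma> \<delta> (T - {v})"
          unfolding w(1) omega_singleton[OF w(2)] using w(3) by (simp add: coboundary_def \<delta>_def)
      qed
      then show False using coboundary_coboundary[OF alt T(1) fU] T(2) by simp
    next
      assume "\<not> q x \<and> \<not> q y"
      then show False using T(2) U xy by (simp add: coboundary_def omega_singleton d)
    qed
  qed
  then show "T \<in> mixed \<and> card T = 2" using card by simp
qed

end

section \<open>The complement of an even cycle\<close>

definition cadj :: "nat \<Rightarrow> nat \<Rightarrow> nat \<Rightarrow> bool" where
  "cadj t a b \<longleftrightarrow> b = csuc t a \<or> a = csuc t b"

lemma cadj_no_quadrangle:
  assumes "t \<ge> 6" "a < t" "a' < t" "b < t" "b' < t" "a \<noteq> a'" "b \<noteq> b'"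
    and "cadj t a b" "cadj t a b'" "cadj t a' b" "cadj t a' b'"
  shows False
  using assms unfolding cadj_def csuc_def by (auto split: if_splits)

lemma csuc_parity: "even t \<Longrightarrow> a < t \<Longrightarrow> even (csuc t a) \<longleftrightarrow> odd a"
  by (auto simp: csuc_def)

text \<open>The cycle contains no quadrangle, so one of the sides of a complete bipartite subgraph is a single
  vertex, and a vertex has only two neighbours.\<close>

lemma three_neighbours:
  assumes t: "t \<ge> 6" "even t" and A: "A \<subseteq> {..<t}" "card A \<ge> 3"
    and ev: "\<exists>a\<in>A. even a" and od: "\<exists>b\<in>A. odd b"
    and adj: "\<And>a b. a \<in> A \<Longrightarrow> b \<in> A \<Longrightarrow> even a \<Longrightarrow> odd b \<Longrightarrow> cadj t a b"
  shows "\<exists>a<t. A = {a, csuc t a, csuc t (csuc t a)}"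
proof -
  have fA: "finite A" using A finite_subset by blast
  define A0 where "A0 = {a \<in> A. even a}"
  define A1 where "A1 = {a \<in> A. odd a}"
  have un: "A = A0 \<union> A1" "A0 \<inter> A1 = {}" by (auto simp: A0_def A1_def)
  have card: "card A = card A0 + card A1" using fA un by (metis card_Un_disjoint finite_Un)
  have sym: "cadj t a b \<Longrightarrow> cadj t b a" for a b by (auto simp: cadj_def)
  have main: "\<exists>a<t. A = {a, csuc t a, csuc t (csuc t a)}"
    if A': "A = B0 \<union> B1" "B0 \<noteq> {}" "card B1 \<ge> 2" "\<And>a b. a \<in> B0 \<Longrightarrow> b \<in> B1 \<Longrightarrow> cadj t a b" for B0 B1
  proof -
    have fB: "finite B0" "finite B1" using fA A'(1) by auto
    have lt: "a < t" if "a \<in> B0 \<union> B1" for a using that A A'(1) by auto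
    have "\<exists>b b'. b \<in> B1 \<and> b' \<in> B1 \<and> b \<noteq> b'"
    proof (rule ccontr)
      assume "\<not> ?thesis"
      then have "card B1 \<le> Suc 0" using card_le_Suc0_iff_eq[OF fB(2)] by blast
      then show False using A'(3) by simp
    qed
    then obtain b b' where bb: "b \<in> B1" "b' \<in> B1" "b \<noteq> b'" by blast
    obtain a where a: "a \<in> B0" using A'(2) by blast
    have "a' = a" if "a' \<in> B0" for a'
    proof (rule ccontr)
      assume ne: "a' \<noteq> a"
      show False
        by (rule cadj_no_quadrangle[OF t(1) _ _ _ _ ne bb(3)
              A'(4)[OF that bb(1)] A'(4)[OF that bb(2)] A'(4)[OF a bb(1)] A'(4)[OF a bb(2)]])
          (use lt a that bb in blast)+
    qed
    then have B0: "B0 = {a}" using a by blast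
    have at: "a < t" using lt a by simp
    have sub: "B1 \<subseteq> {cpred t a, csuc t a}"
    proof
      fix c assume c: "c \<in> B1"
      then have "cadj t a c" "c < t" using A'(4)[OF a] lt by auto
      then show "c \<in> {cpred t a, csuc t a}" by (auto simp: cadj_def csuc_def cpred_def split: if_splits)
    qed
    then have "B1 = {cpred t a, csuc t a}"
    proof (rule card_seteq[rotated])
      show "card {cpred t a, csuc t a} \<le> card B1" using A'(3) by (simp add: card_insert_if)
    qed simp
    then have "A = {cpred t a, a, csuc t a}" using A'(1) B0 by auto
    then show ?thesis using cpred_less[OF at] csuc_cpred[OF at] by (intro exI[of _ "cpred t a"]) simp
  qed
  show ?thesis
  proof (cases "card A1 \<ge> 2")
    case True
    show ?thesis
    proof (rule main[OF un(1) _ True])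
      show "A0 \<noteq> {}" using ev by (auto simp: A0_def)
      show "cadj t a b" if "a \<in> A0" "b \<in> A1" for a b using that adj by (simp add: A0_def A1_def)
    qed
  next
    case False
    then have c0: "card A0 \<ge> 2" using card A(2) by linarith
    show ?thesis
    proof (rule main[OF _ _ c0])
      show "A = A1 \<union> A0" using un(1) by (simp add: Un_commute)
      show "A1 \<noteq> {}" using od by (auto simp: A1_def)
      show "cadj t a b" if "a \<in> A1" "b \<in> A0" for a b using that adj sym by (simp add: A0_def A1_def)
    qed
  qed
qed

lemma arc_index_inject:
  assumes "t \<ge> 6" "a < t" "b < t" "{a, csuc t a} = {b, csuc t b}"
  shows "a = b"
  using assms unfolding csuc_def by (auto simp: doubleton_eq_iff split: if_splits)

lemma path_index_inject:
  assumes "t \<ge> 6" "a < t" "b < t"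
    "{a, csuc t a, csuc t (csuc t a)} = {b, csuc t b, csuc t (csuc t b)}"
  shows "a = b"
proof -
  have "a \<in> {b, csuc t b, csuc t (csuc t b)}" "b \<in> {a, csuc t a, csuc t (csuc t a)}" using assms(4) by auto
  then show ?thesis using assms(1-3) unfolding csuc_def by (auto split: if_splits)
qed

lemma csuc_distinct:
  assumes "t \<ge> 6" "a < t"
  shows "a \<noteq> csuc t a" "a \<noteq> csuc t (csuc t a)" "csuc t a \<noteq> csuc t (csuc t a)"
  using assms by (auto simp: csuc_def)

locale cycle_cochains = bipartite_cochains U q \<sigma>
  for U :: "'v set" and q :: "'v \<Rightarrow> bool" and \<sigma> :: "'v \<Rightarrow> 'v set \<Rightarrow> 'k::field" +
  fixes t :: nat and p :: "nat \<Rightarrow> 'v"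
  assumes t6: "t \<ge> 6" and tev: "even t" and injp: "inj_on p {..<t}" and Up: "U \<subseteq> p ` {..<t}"
    and qp: "\<And>a. a < t \<Longrightarrow> q (p a) \<longleftrightarrow> even a"
begin

definition P :: "nat set" where "P = {a. a < t \<and> p a \<in> U}"

definition arc :: "nat \<Rightarrow> 'v set" where "arc a = {p a, p (csuc t a)}"

definition path :: "nat \<Rightarrow> 'v set" where "path a = {p a, p (csuc t a), p (csuc t (csuc t a))}"

text \<open>The sets containing an edge of the bipartite complement: two vertices on different sides that are
  not adjacent in the cycle.\<close>

definition nonfaces :: "'v set set" where
  "nonfaces = {T. T \<subseteq> U \<and> (\<exists>x\<in>T. \<exists>y\<in>T. q x \<and> \<not> q y \<and> (\<forall>a<t. {x, y} \<noteq> arc a))}"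

abbreviation "arcs \<equiv> cycle_arcs t P"
abbreviation "pairs \<equiv> arc_pairs t P"

lemma P_subset: "P \<subseteq> {..<t}" by (auto simp: P_def)

lemma p_eq_iff: "a < t \<Longrightarrow> b < t \<Longrightarrow> p a = p b \<longleftrightarrow> a = b"
  using injp by (auto simp: inj_on_def)

lemma arcs_iff: "a \<in> arcs \<longleftrightarrow> a < t \<and> arc a \<subseteq> U"
  by (auto simp: cycle_arcs_def arc_def P_def csuc_less)

lemma pairs_iff: "a \<in> pairs \<longleftrightarrow> a < t \<and> path a \<subseteq> U"
  by (auto simp: arc_pairs_def arcs_iff arc_def path_def csuc_less)

lemma nonfaces_subset_mixed: "nonfaces \<subseteq> mixed"
  by (auto simp: nonfaces_def mixed_def)

lemma arc_side: "a < t \<Longrightarrow> q (p a) \<longleftrightarrow> \<not> q (p (csuc t a))"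
  by (simp add: qp csuc_less csuc_parity[OF tev])

lemma arc_mixed: "a \<in> arcs \<Longrightarrow> arc a \<in> mixed"
  using arc_side[of a] by (auto simp: arcs_iff mixed_def arc_def)

lemma card_arc: "a < t \<Longrightarrow> card (arc a) = 2"
  using csuc_distinct[OF t6, of a] by (simp add: arc_def p_eq_iff csuc_less)

lemma path_mixed: "a \<in> pairs \<Longrightarrow> path a \<in> mixed"
  using arc_side[of a] by (auto simp: pairs_iff mixed_def path_def)

lemma path_points:
  assumes "a < t"
  shows "p a \<noteq> p (csuc t a)" "p a \<noteq> p (csuc t (csuc t a))" "p (csuc t a) \<noteq> p (csuc t (csuc t a))"
  using csuc_distinct[OF t6 assms] assms by (simp_all add: p_eq_iff csuc_less)

lemma card_path: "a < t \<Longrightarrow> card (path a) = 3"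
  using path_points[of a] by (simp add: path_def)

lemma image_pair_eq:
  assumes "A \<subseteq> {..<t}" "B \<subseteq> {..<t}"
  shows "p ` A = p ` B \<longleftrightarrow> A = B"
  using inj_on_image_eq_iff[OF injp assms] .

lemma arc_image: "arc a = p ` {a, csuc t a}" by (simp add: arc_def)
lemma path_image: "path a = p ` {a, csuc t a, csuc t (csuc t a)}" by (simp add: path_def)

lemma inj_arc: "inj_on arc {..<t}"
proof (rule inj_onI)
  fix a b assume ab: "a \<in> {..<t}" "b \<in> {..<t}" "arc a = arc b"
  then have "{a, csuc t a} = {b, csuc t b}"
    using image_pair_eq[of "{a, csuc t a}" "{b, csuc t b}"] by (simp add: arc_image csuc_less del: image_insert)
  then show "a = b" using arc_index_inject[OF t6] ab by simp
qed

lemma inj_path: "inj_on path {..<t}"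
proof (rule inj_onI)
  fix a b assume ab: "a \<in> {..<t}" "b \<in> {..<t}" "path a = path b"
  then have "{a, csuc t a, csuc t (csuc t a)} = {b, csuc t b, csuc t (csuc t b)}"
    using image_pair_eq[of "{a, csuc t a, csuc t (csuc t a)}" "{b, csuc t b, csuc t (csuc t b)}"]
    by (simp add: path_image csuc_less del: image_insert)
  then show "a = b" using path_index_inject[OF t6] ab by simp
qed

lemma adjacent_iff:
  assumes "a < t" "b < t"
  shows "(\<exists>c<t. {p a, p b} = arc c) \<longleftrightarrow> cadj t a b"
proof -
  have "{p a, p b} = arc c \<longleftrightarrow> {a, b} = {c, csuc t c}" if "c < t" for c
    using image_pair_eq[of "{a, b}" "{c, csuc t c}"] assms that by (simp add: arc_image csuc_less)
  then have "(\<exists>c<t. {p a, p b} = arc c) \<longleftrightarrow> (\<exists>c<t. {a, b} = {c, csuc t c})" by auto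
  also have "\<dots> \<longleftrightarrow> cadj t a b" using assms by (auto simp: cadj_def doubleton_eq_iff)
  finally show ?thesis .
qed

text \<open>A face that meets both sides is complete bipartite in the cycle.\<close>

lemma face_index:
  assumes T: "T \<in> mixed" "T \<notin> nonfaces" "card T \<ge> 3"
  shows "\<exists>a\<in>pairs. T = path a"
proof -
  have TU: "T \<subseteq> U" using T by (simp add: mixed_def)
  define A where "A = {a. a < t \<and> p a \<in> T}"
  have TA: "T = p ` A" using TU Up by (auto simp: A_def)
  have At: "A \<subseteq> {..<t}" by (auto simp: A_def)
  have "card A = card T" unfolding TA by (rule card_image[symmetric]) (use injp At inj_on_subset in blast)
  have "\<exists>a<t. A = {a, csuc t a, csuc t (csuc t a)}"
  proof (rule three_neighbours[OF t6 tev At])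
    show "3 \<le> card A" using \<open>card A = card T\<close> T(3) by simp
    obtain x y where "x \<in> T" "q x" "y \<in> T" "\<not> q y" using T(1) by (auto simp: mixed_def)
    then show "\<exists>a\<in>A. even a" "\<exists>b\<in>A. odd b" unfolding TA using qp At by auto
    fix a b assume ab: "a \<in> A" "b \<in> A" "even a" "odd b"
    then have lt: "a < t" "b < t" using At by auto
    have "\<exists>c<t. {p a, p b} = arc c"
    proof (rule ccontr)
      assume "\<not> ?thesis"
      moreover have "p a \<in> T" "p b \<in> T" using ab TA by auto
      moreover have "q (p a)" "\<not> q (p b)" using qp lt ab by auto
      ultimately show False using T(2) TU unfolding nonfaces_def by blast
    qed
    then show "cadj t a b" using adjacent_iff[OF lt] by simp
  qed
  then obtain a where a: "a < t" "A = {a, csuc t a, csuc t (csuc t a)}" by blast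
  then have "T = path a" using TA by (simp add: path_image)
  then show ?thesis using a TU pairs_iff by blast
qed

lemma large_mixed_nonface: "T \<in> mixed \<Longrightarrow> card T \<ge> 4 \<Longrightarrow> T \<in> nonfaces"
  using face_index[of T] card_path by (fastforce simp: pairs_iff)

lemma path_face:
  assumes a: "a \<in> pairs"
  shows "path a \<notin> nonfaces"
proof
  assume "path a \<in> nonfaces"
  then obtain x y where xy: "x \<in> path a" "y \<in> path a" "q x" "\<not> q y" "\<forall>c<t. {x, y} \<noteq> arc c"
    by (auto simp: nonfaces_def)
  have at: "a < t" using a by (simp add: pairs_iff)
  have "q (p a) \<longleftrightarrow> q (p (csuc t (csuc t a)))"
    using arc_side[OF at] arc_side[OF csuc_less[OF at]] by blast
  then have "{x, y} = arc a \<or> {x, y} = arc (csuc t a)"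
    using xy(1-4) arc_side[OF at] unfolding path_def arc_def by auto
  then show False using xy(5) at csuc_less by blast
qed

lemma arc_face:
  assumes a: "a \<in> arcs"
  shows "arc a \<notin> nonfaces"
proof
  assume "arc a \<in> nonfaces"
  then obtain x y where xy: "x \<in> arc a" "y \<in> arc a" "q x" "\<not> q y" "\<forall>c<t. {x, y} \<noteq> arc c"
    by (auto simp: nonfaces_def)
  then have "{x, y} = arc a" by (auto simp: arc_def)
  moreover have "a < t" using a by (simp add: arcs_iff)
  ultimately show False using xy(5) by blast
qed

lemma edge_index:
  assumes T: "T \<in> mixed" "T \<notin> nonfaces" "card T = 2"
  shows "\<exists>a\<in>arcs. T = arc a"
proof -
  obtain x y where xy: "x \<in> T" "y \<in> T" "q x" "\<not> q y" using T(1) by (auto simp: mixed_def)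
  then have "T = {x, y}" using T(3) by (auto simp: card_2_iff)
  moreover have TU: "T \<subseteq> U" using T by (simp add: mixed_def)
  moreover have "\<exists>a<t. {x, y} = arc a"
  proof (rule ccontr)
    assume "\<not> ?thesis"
    then have "T \<in> nonfaces" unfolding nonfaces_def using xy TU by blast
    then show False using T(2) by simp
  qed
  ultimately obtain a where "a < t" "T = arc a" by auto
  then show ?thesis using TU by (intro bexI[of _ a]) (simp_all add: arcs_iff)
qed

lemma theta_arc_square: "a \<in> arcs \<Longrightarrow> theta (arc a) * theta (arc a) = 1"
proof -
  assume a: "a \<in> arcs"
  then have at: "a < t" "p a \<in> U" "p (csuc t a) \<in> U" by (auto simp: arcs_iff arc_def)
  show ?thesis
  proof (cases "q (p a)")
    case True
    then show ?thesis using theta_pair_square[of "p a" "p (csuc t a)"] at arc_side[of a] by (simp add: arc_def)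
  next
    case False
    then show ?thesis using theta_pair_square[of "p (csuc t a)" "p a"] at arc_side[of a]
      by (simp add: arc_def insert_commute)
  qed
qed

text \<open>Restriction of a cochain on mixed sets to the edges of the cycle. Division by \<open>theta\<close>, which is a
  sign on every edge, makes \<open>theta\<close> the constant function \<open>1\<close>.\<close>

definition pi2 :: "('v set \<Rightarrow> 'k) \<Rightarrow> nat \<Rightarrow> 'k" where
  "pi2 G a = (if a \<in> arcs then theta (arc a) * G (arc a) else 0)"

definition tau :: "nat \<Rightarrow> 'k" where
  "tau a = \<sigma> (p a) (path a) * theta (arc (csuc t a))"

text \<open>Restriction to three-vertex paths. Since \<open>theta\<close> is a cocycle, the sign \<open>tau\<close> makes the coboundary
  the difference of the values of \<open>pi2\<close> at the two edges of a path.\<close>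

definition pi3 :: "('v set \<Rightarrow> 'k) \<Rightarrow> nat \<Rightarrow> 'k" where
  "pi3 G a = (if a \<in> pairs then tau a * G (path a) else 0)"

lemma linear_pi2: "Vector_Spaces.linear fscale fscale pi2"
  unfolding Vector_Spaces.linear_iff
  by (intro conjI allI vector_space_fun) (auto simp: fun_eq_iff pi2_def algebra_simps)

lemma linear_pi3: "Vector_Spaces.linear fscale fscale pi3"
  unfolding Vector_Spaces.linear_iff
  by (intro conjI allI vector_space_fun) (auto simp: fun_eq_iff pi3_def algebra_simps)

lemma tau_square: "a \<in> pairs \<Longrightarrow> tau a * tau a = 1"
proof -
  assume a: "a \<in> pairs"
  have "tau a * tau a = (\<sigma> (p a) (path a) * \<sigma> (p a) (path a)) * (theta (arc (csuc t a)) * theta (arc (csuc t a)))"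
    by (simp add: tau_def algebra_simps)
  moreover have "\<sigma> (p a) (path a) * \<sigma> (p a) (path a) = 1"
    using a by (intro sq) (auto simp: pairs_iff path_def)
  moreover have "theta (arc (csuc t a)) * theta (arc (csuc t a)) = 1"
    using restrict_to_arcs(2)[OF a] by (rule theta_arc_square)
  ultimately show ?thesis by simp
qed

lemma coboundary_path:
  assumes a: "a \<in> pairs" and G: "G \<in> cochains mixed 2"
  shows "coboundary \<sigma> G (path a)
    = \<sigma> (p a) (path a) * G (arc (csuc t a)) + \<sigma> (p (csuc t (csuc t a))) (path a) * G (arc a)"
proof -
  have at: "a < t" using a by (simp add: pairs_iff)
  note d = path_points[OF at]
  let ?x = "p a" and ?y = "p (csuc t a)" and ?z = "p (csuc t (csuc t a))"
  have del: "path a - {?x} = {?y, ?z}" "path a - {?y} = {?x, ?z}" "path a - {?z} = {?x, ?y}"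
    using d by (auto simp: path_def)
  have "q ?x \<longleftrightarrow> q ?z" using arc_side[OF at] arc_side[OF csuc_less[OF at]] by blast
  then have "{?x, ?z} \<notin> mixed" by (auto simp: mixed_def)
  then have z: "G {?x, ?z} = 0" using G by (auto simp: cochains_def)
  have "coboundary \<sigma> G (path a) = (\<Sum>v\<in>{?x, ?y, ?z}. \<sigma> v (path a) * G (path a - {v}))"
    by (simp add: coboundary_def path_def)
  also have "\<dots> = \<sigma> ?x (path a) * G {?y, ?z} + (\<sigma> ?y (path a) * G {?x, ?z} + \<sigma> ?z (path a) * G {?x, ?y})"
    using d by (simp add: del)
  finally show ?thesis by (simp add: z arc_def)
qed

lemma pi3_coboundary:
  assumes a: "a \<in> pairs" and G: "G \<in> cochains mixed 2"
  shows "pi3 (trunc_coboundary \<sigma> U G) a = pi2 G (csuc t a) - pi2 G a"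
proof -
  let ?\<alpha> = "\<sigma> (p a) (path a)" and ?\<gamma> = "\<sigma> (p (csuc t (csuc t a))) (path a)"
  let ?\<theta> = "theta (arc a)" and ?\<theta>' = "theta (arc (csuc t a))"
  have pU: "path a \<subseteq> U" using a by (simp add: pairs_iff)
  have z: "?\<alpha> * ?\<theta>' + ?\<gamma> * ?\<theta> = 0"
    using coboundary_path[OF a theta_cochain] coboundary_theta[OF pU] by simp
  then have tau: "tau a = - (?\<gamma> * ?\<theta>)" by (simp add: tau_def eq_neg_iff_add_eq_0)
  have sa: "?\<alpha> * ?\<alpha> = 1" and sg: "?\<gamma> * ?\<gamma> = 1"
    by (rule sq[OF pU], simp add: path_def)+
  have "pi3 (trunc_coboundary \<sigma> U G) a = tau a * (?\<alpha> * G (arc (csuc t a))) + tau a * (?\<gamma> * G (arc a))"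
    using a pU coboundary_path[OF a G] by (simp add: pi3_def trunc_coboundary_def algebra_simps)
  also have "tau a * (?\<alpha> * G (arc (csuc t a))) = (?\<alpha> * ?\<alpha>) * ?\<theta>' * G (arc (csuc t a))"
    by (simp add: tau_def algebra_simps)
  also have "tau a * (?\<gamma> * G (arc a)) = - ((?\<gamma> * ?\<gamma>) * ?\<theta> * G (arc a))"
    unfolding tau by (simp add: algebra_simps)
  finally show ?thesis using restrict_to_arcs[OF a] by (simp add: sa sg pi2_def)
qed

lemma trunc_in_mixed:
  assumes G: "G \<in> cochains mixed n"
  shows "trunc_coboundary \<sigma> U G \<in> cochains mixed (Suc n)"
  unfolding cochains_def
proof (intro CollectI allI impI)
  fix T assume c: "trunc_coboundary \<sigma> U G T \<noteq> 0"
  then have T: "T \<subseteq> U" "coboundary \<sigma> G T \<noteq> 0" by (auto simp: trunc_coboundary_def split: if_splits)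
  have fT: "finite T" using T fU finite_subset by blast
  obtain v where v: "v \<in> T" "G (T - {v}) \<noteq> 0"
  proof -
    have "\<exists>v\<in>T. \<sigma> v T * G (T - {v}) \<noteq> 0"
    proof (rule ccontr)
      assume "\<not> ?thesis"
      then have "coboundary \<sigma> G T = 0" unfolding coboundary_def by (intro sum.neutral) blast
      then show False using T(2) by simp
    qed
    then show ?thesis using that by auto
  qed
  then have "T - {v} \<in> mixed" "card (T - {v}) = n" using G by (auto simp: cochains_def)
  then show "T \<in> mixed \<and> card T = Suc n" using T(1) card_Suc_Diff1[OF fT v(1)] by (auto simp: mixed_def)
qed

lemma trunc_trunc: "trunc_coboundary \<sigma> U (trunc_coboundary \<sigma> U G) = 0"
proof
  fix T
  have "coboundary \<sigma> (trunc_coboundary \<sigma> U G) T = coboundary \<sigma> (coboundary \<sigma> G) T" if "T \<subseteq> U"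
    by (rule coboundary_cong) (use that in \<open>auto simp: trunc_coboundary_def\<close>)
  then show "trunc_coboundary \<sigma> U (trunc_coboundary \<sigma> U G) T = 0 T"
    using coboundary_coboundary[OF alt _ fU] by (simp add: trunc_coboundary_def)
qed

lemma trunc_zero_iff: "trunc_coboundary \<sigma> U F = 0 \<longleftrightarrow> (\<forall>T\<subseteq>U. coboundary \<sigma> F T = 0)"
  by (auto simp: trunc_coboundary_def fun_eq_iff)

lemma cochains_mono: "C \<subseteq> D \<Longrightarrow> cochains C n \<subseteq> cochains D n"
  by (auto simp: cochains_def)

lemma nonface_cochain_iff:
  "G \<in> cochains nonfaces n \<longleftrightarrow> G \<in> cochains mixed n \<and> (\<forall>T. T \<in> mixed \<longrightarrow> T \<notin> nonfaces \<longrightarrow> card T = n \<longrightarrow> G T = 0)"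
  using nonfaces_subset_mixed by (auto simp: cochains_def)

definition Zc :: "nat \<Rightarrow> ('v set \<Rightarrow> 'k) set" where
  "Zc n = {F \<in> cochains nonfaces n. trunc_coboundary \<sigma> U F = 0}"

lemma Zc_mixed_exact:
  assumes F: "F \<in> Zc (Suc (Suc (Suc n)))"
  shows "\<exists>G\<in>cochains mixed (Suc (Suc n)). trunc_coboundary \<sigma> U G = F"
proof (rule mixed_exact)
  show "F \<in> cochains mixed (Suc (Suc (Suc n)))" using F by (simp add: Zc_def nonface_cochain_iff)
  show "coboundary \<sigma> F T = 0" if "T \<subseteq> U" for T using F that by (simp add: Zc_def trunc_zero_iff)
qed

lemma large_cochains: "n \<ge> 4 \<Longrightarrow> cochains nonfaces n = (cochains mixed n :: ('v set \<Rightarrow> 'k) set)"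
  using large_mixed_nonface nonfaces_subset_mixed by (auto simp: cochains_def)

text \<open>All mixed sets with at least four elements are nonfaces, so exactness of the mixed cochains can be
  used.\<close>

lemma Zc_large:
  assumes "n \<ge> 5"
  shows "Zc n \<subseteq> trunc_coboundary \<sigma> U ` cochains nonfaces (n - 1)"
proof
  fix F assume F: "F \<in> Zc n"
  have n: "n = Suc (Suc (Suc (n - 3)))" using assms by simp
  obtain G where "G \<in> cochains mixed (Suc (Suc (n - 3)))" "trunc_coboundary \<sigma> U G = F"
    using Zc_mixed_exact F n by metis
  moreover have "Suc (Suc (n - 3)) = n - 1" using assms by simp
  ultimately show "F \<in> trunc_coboundary \<sigma> U ` cochains nonfaces (n - 1)"
    using large_cochains[of "n - 1"] assms by auto
qed

lemma pi2_surj: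
  assumes r: "r \<in> supported arcs"
  shows "\<exists>G\<in>cochains mixed 2. pi2 G = r"
proof
  define G where "G T = (if T \<in> arc ` arcs then theta T * r (inv_into arcs arc T) else 0)" for T
  have inj: "inj_on arc arcs" by (rule inj_on_subset[OF inj_arc]) (auto simp: arcs_iff)
  show "G \<in> cochains mixed 2"
    using arc_mixed card_arc by (auto simp: cochains_def G_def arcs_iff split: if_splits)
  show "pi2 G = r"
  proof
    fix a show "pi2 G a = r a"
    proof (cases "a \<in> arcs")
      case True
      then have "G (arc a) = theta (arc a) * r a" using inj by (simp add: G_def)
      then show ?thesis using True theta_arc_square[OF True] by (simp add: pi2_def mult.assoc[symmetric])
    next
      case False then show ?thesis using r by (simp add: pi2_def supported_def)
    qed
  qed
qed

lemma pi3_surj: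
  assumes r: "r \<in> supported pairs"
  shows "\<exists>G\<in>cochains mixed 3. pi3 G = r"
proof
  define G where "G T = (if T \<in> path ` pairs then tau (inv_into pairs path T) * r (inv_into pairs path T) else 0)" for T
  have inj: "inj_on path pairs" by (rule inj_on_subset[OF inj_path]) (auto simp: pairs_iff)
  show "G \<in> cochains mixed 3"
    using path_mixed card_path by (auto simp: cochains_def G_def pairs_iff split: if_splits)
  show "pi3 G = r"
  proof
    fix a show "pi3 G a = r a"
    proof (cases "a \<in> pairs")
      case True
      then have "G (path a) = tau a * r a" using inj by (simp add: G_def)
      then show ?thesis using True tau_square[OF True] by (simp add: pi3_def mult.assoc[symmetric])
    next
      case False then show ?thesis using r by (simp add: pi3_def supported_def)
    qed
  qed
qed

lemma pi3_supported: "pi3 G \<in> supported pairs" by (simp add: supported_def pi3_def)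
lemma pi2_supported: "pi2 G \<in> supported arcs" by (simp add: supported_def pi2_def)

lemma pi3_zero_iff:
  assumes G: "G \<in> cochains mixed 3"
  shows "pi3 G = 0 \<longleftrightarrow> G \<in> cochains nonfaces 3"
proof
  assume z: "pi3 G = 0"
  have "G T = 0" if T: "T \<in> mixed" "T \<notin> nonfaces" "card T = 3" for T
  proof -
    obtain a where a: "a \<in> pairs" "T = path a" using face_index[of T] T by auto
    have "tau a * G (path a) = 0" using fun_cong[OF z, of a] a by (simp add: pi3_def)
    moreover have "tau a \<noteq> 0" using tau_square[OF a(1)] by auto
    ultimately show ?thesis using a by simp
  qed
  then show "G \<in> cochains nonfaces 3" using G by (simp add: nonface_cochain_iff)
next
  assume "G \<in> cochains nonfaces 3"
  then have "G (path a) = 0" if "a \<in> pairs" for a using path_face[OF that] by (auto simp: cochains_def)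
  then show "pi3 G = 0" by (auto simp: pi3_def fun_eq_iff)
qed

lemma pi2_zero_iff:
  assumes G: "G \<in> cochains mixed 2"
  shows "pi2 G = 0 \<longleftrightarrow> G \<in> cochains nonfaces 2"
proof
  assume z: "pi2 G = 0"
  have "G T = 0" if T: "T \<in> mixed" "T \<notin> nonfaces" "card T = 2" for T
  proof -
    obtain a where a: "a \<in> arcs" "T = arc a" using edge_index[of T] T by auto
    have "theta (arc a) * G (arc a) = 0" using fun_cong[OF z, of a] a by (simp add: pi2_def)
    moreover have "theta (arc a) \<noteq> 0" using theta_arc_square[OF a(1)] by auto
    ultimately show ?thesis using a by simp
  qed
  then show "G \<in> cochains nonfaces 2" using G by (simp add: nonface_cochain_iff)
next
  assume "G \<in> cochains nonfaces 2"
  then have "G (arc a) = 0" if "a \<in> arcs" for a using arc_face[OF that] by (auto simp: cochains_def)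
  then show "pi2 G = 0" by (auto simp: pi2_def fun_eq_iff)
qed

text \<open>Every cocycle on four-element nonfaces is the coboundary of a mixed cochain \<open>G\<close>, unique up to
  mixed cocycles; a primitive supported on nonfaces exists iff some mixed cocycle agrees with \<open>G\<close> on
  the paths. So the homology is the space of functions on paths modulo the restrictions of mixed
  cocycles, which are the differences of functions on edges.\<close>

lemma qdim_Zc_4:
  "qdim fscale (Zc 4) (trunc_coboundary \<sigma> U ` cochains nonfaces 3) (if P = {..<t} then 1 else 0)"
proof -
  let ?D = "trunc_coboundary \<sigma> U"
  let ?F = "cochains mixed 3 :: ('v set \<Rightarrow> 'k) set"
  have 1: "pi3 ` ?F = supported pairs"
    using pi3_surj pi3_supported by blast
  have 2: "pi3 ` {G \<in> ?F. ?D G = 0} = arc_coboundaries t P"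
  proof
    show "pi3 ` {G \<in> ?F. ?D G = 0} \<subseteq> arc_coboundaries t P"
    proof clarify
      fix G assume G: "G \<in> ?F" "?D G = 0"
      then have "G \<in> cochains mixed (Suc (Suc (Suc 0)))" by (simp add: numeral_3_eq_3)
      then obtain K where K: "K \<in> cochains mixed 2" "?D K = G"
        using mixed_exact[of G 0] G(2) by (auto simp: trunc_zero_iff numeral_2_eq_2)
      have "\<forall>a\<in>pairs. pi3 G a = pi2 K (csuc t a) - pi2 K a" using pi3_coboundary[OF _ K(1)] K(2) by blast
      then show "pi3 G \<in> arc_coboundaries t P"
        unfolding arc_coboundaries_def using pi2_supported pi3_supported by blast
    qed
    show "arc_coboundaries t P \<subseteq> pi3 ` {G \<in> ?F. ?D G = 0}"
    proof
      fix r :: "nat \<Rightarrow> 'k" assume "r \<in> arc_coboundaries t P"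
      then obtain b where r: "r \<in> supported pairs" "b \<in> supported arcs" "\<forall>a\<in>pairs. r a = b (csuc t a) - b a"
        unfolding arc_coboundaries_def by blast
      obtain K where K: "K \<in> cochains mixed 2" "pi2 K = b" using pi2_surj[OF r(2)] by blast
      have "?D K \<in> ?F" using trunc_in_mixed[OF K(1)] by (simp add: eval_nat_numeral)
      moreover have "pi3 (?D K) = r"
      proof
        fix a show "pi3 (?D K) a = r a"
        proof (cases "a \<in> pairs")
          case True then show ?thesis using pi3_coboundary[OF True K(1)] K(2) r(3) by simp
        next
          case False then show ?thesis using r(1) by (simp add: pi3_def supported_def)
        qed
      qed
      ultimately show "r \<in> pi3 ` {G \<in> ?F. ?D G = 0}" using trunc_trunc by blast
    qed
  qed
  have 3: "?D ` ?F = Zc 4"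
  proof
    show "?D ` ?F \<subseteq> Zc 4"
    proof clarify
      fix G assume "G \<in> ?F"
      then have "?D G \<in> cochains mixed 4" using trunc_in_mixed[of G 3] by (simp add: eval_nat_numeral)
      then show "?D G \<in> Zc 4" using large_cochains[of 4] trunc_trunc by (simp add: Zc_def)
    qed
    show "Zc 4 \<subseteq> ?D ` ?F"
    proof
      fix F assume "F \<in> Zc 4"
      then have "F \<in> Zc (Suc (Suc (Suc 1)))" by (simp add: eval_nat_numeral)
      then show "F \<in> ?D ` ?F" using Zc_mixed_exact[of F 1] by (auto simp: eval_nat_numeral)
    qed
  qed
  have 4: "?D ` {G \<in> ?F. pi3 G = 0} = ?D ` cochains nonfaces 3"
  proof -
    have "{G \<in> ?F. pi3 G = 0} = cochains nonfaces 3"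
      using pi3_zero_iff cochains_mono[OF nonfaces_subset_mixed] by blast
    then show ?thesis by simp
  qed
  have "qdim fscale (pi3 ` ?F) (pi3 ` {G \<in> ?F. ?D G = 0}) (if P = {..<t} then 1 else 0)"
    unfolding 1 2 by (rule qdim_arc_coboundaries[OF _ P_subset]) (use t6 in simp)
  from qdim_two_images[OF linear_pi3 linear_trunc_coboundary subspace_cochains this]
  show ?thesis unfolding 3 4 .
qed

text \<open>Every cocycle on three-element nonfaces is the coboundary of a mixed cochain \<open>G\<close>. That it vanishes
  on the paths says that \<open>pi2 G\<close> has equal values at neighbouring edges, and \<open>G\<close> is unique up to
  multiples of \<open>theta\<close>, which are the constants.\<close>

lemma qdim_Zc_3:
  "qdim fscale (Zc 3) (trunc_coboundary \<sigma> U ` cochains nonfaces 2) (card (cyclic_starts 2 t P) - 1)"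
proof -
  let ?D = "trunc_coboundary \<sigma> U"
  define F where "F = {G \<in> cochains mixed 2. pi2 G \<in> arc_cocycles t P}"
  interpret l: Vector_Spaces.linear fscale fscale pi2 by (rule linear_pi2)
  have subF: "module.subspace fscale F"
  proof -
    have C: "l.vs1.subspace (cochains mixed 2 :: ('v set \<Rightarrow> 'k) set)" by (rule subspace_cochains)
    have A: "l.vs1.subspace {G. pi2 G \<in> arc_cocycles t P}"
      by (auto simp: l.vs1.subspace_def l.add l.scale l.zero arc_cocycles_def supported_def)
    show ?thesis using l.vs1.subspace_inter[OF C A] by (simp add: F_def Int_def)
  qed
  have in_F: "pi2 G \<in> arc_cocycles t P \<longleftrightarrow> ?D G \<in> cochains nonfaces 3" if G: "G \<in> cochains mixed 2" for G
  proof -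
    have m: "?D G \<in> cochains mixed 3" using trunc_in_mixed[OF G] by (simp add: eval_nat_numeral)
    have "pi2 G \<in> arc_cocycles t P \<longleftrightarrow> (\<forall>a\<in>pairs. pi3 (?D G) a = 0)"
      using pi2_supported pi3_coboundary[OF _ G] by (simp add: arc_cocycles_def)
    also have "\<dots> \<longleftrightarrow> pi3 (?D G) = 0" by (auto simp: fun_eq_iff pi3_def)
    also have "\<dots> \<longleftrightarrow> ?D G \<in> cochains nonfaces 3" by (rule pi3_zero_iff[OF m])
    finally show ?thesis .
  qed
  have 1: "pi2 ` F = arc_cocycles t P"
  proof
    show "arc_cocycles t P \<subseteq> pi2 ` F"
    proof
      fix r :: "nat \<Rightarrow> 'k" assume r: "r \<in> arc_cocycles t P"
      then have "r \<in> supported arcs" by (simp add: arc_cocycles_def)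
      then show "r \<in> pi2 ` F" using pi2_surj[of r] r by (auto simp: F_def)
    qed
  qed (auto simp: F_def)
  have 2: "pi2 ` {G \<in> F. ?D G = 0} = arc_constants t P"
  proof
    show "pi2 ` {G \<in> F. ?D G = 0} \<subseteq> arc_constants t P"
    proof clarify
      fix G assume G: "G \<in> F" "?D G = 0"
      then obtain c where c: "\<And>T. G T = c * theta T"
        using mixed_2_cocycle[of G] by (auto simp: F_def trunc_zero_iff)
      have "pi2 G = (\<lambda>a. if a \<in> arcs then c else 0)"
      proof
        fix a
        have "theta (arc a) * (c * theta (arc a)) = c" if "a \<in> arcs"
          using theta_arc_square[OF that] by (simp add: mult.left_commute)
        then show "pi2 G a = (if a \<in> arcs then c else 0)" by (simp add: pi2_def c)
      qed
      then show "pi2 G \<in> arc_constants t P" unfolding arc_constants_def by blast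
    qed
    show "arc_constants t P \<subseteq> pi2 ` {G \<in> F. ?D G = 0}"
    proof
      fix r :: "nat \<Rightarrow> 'k" assume "r \<in> arc_constants t P"
      then obtain c where r: "r = (\<lambda>a. if a \<in> arcs then c else 0)" unfolding arc_constants_def by blast
      let ?G = "\<lambda>T. c * theta T"
      have G: "?G \<in> cochains mixed 2"
        using l.vs1.subspace_scale[OF subspace_cochains theta_cochain, of c] .
      have D: "?D ?G = 0" using coboundary_theta by (simp add: trunc_zero_iff coboundary_cmult)
      have "pi2 ?G = r"
      proof
        fix a
        have "theta (arc a) * (c * theta (arc a)) = c" if "a \<in> arcs"
          using theta_arc_square[OF that] by (simp add: mult.left_commute)
        then show "pi2 ?G a = r a" by (simp add: pi2_def r)
      qed
      moreover have "?G \<in> F" using in_F[OF G] G unfolding D F_def by (simp add: cochains_def)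
      ultimately show "r \<in> pi2 ` {G \<in> F. ?D G = 0}" using D by blast
    qed
  qed
  have 3: "?D ` F = Zc 3"
  proof
    show "?D ` F \<subseteq> Zc 3" using in_F trunc_trunc by (auto simp: F_def Zc_def)
    show "Zc 3 \<subseteq> ?D ` F"
    proof
      fix H assume H: "H \<in> Zc 3"
      then have "H \<in> Zc (Suc (Suc (Suc 0)))" by (simp add: numeral_3_eq_3)
      then obtain G where G: "G \<in> cochains mixed 2" "?D G = H"
        using Zc_mixed_exact[of H 0] by (auto simp: numeral_2_eq_2)
      then have "G \<in> F" using in_F[OF G(1)] H by (simp add: F_def Zc_def)
      then show "H \<in> ?D ` F" using G(2) by blast
    qed
  qed
  have 4: "?D ` {G \<in> F. pi2 G = 0} = ?D ` cochains nonfaces 2"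
  proof -
    have "0 \<in> (arc_cocycles t P :: (nat \<Rightarrow> 'k) set)" by (simp add: arc_cocycles_def supported_def)
    then have "G \<in> F \<and> pi2 G = 0 \<longleftrightarrow> G \<in> cochains mixed 2 \<and> pi2 G = 0" for G
      unfolding F_def by auto
    then have "{G \<in> F. pi2 G = 0} = cochains nonfaces 2"
      using pi2_zero_iff cochains_mono[OF nonfaces_subset_mixed, of 2] by blast
    then show ?thesis by simp
  qed
  have "qdim fscale (pi2 ` F) (pi2 ` {G \<in> F. ?D G = 0}) (card (cyclic_starts 2 t P) - 1)"
    unfolding 1 2 by (rule qdim_arc_cocycles[OF P_subset])
  from qdim_two_images[OF linear_pi2 linear_trunc_coboundary subF this]
  show ?thesis unfolding 3 4 .
qed

lemma small_cochains: "n \<le> 1 \<Longrightarrow> cochains nonfaces n \<subseteq> {0}"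
proof
  fix F assume n: "n \<le> 1" and F: "F \<in> cochains nonfaces n"
  have "F T = 0" for T
  proof (rule ccontr)
    assume "F T \<noteq> 0"
    then have T: "T \<in> mixed" "card T \<le> 1" using F n nonfaces_subset_mixed by (auto simp: cochains_def)
    then obtain x y where xy: "x \<in> T" "y \<in> T" "x \<noteq> y" "T \<subseteq> U" by (auto simp: mixed_def)
    have "finite T" using xy(4) fU finite_subset by blast
    then show False using card_mono[of T "{x, y}"] xy T(2) by simp
  qed
  then show "F \<in> {0}" by auto
qed

text \<open>The multiples of \<open>theta\<close> that vanish on the edges of the cycle; \<open>theta\<close> is nonzero on every edge.\<close>

lemma qdim_Zc_2:
  "qdim fscale (Zc 2) (trunc_coboundary \<sigma> U ` cochains nonfaces 1) (if arcs = {} then 1 else 0)"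
proof -
  let ?D = "trunc_coboundary \<sigma> U"
  interpret l: Vector_Spaces.linear fscale fscale ?D by (rule linear_trunc_coboundary)
  have "0 \<in> (cochains nonfaces 1 :: ('v set \<Rightarrow> 'k) set)" by (simp add: cochains_def)
  then have "cochains nonfaces 1 = {0 :: 'v set \<Rightarrow> 'k}" using small_cochains[of 1] by blast
  then have B: "?D ` cochains nonfaces 1 = {0}" using l.zero by simp
  have Z: "\<exists>c. \<forall>T. F T = c * theta T" if "F \<in> Zc 2" for F
    using that mixed_2_cocycle[of F] by (simp add: Zc_def nonface_cochain_iff trunc_zero_iff)
  show ?thesis
  proof (cases "arcs = {}")
    case False
    then obtain a where a: "a \<in> arcs" by blast
    have "Zc 2 \<subseteq> {0}"
    proof
      fix F assume F: "F \<in> Zc 2"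
      then obtain c where c: "\<And>T. F T = c * theta T" using Z by blast
      have "F (arc a) = 0" using F arc_face[OF a] by (auto simp: Zc_def cochains_def)
      then have "c = 0" using c[of "arc a"] theta_arc_square[OF a] by auto
      then show "F \<in> {0}" using c by auto
    qed
    then show ?thesis using False unfolding B by (simp add: qdim_zero[OF vector_space_fun])
  next
    case True
    obtain x y where xy: "x \<in> U" "y \<in> U" "q x" "\<not> q y" using sideX sideY by blast
    have "theta \<in> cochains nonfaces 2"
      using theta_cochain edge_index True unfolding nonface_cochain_iff by blast
    then have th: "theta \<in> Zc 2" using coboundary_theta by (simp add: Zc_def trunc_zero_iff)
    have "basis_mod fscale (Zc 2) {0} {0::nat} (\<lambda>_. theta)"
      unfolding basis_mod_def
    proof (intro conjI ballI allI impI th)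
      fix F assume "F \<in> Zc 2"
      then obtain c where c: "\<And>T. F T = c * theta T" using Z by blast
      have "F - (\<Sum>i\<in>{0::nat}. (\<lambda>x. c * theta x)) = 0" using c by (auto simp: fun_eq_iff)
      then show "\<exists>c. F - (\<Sum>i\<in>{0::nat}. (\<lambda>x. c i * theta x)) \<in> {0}"
        by (intro exI[of _ "\<lambda>_. c"]) blast
    next
      fix c :: "nat \<Rightarrow> 'k" and i :: nat assume "(\<Sum>i\<in>{0::nat}. (\<lambda>x. c i * theta x)) \<in> {0}" and i: "i \<in> {0}"
      then have "(\<lambda>x. c 0 * theta x) = 0" by simp
      then have "c 0 * theta {x, y} = 0" by (metis zero_fun_apply)
      then show "c i = 0" using theta_pair_square[OF xy] i by auto
    qed
    then have "qdim fscale (Zc 2) {0} (card {0::nat})" by (intro qdimI) auto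
    then show ?thesis using True unfolding B by simp
  qed
qed

text \<open>The first elements of the runs of length at least two correspond to the components with at least
  one edge, except that the full cycle is not counted; the truncated difference is zero in that
  case, as it should.\<close>

definition local_number :: "nat \<Rightarrow> nat" where
  "local_number k =
    (if card U = k + 2 then if arcs = {} then 1 else 0
     else if card U = k + 3 then card (cyclic_starts 2 t P) - 1
     else if card U = k + 4 then if P = {..<t} then 1 else 0
     else 0)"

theorem qdim_local:
  "qdim fscale (local_cycles \<sigma> U nonfaces k) (local_boundaries \<sigma> U nonfaces k) (local_number k)"
proof -
  have sub: "T \<subseteq> U" if "T \<in> nonfaces" for T using that by (simp add: nonfaces_def)
  have L: "local_cochains U nonfaces k = (cochains nonfaces (card U - k) :: ('v set \<Rightarrow> 'k) set)"
    if "k \<le> card U" for k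
    unfolding local_cochains_def cochains_def using that sub by auto
  have Zk: "local_cycles \<sigma> U nonfaces k = Zc (card U - k)" if "k \<le> card U"
    unfolding local_cycles_def Zc_def L[OF that] trunc_zero_iff ..
  have Bk: "local_boundaries \<sigma> U nonfaces k = trunc_coboundary \<sigma> U ` cochains nonfaces (card U - k - 1)"
    if "Suc k \<le> card U"
  proof -
    have e: "(\<lambda>G T. if T \<subseteq> U then coboundary \<sigma> G T else 0) = trunc_coboundary \<sigma> U"
      by (intro ext) (simp add: trunc_coboundary_def)
    have "local_cochains U nonfaces (Suc k) = (cochains nonfaces (card U - k - 1) :: ('v set \<Rightarrow> 'k) set)"
      unfolding local_cochains_def cochains_def using that sub by auto
    then show ?thesis unfolding local_boundaries_def e by simp
  qed
  have zeroB: "0 \<in> local_boundaries \<sigma> U nonfaces k"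
  proof -
    have "(0 :: 'v set \<Rightarrow> 'k) \<in> local_cochains U nonfaces (Suc k)" by (simp add: local_cochains_def)
    moreover have "(0 :: 'v set \<Rightarrow> 'k) = (\<lambda>T. if T \<subseteq> U then coboundary \<sigma> 0 T else 0)"
      by (auto simp: coboundary_def)
    ultimately show ?thesis unfolding local_boundaries_def by (intro image_eqI[of _ _ 0])
  qed
  consider "card U \<le> k + 1" | "card U = k + 2" | "card U = k + 3" | "card U = k + 4" | "card U \<ge> k + 5" by linarith
  then show ?thesis
  proof cases
    case 1
    have "local_cycles \<sigma> U nonfaces k \<subseteq> {0}"
    proof (cases "k \<le> card U")
      case True
      have "card U - k \<le> 1" using 1 by simp
      from small_cochains[OF this] show ?thesis unfolding Zk[OF True] Zc_def by blast
    next
      case False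
      then show ?thesis by (auto simp: local_cycles_def local_cochains_def fun_eq_iff)
    qed
    then show ?thesis using zeroB 1 by (auto simp: local_number_def intro!: qdim_zero vector_space_fun)
  next
    case 2
    then have "card U - k = 2" "card U - k - 1 = 1" by auto
    then show ?thesis using qdim_Zc_2 Zk Bk 2 by (simp add: local_number_def)
  next
    case 3
    then have "card U - k = 3" "card U - k - 1 = 2" by auto
    then show ?thesis using qdim_Zc_3 Zk Bk 3 by (simp add: local_number_def)
  next
    case 4
    then have "card U - k = 4" "card U - k - 1 = 3" by auto
    then show ?thesis using qdim_Zc_4 Zk Bk 4 by (simp add: local_number_def)
  next
    case 5
    then have "local_cycles \<sigma> U nonfaces k \<subseteq> local_boundaries \<sigma> U nonfaces k"
      using Zc_large[of "card U - k"] Zk Bk by simp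
    then show ?thesis using 5 by (auto simp: local_number_def intro!: qdim_zero vector_space_fun)
  qed
qed

end

section \<open>Edge ideals are spanned by monomials\<close>

lemma cring_poly_ring: "cring (poly_ring V :: ('v, 'k::field) polynomial ring)"
proof (rule cringI)
  show "abelian_group (poly_ring V :: ('v, 'k) polynomial ring)"
  proof (rule abelian_groupI)
    fix x :: "('v, 'k) polynomial" assume "x \<in> carrier (poly_ring V)"
    then show "\<exists>y\<in>carrier (poly_ring V). y \<oplus>\<^bsub>poly_ring V\<^esub> x = \<zero>\<^bsub>poly_ring V\<^esub>"
      by (intro bexI[of _ "- x"]) (simp_all add: poly_ring_def poly_carrier_uminus)
  qed (auto simp: poly_ring_def poly_carrier_add algebra_simps poly_carrier_zero)
  show "comm_monoid (poly_ring V :: ('v, 'k) polynomial ring)"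
    by (rule comm_monoidI) (auto simp: poly_ring_def poly_carrier_mult poly_carrier_one algebra_simps)
qed (auto simp: poly_ring_def algebra_simps)

definition edge_monomials :: "'v set set \<Rightarrow> ('v \<Rightarrow>\<^sub>0 nat) set" where
  "edge_monomials E = {m. \<exists>u v. {u, v} \<in> E \<and> u \<in> Poly_Mapping.keys m \<and> v \<in> Poly_Mapping.keys m}"

definition monomial_ideal :: "'v set \<Rightarrow> ('v \<Rightarrow>\<^sub>0 nat) set \<Rightarrow> ('v, 'k::field) polynomial set" where
  "monomial_ideal V L = {p \<in> poly_carrier V. Poly_Mapping.keys p \<subseteq> L}"

lemma poly_eq_sum_single:
  "p = (\<Sum>m\<in>Poly_Mapping.keys p. Poly_Mapping.single m (Poly_Mapping.lookup p m))"
proof (rule poly_mapping_eqI)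
  fix m
  have "Poly_Mapping.lookup (\<Sum>m\<in>Poly_Mapping.keys p. Poly_Mapping.single m (Poly_Mapping.lookup p m)) m
     = (\<Sum>n\<in>Poly_Mapping.keys p. if n = m then Poly_Mapping.lookup p m else 0)"
    unfolding lookup_sum by (rule sum.cong) (auto simp: lookup_single when_def)
  then show "Poly_Mapping.lookup p m
     = Poly_Mapping.lookup (\<Sum>m\<in>Poly_Mapping.keys p. Poly_Mapping.single m (Poly_Mapping.lookup p m)) m"
    by (simp add: in_keys_iff)
qed

lemma monomial_ideal_closed:
  shows "0 \<in> monomial_ideal V L"
    "p \<in> monomial_ideal V L \<Longrightarrow> q \<in> monomial_ideal V L \<Longrightarrow> p + q \<in> monomial_ideal V L"
    "p \<in> monomial_ideal V L \<Longrightarrow> - p \<in> monomial_ideal V L"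
proof -
  show "0 \<in> monomial_ideal V L" by (simp add: monomial_ideal_def poly_carrier_def)
  show "p \<in> monomial_ideal V L \<Longrightarrow> q \<in> monomial_ideal V L \<Longrightarrow> p + q \<in> monomial_ideal V L"
    using keys_add[of p q] by (auto simp: monomial_ideal_def poly_carrier_add)
  show "p \<in> monomial_ideal V L \<Longrightarrow> - p \<in> monomial_ideal V L"
    by (auto simp: monomial_ideal_def poly_carrier_def in_keys_iff)
qed

lemma monomial_ideal_mult:
  assumes "\<And>m n. m \<in> L \<Longrightarrow> n + m \<in> L" "p \<in> monomial_ideal V L" "q \<in> poly_carrier V"
  shows "q * p \<in> monomial_ideal V L"
  using keys_mult[of q p] assms by (fastforce simp: monomial_ideal_def poly_carrier_mult)

lemma edge_monomials_up: "m \<in> edge_monomials E \<Longrightarrow> n + m \<in> edge_monomials E"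
  by (auto simp: edge_monomials_def keys_add_nat)

lemma indet_mult_indet: "indet u * indet v = (Poly_Mapping.single (set_mono {u} + set_mono {v}) 1 :: ('v, 'k::field) polynomial)"
  by (simp add: indet_def mult_single set_mono_def)

text \<open>The span of the monomials divisible by the two ends of an edge is an ideal that contains the
  generators, and every such monomial is a multiple of a generator.\<close>

lemma edge_ideal_eq:
  assumes E: "\<And>e. e \<in> E \<Longrightarrow> e \<subseteq> V" and simple: "\<And>u v. {u, v} \<in> E \<Longrightarrow> u \<noteq> v"
  shows "edge_ideal V E = (monomial_ideal V (edge_monomials E) :: ('v, 'k::field) polynomial set)"
proof
  let ?R = "poly_ring V :: ('v, 'k) polynomial ring"
  let ?S = "{indet u * indet v | u v. {u, v} \<in> E} :: ('v, 'k) polynomial set"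
  let ?J = "monomial_ideal V (edge_monomials E) :: ('v, 'k) polynomial set"
  interpret R: cring ?R by (rule cring_poly_ring)
  have cl4: "q * p \<in> ?J" if "p \<in> ?J" "q \<in> poly_carrier V" for p q
    using monomial_ideal_mult[OF edge_monomials_up] that by blast
  have Rsimps: "carrier ?R = poly_carrier V" "monoid.mult ?R = (*)" "monoid.one ?R = 1" "ring.zero ?R = 0" "ring.add ?R = (+)"
    by (auto simp: poly_ring_def)
  have S: "?S \<subseteq> ?J"
  proof clarify
    fix u v assume uv: "{u, v} \<in> E"
    then have "u \<in> V" "v \<in> V" using E by auto
    then show "indet u * indet v \<in> ?J"
      using uv by (auto simp: indet_mult_indet monomial_ideal_def poly_carrier_def edge_monomials_def keys_add_nat keys_set_mono)
  qed
  have J: "ideal ?J ?R"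
  proof (rule idealI)
    show "ring ?R" by (rule R.ring_axioms)
    show "subgroup ?J (add_monoid ?R)"
    proof (rule R.add.subgroupI)
      show "?J \<subseteq> carrier ?R" by (auto simp: Rsimps monomial_ideal_def)
      show "?J \<noteq> {}" using monomial_ideal_closed(1) by blast
      fix a assume a: "a \<in> ?J"
      have "\<ominus>\<^bsub>?R\<^esub> a = - a"
        by (rule R.minus_equality) (use a in \<open>auto simp: Rsimps monomial_ideal_def poly_carrier_uminus\<close>)
      then show "\<ominus>\<^bsub>?R\<^esub> a \<in> ?J" using monomial_ideal_closed(3)[OF a] by simp
      fix b assume "b \<in> ?J"
      then show "a \<oplus>\<^bsub>?R\<^esub> b \<in> ?J" using monomial_ideal_closed(2)[OF a] by (simp add: Rsimps)
    qed
    show "x \<otimes>\<^bsub>?R\<^esub> a \<in> ?J" if "a \<in> ?J" "x \<in> carrier ?R" for a x using cl4 that by (simp add: Rsimps)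
    show "a \<otimes>\<^bsub>?R\<^esub> x \<in> ?J" if "a \<in> ?J" "x \<in> carrier ?R" for a x
      using cl4[OF that(1), of x] that by (simp add: Rsimps mult.commute)
  qed
  show "edge_ideal V E \<subseteq> ?J" unfolding edge_ideal_def by (rule R.genideal_minimal[OF J S])
  have SR: "?S \<subseteq> carrier ?R" using S by (auto simp: Rsimps monomial_ideal_def)
  interpret I: ideal "edge_ideal V E" ?R unfolding edge_ideal_def by (rule R.genideal_ideal[OF SR])
  have gen: "?S \<subseteq> edge_ideal V E" unfolding edge_ideal_def by (rule R.genideal_self[OF SR])
  show "?J \<subseteq> edge_ideal V E"
  proof
    fix p assume p: "p \<in> ?J"
    have mono: "Poly_Mapping.single m c \<in> edge_ideal V E"
      if m: "m \<in> edge_monomials E" "Poly_Mapping.keys m \<subseteq> V" for m and c :: 'k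
    proof -
      obtain u v where uv: "{u, v} \<in> E" "u \<in> Poly_Mapping.keys m" "v \<in> Poly_Mapping.keys m"
        using m by (auto simp: edge_monomials_def)
      have ne: "u \<noteq> v" by (rule simple[OF uv(1)])
      let ?n = "m - set_mono {u, v}"
      have "?n + set_mono {u, v} = m" by (rule minus_set_mono_add) (use uv in auto)
      then have "Poly_Mapping.single m c = Poly_Mapping.single ?n c * (indet u * indet v)"
        using ne by (simp add: indet_mult_indet mult_single set_mono_def)
      moreover have "Poly_Mapping.single ?n c \<in> carrier ?R"
        using m(2) keys_minus_set_mono[of "{u, v}" m] by (auto simp: Rsimps poly_carrier_def)
      moreover have "(indet u * indet v :: ('v, 'k) polynomial) \<in> edge_ideal V E"
        by (rule subsetD[OF gen], rule CollectI, rule exI[of _ u], rule exI[of _ v]) (simp add: uv(1))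
      ultimately show ?thesis using I.I_l_closed[of "indet u * indet v" "Poly_Mapping.single ?n c"] by (simp add: Rsimps)
    qed
    have sum: "(\<Sum>m\<in>A. f m) \<in> edge_ideal V E" if "\<And>m. m \<in> A \<Longrightarrow> f m \<in> edge_ideal V E"
      for A and f :: "('v \<Rightarrow>\<^sub>0 nat) \<Rightarrow> ('v, 'k) polynomial"
      using that
    proof (induction A rule: infinite_finite_induct)
      case (insert x A)
      then show ?case using I.a_closed[of "f x" "\<Sum>m\<in>A. f m"] by (simp add: Rsimps)
    qed (use I.zero_closed in \<open>simp_all add: Rsimps\<close>)
    have "(\<Sum>m\<in>Poly_Mapping.keys p. Poly_Mapping.single m (Poly_Mapping.lookup p m)) \<in> edge_ideal V E"
      using p by (intro sum mono) (auto simp: monomial_ideal_def poly_carrier_def)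
    then show "p \<in> edge_ideal V E" using poly_eq_sum_single[of p] by simp
  qed
qed

section \<open>Betti numbers of monomial ideals\<close>

lemma qdim_image_inj:
  assumes e: "Vector_Spaces.linear s1 s2 e" and inj: "inj e" and Z: "module.subspace s1 Z"
    and q: "qdim s1 Z B n"
  shows "qdim s2 (e ` Z) (e ` B) n"
proof -
  interpret e: Vector_Spaces.linear s1 s2 e by fact
  obtain b where b: "basis_mod s1 Z B {..<n} b" using q unfolding qdim_def by blast
  have s: "e (\<Sum>i<n. s1 (c i) (b i)) = (\<Sum>i<n. s2 (c i) (e (b i)))" for c by (simp add: e.sum e.scale)
  have "basis_mod s2 (e ` Z) (e ` B) {..<n} (\<lambda>i. e (b i))"
    unfolding basis_mod_def
  proof (intro conjI ballI allI impI)
    fix i assume "i \<in> {..<n}" then show "e (b i) \<in> e ` Z" using b unfolding basis_mod_def by blast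
  next
    fix z assume "z \<in> e ` Z"
    then obtain y where y: "y \<in> Z" "z = e y" by blast
    then obtain c where "y - (\<Sum>i<n. s1 (c i) (b i)) \<in> B" using b unfolding basis_mod_def by blast
    then have "e (y - (\<Sum>i<n. s1 (c i) (b i))) \<in> e ` B" by blast
    then show "\<exists>c. z - (\<Sum>i<n. s2 (c i) (e (b i))) \<in> e ` B" unfolding e.diff s y(2) by blast
  next
    fix c i assume "(\<Sum>i<n. s2 (c i) (e (b i))) \<in> e ` B" and i: "i \<in> {..<n}"
    then have "(\<Sum>i<n. s1 (c i) (b i)) \<in> B" unfolding s[symmetric] using inj by (auto dest: injD)
    then show "c i = 0" using b i unfolding basis_mod_def by blast
  qed
  then show ?thesis unfolding qdim_def by blast
qed

context koszul
begin

text \<open>Passes from polynomials to vectors of rank one, whose only entry is at position \<open>0\<close>.\<close>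

definition at_zero :: "('v set \<Rightarrow> ('v, 'k::field) polynomial) \<Rightarrow> 'v set \<Rightarrow> ('v, 'k) pvec" where
  "at_zero f S l = (if l = 0 then f S else 0)"

lemma linear_at_zero: "Vector_Spaces.linear chain_scale mscale (at_zero :: ('v set \<Rightarrow> ('v, 'k::field) polynomial) \<Rightarrow> _)"
  unfolding Vector_Spaces.linear_iff
  by (intro conjI allI vector_space_chain_scale vector_space_mscale)
    (auto simp: fun_eq_iff at_zero_def chain_scale_def poly_scale_def mscale_def vmult_def)

lemma inj_at_zero: "inj at_zero"
proof (rule injI)
  fix f h :: "'v set \<Rightarrow> ('v, 'k::field) polynomial" assume e: "at_zero f = at_zero h"
  show "f = h"
  proof
    fix S show "f S = h S" using fun_cong[OF fun_cong[OF e, of S], of 0] by (simp add: at_zero_def)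
  qed
qed

lemma ideal_module_monomial:
  "z \<in> ideal_module (monomial_ideal V L) j \<longleftrightarrow> z 0 \<in> mono_piece V L j \<and> (\<forall>l. l \<noteq> 0 \<longrightarrow> z l = 0)"
  unfolding ideal_module_def free_piece_def monomial_ideal_def mono_piece_def
  by (auto simp: graded_piece_def)

lemma at_zero_kchains:
  "at_zero ` kchains L p j = mchains (ideal_module (monomial_ideal V L)) p j"
proof
  show "at_zero ` kchains L p j \<subseteq> mchains (ideal_module (monomial_ideal V L)) p j"
  proof clarify
    fix f assume f: "f \<in> kchains L p j"
    have "if S \<subseteq> V \<and> card S = p then at_zero f S \<in> ideal_module (monomial_ideal V L) (j - int p) else at_zero f S = 0" for S
    proof -
      have "if S \<subseteq> V \<and> card S = p then f S \<in> mono_piece V L (j - int p) else f S = 0"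
        using f unfolding kchains_def by blast
      then show ?thesis by (auto simp: ideal_module_monomial at_zero_def split: if_splits)
    qed
    then show "at_zero f \<in> mchains (ideal_module (monomial_ideal V L)) p j" unfolding mchains_def by blast
  qed
  show "mchains (ideal_module (monomial_ideal V L)) p j \<subseteq> at_zero ` kchains L p j"
  proof
    fix h assume h: "h \<in> mchains (ideal_module (monomial_ideal V L)) p j"
    have hS: "if S \<subseteq> V \<and> card S = p then h S 0 \<in> mono_piece V L (j - int p) \<and> (\<forall>l. l \<noteq> 0 \<longrightarrow> h S l = 0) else h S = 0" for S
      using mchains_inside[OF h, of S] mchains_outside[OF h, of S] by (auto simp: ideal_module_monomial)
    have "(if S \<subseteq> V \<and> card S = p then h S 0 \<in> mono_piece V L (j - int p) else h S 0 = 0) \<and> (\<forall>l. l \<noteq> 0 \<longrightarrow> h S l = 0)" for S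
      using hS[of S] by (auto split: if_splits)
    then have "(\<lambda>S. h S 0) \<in> kchains L p j" "at_zero (\<lambda>S. h S 0) = h"
      unfolding kchains_def by (blast, auto simp: at_zero_def fun_eq_iff)
    then show "h \<in> at_zero ` kchains L p j" by (metis imageI)
  qed
qed

lemma mdiff_at_zero: "mdiff (at_zero f) = at_zero (kdiff f)"
proof (intro ext)
  fix S l
  have "(\<lambda>S. at_zero f S l) = (if l = 0 then f else 0)" by (auto simp: at_zero_def)
  then show "mdiff (at_zero f) S l = at_zero (kdiff f) S l"
    unfolding mdiff_apply by (simp add: at_zero_def kdiff_def)
qed

lemma koszul_betti_monomial_ideal:
  assumes "qdim chain_scale (kcycles L p j :: ('v set \<Rightarrow> ('v, 'k::field) polynomial) set) (kboundaries L p j) n"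
  shows "koszul_betti (ideal_module (monomial_ideal V L :: ('v, 'k) polynomial set)) p j n"
proof -
  let ?M = "ideal_module (monomial_ideal V L :: ('v, 'k) polynomial set)"
  interpret a: Vector_Spaces.linear chain_scale mscale "at_zero :: ('v set \<Rightarrow> ('v, 'k) polynomial) \<Rightarrow> _"
    by (rule linear_at_zero)
  interpret k: Vector_Spaces.linear chain_scale chain_scale "kdiff :: ('v set \<Rightarrow> ('v, 'k) polynomial) \<Rightarrow> _"
    by (rule linear_kdiff)
  have Z: "at_zero ` kcycles L p j = mcycles ?M p j"
  proof -
    have "mdiff (at_zero f) = 0 \<longleftrightarrow> kdiff f = 0" for f :: "'v set \<Rightarrow> ('v, 'k) polynomial"
      unfolding mdiff_at_zero using inj_at_zero a.zero by (metis injD)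
    then show ?thesis unfolding kcycles_def mcycles_def at_zero_kchains[symmetric] by auto
  qed
  have B: "at_zero ` kboundaries L p j = mboundaries ?M p j"
    unfolding kboundaries_def mboundaries_def at_zero_kchains[symmetric] image_image mdiff_at_zero ..
  have sub: "a.vs1.subspace (kcycles L p j :: ('v set \<Rightarrow> ('v, 'k) polynomial) set)"
  proof -
    have C: "a.vs1.subspace (kchains L p j :: ('v set \<Rightarrow> ('v, 'k) polynomial) set)" by (rule subspace_kchains)
    show ?thesis unfolding kcycles_def a.vs1.subspace_def
      using a.vs1.subspace_0[OF C] a.vs1.subspace_add[OF C] a.vs1.subspace_scale[OF C]
      by (simp add: k.add k.scale k.zero)
  qed
  show ?thesis unfolding koszul_betti_def Z[symmetric] B[symmetric]
    by (rule qdim_image_inj[OF linear_at_zero inj_at_zero sub assms])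
qed

text \<open>Betti numbers are defined by minimal resolutions; every one of them is a sequence of minimal
  covers, whose generators are counted by Koszul homology, and there is one because these dimensions
  vanish in high degrees.\<close>

theorem graded_betti_monomial_ideal:
  fixes L :: "('v \<Rightarrow>\<^sub>0 nat) set"
  assumes up: "\<And>m n. m \<in> L \<Longrightarrow> n + m \<in> L"
    and b: "\<And>p j. qdim chain_scale (kcycles L p j :: ('v set \<Rightarrow> ('v, 'k::field) polynomial) set) (kboundaries L p j) (b p j)"
    and bJ: "\<And>p j. j > J \<Longrightarrow> b p j = 0"
  shows "graded_betti V (monomial_ideal V L :: ('v, 'k) polynomial set) i j = b i j"
proof -
  let ?I = "monomial_ideal V L :: ('v, 'k) polynomial set"
  let ?M = "ideal_module ?I"
  have cl4: "q * p \<in> ?I" if "p \<in> ?I" "q \<in> poly_carrier V" for p q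
    using monomial_ideal_mult[OF up] that by blast
  have kb: "koszul_betti ?M p j (b p j)" for p j by (rule koszul_betti_monomial_ideal[OF b])
  have M: "graded_module ?M"
    unfolding graded_module_def
  proof (intro conjI allI ballI)
    show "0 \<in> ?M j" for j by (simp add: ideal_module_monomial mono_piece_iff)
    show "f + h \<in> ?M j" if "f \<in> ?M j" "h \<in> ?M j" for f h j
      using that graded_moduleD(2)[OF graded_module_free_piece, of f "[0]" j h] monomial_ideal_closed(2)
      by (auto simp: ideal_module_def)
    show "vmult q f \<in> ?M (i + j)" if "q \<in> graded_piece V i" "f \<in> ?M j" for i j q f
      using that graded_moduleD(3)[OF graded_module_free_piece, of q i f "[0]" j] cl4[of "f 0" q]
      by (auto simp: ideal_module_def vmult_def graded_piece_def)
  qed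
  have low: "?M j \<subseteq> {0}" if "j < 0" for j
  proof
    fix f assume f: "f \<in> ?M j"
    then have "f 0 \<in> mono_piece V L j" by (simp add: ideal_module_monomial)
    then have "Poly_Mapping.lookup (f 0) m = 0" for m using that by (auto simp: mono_piece_iff)
    then have "f 0 = 0" by (simp add: poly_mapping_eqI)
    then have "f l = 0" for l using f by (cases "l = 0") (auto simp: ideal_module_monomial)
    then show "f \<in> {0}" by auto
  qed
  have ex: "\<exists>d \<phi>. minimal_graded_free_resolution V ?I d \<phi>"
  proof -
    obtain d g where "cover_sequence ?M d g" using cover_sequence_exists[OF M low kb bJ] by blast
    then have "minimal_graded_free_resolution V ?I d
     (\<lambda>i. mat (length (target_degrees d i)) (length (d i)) (\<lambda>(l, k). g i k l))"
    proof (rule resolution_of_cover_sequence)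
      show "?I \<subseteq> poly_carrier V" by (auto simp: monomial_ideal_def)
      show "hcomp j p \<in> ?I" if "p \<in> ?I" for p j
        using that by (auto simp: monomial_ideal_def poly_carrier_def in_keys_iff lookup_hcomp split: if_splits)
    qed (use monomial_ideal_closed cl4 in auto)
    then show ?thesis by blast
  qed
  have un: "count_list (d i) j = b i j" if r: "minimal_graded_free_resolution V ?I d \<phi>" for d \<phi>
  proof -
    obtain g where "cover_sequence ?M d g" using cover_sequence_of_resolution[OF r M] by blast
    then show ?thesis by (rule cover_sequence_betti[OF _ kb])
  qed
  show ?thesis unfolding graded_betti_def
    by (rule the_equality) (use ex un in \<open>metis+\<close>)
qed

end

section \<open>The cycle as a cyclic sequence of vertices\<close>

text \<open>The cycle is traversed as \<open>x\<^sub>1, y\<^sub>1, x\<^sub>2, y\<^sub>2, \<dots>\<close>, numbered from \<open>0\<close>, so that the sides are the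
  even and the odd numbers and the edges join cyclically consecutive numbers.\<close>

definition cycle_vertex :: "nat \<Rightarrow> vertex" where
  "cycle_vertex a = (if even a then vx (a div 2 + 1) else vy (a div 2 + 1))"

definition vertex_rank :: "vertex \<Rightarrow> nat" where
  "vertex_rank v = (case v of vx i \<Rightarrow> 2 * i | vy i \<Rightarrow> 2 * i + 1)"

definition is_vx :: "vertex \<Rightarrow> bool" where
  "is_vx v = (case v of vx i \<Rightarrow> True | vy i \<Rightarrow> False)"

lemma is_vx_cycle_vertex: "is_vx (cycle_vertex a) \<longleftrightarrow> even a"
  by (simp add: is_vx_def cycle_vertex_def)

lemma inj_vertex_rank: "inj vertex_rank"
proof (rule injI)
  fix u v assume "vertex_rank u = vertex_rank v"
  then show "u = v" by (cases u; cases v) (simp_all add: vertex_rank_def, presburger+)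
qed

lemma inj_cycle_vertex: "inj cycle_vertex"
proof (rule injI)
  fix a b assume "cycle_vertex a = cycle_vertex b"
  then show "a = b" by (auto simp: cycle_vertex_def split: if_splits elim!: evenE oddE)
qed

lemma cycle_vertex_simps [simp]:
  "cycle_vertex (2 * i) = vx (i + 1)" "cycle_vertex (Suc (2 * i)) = vy (i + 1)"
  by (simp_all add: cycle_vertex_def)

lemma lessThan_double: "{..<2 * s} = (\<lambda>i. 2 * i) ` {..<s} \<union> (\<lambda>i. Suc (2 * i)) ` {..<s}" for s :: nat
proof
  show "{..<2 * s} \<subseteq> (\<lambda>i. 2 * i) ` {..<s} \<union> (\<lambda>i. Suc (2 * i)) ` {..<s}"
  proof
    fix a assume a: "a \<in> {..<2 * s}"
    show "a \<in> (\<lambda>i. 2 * i) ` {..<s} \<union> (\<lambda>i. Suc (2 * i)) ` {..<s}"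
    proof (cases "even a")
      case True then show ?thesis using a by (auto elim!: evenE)
    next
      case False then show ?thesis using a by (auto elim!: oddE)
    qed
  qed
qed auto

lemma image_Suc_atLeastAtMost: "f ` {1..s} = (\<lambda>i. f (i + 1)) ` {..<s}" for s :: nat
proof -
  have "{1..s} = Suc ` {..<s}" by (simp add: image_Suc_lessThan)
  then show ?thesis by (simp add: image_image)
qed

lemma cycle_vertex_image: "cycle_vertex ` {..<2 * s} = cycle_X s \<union> cycle_Y s"
  unfolding cycle_X_def cycle_Y_def lessThan_double image_Un image_image image_Suc_atLeastAtMost by simp

lemma cycle_X_iff: "v \<in> cycle_X s \<longleftrightarrow> v \<in> cycle_vertex ` {..<2 * s} \<and> is_vx v"
  by (auto simp: cycle_vertex_image cycle_X_def cycle_Y_def is_vx_def)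

lemma cycle_Y_iff: "v \<in> cycle_Y s \<longleftrightarrow> v \<in> cycle_vertex ` {..<2 * s} \<and> \<not> is_vx v"
  by (auto simp: cycle_vertex_image cycle_X_def cycle_Y_def is_vx_def)

lemma even_cycle_edges_eq:
  assumes "s > 0"
  shows "even_cycle_edges s = {{cycle_vertex a, cycle_vertex (csuc (2 * s) a)} | a. a < 2 * s}"
proof -
  let ?e = "\<lambda>a. {cycle_vertex a, cycle_vertex (csuc (2 * s) a)}"
  have "{?e a | a. a < 2 * s} = ?e ` {..<2 * s}" by blast
  also have "\<dots> = (\<lambda>i. ?e (2 * i)) ` {..<s} \<union> (\<lambda>i. ?e (Suc (2 * i))) ` {..<s}"
    unfolding lessThan_double image_Un image_image ..
  also have "(\<lambda>i. ?e (2 * i)) ` {..<s} = (\<lambda>i. {vx (i + 1), vy (i + 1)}) ` {..<s}"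
  proof (rule image_cong[OF refl])
    fix i assume "i \<in> {..<s}"
    then have "csuc (2 * s) (2 * i) = Suc (2 * i)" by (simp add: csuc_def)
    then show "?e (2 * i) = {vx (i + 1), vy (i + 1)}" by simp
  qed
  also have "\<dots> = {{vx i, vy i} | i. i \<in> {1..s}}"
    unfolding Setcompr_eq_image image_Suc_atLeastAtMost ..
  also have "(\<lambda>i. ?e (Suc (2 * i))) ` {..<s} = {{vy i, vx (i + 1)} | i. i \<in> {1..<s}} \<union> {{vy s, vx 1}}"
  proof -
    obtain s' where s': "s = Suc s'" using assms by (cases s) auto
    have "{..<s} = insert s' {..<s'}" by (auto simp: s')
    then have "(\<lambda>i. ?e (Suc (2 * i))) ` {..<s} = insert (?e (Suc (2 * s'))) ((\<lambda>i. ?e (Suc (2 * i))) ` {..<s'})" by simp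
    also have "?e (Suc (2 * s')) = {vy s, vx 1}"
    proof -
      have "csuc (2 * s) (Suc (2 * s')) = 2 * 0" by (simp add: csuc_def s')
      then show ?thesis using cycle_vertex_simps(1)[of 0] by (simp add: s' del: cycle_vertex_simps(1))
    qed
    also have "(\<lambda>i. ?e (Suc (2 * i))) ` {..<s'} = (\<lambda>i. {vy (i + 1), vx (i + 1 + 1)}) ` {..<s'}"
    proof (rule image_cong[OF refl])
      fix i assume "i \<in> {..<s'}"
      then have "csuc (2 * s) (Suc (2 * i)) = 2 * (i + 1)" by (simp add: csuc_def s')
      then show "?e (Suc (2 * i)) = {vy (i + 1), vx (i + 1 + 1)}"
        using cycle_vertex_simps(1)[of "i + 1"] cycle_vertex_simps(2)[of i] by metis
    qed
    also have "\<dots> = (\<lambda>i. {vy i, vx (i + 1)}) ` {1..s'}"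
      using image_Suc_atLeastAtMost[of "\<lambda>i. {vy i, vx (i + 1)}" s'] by simp
    also have "{1..s'} = {1..<s}" by (auto simp: s')
    finally show ?thesis unfolding Setcompr_eq_image by simp
  qed
  finally show ?thesis unfolding even_cycle_edges_def by (simp only: Un_assoc)
qed

section \<open>Betti numbers of the bipartite complement\<close>

text \<open>The contribution of the squarefree multidegree with support \<open>P\<close> to the Koszul homology at place
  \<open>p\<close>. A set on one side contributes nothing, as it contains no edge of the bipartite complement.\<close>

definition position_number :: "nat \<Rightarrow> nat set \<Rightarrow> nat \<Rightarrow> nat" where
  "position_number t P p =
    (if (\<exists>a\<in>P. even a) \<and> (\<exists>a\<in>P. odd a) then
       if card P = p + 2 then if cycle_arcs t P = {} then 1 else 0
       else if card P = p + 3 then card (cyclic_starts 2 t P) - 1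
       else if card P = p + 4 then if P = {..<t} then 1 else 0
       else 0
     else 0)"

definition bc_edges :: "nat \<Rightarrow> vertex set set" where
  "bc_edges s = bipartite_complement (cycle_X s) (cycle_Y s) (even_cycle_edges s)"

definition bc_vertices :: "nat \<Rightarrow> vertex set" where
  "bc_vertices s = cycle_vertex ` {..<2 * s}"

definition positions :: "nat \<Rightarrow> vertex set \<Rightarrow> nat set" where
  "positions s W = {a. a < 2 * s \<and> cycle_vertex a \<in> W}"

definition bc_betti :: "nat \<Rightarrow> nat \<Rightarrow> int \<Rightarrow> nat" where
  "bc_betti s p j = (\<Sum>P\<in>{P. P \<subseteq> {..<2 * s} \<and> int (card P) = j}. position_number (2 * s) P p)"

lemma koszul_bc: "koszul (bc_vertices s) vertex_rank"
  by unfold_locales (auto simp: bc_vertices_def intro: inj_on_subset[OF inj_vertex_rank])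

lemma bc_edges_iff:
  assumes "s > 0"
  shows "e \<in> bc_edges s \<longleftrightarrow> (\<exists>x y. e = {x, y} \<and> x \<in> bc_vertices s \<and> is_vx x \<and> y \<in> bc_vertices s \<and> \<not> is_vx y
     \<and> (\<forall>a<2 * s. {x, y} \<noteq> {cycle_vertex a, cycle_vertex (csuc (2 * s) a)}))"
  unfolding bc_edges_def bipartite_complement_def even_cycle_edges_eq[OF assms] cycle_X_iff cycle_Y_iff bc_vertices_def
  by blast

text \<open>A variable with exponent at least two divides all monomials involved, whether or not it belongs to
  \<open>T\<close>, so the complex is a cone over it. In squarefree multidegrees the complex is the one on
  nonfaces.\<close>

lemma qdim_bc_degree:
  fixes \<alpha> :: "vertex \<Rightarrow>\<^sub>0 nat"
  assumes s: "s \<ge> 3" and \<alpha>: "\<alpha> \<in> koszul.multidegrees (bc_vertices s) j"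
  shows "qdim fscale
      (local_cycles (\<lambda>v T. koszul.ksign vertex_rank v (Poly_Mapping.keys \<alpha> - T) :: 'k::field) (Poly_Mapping.keys \<alpha>)
         (koszul.mono_complex (edge_monomials (bc_edges s)) \<alpha>) p)
      (local_boundaries (\<lambda>v T. koszul.ksign vertex_rank v (Poly_Mapping.keys \<alpha> - T)) (Poly_Mapping.keys \<alpha>)
         (koszul.mono_complex (edge_monomials (bc_edges s)) \<alpha>) p)
      (if \<exists>v. Poly_Mapping.lookup \<alpha> v \<ge> 2 then 0 else position_number (2 * s) (positions s (Poly_Mapping.keys \<alpha>)) p)"
proof -
  interpret K: koszul "bc_vertices s" vertex_rank by (rule koszul_bc)
  let ?U = "Poly_Mapping.keys \<alpha>"
  let ?L = "edge_monomials (bc_edges s)"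
  let ?C = "K.mono_complex ?L \<alpha>"
  let ?\<sigma> = "\<lambda>v T. K.ksign v (?U - T) :: 'k"
  have UV: "?U \<subseteq> bc_vertices s" using \<alpha> by (simp add: K.multidegrees_def)
  have alt: "alt_signs ?U ?\<sigma>" by (rule K.alt_signs_ksign[OF UV])
  have keysT: "Poly_Mapping.keys (\<alpha> - set_mono (?U - T)) = T \<union> {v \<in> ?U. Poly_Mapping.lookup \<alpha> v \<ge> 2}"
    if "T \<subseteq> ?U" for T
    using that by (subst keys_minus_set_mono) auto
  have C_iff: "T \<in> ?C \<longleftrightarrow> T \<subseteq> ?U \<and> (\<exists>u v. {u, v} \<in> bc_edges s \<and>
      {u, v} \<subseteq> T \<union> {v \<in> ?U. Poly_Mapping.lookup \<alpha> v \<ge> 2})" for T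
  proof (cases "T \<subseteq> ?U")
    case True
    have "T \<in> ?C \<longleftrightarrow> (\<exists>u v. {u, v} \<in> bc_edges s \<and> u \<in> Poly_Mapping.keys (\<alpha> - set_mono (?U - T))
        \<and> v \<in> Poly_Mapping.keys (\<alpha> - set_mono (?U - T)))"
      using True by (simp add: K.mono_complex_def edge_monomials_def)
    also have "\<dots> \<longleftrightarrow> (\<exists>u v. {u, v} \<in> bc_edges s \<and> {u, v} \<subseteq> T \<union> {v \<in> ?U. Poly_Mapping.lookup \<alpha> v \<ge> 2})"
      unfolding keysT[OF True] by (simp only: insert_subset empty_subsetI simp_thms)
    finally show ?thesis using True by (simp only: simp_thms)
  qed (simp add: K.mono_complex_def)
  show ?thesis
  proof (cases "\<exists>v. Poly_Mapping.lookup \<alpha> v \<ge> 2")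
    case True
    then obtain v where v: "Poly_Mapping.lookup \<alpha> v \<ge> 2" by blast
    then have vU: "v \<in> ?U" by (simp add: in_keys_iff)
    have "local_cycles ?\<sigma> ?U ?C p \<subseteq> local_boundaries ?\<sigma> ?U ?C p"
    proof (rule local_cone_acyclic[OF alt _ vU])
      fix T assume T: "T \<subseteq> ?U" "insert v T \<in> ?C"
      have "insert v T \<union> {v \<in> ?U. Poly_Mapping.lookup \<alpha> v \<ge> 2} = T \<union> {v \<in> ?U. Poly_Mapping.lookup \<alpha> v \<ge> 2}"
        using v vU by auto
      then show "T \<in> ?C" using T unfolding C_iff by simp
    qed simp
    then show ?thesis using True by (simp add: qdim_zero[OF vector_space_fun])
  next
    case False
    then have sqfree: "{v \<in> ?U. Poly_Mapping.lookup \<alpha> v \<ge> 2} = {}" by auto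
    have s0: "s > 0" using s by simp
    have C_iff': "T \<in> ?C \<longleftrightarrow> T \<subseteq> ?U \<and> (\<exists>x\<in>T. \<exists>y\<in>T. is_vx x \<and> \<not> is_vx y
        \<and> (\<forall>a<2 * s. {x, y} \<noteq> {cycle_vertex a, cycle_vertex (csuc (2 * s) a)}))" for T
    proof
      assume "T \<in> ?C"
      then obtain u v where uv: "T \<subseteq> ?U" "{u, v} \<in> bc_edges s" "{u, v} \<subseteq> T" unfolding C_iff sqfree by auto
      then obtain x y where "{u, v} = {x, y}" "is_vx x" "\<not> is_vx y"
        "\<forall>a<2 * s. {x, y} \<noteq> {cycle_vertex a, cycle_vertex (csuc (2 * s) a)}" unfolding bc_edges_iff[OF s0] by blast
      then show "T \<subseteq> ?U \<and> (\<exists>x\<in>T. \<exists>y\<in>T. is_vx x \<and> \<not> is_vx y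
        \<and> (\<forall>a<2 * s. {x, y} \<noteq> {cycle_vertex a, cycle_vertex (csuc (2 * s) a)}))" using uv by blast
    next
      assume r: "T \<subseteq> ?U \<and> (\<exists>x\<in>T. \<exists>y\<in>T. is_vx x \<and> \<not> is_vx y
        \<and> (\<forall>a<2 * s. {x, y} \<noteq> {cycle_vertex a, cycle_vertex (csuc (2 * s) a)}))"
      then obtain x y where xy: "x \<in> T" "y \<in> T" "is_vx x" "\<not> is_vx y"
        "\<forall>a<2 * s. {x, y} \<noteq> {cycle_vertex a, cycle_vertex (csuc (2 * s) a)}" by blast
      have "x \<in> bc_vertices s" "y \<in> bc_vertices s" using xy r UV by auto
      then have "{x, y} \<in> bc_edges s" unfolding bc_edges_iff[OF s0]
        by (intro exI[of _ x] exI[of _ y] conjI refl xy)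
      moreover have "{x, y} \<subseteq> T \<union> {}" using xy by simp
      ultimately have "\<exists>u v. {u, v} \<in> bc_edges s \<and> {u, v} \<subseteq> T \<union> {}"
        by (intro exI[of _ x] exI[of _ y] conjI)
      then show "T \<in> ?C" unfolding C_iff sqfree using r by (intro conjI) simp_all
    qed
    let ?P = "positions s ?U"
    have ev: "(\<exists>x\<in>?U. is_vx x) \<longleftrightarrow> (\<exists>a\<in>?P. even a)" "(\<exists>x\<in>?U. \<not> is_vx x) \<longleftrightarrow> (\<exists>a\<in>?P. odd a)"
    proof -
      have "?U = cycle_vertex ` ?P" using UV by (auto simp: positions_def bc_vertices_def)
      then show "(\<exists>x\<in>?U. is_vx x) \<longleftrightarrow> (\<exists>a\<in>?P. even a)" "(\<exists>x\<in>?U. \<not> is_vx x) \<longleftrightarrow> (\<exists>a\<in>?P. odd a)"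
        by (metis (no_types, lifting) imageE imageI is_vx_cycle_vertex)+
    qed
    show ?thesis
    proof (cases "(\<exists>x\<in>?U. is_vx x) \<and> (\<exists>x\<in>?U. \<not> is_vx x)")
      case True
      interpret cycle_cochains ?U is_vx ?\<sigma> "2 * s" cycle_vertex
      proof
        show "2 * s \<ge> 6" using s by simp
        show "inj_on cycle_vertex {..<2 * s}" by (rule inj_on_subset[OF inj_cycle_vertex]) simp
        show "?U \<subseteq> cycle_vertex ` {..<2 * s}" using UV by (simp add: bc_vertices_def)
      qed (use alt True is_vx_cycle_vertex in auto)
      have C: "?C = nonfaces" unfolding nonfaces_def arc_def using C_iff' by blast
      have PP: "P = ?P" by (auto simp: P_def positions_def)
      have "card ?U = card ?P"
      proof -
        have "?U = cycle_vertex ` ?P" using UV by (auto simp: positions_def bc_vertices_def)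
        then show ?thesis by (metis card_image inj_cycle_vertex inj_on_subset subset_UNIV)
      qed
      then have "local_number p = position_number (2 * s) ?P p"
        using True ev unfolding local_number_def position_number_def PP by simp
      then show ?thesis using qdim_local[of p] False unfolding C by simp
    next
      case F: False
      have "?C = {}"
      proof (rule ccontr)
        assume "?C \<noteq> {}"
        then obtain T where "T \<in> ?C" by blast
        then show False using F unfolding C_iff' by blast
      qed
      then have "local_cycles ?\<sigma> ?U ?C p \<subseteq> {0}"
        by (auto simp: local_cycles_def local_cochains_def fun_eq_iff)
      moreover have "0 \<in> local_boundaries ?\<sigma> ?U ?C p"
      proof -
        have "(0 :: vertex set \<Rightarrow> 'k) \<in> local_cochains ?U ?C (Suc p)" by (simp add: local_cochains_def)
        moreover have "(0 :: vertex set \<Rightarrow> 'k) = (\<lambda>T. if T \<subseteq> ?U then coboundary ?\<sigma> 0 T else 0)"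
          by (auto simp: coboundary_def)
        ultimately show ?thesis unfolding local_boundaries_def by (intro image_eqI[of _ _ 0])
      qed
      ultimately have "qdim fscale (local_cycles ?\<sigma> ?U ?C p) (local_boundaries ?\<sigma> ?U ?C p) 0"
        by (intro qdim_zero[OF vector_space_fun]) blast
      moreover have "position_number (2 * s) ?P p = 0" using F ev by (auto simp: position_number_def)
      ultimately show ?thesis using False by simp
    qed
  qed
qed

text \<open>Squarefree multidegrees correspond to sets of vertices, and these to sets of positions.\<close>

lemma sum_multidegrees:
  assumes s: "s \<ge> 3"
  shows "(\<Sum>\<alpha>\<in>koszul.multidegrees (bc_vertices s) j.
      if \<exists>v. Poly_Mapping.lookup \<alpha> v \<ge> 2 then 0 else position_number (2 * s) (positions s (Poly_Mapping.keys \<alpha>)) p)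
    = bc_betti s p j"
proof -
  interpret K: koszul "bc_vertices s" vertex_rank by (rule koszul_bc)
  let ?f = "\<lambda>\<alpha>. position_number (2 * s) (positions s (Poly_Mapping.keys \<alpha>)) p"
  let ?S = "{\<alpha> \<in> K.multidegrees j. \<not> (\<exists>v. Poly_Mapping.lookup \<alpha> v \<ge> 2)}"
  let ?Ps = "{P. P \<subseteq> {..<2 * s} \<and> int (card P) = j}"
  have keysP: "Poly_Mapping.keys \<alpha> = cycle_vertex ` positions s (Poly_Mapping.keys \<alpha>)" if "\<alpha> \<in> K.multidegrees j" for \<alpha>
  proof -
    have "Poly_Mapping.keys \<alpha> \<subseteq> bc_vertices s" using that by (simp add: K.multidegrees_def)
    then show ?thesis by (auto simp: positions_def bc_vertices_def)
  qed
  have pos: "positions s (cycle_vertex ` P) = P" if "P \<subseteq> {..<2 * s}" for P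
    using that inj_cycle_vertex by (auto simp: positions_def inj_def)
  have finP: "finite P" if "P \<subseteq> {..<2 * s}" for P using that finite_subset by blast
  have sqf: "set_mono (Poly_Mapping.keys \<alpha>) = \<alpha>" if "\<alpha> \<in> ?S" for \<alpha>
  proof (rule poly_mapping_eqI)
    fix v
    have "\<not> Poly_Mapping.lookup \<alpha> v \<ge> 2" using that by blast
    then show "Poly_Mapping.lookup (set_mono (Poly_Mapping.keys \<alpha>)) v = Poly_Mapping.lookup \<alpha> v"
      by (auto simp: lookup_set_mono in_keys_iff)
  qed
  have cardP: "card (cycle_vertex ` P) = card P" for P
    by (rule card_image) (rule inj_on_subset[OF inj_cycle_vertex subset_UNIV])
  have "(\<Sum>\<alpha>\<in>K.multidegrees j. if \<exists>v. Poly_Mapping.lookup \<alpha> v \<ge> 2 then 0 else ?f \<alpha>) = (\<Sum>\<alpha>\<in>?S. ?f \<alpha>)"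
    using K.finite_multidegrees by (intro sum.mono_neutral_cong_right) auto
  also have "\<dots> = (\<Sum>P\<in>?Ps. position_number (2 * s) P p)"
  proof (rule sum.reindex_bij_witness[where i = "\<lambda>P. set_mono (cycle_vertex ` P)" and j = "\<lambda>\<alpha>. positions s (Poly_Mapping.keys \<alpha>)"])
    fix \<alpha> assume a: "\<alpha> \<in> ?S"
    then have am: "\<alpha> \<in> K.multidegrees j" by blast
    show "set_mono (cycle_vertex ` positions s (Poly_Mapping.keys \<alpha>)) = \<alpha>"
      unfolding keysP[OF am, symmetric] by (rule sqf[OF a])
    have "mono_degree \<alpha> = card (Poly_Mapping.keys \<alpha>)"
      using mono_degree_set_mono[of "Poly_Mapping.keys \<alpha>"] unfolding sqf[OF a] by simp
    also have "\<dots> = card (positions s (Poly_Mapping.keys \<alpha>))" by (subst keysP[OF am]) (rule cardP)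
    finally have "int (card (positions s (Poly_Mapping.keys \<alpha>))) = j" using am by (simp add: K.multidegrees_def)
    then show "positions s (Poly_Mapping.keys \<alpha>) \<in> ?Ps" by (auto simp: positions_def)
  next
    fix P assume P: "P \<in> ?Ps"
    then have fin: "finite (cycle_vertex ` P)" using finP by blast
    show "positions s (Poly_Mapping.keys (set_mono (cycle_vertex ` P))) = P"
      unfolding keys_set_mono[OF fin] using pos P by blast
    have "cycle_vertex ` P \<subseteq> bc_vertices s" using P by (auto simp: bc_vertices_def)
    then have "set_mono (cycle_vertex ` P) \<in> K.multidegrees j"
      using P cardP[of P] by (simp add: K.multidegrees_def keys_set_mono[OF fin] mono_degree_set_mono[OF fin])
    moreover have "\<not> (\<exists>v. Poly_Mapping.lookup (set_mono (cycle_vertex ` P)) v \<ge> 2)"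
      by (simp add: lookup_set_mono[OF fin])
    ultimately show "set_mono (cycle_vertex ` P) \<in> ?S" by blast
  qed simp
  finally show ?thesis by (simp add: bc_betti_def)
qed

lemma bc_betti_large: "j > int (2 * s) \<Longrightarrow> bc_betti s p j = 0"
proof -
  assume j: "j > int (2 * s)"
  have "int (card P) \<noteq> j" if "P \<subseteq> {..<2 * s}" for P
    using card_mono[OF _ that] j by simp
  then have "{P. P \<subseteq> {..<2 * s} \<and> int (card P) = j} = {}" by blast
  then show ?thesis unfolding bc_betti_def by (simp only: sum.empty)
qed

lemma graded_betti_bc:
  assumes s: "s \<ge> 3"
  shows "graded_betti (cycle_X s \<union> cycle_Y s)
     (edge_ideal (cycle_X s \<union> cycle_Y s) (bipartite_complement (cycle_X s) (cycle_Y s) (even_cycle_edges s))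
        :: (vertex, 'k::field) polynomial set) i j = bc_betti s i j"
proof -
  interpret K: koszul "bc_vertices s" vertex_rank by (rule koszul_bc)
  have V: "cycle_X s \<union> cycle_Y s = bc_vertices s" unfolding bc_vertices_def cycle_vertex_image ..
  have s0: "s > 0" using s by simp
  have I: "edge_ideal (bc_vertices s) (bc_edges s)
     = (monomial_ideal (bc_vertices s) (edge_monomials (bc_edges s)) :: (vertex, 'k) polynomial set)"
  proof (rule edge_ideal_eq)
    show "e \<subseteq> bc_vertices s" if "e \<in> bc_edges s" for e using that unfolding bc_edges_iff[OF s0] by blast
    show "u \<noteq> v" if "{u, v} \<in> bc_edges s" for u v using that unfolding bc_edges_iff[OF s0] by (auto simp: doubleton_eq_iff)
  qed
  show ?thesis
    unfolding V bc_edges_def[symmetric] I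
  proof (rule K.graded_betti_monomial_ideal[where J = "int (2 * s)"])
    show "n + m \<in> edge_monomials (bc_edges s)" if "m \<in> edge_monomials (bc_edges s)" for m n
      by (rule edge_monomials_up[OF that])
    show "qdim K.chain_scale (K.kcycles (edge_monomials (bc_edges s)) p j :: (vertex set \<Rightarrow> (vertex, 'k) polynomial) set)
       (K.kboundaries (edge_monomials (bc_edges s)) p j) (bc_betti s p j)" for p j
      unfolding sum_multidegrees[OF s, symmetric]
      by (rule K.qdim_koszul_by_multidegree) (rule qdim_bc_degree[OF s])
    show "bc_betti s p j = 0" if "j > int (2 * s)" for p j using bc_betti_large[OF that] .
  qed
qed

section \<open>The entries of the Betti diagram\<close>

lemma cycle_arcs_empty_iff:
  assumes "P \<subseteq> {..<t}"
  shows "cycle_arcs t P = {} \<longleftrightarrow> cyclic_independent t P"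
  using assms by (auto simp: cycle_arcs_def cyclic_independent_def csuc_mod)

lemma bc_betti_row_2:
  "bc_betti s p (int p + 2) = card {P. P \<subseteq> {..<2 * s} \<and> card P = p + 2 \<and> cyclic_independent (2 * s) P
      \<and> (\<exists>a\<in>P. even a) \<and> (\<exists>a\<in>P. odd a)}"
proof -
  let ?Ps = "{P. P \<subseteq> {..<2 * s} \<and> int (card P) = int p + 2}"
  let ?good = "\<lambda>P. cyclic_independent (2 * s) P \<and> (\<exists>a\<in>P. even a) \<and> (\<exists>a\<in>P. odd a)"
  have fin: "finite ?Ps" by (rule finite_subset[of _ "Pow {..<2 * s}"]) auto
  have "bc_betti s p (int p + 2) = (\<Sum>P\<in>?Ps. if ?good P then 1 else 0)"
    unfolding bc_betti_def by (rule sum.cong) (auto simp: position_number_def cycle_arcs_empty_iff)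
  also have "\<dots> = card (?Ps \<inter> {P. ?good P})" using fin by (simp add: sum.If_cases)
  also have "?Ps \<inter> {P. ?good P} = {P. P \<subseteq> {..<2 * s} \<and> card P = p + 2 \<and> cyclic_independent (2 * s) P
      \<and> (\<exists>a\<in>P. even a) \<and> (\<exists>a\<in>P. odd a)}" by (rule Set.set_eqI) (simp, linarith)
  finally show ?thesis .
qed

text \<open>A set on one side contains no edge of the cycle, so it need not be excluded from the sum.\<close>

lemma bc_betti_row_3:
  "bc_betti s p (int p + 3) = (\<Sum>P\<in>{P. P \<subseteq> {..<2 * s} \<and> card P = p + 3}. card (cyclic_starts 2 (2 * s) P) - 1)"
proof -
  have e: "{P. P \<subseteq> {..<2 * s} \<and> int (card P) = int p + 3} = {P. P \<subseteq> {..<2 * s} \<and> card P = p + 3}"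
    by (rule Set.set_eqI) (simp, linarith)
  show ?thesis
    unfolding bc_betti_def e
  proof (rule sum.cong[OF refl])
    fix P assume P: "P \<in> {P. P \<subseteq> {..<2 * s} \<and> card P = p + 3}"
    show "position_number (2 * s) P p = card (cyclic_starts 2 (2 * s) P) - 1"
    proof (cases "(\<exists>a\<in>P. even a) \<and> (\<exists>a\<in>P. odd a)")
      case True then show ?thesis using P by (simp add: position_number_def)
    next
      case False
      have "cyclic_starts 2 (2 * s) P = {}"
      proof (rule ccontr)
        assume "cyclic_starts 2 (2 * s) P \<noteq> {}"
        then obtain a where "a \<in> cycle_arcs (2 * s) P" using cyclic_starts_2_iff[of P "2 * s"] P by auto
        then have "a < 2 * s" "a \<in> P" "csuc (2 * s) a \<in> P" by (auto simp: cycle_arcs_def)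
        then show False using False csuc_parity[of "2 * s" a] by auto
      qed
      then show ?thesis using False by (auto simp: position_number_def)
    qed
  qed
qed

lemma bc_betti_row_4:
  assumes s: "s \<ge> 3"
  shows "bc_betti s p (int p + 4) = (if p + 4 = 2 * s then 1 else 0)"
proof -
  let ?Ps = "{P. P \<subseteq> {..<2 * s} \<and> int (card P) = int p + 4}"
  have fin: "finite ?Ps" by (rule finite_subset[of _ "Pow {..<2 * s}"]) auto
  have full: "(\<exists>a\<in>{..<2 * s}. even a)" "(\<exists>a\<in>{..<2 * s}. odd a)"
  proof -
    have "0 \<in> {..<2 * s}" "1 \<in> {..<2 * s}" using s by auto
    then show "\<exists>a\<in>{..<2 * s}. even a" "\<exists>a\<in>{..<2 * s}. odd a" by (metis even_zero odd_one)+
  qed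
  have "bc_betti s p (int p + 4) = (\<Sum>P\<in>?Ps. if P = {..<2 * s} then 1 else 0)"
    unfolding bc_betti_def by (rule sum.cong) (use full in \<open>auto simp: position_number_def\<close>)
  also have "\<dots> = (if {..<2 * s} \<in> ?Ps then 1 else 0)" using fin by (rule sum.delta)
  also have "{..<2 * s} \<in> ?Ps \<longleftrightarrow> p + 4 = 2 * s" by simp linarith
  finally show ?thesis .
qed

lemma bc_betti_other_rows:
  assumes "j \<noteq> int p + 2" "j \<noteq> int p + 3" "j \<noteq> int p + 4"
  shows "bc_betti s p j = 0"
  unfolding bc_betti_def
proof (rule sum.neutral, rule ballI)
  fix P assume "P \<in> {P. P \<subseteq> {..<2 * s} \<and> int (card P) = j}"
  then have "card P \<noteq> p + 2" "card P \<noteq> p + 3" "card P \<noteq> p + 4" using assms by auto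
  then show "position_number (2 * s) P p = 0" by (simp add: position_number_def)
qed

lemma bc_betti_linear_strand:
  assumes "s > 0" "2 \<le> j"
  shows "real (bc_betti s (j - 2) (int j)) =
    (\<Sum>k = 1..j - 1. \<Sum>c = 1..k.
        real s / real c
        * real (binom (int k - 1) (int c - 1))
        * real (binom (int s - int k - 1) (int c - 1))
        * real (binom (int s - int k - int c) (int j - int k)))"
proof -
  have "int j = int (j - 2) + 2" "j - 2 + 2 = j" using assms(2) by auto
  then show ?thesis using bc_betti_row_2[of s "j - 2"] card_independent_sets[OF assms(1), of j] by simp
qed

lemma bc_betti_second_strand:
  assumes "s > 0" "3 \<le> j"
  shows "real (bc_betti s (j - 3) (int j)) =
    (\<Sum>m = 2..j div 2.
       real (2 * s) * ((real m - 1) / real m)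
       * real (binom (int (2 * s) - int j - 1) (int m - 1))
       * (\<Sum>a = 0..j - 2 * m.
            real (binom (int j - int m - int a - 1) (int m - 1))
            * real (binom (int (2 * s) - int j - int m) (int a))))"
proof -
  have "int j = int (j - 3) + 3" "j - 3 + 3 = j" using assms(2) by auto
  then show ?thesis using bc_betti_row_3[of s "j - 3"] sum_edge_runs[of "2 * s" j] assms(1) by simp
qed

text \<open>The summands are nonnegative, and the one for \<open>k = c = 1\<close> is positive in the given range, while
  all last factors vanish beyond it.\<close>

lemma bc_betti_row_2_nonzero_iff:
  assumes s: "s \<ge> 3"
  shows "bc_betti s i (int i + 2) \<noteq> 0 \<longleftrightarrow> i \<le> s - 3"
proof -
  let ?j = "i + 2"
  let ?f = "\<lambda>k c. real s / real c * real (binom (int k - 1) (int c - 1))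
        * real (binom (int s - int k - 1) (int c - 1)) * real (binom (int s - int k - int c) (int ?j - int k))"
  have eq: "real (bc_betti s i (int i + 2)) = (\<Sum>k = 1..?j - 1. \<Sum>c = 1..k. ?f k c)"
    using bc_betti_linear_strand[of s ?j] s by (simp add: add.commute)
  show ?thesis
  proof
    assume nz: "bc_betti s i (int i + 2) \<noteq> 0"
    show "i \<le> s - 3"
    proof (rule ccontr)
      assume "\<not> i \<le> s - 3"
      then have j: "?j \<ge> s" using s by simp
      have "(\<Sum>k = 1..?j - 1. \<Sum>c = 1..k. ?f k c) = 0"
      proof (intro sum.neutral ballI)
        fix k c :: nat assume "c \<in> {1..k}"
        then have "binom (int s - int k - int c) (int ?j - int k) = 0" using j by (auto simp: binom_def)
        then show "?f k c = 0" by simp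
      qed
      then show False using nz eq by simp
    qed
  next
    assume i: "i \<le> s - 3"
    have "?f 1 1 > 0" using i s by (simp add: binom_def)
    also have "?f 1 1 = (\<Sum>c = 1..1. ?f 1 c)" by simp
    also have "\<dots> \<le> (\<Sum>k = 1..?j - 1. \<Sum>c = 1..k. ?f k c)"
      by (rule member_le_sum[of 1 _ "\<lambda>k. \<Sum>c = 1..k. ?f k c"]) (auto intro!: sum_nonneg)
    finally show "bc_betti s i (int i + 2) \<noteq> 0" unfolding eq[symmetric] by simp
  qed
qed

text \<open>The summands are nonnegative, and the one for \<open>m = 2\<close>, \<open>a = 0\<close> is positive in the given range;
  for \<open>i = 0\<close> the sum is empty, and above the range the binomial coefficient in front of the inner
  sum vanishes for all \<open>m \<ge> 2\<close>.\<close>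

lemma bc_betti_row_3_nonzero_iff:
  assumes s: "s \<ge> 3"
  shows "bc_betti s i (int i + 3) \<noteq> 0 \<longleftrightarrow> 1 \<le> i \<and> i \<le> 2 * s - 5"
proof -
  let ?j = "i + 3" and ?t = "2 * s"
  let ?g = "\<lambda>m a. real (binom (int ?j - int m - int a - 1) (int m - 1)) * real (binom (int ?t - int ?j - int m) (int a))"
  let ?f = "\<lambda>m. real ?t * ((real m - 1) / real m) * real (binom (int ?t - int ?j - 1) (int m - 1))
       * (\<Sum>a = 0..?j - 2 * m. ?g m a)"
  have eq: "real (bc_betti s i (int i + 3)) = (\<Sum>m = 2..?j div 2. ?f m)"
    using bc_betti_second_strand[of s ?j] s by (simp add: add.commute)
  show ?thesis
  proof
    assume nz: "bc_betti s i (int i + 3) \<noteq> 0"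
    then have "(\<Sum>m = 2..?j div 2. ?f m) \<noteq> 0" unfolding eq[symmetric] by simp
    then obtain m where m: "m \<in> {2..?j div 2}" "?f m \<noteq> 0" by (meson sum.neutral)
    then have "binom (int ?t - int ?j - 1) (int m - 1) \<noteq> 0" by auto
    then have "int m - 1 \<le> int ?t - int ?j - 1" by (auto simp: binom_def split: if_splits)
    then show "1 \<le> i \<and> i \<le> 2 * s - 5" using m(1) by auto
  next
    assume i: "1 \<le> i \<and> i \<le> 2 * s - 5"
    have i': "int i + 5 \<le> 2 * int s" using i s by arith
    have "0 < ?g 2 0" using i i' by (simp add: binom_def)
    also have "?g 2 0 \<le> (\<Sum>a = 0..?j - 2 * 2. ?g 2 a)"
      by (rule member_le_sum[of 0 _ "?g 2"]) auto
    finally have "0 < (\<Sum>a = 0..?j - 2 * 2. ?g 2 a)" .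
    moreover have "0 < real (binom (int ?t - int ?j - 1) (int 2 - 1))" using i' by (simp add: binom_def)
    moreover have "0 < real ?t" "0 < (real 2 - 1) / real 2" using s by simp_all
    ultimately have "0 < ?f 2" by (intro mult_pos_pos)
    also have "?f 2 \<le> (\<Sum>m = 2..?j div 2. ?f m)"
    proof (rule member_le_sum[of 2 _ ?f])
      show "0 \<le> ?f m" if "m \<in> {2..?j div 2} - {2}" for m
        using that by (intro mult_nonneg_nonneg sum_nonneg divide_nonneg_nonneg of_nat_0_le_iff) auto
    qed (use i in auto)
    finally show "bc_betti s i (int i + 3) \<noteq> 0" unfolding eq[symmetric] by simp
  qed
qed

lemma bc_betti_positions:
  assumes s: "s \<ge> 3"
  shows "{(i, j). bc_betti s i j \<noteq> 0} =
        {(i, int i + 2) | i. 0 \<le> i \<and> i \<le> s - 3}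
        \<union> {(i, int i + 3) | i. 1 \<le> i \<and> i \<le> 2 * s - 5}
        \<union> {(2 * s - 4, int (2 * s))}" (is "?L = ?R")
proof -
  have "(i, j) \<in> ?L \<longleftrightarrow> (i, j) \<in> ?R" for i j
  proof -
    consider "j = int i + 2" | "j = int i + 3" | "j = int i + 4"
      | "j \<noteq> int i + 2" "j \<noteq> int i + 3" "j \<noteq> int i + 4" by blast
    then show ?thesis
    proof cases
      case 1 then show ?thesis using bc_betti_row_2_nonzero_iff[OF s, of i] s by auto
    next
      case 2 then show ?thesis using bc_betti_row_3_nonzero_iff[OF s, of i] s by auto
    next
      case 3
      have "i + 4 = 2 * s \<longleftrightarrow> i = 2 * s - 4 \<and> int i + 4 = int (2 * s)" using s by auto
      then show ?thesis using bc_betti_row_4[OF s, of i] 3 by auto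
    next
      case 4 then show ?thesis using bc_betti_other_rows[OF 4] s by auto
    qed
  qed
  then show ?thesis by (intro Set.set_eqI) auto
qed

theorem theorem2p1:
  fixes s t :: nat
    and V :: "vertex set"
    and I :: "(vertex, 'k::field) polynomial set"
    and \<beta> :: "nat \<Rightarrow> int \<Rightarrow> nat"
  assumes "s \<ge> 3" and "t = 2 * s"
    and "V = cycle_X s \<union> cycle_Y s"
    and "I = edge_ideal V (bipartite_complement (cycle_X s) (cycle_Y s) (even_cycle_edges s))"
    and "\<beta> = graded_betti V I"
  shows "regularity V I = 4
    \<and> {(i, j). \<beta> i j \<noteq> 0} =
        {(i, int i + 2) | i. 0 \<le> i \<and> i \<le> s - 3}
        \<union> {(i, int i + 3) | i. 1 \<le> i \<and> i \<le> t - 5}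
        \<union> {(t - 4, int t)}
    \<and> \<beta> (t - 4) (int t) = 1
    \<and> (\<forall>j. 2 \<le> j \<and> j \<le> s - 1 \<longrightarrow>
        real (\<beta> (j - 2) (int j)) =
          (\<Sum>k = 1..j - 1. \<Sum>c = 1..k.
             real s / real c
             * real (binom (int k - 1) (int c - 1))
             * real (binom (int s - int k - 1) (int c - 1))
             * real (binom (int s - int k - int c) (int j - int k))))
    \<and> (\<forall>j. 4 \<le> j \<and> j \<le> t - 2 \<longrightarrow>
        real (\<beta> (j - 3) (int j)) =
          (\<Sum>m = 2..j div 2.
             real t * ((real m - 1) / real m)
             * real (binom (int t - int j - 1) (int m - 1))
             * (\<Sum>a = 0..j - 2 * m.
                  real (binom (int j - int m - int a - 1) (int m - 1))
                  * real (binom (int t - int j - int m) (int a)))))"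
proof -
  have \<beta>: "\<beta> = bc_betti s"
    unfolding assms(3-5) by (intro ext) (rule graded_betti_bc[OF assms(1)])
  have pos: "{(i, j). \<beta> i j \<noteq> 0} =
        {(i, int i + 2) | i. 0 \<le> i \<and> i \<le> s - 3}
        \<union> {(i, int i + 3) | i. 1 \<le> i \<and> i \<le> t - 5}
        \<union> {(t - 4, int t)}"
    unfolding \<beta> assms(2) by (rule bc_betti_positions[OF assms(1)])
  have "{j - int i | i j. graded_betti V I i j \<noteq> 0} = (\<lambda>(i, j). j - int i) ` {(i, j). \<beta> i j \<noteq> 0}"
    unfolding assms(5) by auto
  also have "\<dots> = {2, 3, 4}"
  proof -
    have e: "{(i, int i + 2) | i. 0 \<le> i \<and> i \<le> s - 3} = (\<lambda>i. (i, int i + 2)) ` {..s - 3}"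
      "{(i, int i + 3) | i. 1 \<le> i \<and> i \<le> t - 5} = (\<lambda>i. (i, int i + 3)) ` {1..t - 5}" by auto
    have im: "(\<lambda>(i, j). j - int i) ` ((\<lambda>i. (i, int i + 2)) ` {..s - 3}) = {2}"
      "(\<lambda>(i, j). j - int i) ` ((\<lambda>i. (i, int i + 3)) ` {1..t - 5}) = {3}"
      "(\<lambda>(i, j). j - int i) ` {(t - 4, int t)} = {4}"
      using assms(1,2) by (simp_all add: image_image image_constant_conv of_nat_diff)
    show ?thesis unfolding pos e image_Un im by blast
  qed
  finally have "regularity V I = Max {2, 3, 4}" unfolding regularity_def by (rule arg_cong)
  then have reg: "regularity V I = 4" by simp
  have top: "\<beta> (t - 4) (int t) = 1"
  proof -
    have "t - 4 + 4 = 2 * s" using assms(1,2) by auto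
    then have "\<beta> (t - 4) (int (t - 4) + 4) = 1"
      unfolding \<beta> using bc_betti_row_4[OF assms(1), of "t - 4"] by (simp only: simp_thms if_True)
    moreover have "int (t - 4) + 4 = int t" using assms(1,2) by auto
    ultimately show ?thesis by (simp only:)
  qed
  show ?thesis
  proof (intro conjI reg pos top allI impI)
    fix j assume "2 \<le> j \<and> j \<le> s - 1"
    then show "real (\<beta> (j - 2) (int j)) =
          (\<Sum>k = 1..j - 1. \<Sum>c = 1..k.
             real s / real c
             * real (binom (int k - 1) (int c - 1))
             * real (binom (int s - int k - 1) (int c - 1))
             * real (binom (int s - int k - int c) (int j - int k)))"
      unfolding \<beta> using assms(1) by (intro bc_betti_linear_strand) auto
  next
    fix j assume "4 \<le> j \<and> j \<le> t - 2"
    then show "real (\<beta> (j - 3) (int j)) =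
          (\<Sum>m = 2..j div 2.
             real t * ((real m - 1) / real m)
             * real (binom (int t - int j - 1) (int m - 1))
             * (\<Sum>a = 0..j - 2 * m.
                  real (binom (int j - int m - int a - 1) (int m - 1))
                  * real (binom (int t - int j - int m) (int a))))"
      unfolding \<beta> assms(2) using assms(1) by (intro bc_betti_second_strand) auto
  qed
qed

end
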